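(* Let $\mathcal M,\mathcal N$ be connected, compact, oriented smooth $2$-dimensional Riemannian manifolds (possibly with Lipschitz boundaries), and let $p\ge 2$. If $V_{\mathcal N}\le V_{\mathcal M}$, then for every $\phi\in \operatorname{Lip}_+^{\mathrm{inj}}(\mathcal M,\mathcal N)$, $$E_p(\phi)\ge F^{p/2}\left(\frac{V_{\mathcal N}}{V_{\mathcal M}}\right),$$ with equality if and only if $\phi$ is surjective and satisfies the following condition: (i) if $V_{\mathcal N}/V_{\mathcal M}\ge 1/4$: $\phi$ is a homothety; (ii) if $V_{\mathcal N}/V_{\mathcal M}\le 1/4$ and $p=2$: $d\phi\in K$ a.e.; (iii) if $V_{\mathcal N}/V_{\mathcal M}\le 1/4$ and $p>2$: $d\phi\in K_{s}$ a.e. with $s=V_{\mathcal N}/V_{\mathcal M}$. In particular, if there exists a bijection in $\operatorname{Lip}_+^{\mathrm{inj}}(\mathcal M,\mathcal N)$ with the required property, it minimizes $E_p$ over $\operatorname{Lip}_+^{\mathrm{inj}}(\mathcal M,\mathcal N)$.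
   Context: Write $\mathfrak g,\mathfrak h$ for the metrics of $\mathcal M,\mathcal N$; $V_{X}$ denotes the (Riemannian) area of $X$. $\operatorname{Lip}_+^{\mathrm{inj}}(\mathcal M,\mathcal N)$ is the set of Lipschitz maps $\phi:\mathcal M\to\mathcal N$ whose (signed) Jacobian $J\phi$ (the determinant of $d\phi$ with respect to the metrics and orientations) is $\ge 0$ a.e. and which are injective a.e., meaning $|\phi^{-1}(q)|\le 1$ for a.e. $q\in\mathcal N$. For $x\in\mathcal M$, $\operatorname{SO}(\mathfrak g,\phi^*\mathfrak h)_x$ is the set of orientation-preserving linear isometries $T_x\mathcal M\to T_{\phi(x)}\mathcal N$; distances in $\operatorname{Hom}(T_x\mathcal M,T_{\phi(x)}\mathcal N)$ are measured with the inner product induced by $\mathfrak g,\mathfrak h$ (Frobenius inner product in orthonormal frames). With area integration, $$E_p(\phi)=\frac1{V_{\mathcal M}}\int_{\mathcal M}\operatorname{dist}^p\big(d\phi,\operatorname{SO}(\mathfrak g,\phi^*\mathfrak h)\big).$$ $F:[0,\infty)\to\mathbb R$ is $F(s)=1-2s$ for $0\le s\le \frac14$ and $F(s)=2(\sqrt s-1)^2$ for $s\ge\frac14$; $F^{p/2}(s)=(F(s))^{p/2}$. $\sigma_1(A)\le\sigma_2(A)$ denote singular values of a linear map $A$ between oriented $2$-dimensional inner product spaces. $K$ is the set of such $A$ with $\det A\ge 0$ and $\sigma_1(A)+\sigma_2(A)=1$, and $K_s=\{A\in K:\det A=s\}$ for $0\le s\le 1/4$. "$d\phi\in K$ a.e."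 means $d\phi_x\in K$ for a.e. $x$, singular values being taken with respect to $\mathfrak g_x,\mathfrak h_{\phi(x)}$. $\phi$ is a homothety if $\phi^*\mathfrak h=\lambda^2\mathfrak g$ for some constant $\lambda>0$ (for Lipschitz $\phi$: a.e.; a Lipschitz map with $d\phi\in\lambda\operatorname{SO}(\mathfrak g,\phi^*\mathfrak h)$ a.e. is automatically smooth). *)

theory Defs
  imports "HOL-Analysis.Analysis"
begin

subsection \<open>Smooth functions and Lipschitz regions in the plane\<close>

primrec Ck_on :: "nat \<Rightarrow> 'a::euclidean_space set \<Rightarrow> ('a \<Rightarrow> 'b::real_normed_vector) \<Rightarrow> bool" where
  "Ck_on 0 W f \<longleftrightarrow> continuous_on W f"
| "Ck_on (Suc n) W f \<longleftrightarrow>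
     (\<forall>x\<in>W. f differentiable (at x)) \<and>
     (\<forall>i\<in>Basis. Ck_on n W (\<lambda>x. frechet_derivative f (at x) i))"

text \<open>On a set that need not be open, smooth means: locally the restriction of a
  \<open>C\<^sup>\<infinity>\<close> function defined on an open set.\<close>

definition smooth_on :: "'a::euclidean_space set \<Rightarrow> ('a \<Rightarrow> 'b::real_normed_vector) \<Rightarrow> bool" where
  "smooth_on S f \<longleftrightarrow>
     (\<forall>x\<in>S. \<exists>W F. open W \<and> x \<in> W \<and> (\<forall>n. Ck_on n W F) \<and> (\<forall>y\<in>S \<inter> W. f y = F y))"

text \<open>Locally, either an open set or, in suitable orthonormal coordinates, the closed region
  above the graph of a Lipschitz function. (The first case is subsumed: a point may lie
  strictly above the graph.)\<close>

definition lipschitz_region :: "(real^2) set \<Rightarrow> bool" where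
  "lipschitz_region S \<longleftrightarrow>
     (\<forall>p\<in>S. \<exists>W e n f L. open W \<and> p \<in> W \<and> norm e = 1 \<and> norm n = 1 \<and> e \<bullet> n = 0 \<and>
        L-lipschitz_on UNIV (f :: real \<Rightarrow> real) \<and>
        S \<inter> W = {q \<in> W. f (q \<bullet> e) \<le> q \<bullet> n})"


subsection \<open>Compact connected oriented Riemannian surfaces with Lipschitz boundary\<close>

record 'a chart =
  cdom :: "'a set"
  cmap :: "'a \<Rightarrow> real^2"

abbreviation cinv :: "'a chart \<Rightarrow> real^2 \<Rightarrow> 'a" where
  "cinv c \<equiv> inv_into (cdom c) (cmap c)"

text \<open>\<open>gmat M c x\<close> is the Gram matrix, at the point \<open>x\<close> of the surface, of the metric with
  respect to the coordinate basis of the chart \<open>c\<close>. The smooth structure and the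
  orientation are those of the atlas, whose transition maps are smooth with positive Jacobian.\<close>

record 'a surface =
  mtop :: "'a topology"
  atlas :: "'a chart set"
  gmat :: "'a chart \<Rightarrow> 'a \<Rightarrow> real^2^2"

abbreviation pts :: "'a surface \<Rightarrow> 'a set" where
  "pts M \<equiv> topspace (mtop M)"

text \<open>Derivative at \<open>x\<close> of the transition from \<open>c\<close>- to \<open>d\<close>-coordinates.\<close>

definition transition_deriv :: "'a chart \<Rightarrow> 'a chart \<Rightarrow> 'a \<Rightarrow> real^2^2" where
  "transition_deriv c d x =
     matrix (frechet_derivative (cmap d \<circ> cinv c)
       (at (cmap c x) within cmap c ` (cdom c \<inter> cdom d)))"

locale riemannian_surface =
  fixes M :: "'a surface"
  assumes nonempty: "pts M \<noteq> {}"
    and hausdorff: "Hausdorff_space (mtop M)"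
    and second_countable: "second_countable (mtop M)"
    and compact: "compact_space (mtop M)"
    and connected: "connected_space (mtop M)"
    and charts_cover: "(\<Union>c\<in>atlas M. cdom c) = pts M"
    and chart_open: "c \<in> atlas M \<Longrightarrow> openin (mtop M) (cdom c)"
    and chart_homeo: "c \<in> atlas M \<Longrightarrow>
      homeomorphic_map (subtopology (mtop M) (cdom c))
        (subtopology euclidean (cmap c ` cdom c)) (cmap c)"
    and chart_region: "c \<in> atlas M \<Longrightarrow> lipschitz_region (cmap c ` cdom c)"
    and transition_smooth: "c \<in> atlas M \<Longrightarrow> d \<in> atlas M \<Longrightarrow>
      smooth_on (cmap c ` (cdom c \<inter> cdom d)) (cmap d \<circ> cinv c)"
    and oriented: "c \<in> atlas M \<Longrightarrow> d \<in> atlas M \<Longrightarrow> x \<in> cdom c \<inter> cdom d \<Longrightarrow>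
      det (transition_deriv c d x) > 0"
    and metric_smooth: "c \<in> atlas M \<Longrightarrow> smooth_on (cmap c ` cdom c) (gmat M c \<circ> cinv c)"
    and metric_sym: "c \<in> atlas M \<Longrightarrow> x \<in> cdom c \<Longrightarrow> transpose (gmat M c x) = gmat M c x"
    and metric_pos: "c \<in> atlas M \<Longrightarrow> x \<in> cdom c \<Longrightarrow> v \<noteq> 0 \<Longrightarrow> v \<bullet> (gmat M c x *v v) > 0"
    and metric_compat: "c \<in> atlas M \<Longrightarrow> d \<in> atlas M \<Longrightarrow> x \<in> cdom c \<inter> cdom d \<Longrightarrow>
      gmat M c x = transpose (transition_deriv c d x) ** gmat M d x ** transition_deriv c d x"

text \<open>Tangent spaces are identified with the coordinate plane of an arbitrary chart around the
  point. None of the notions defined from \<open>chart_at\<close> depends on the chart that is picked,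
  except the coordinate matrix \<open>diff_at\<close>.\<close>

definition chart_at :: "'a surface \<Rightarrow> 'a \<Rightarrow> 'a chart" where
  "chart_at M x = (SOME c. c \<in> atlas M \<and> x \<in> cdom c)"

definition gmat_at :: "'a surface \<Rightarrow> 'a \<Rightarrow> real^2^2" where
  "gmat_at M x = gmat M (chart_at M x) x"


subsection \<open>Riemannian distance and area\<close>

definition piecewise_C1_curve :: "'a surface \<Rightarrow> (real \<Rightarrow> 'a) \<Rightarrow> bool" where
  "piecewise_C1_curve M \<gamma> \<longleftrightarrow>
     continuous_map (subtopology euclideanreal {0..1}) (mtop M) \<gamma> \<and>
     (\<exists>S. finite S \<and>
       (\<forall>a b. 0 \<le> a \<and> a < b \<and> b \<le> 1 \<and> S \<inter> {a<..<b} = {} \<longrightarrow>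
         (\<forall>c\<in>atlas M. \<exists>D. continuous_on {t\<in>{a..b}. \<gamma> t \<in> cdom c} D \<and>
            (\<forall>t\<in>{a..b}. \<gamma> t \<in> cdom c \<longrightarrow>
               (cmap c \<circ> \<gamma> has_vector_derivative D t) (at t within {a..b})))))"

definition speed :: "'a surface \<Rightarrow> (real \<Rightarrow> 'a) \<Rightarrow> real \<Rightarrow> real" where
  "speed M \<gamma> t =
     (let v = vector_derivative (cmap (chart_at M (\<gamma> t)) \<circ> \<gamma>) (at t)
      in sqrt (v \<bullet> (gmat_at M (\<gamma> t) *v v)))"

definition curve_length :: "'a surface \<Rightarrow> (real \<Rightarrow> 'a) \<Rightarrow> ennreal" where
  "curve_length M \<gamma> = (\<integral>\<^sup>+t\<in>{0..1}. ennreal (speed M \<gamma> t) \<partial>lborel)"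

definition rdist :: "'a surface \<Rightarrow> 'a \<Rightarrow> 'a \<Rightarrow> ennreal" where
  "rdist M x y = (INF \<gamma>\<in>{\<gamma>. piecewise_C1_curve M \<gamma> \<and> \<gamma> 0 = x \<and> \<gamma> 1 = y}. curve_length M \<gamma>)"

text \<open>The area measure is the unique measure that has density \<open>sqrt (det g)\<close> with respect to
  Lebesgue measure in every chart. It is complete, so that a.e. statements need no
  measurability provisos.\<close>

definition area_sets :: "'a surface \<Rightarrow> 'a set set" where
  "area_sets M = {S. S \<subseteq> pts M \<and> (\<forall>c\<in>atlas M. cmap c ` (S \<inter> cdom c) \<in> sets lebesgue)}"

definition chart_area :: "'a surface \<Rightarrow> 'a chart \<Rightarrow> 'a set \<Rightarrow> ennreal" where
  "chart_area M c S =
     (\<integral>\<^sup>+p\<in>cmap c ` S. ennreal (sqrt (det (gmat M c (cinv c p)))) \<partial>lebesgue)"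

definition area :: "'a surface \<Rightarrow> 'a measure" where
  "area M = (THE \<mu>. space \<mu> = pts M \<and> sets \<mu> = area_sets M \<and>
     (\<forall>c\<in>atlas M. \<forall>S\<in>area_sets M. S \<subseteq> cdom c \<longrightarrow> emeasure \<mu> S = chart_area M c S))"

definition total_area :: "'a surface \<Rightarrow> real" where
  "total_area M = measure (area M) (pts M)"


subsection \<open>Linear maps between oriented inner product planes\<close>

text \<open>Inner products on \<open>real^2\<close> are given by their Gram matrices \<open>G\<close>, \<open>H\<close>; the orientation is
  the standard one.\<close>

definition gram_inner :: "real^2^2 \<Rightarrow> real^2 \<Rightarrow> real^2 \<Rightarrow> real" where
  "gram_inner G u v = u \<bullet> (G *v v)"

text \<open>The columns of \<open>oriented_frame G\<close> are a positively oriented \<open>G\<close>-orthonormal basis.\<close>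

definition oriented_frame :: "real^2^2 \<Rightarrow> real^2^2" where
  "oriented_frame G = (SOME P. transpose P ** G ** P = mat 1 \<and> det P > 0)"

text \<open>The matrix of \<open>A : (real^2, G) \<rightarrow> (real^2, H)\<close> with respect to such frames.
  Another choice of frames multiplies it by rotations on both sides.\<close>

definition in_frames :: "real^2^2 \<Rightarrow> real^2^2 \<Rightarrow> real^2^2 \<Rightarrow> real^2^2" where
  "in_frames G H A = matrix_inv (oriented_frame H) ** A ** oriented_frame G"

text \<open>The norm of \<open>real^2^2\<close> is the Frobenius norm.\<close>

definition hom_norm :: "real^2^2 \<Rightarrow> real^2^2 \<Rightarrow> real^2^2 \<Rightarrow> real" where
  "hom_norm G H A = norm (in_frames G H A)"

definition hom_det :: "real^2^2 \<Rightarrow> real^2^2 \<Rightarrow> real^2^2 \<Rightarrow> real" where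
  "hom_det G H A = det (in_frames G H A)"

definition SO :: "real^2^2 \<Rightarrow> real^2^2 \<Rightarrow> (real^2^2) set" where
  "SO G H = {R. (\<forall>u v. gram_inner H (R *v u) (R *v v) = gram_inner G u v) \<and> det R > 0}"

definition dist_SO :: "real^2^2 \<Rightarrow> real^2^2 \<Rightarrow> real^2^2 \<Rightarrow> real" where
  "dist_SO G H A = (INF R\<in>SO G H. hom_norm G H (A - R))"

text \<open>Singular values: the square roots of the eigenvalues, with multiplicity, of \<open>A\<^sup>* A\<close>.\<close>

definition singular_values :: "real^2^2 \<Rightarrow> real^2^2 \<Rightarrow> real^2^2 \<Rightarrow> real \<Rightarrow> real \<Rightarrow> bool" where
  "singular_values G H A \<sigma>1 \<sigma>2 \<longleftrightarrow> 0 \<le> \<sigma>1 \<and> \<sigma>1 \<le> \<sigma>2 \<and>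
     (\<forall>x. det (mat x - transpose (in_frames G H A) ** in_frames G H A)
            = (x - \<sigma>1\<^sup>2) * (x - \<sigma>2\<^sup>2))"

definition K :: "real^2^2 \<Rightarrow> real^2^2 \<Rightarrow> (real^2^2) set" where
  "K G H = {A. hom_det G H A \<ge> 0 \<and> (\<exists>\<sigma>1 \<sigma>2. singular_values G H A \<sigma>1 \<sigma>2 \<and> \<sigma>1 + \<sigma>2 = 1)}"

definition Ks :: "real \<Rightarrow> real^2^2 \<Rightarrow> real^2^2 \<Rightarrow> (real^2^2) set" where
  "Ks s G H = {A \<in> K G H. hom_det G H A = s}"


subsection \<open>Maps between surfaces\<close>

text \<open>Coordinate matrix of the differential of \<open>\<phi>\<close> at \<open>x\<close>; meaningful where \<open>\<phi>\<close> is
  differentiable, hence almost everywhere for Lipschitz \<open>\<phi>\<close>.\<close>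

definition diff_at :: "'a surface \<Rightarrow> 'b surface \<Rightarrow> ('a \<Rightarrow> 'b) \<Rightarrow> 'a \<Rightarrow> real^2^2" where
  "diff_at M N \<phi> x =
     (let c = chart_at M x; d = chart_at N (\<phi> x)
      in matrix (frechet_derivative (cmap d \<circ> \<phi> \<circ> cinv c)
           (at (cmap c x) within cmap c ` cdom c)))"

definition jacobian :: "'a surface \<Rightarrow> 'b surface \<Rightarrow> ('a \<Rightarrow> 'b) \<Rightarrow> 'a \<Rightarrow> real" where
  "jacobian M N \<phi> x = hom_det (gmat_at M x) (gmat_at N (\<phi> x)) (diff_at M N \<phi> x)"

definition lipschitz_map :: "'a surface \<Rightarrow> 'b surface \<Rightarrow> ('a \<Rightarrow> 'b) \<Rightarrow> bool" where
  "lipschitz_map M N \<phi> \<longleftrightarrow> \<phi> ` pts M \<subseteq> pts N \<and>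
     (\<exists>L::real. L \<ge> 0 \<and>
       (\<forall>x\<in>pts M. \<forall>y\<in>pts M. rdist N (\<phi> x) (\<phi> y) \<le> ennreal L * rdist M x y))"

text \<open>The last clause says that a.e. fibre has at most one point.\<close>

definition Lip_inj_plus :: "'a surface \<Rightarrow> 'b surface \<Rightarrow> ('a \<Rightarrow> 'b) set" where
  "Lip_inj_plus M N = {\<phi>. lipschitz_map M N \<phi> \<and>
     (AE x in area M. jacobian M N \<phi> x \<ge> 0) \<and>
     (AE q in area N. \<forall>x\<in>pts M. \<forall>y\<in>pts M. \<phi> x = q \<and> \<phi> y = q \<longrightarrow> x = y)}"

definition energy :: "'a surface \<Rightarrow> 'b surface \<Rightarrow> real \<Rightarrow> ('a \<Rightarrow> 'b) \<Rightarrow> real" where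
  "energy M N p \<phi> = 1 / total_area M *
     (\<integral>x. dist_SO (gmat_at M x) (gmat_at N (\<phi> x)) (diff_at M N \<phi> x) powr p \<partial>area M)"

definition F :: "real \<Rightarrow> real" where
  "F s = (if s \<le> 1/4 then 1 - 2 * s else 2 * (sqrt s - 1)\<^sup>2)"

definition homothety :: "'a surface \<Rightarrow> 'b surface \<Rightarrow> ('a \<Rightarrow> 'b) \<Rightarrow> bool" where
  "homothety M N \<phi> \<longleftrightarrow> (\<exists>r>0. AE x in area M. \<forall>u v.
     gram_inner (gmat_at N (\<phi> x)) (diff_at M N \<phi> x *v u) (diff_at M N \<phi> x *v v)
       = r\<^sup>2 * gram_inner (gmat_at M x) u v)"

definition diff_in_K :: "'a surface \<Rightarrow> 'b surface \<Rightarrow> ('a \<Rightarrow> 'b) \<Rightarrow> bool" where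
  "diff_in_K M N \<phi> \<longleftrightarrow>
     (AE x in area M. diff_at M N \<phi> x \<in> K (gmat_at M x) (gmat_at N (\<phi> x)))"

definition diff_in_Ks :: "real \<Rightarrow> 'a surface \<Rightarrow> 'b surface \<Rightarrow> ('a \<Rightarrow> 'b) \<Rightarrow> bool" where
  "diff_in_Ks s M N \<phi> \<longleftrightarrow>
     (AE x in area M. diff_at M N \<phi> x \<in> Ks s (gmat_at M x) (gmat_at N (\<phi> x)))"

definition optimality_condition :: "'a surface \<Rightarrow> 'b surface \<Rightarrow> real \<Rightarrow> ('a \<Rightarrow> 'b) \<Rightarrow> bool" where
  "optimality_condition M N p \<phi> \<longleftrightarrow>
     (let s = total_area N / total_area M in
       (s \<ge> 1/4 \<longrightarrow> homothety M N \<phi>) \<and>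
       (s \<le> 1/4 \<and> p = 2 \<longrightarrow> diff_in_K M N \<phi>) \<and>
       (s \<le> 1/4 \<and> p > 2 \<longrightarrow> diff_in_Ks s M N \<phi>))"

end

theory Submission
  imports Defs
begin

text \<open>In terms of the singular values, the squared distance of \<open>A\<close> to the rotations is
  \<open>(\<sigma>1 + \<sigma>2 - 1)\<^sup>2 + 1 - 2 \<sigma>1 \<sigma>2\<close> when \<open>det A \<ge> 0\<close>. Subtracting from it the tangent line of
  \<open>F\<close> at \<open>s\<close>, evaluated at \<open>\<sigma>1 \<sigma>2 = det A\<close>, leaves a nonnegative remainder, which vanishes exactly
  for \<open>\<sigma>1 + \<sigma>2 = 1\<close> if \<open>s \<le> 1/4\<close> and for \<open>\<sigma>1 = \<sigma>2 = sqrt s\<close> if \<open>s > 1/4\<close>. (At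
  \<open>s = 1/4\<close> the former forces the Jacobian to be at most its mean \<open>1/4\<close>, hence constant, so the
  conditions agree.) By a.e. injectivity and the area formula the Jacobian integrates to
  the area of the image, which is at most \<open>s\<close> times the area of \<open>M\<close> for \<open>s\<close> the quotient of the
  areas; since \<open>F\<close> decreases on \<open>[0,1]\<close>, integrating the tangent line gives the bound for
  \<open>p = 2\<close>. For \<open>p > 2\<close> one inserts the tangent line of \<open>t \<mapsto> t powr (p/2)\<close> at \<open>F s\<close>. The area
  formula rests on Rademacher's theorem; the image being closed, it has full area only if it is everything.\<close>

subsection \<open>Rademacher's theorem\<close>

text \<open>Obstacles around the inequality shape the work. Lipschitz maps are given through infima
  of curve lengths and must become Lipschitz in coordinates: in the domain, distances are bounded
  above along broken segments inside a chart; in the target they are bounded below because a short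
  curve cannot leave a coordinate ball. Moreover \<open>chart_at\<close> and
  \<open>oriented_frame\<close> are arbitrary choices without measurability. Only the norm and the
  determinant of the differential in frames are used, since these do not depend on the choices and
  have choice-free formulas in fixed charts; \<open>area\<close>, a definite description, is glued
  from chart areas. The null set of values with several preimages may have a preimage of positive
  area; but the Jacobian vanishes almost everywhere there, so it can be cut out before changing
  variables. Finally, when the areas are equal, the tangent to the power at \<open>F 1 = 0\<close>
  is horizontal and detects nothing; equality then says directly that the distance to the rotations
  vanishes almost everywhere.\<close>

text \<open>A continuation argument takes the place of a covering theorem. The points reached with
  increment at most \<open>G\<close> form a closed set; from its supremum one can always move right,
  by a step of slope at most \<open>p\<close> at a point of \<open>C\<close> and by the Lipschitz
  bound inside a gap of \<open>C\<close>.\<close>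

lemma lipschitz_increment_le_closed:
  fixes g :: "real \<Rightarrow> real"
  assumes g: "L-lipschitz_on UNIV g" and pL: "p \<le> L" and C: "compact C"
    and lower: "\<And>x d. x \<in> C \<Longrightarrow> d > 0 \<Longrightarrow> \<exists>h. 0 < h \<and> h < d \<and> g (x + h) - g x \<le> p * h"
    and ab: "a \<le> b"
  shows "(L - p) * measure lebesgue (C \<inter> {a..b}) \<le> L * (b - a) - (g b - g a)"
proof -
  have gl: "g y - g x \<le> L * (y - x)" if "x \<le> y" for x y
    using lipschitz_onD[OF g, of y x] that by (auto simp: dist_real_def abs_if split: if_splits)
  define m where "m x = measure lebesgue (C \<inter> {a..x})" for x
  have Clm: "C \<inter> {x..y} \<in> lmeasurable" "C \<inter> {x<..y} \<in> lmeasurable" for x y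
    using C by (auto intro!: fmeasurable_Int_fmeasurable simp: lmeasurable_compact)
  have msplit: "m y = m x + measure lebesgue (C \<inter> {x<..y})" if "a \<le> x" "x \<le> y" for x y
  proof -
    have "C \<inter> {a..y} = (C \<inter> {a..x}) \<union> (C \<inter> {x<..y})" using that by auto
    moreover have "(C \<inter> {a..x}) \<inter> (C \<inter> {x<..y}) = {}" by auto
    ultimately show ?thesis unfolding m_def
      using measure_Un2[OF Clm(1)[of a x] Clm(2)[of x y]] by (simp add: Diff_triv Int_commute)
  qed
  have mle: "0 \<le> m y - m x" "m y - m x \<le> y - x" if "a \<le> x" "x \<le> y" for x y
  proof -
    have "measure lebesgue (C \<inter> {x<..y}) \<le> measure lebesgue (cbox x y)"
      by (rule measure_mono_fmeasurable[OF _ fmeasurableD[OF Clm(2)] lmeasurable_cbox]) auto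
    then show "m y - m x \<le> y - x" using msplit[OF that] that by simp
    show "0 \<le> m y - m x" using msplit[OF that] by simp
  qed
  \<comment> \<open>This majorant has slope at least \<open>p\<close> everywhere, since
    \<open>m\<close> is 1-Lipschitz, and slope \<open>L\<close> on the gaps of \<open>C\<close>; so
    either kind of step preserves \<open>g x - g a \<le> G x\<close>.\<close>
  define G where "G x = L * (x - a) - (L - p) * m x" for x
  have Gp: "G y - G x \<ge> p * (y - x)" if "a \<le> x" "x \<le> y" for x y
  proof -
    have "(L - p) * (m y - m x) \<le> (L - p) * (y - x)"
      using mle[OF that] pL by (intro mult_left_mono) auto
    then show ?thesis unfolding G_def by (simp add: algebra_simps)
  qed
  define T where "T = {x\<in>{a..b}. g x - g a \<le> G x}"
  have ml: "1-lipschitz_on {a..b} m"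
  proof (rule lipschitz_onI)
    fix x y assume "x \<in> {a..b}" "y \<in> {a..b}"
    then show "dist (m x) (m y) \<le> 1 * dist x y"
      using mle[of x y] mle[of y x] by (cases "x \<le> y") (auto simp: dist_real_def)
  qed simp
  have cont: "continuous_on {a..b} (\<lambda>x. G x - (g x - g a))"
    unfolding G_def
    by (intro continuous_intros lipschitz_on_continuous_on[OF ml]
        continuous_on_subset[OF lipschitz_on_continuous_on[OF g]]) auto
  have "T = {x\<in>{a..b}. 0 \<le> G x - (g x - g a)}" unfolding T_def by auto
  then have "T = {a..b} \<inter> (\<lambda>x. G x - (g x - g a)) -` {0..}" by auto
  then have clT: "closed T"
    using continuous_closed_preimage[OF cont, of "{0..}"] by simp
  have ma: "m a = 0"
  proof -
    have "m a \<le> measure lebesgue (cbox a a)" unfolding m_def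
      by (rule measure_mono_fmeasurable[OF _ fmeasurableD[OF Clm(1)] lmeasurable_cbox]) auto
    then show ?thesis unfolding m_def by (simp add: measure_le_0_iff)
  qed
  have aT: "a \<in> T" unfolding T_def G_def using ab ma by simp
  define s where "s = Sup T"
  have bdd: "bdd_above T" unfolding T_def by (auto intro: bdd_aboveI[of _ b])
  have sT: "s \<in> T" unfolding s_def using closed_contains_Sup aT clT bdd by blast
  have "s = b"
  proof (rule ccontr)
    assume "s \<noteq> b"
    then have sb: "a \<le> s" "s < b" using sT unfolding T_def by auto
    have "\<exists>y\<in>T. y > s"
    proof (cases "s \<in> C")
      case True
      then obtain h where h: "0 < h" "h < b - s" "g (s + h) - g s \<le> p * h"
        using lower[of s "b - s"] sb by auto
      have "s + h \<in> T" using Gp[of s "s + h"] h sb sT unfolding T_def by auto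
      then show ?thesis using h by (intro bexI[of _ "s + h"]) auto
    next
      case False
      then have "open (- C)" "s \<in> - C" using C compact_imp_closed by auto
      then obtain e where e: "e > 0" "ball s e \<subseteq> - C" using open_contains_ball by blast
      define h where "h = min (e/2) (b - s)"
      have h: "h > 0" "h < e" "s + h \<le> b" using e sb unfolding h_def by auto
      have "C \<inter> {s<..s+h} = {}"
      proof -
        have "{s<..s+h} \<subseteq> ball s e" using h by (auto simp: dist_real_def)
        then show ?thesis using e by auto
      qed
      then have "m (s + h) = m s" using msplit[of s "s + h"] sb h by simp
      then have "G (s + h) - G s = L * h" unfolding G_def by (simp add: algebra_simps)
      then have "s + h \<in> T" using gl[of s "s + h"] h sb sT unfolding T_def by auto
      then show ?thesis using h by (intro bexI[of _ "s + h"]) auto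
    qed
    then obtain y where "y \<in> T" "y > s" by blast
    moreover have "y \<le> s" unfolding s_def using bdd \<open>y \<in> T\<close> cSup_upper by blast
    ultimately show False by simp
  qed
  then have "g b - g a \<le> G b" using sT unfolding T_def by auto
  then show ?thesis unfolding G_def m_def by (simp add: algebra_simps)
qed

text \<open>Reflection: the function \<open>- g (- x)\<close> turns left steps of \<open>g\<close>
  into right steps.\<close>

lemma lipschitz_increment_le_closed_left:
  fixes g :: "real \<Rightarrow> real"
  assumes g: "L-lipschitz_on UNIV g" and pL: "p \<le> L" and C: "compact C"
    and lower: "\<And>x d. x \<in> C \<Longrightarrow> d > 0 \<Longrightarrow> \<exists>h. 0 < h \<and> h < d \<and> g x - g (x - h) \<le> p * h"
    and ab: "a \<le> b"
  shows "(L - p) * measure lebesgue (C \<inter> {a..b}) \<le> L * (b - a) - (g b - g a)"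
proof -
  have 1: "L-lipschitz_on UNIV (\<lambda>x. - g (- x))"
  proof (rule lipschitz_onI)
    fix x y :: real
    show "dist (- g (- x)) (- g (- y)) \<le> L * dist x y"
      using lipschitz_onD[OF g, of "-x" "-y"] by (simp add: dist_real_def abs_minus_commute)
  qed (use g lipschitz_on_nonneg in blast)
  have 2: "\<exists>h. 0 < h \<and> h < d \<and> - g (- (x + h)) - (- g (- x)) \<le> p * h"
    if "x \<in> uminus ` C" "d > 0" for x d
    using lower[of "- x" d] that by (auto simp: algebra_simps)
  have "(L - p) * measure lebesgue (uminus ` C \<inter> {-b..-a}) \<le> L * (- a - (- b)) - (- g (- (- a)) - (- g (-(- b))))"
    by (rule lipschitz_increment_le_closed[OF 1 pL _ 2])
       (use ab C in \<open>auto intro: compact_negations\<close>)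
  moreover have "uminus ` C \<inter> {-b..-a} = (\<lambda>x. (-1) *\<^sub>R x + 0) ` (C \<inter> {a..b})" by force
  ultimately show ?thesis by (simp only: measure_lebesgue_affine) simp
qed

text \<open>A weak form of Lebesgue density: covering \<open>C\<close> by nonoverlapping intervals
  of total length at most \<open>|C| + e\<close> and summing the bound gives
  \<open>|C| \<le> \<theta> * (|C| + e)\<close> for every \<open>e\<close>, which leaves only
  measure zero.\<close>

lemma negligible_if_interval_density:
  fixes C :: "real set"
  assumes C: "compact C" and th: "0 \<le> \<theta>" "\<theta> < 1"
    and dens: "\<And>a b. a \<le> b \<Longrightarrow> measure lebesgue (C \<inter> {a..b}) \<le> \<theta> * (b - a)"
  shows "negligible C"
proof -
  have Clm: "C \<in> lmeasurable" using C lmeasurable_compact by blast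
  obtain a b where ab: "C \<subseteq> cbox a b" using C compact_imp_bounded bounded_subset_cbox_symmetric by metis
  have main: "measure lebesgue C \<le> \<theta> * (measure lebesgue C + e)" if e: "e > 0" for e
  proof -
    obtain D where D: "countable D" "\<And>K. K \<in> D \<Longrightarrow> K \<subseteq> cbox a b \<and> K \<noteq> {} \<and> (\<exists>c d. K = cbox c d)"
        "pairwise (\<lambda>A B. interior A \<inter> interior B = {}) D"
        "C \<subseteq> \<Union>D" "\<Union>D \<in> lmeasurable" "measure lebesgue (\<Union>D) \<le> measure lebesgue C + e"
      using measurable_outer_intervals_bounded[OF Clm ab e] by metis
    have disj: "disjoint_family_on interior D"
      using D(3) by (auto simp: disjoint_family_on_def pairwise_def)
    have neg: "negligible (\<Union>K\<in>D. K - interior K)"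
    proof (rule negligible_countable_Union)
      show "countable ((\<lambda>K. K - interior K) ` D)" using D(1) by auto
      fix X assume "X \<in> (\<lambda>K. K - interior K) ` D"
      then obtain K c d where "K \<in> D" "X = K - interior K" "K = cbox c d" using D(2) by blast
      then have "X = frontier K" by (simp add: frontier_def)
      then show "negligible X" using \<open>K = cbox c d\<close> negligible_convex_frontier convex_box by blast
    qed
    \<comment> \<open>The covering intervals may share endpoints; their interiors are disjoint and
      lose only a null part of \<open>C\<close>.\<close>
    have "emeasure lebesgue C = emeasure lebesgue (\<Union>K\<in>D. C \<inter> interior K)"
    proof (rule emeasure_eq_AE)
      have D4: "\<And>x. x \<in> C \<Longrightarrow> \<exists>K\<in>D. x \<in> K" using D(4) by blast
      have "(\<Union>K\<in>D. K - interior K) \<in> null_sets lebesgue" using neg negligible_iff_null_sets by blast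
      from AE_not_in[OF this] show "AE x in lebesgue. (x \<in> C) = (x \<in> (\<Union>K\<in>D. C \<inter> interior K))"
        by eventually_elim (use D4 in \<open>fastforce\<close>)
      show "C \<in> sets lebesgue" using Clm by auto
      show "(\<Union>K\<in>D. C \<inter> interior K) \<in> sets lebesgue"
        using D(1) Clm by (intro sets.countable_UN') auto
    qed
    also have "\<dots> = (\<integral>\<^sup>+K. emeasure lebesgue (C \<inter> interior K) \<partial>count_space D)"
      using D(1) Clm disj
      by (intro emeasure_UN_countable) (auto simp: disjoint_family_on_def)
    also have "\<dots> \<le> (\<integral>\<^sup>+K. ennreal \<theta> * emeasure lebesgue (interior K) \<partial>count_space D)"
    proof (rule nn_integral_mono)
      fix K assume "K \<in> space (count_space D)"
      then have KD: "K \<in> D" by simp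
      then obtain c d where K: "K = cbox c d" "K \<noteq> {}" using D(2) by blast
      then have cd: "c \<le> d" by auto
      have "emeasure lebesgue (C \<inter> interior K) \<le> emeasure lebesgue (C \<inter> {c..d})"
        using K Clm by (intro emeasure_mono) auto
      also have "\<dots> = ennreal (measure lebesgue (C \<inter> {c..d}))"
        using C by (intro emeasure_eq_ennreal_measure)
          (metis Clm K(1) cbox_interval emeasure_eq_measure2 ennreal_neq_top fmeasurableD2 fmeasurable_Int_fmeasurable lmeasurable_cbox fmeasurableD)
      also have "\<dots> \<le> ennreal (\<theta> * (d - c))" using dens[OF cd] ennreal_leI by blast
      also have "\<dots> = ennreal \<theta> * emeasure lebesgue (interior K)"
        using cd th K by (simp add: ennreal_mult interior_cbox)
      finally show "emeasure lebesgue (C \<inter> interior K) \<le> ennreal \<theta> * emeasure lebesgue (interior K)" .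
    qed
    also have "\<dots> = ennreal \<theta> * emeasure lebesgue (\<Union>K\<in>D. interior K)"
      using D(1) disj by (subst emeasure_UN_countable) (auto simp: nn_integral_cmult)
    also have "\<dots> \<le> ennreal \<theta> * emeasure lebesgue (\<Union>D)"
      using D(5) interior_subset by (intro mult_left_mono emeasure_mono) auto
    also have "\<dots> = ennreal (\<theta> * measure lebesgue (\<Union>D))"
      using D(5) th by (simp add: emeasure_eq_measure2 ennreal_mult)
    also have "\<dots> \<le> ennreal (\<theta> * (measure lebesgue C + e))"
      using D(6) th by (intro ennreal_leI mult_left_mono) auto
    finally show ?thesis using Clm th e
      by (simp add: emeasure_eq_measure2 ennreal_le_iff)
  qed
  have "measure lebesgue C = 0"
  proof (rule ccontr)
    assume "measure lebesgue C \<noteq> 0"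
    then have pos: "measure lebesgue C > 0" using measure_nonneg[of lebesgue C] by linarith
    have "measure lebesgue C \<le> \<theta> * measure lebesgue C"
    proof (rule field_le_epsilon)
      fix e :: real assume "e > 0"
      have "measure lebesgue C \<le> \<theta> * (measure lebesgue C + e)" by (rule main) fact
      also have "\<dots> \<le> \<theta> * measure lebesgue C + 1 * e" using th \<open>e > 0\<close> by (simp add: distrib_left mult_right_mono)
      finally show "measure lebesgue C \<le> \<theta> * measure lebesgue C + e" by simp
    qed
    then show False using th pos by (simp add: mult_less_cancel_right1 not_le[symmetric])
  qed
  then show ?thesis using Clm negligible_iff_measure0 by blast
qed

text \<open>By inner regularity. The increment estimates are for compact sets, whereas the sets of
  bad points are only Borel.\<close>

lemma negligible_if_compact_subsets:
  fixes S :: "'a::euclidean_space set"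
  assumes S: "S \<in> sets lebesgue" and C: "\<And>C. compact C \<Longrightarrow> C \<subseteq> S \<Longrightarrow> negligible C"
  shows "negligible S"
proof -
  have clo: "negligible T" if T: "closed T" "T \<subseteq> S" for T
  proof -
    have "\<exists>n. x \<in> cball 0 (real n)" for x :: 'a
      using real_arch_simple[of "norm x"] by simp
    then have "T = (\<Union>n. T \<inter> cball 0 (real n))" by blast
    moreover have "negligible (\<Union>n. T \<inter> cball 0 (real n))"
      using T by (intro negligible_Union_nat C) auto
    ultimately show ?thesis by simp
  qed
  show ?thesis
  proof (subst negligible_outer_le, intro allI impI)
    fix e :: real assume "e > 0"
    then obtain T where T: "closed T" "T \<subseteq> S" "S-T \<in> lmeasurable" "emeasure lebesgue (S - T) < ennreal e"
      using sets_lebesgue_inner_closed[OF S] by blast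
    have nT: "negligible T" using clo T by blast
    have "S = (S - T) \<union> T" using T by auto
    moreover have "(S - T) \<union> T \<in> lmeasurable" using T nT negligible_imp_measurable by (intro fmeasurable.Un) auto
    moreover have "measure lebesgue ((S - T) \<union> T) \<le> measure lebesgue (S - T) + measure lebesgue T"
      using T nT by (intro measure_Un_le) (auto simp: negligible_imp_sets)
    moreover have "measure lebesgue T = 0" using nT negligible_imp_measure0 by blast
    moreover have "measure lebesgue (S - T) \<le> e" using T \<open>e > 0\<close>
      by (simp add: emeasure_eq_measure2 ennreal_less_iff less_imp_le)
    ultimately show "\<exists>T. S \<subseteq> T \<and> T \<in> lmeasurable \<and> measure lebesgue T \<le> e"
      by (intro exI[of _ S]) auto
  qed
qed

text \<open>Differentiability along a line fails only where, for some rational \<open>p < q\<close>, one of the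
  Dini derivatives is below \<open>p\<close> and another above \<open>q\<close>. The steps \<open>h\<close> are rational so that the sets
  are evidently Borel; the sign \<open>s\<close> selects the side.\<close>

definition dini_below :: "real \<Rightarrow> ('a::euclidean_space \<Rightarrow> real) \<Rightarrow> 'a \<Rightarrow> real \<Rightarrow> 'a set" where
  "dini_below s f v p = {x. \<forall>n::nat. \<exists>h\<in>\<rat> \<inter> {0<..<1 / (real n + 1)}. s * (f (x + (s * h) *\<^sub>R v) - f x) < p * h}"

lemma dini_below_borel:
  assumes "continuous_on UNIV f"
  shows "dini_below s f v p \<in> sets borel"
proof -
  have "dini_below s f v p =
    (\<Inter>n::nat. \<Union>h\<in>\<rat> \<inter> {0<..<1 / (real n + 1)}. {x. s * (f (x + (s * h) *\<^sub>R v) - f x) < p * h})"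
    by (auto simp: dini_below_def)
  moreover have "open {x. s * (f (x + (s * h) *\<^sub>R v) - f x) < p * h}" for h
    by (intro open_Collect_less continuous_intros continuous_on_compose2[OF assms]) auto
  moreover have "countable (\<rat> \<inter> A)" for A :: "real set"
    using countable_rat by blast
  ultimately show ?thesis
    by (auto intro!: sets.countable_INT'' sets.countable_UN')
qed

lemma dini_belowD:
  assumes "x \<in> dini_below s f v p" "d > 0"
  obtains h where "0 < h" "h < d" "s * (f (x + (s * h) *\<^sub>R v) - f x) < p * h"
proof -
  obtain n where n: "inverse (real (Suc n)) < d" using assms(2) reals_Archimedean by blast
  then obtain h where h: "h\<in>\<rat> \<inter> {0<..<1 / (real n + 1)}" "s * (f (x + (s * h) *\<^sub>R v) - f x) < p * h"
    using assms(1) unfolding dini_below_def by blast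
  have "h < inverse (real (Suc n))" using h by (simp add: inverse_eq_divide add.commute)
  then show ?thesis using h n by (intro that[of h]) auto
qed

text \<open>The estimates for \<open>g\<close> and \<open>- g\<close> are added: the increment
  cancels and only the measure of \<open>C\<close> remains, with density at most
  \<open>2 * M / (2 * M + (q - p)) < 1\<close> in every interval.\<close>

lemma dini_gap_compact_negligible:
  fixes g :: "real \<Rightarrow> real"
  assumes g: "L-lipschitz_on UNIV g" and pq: "p < q" and C: "compact C"
    and s: "s \<in> {1,-1}" "s' \<in> {1,-1}"
    and sub: "C \<subseteq> dini_below s g 1 p" "C \<subseteq> dini_below s' (\<lambda>x. - g x) 1 (- q)"
  shows "negligible C"
proof -
  \<comment> \<open>The Lipschitz constant is enlarged so that both slopes \<open>p\<close> and
    \<open>- q\<close> lie below it, as the increment estimates demand.\<close>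
  define M where "M = L + \<bar>p\<bar> + \<bar>q\<bar> + 1"
  have L0: "L \<ge> 0" using g lipschitz_on_nonneg by blast
  have M: "p \<le> M" "- q \<le> M" "L \<le> M" "M > 0" using L0 unfolding M_def by auto
  have gM: "M-lipschitz_on UNIV g" "M-lipschitz_on UNIV (\<lambda>x. - g x)"
    using lipschitz_on_mono[OF g subset_refl M(3)] by simp_all
  have inc: "(M - r) * measure lebesgue (C \<inter> {a..b}) \<le> M * (b - a) - (k b - k a)"
    if k: "M-lipschitz_on UNIV k" and r: "r \<le> M" and t: "t \<in> {1,-1}"
      and sub: "C \<subseteq> dini_below t k 1 r" and ab: "a \<le> b" for k r t a b
  proof (cases "t = 1")
    case True
    show ?thesis
    proof (rule lipschitz_increment_le_closed[OF k r C _ ab])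
      fix x d :: real assume "x \<in> C" "d > 0"
      then obtain h where "0 < h" "h < d" "t * (k (x + (t * h) *\<^sub>R 1) - k x) < r * h"
        using dini_belowD sub by blast
      then show "\<exists>h>0. h < d \<and> k (x + h) - k x \<le> r * h" using True by (intro exI[of _ h]) auto
    qed
  next
    case False
    then have t: "t = -1" using t by auto
    show ?thesis
    proof (rule lipschitz_increment_le_closed_left[OF k r C _ ab])
      fix x d :: real assume "x \<in> C" "d > 0"
      then obtain h where "0 < h" "h < d" "t * (k (x + (t * h) *\<^sub>R 1) - k x) < r * h"
        using dini_belowD sub by blast
      then show "\<exists>h>0. h < d \<and> k x - k (x - h) \<le> r * h" using t by (intro exI[of _ h]) auto
    qed
  qed
  show ?thesis
  proof (rule negligible_if_interval_density[OF C, of "2 * M / (2 * M + (q - p))"])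
    show "0 \<le> 2 * M / (2 * M + (q - p))" "2 * M / (2 * M + (q - p)) < 1"
      using M pq by (auto simp: divide_less_eq)
    fix a b :: real assume ab: "a \<le> b"
    have "(M - p) * measure lebesgue (C \<inter> {a..b}) \<le> M * (b - a) - (g b - g a)"
      by (rule inc[OF gM(1) M(1) s(1) sub(1) ab])
    moreover have "(M - (- q)) * measure lebesgue (C \<inter> {a..b}) \<le> M * (b - a) - (- g b - (- g a))"
      by (rule inc[OF gM(2) M(2) s(2) sub(2) ab])
    ultimately have "(2 * M + (q - p)) * measure lebesgue (C \<inter> {a..b}) \<le> 2 * M * (b - a)"
      by (simp add: algebra_simps)
    then show "measure lebesgue (C \<inter> {a..b}) \<le> 2 * M / (2 * M + (q - p)) * (b - a)"
      using M pq by (simp add: field_simps)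
  qed
qed

lemma dini_gap_negligible_real:
  fixes g :: "real \<Rightarrow> real"
  assumes g: "L-lipschitz_on UNIV g" and pq: "p < q" and s: "s \<in> {1,-1}" "s' \<in> {1,-1}"
  shows "negligible (dini_below s g 1 p \<inter> dini_below s' (\<lambda>x. - g x) 1 (- q))"
proof (rule negligible_if_compact_subsets)
  have "continuous_on UNIV g" using g lipschitz_on_continuous_on by blast
  then have "dini_below s g 1 p \<inter> dini_below s' (\<lambda>x. - g x) 1 (- q) \<in> sets borel"
    by (intro sets.Int dini_below_borel continuous_on_minus)
  then show "dini_below s g 1 p \<inter> dini_below s' (\<lambda>x. - g x) 1 (- q) \<in> sets lebesgue"
    by simp
qed (use dini_gap_compact_negligible[OF g pq _ s] in blast)

section \<open>Fubini along lines and directional derivatives\<close>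

lemma nn_integral_lborel_translate:
  fixes c :: "'a::euclidean_space"
  assumes [measurable]: "f \<in> borel_measurable borel"
  shows "(\<integral>\<^sup>+x. f (x + c) \<partial>lborel) = (\<integral>\<^sup>+x. f x \<partial>lborel)"
proof -
  have "(\<integral>\<^sup>+x. f x \<partial>lborel) = (\<integral>\<^sup>+x. f x \<partial>distr lborel borel ((+) c))"
    by (simp add: lborel_distr_plus)
  also have "\<dots> = (\<integral>\<^sup>+x. f (c + x) \<partial>lborel)"
    by (subst nn_integral_distr) auto
  finally show ?thesis by (simp add: add.commute)
qed

text \<open>Averaging over the translates of \<open>B\<close> along \<open>v\<close>, with
  \<open>t\<close> in \<open>[0,1]\<close>, and exchanging the integrals reduces the measure of
  \<open>B\<close> to that of its slices; this treats every direction alike, without coordinates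
  adapted to \<open>v\<close>.\<close>

lemma negligible_if_line_slices:
  fixes B :: "'a::euclidean_space set"
  assumes B: "B \<in> sets borel" and sl: "\<And>x. negligible {t::real. x + t *\<^sub>R v \<in> B}"
  shows "negligible B"
proof -
  note [measurable] = B
  have msl: "{t::real. x + t *\<^sub>R v \<in> B} \<in> sets borel" for x
    by measurable
  have "emeasure lborel B = (\<integral>\<^sup>+t. indicator {0..1::real} t * emeasure lborel B \<partial>lborel)"
    by (simp add: nn_integral_multc)
  also have "\<dots> = (\<integral>\<^sup>+t. indicator {0..1::real} t * (\<integral>\<^sup>+x. indicator B (x + t *\<^sub>R v) \<partial>lborel) \<partial>lborel)"
    by (subst nn_integral_lborel_translate) auto
  also have "\<dots> = (\<integral>\<^sup>+t. (\<integral>\<^sup>+x. indicator {0..1::real} t * indicator B (x + t *\<^sub>R v) \<partial>lborel) \<partial>lborel)"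
    by (intro nn_integral_cong) (simp add: nn_integral_cmult)
  also have "\<dots> = (\<integral>\<^sup>+x. (\<integral>\<^sup>+t. indicator {0..1::real} t * indicator B (x + t *\<^sub>R v) \<partial>lborel) \<partial>lborel)"
  proof (rule lborel_pair.Fubini')
    have "(\<lambda>z::'a \<times> real. fst z + snd z *\<^sub>R v) \<in> borel_measurable borel"
      by (intro borel_measurable_continuous_onI continuous_intros)
    then have 1: "(\<lambda>z. fst z + snd z *\<^sub>R v) \<in> borel_measurable (borel \<Otimes>\<^sub>M borel)"
      by (simp add: borel_prod)
    have 2[measurable]: "(\<lambda>z. indicator B (fst z + snd z *\<^sub>R v) :: ennreal) \<in> borel_measurable (borel \<Otimes>\<^sub>M borel)"
      by (rule measurable_compose[OF 1 borel_measurable_indicator[OF B]])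
    show "(\<lambda>(x, t). indicator {0..1::real} t * indicator B (x + t *\<^sub>R v) :: ennreal) \<in> borel_measurable (lborel \<Otimes>\<^sub>M lborel)"
    proof -
      have 3[measurable]: "(\<lambda>z. indicator {0..1} (snd z) :: ennreal) \<in> borel_measurable ((borel :: 'a measure) \<Otimes>\<^sub>M (borel :: real measure))"
        by (rule measurable_compose[OF measurable_snd borel_measurable_indicator]) simp
      have "(\<lambda>z. indicator {0..1} (snd z) * indicator B (fst z + snd z *\<^sub>R v) :: ennreal) \<in> borel_measurable ((borel :: 'a measure) \<Otimes>\<^sub>M (borel :: real measure))"
        by (rule borel_measurable_times_ennreal[OF 3 2])
      moreover have e: "sets ((lborel :: 'a measure) \<Otimes>\<^sub>M (lborel :: real measure)) = sets (borel \<Otimes>\<^sub>M borel)"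
        by (intro sets_pair_measure_cong) simp_all
      ultimately show ?thesis
        by (simp only: case_prod_beta' measurable_cong_sets[OF e refl])
    qed
  qed
  also have "\<dots> = (\<integral>\<^sup>+x. 0 \<partial>(lborel :: 'a measure))"
  proof (rule nn_integral_cong)
    fix x :: 'a
    have "(\<integral>\<^sup>+t. indicator {0..1::real} t * indicator B (x + t *\<^sub>R v) \<partial>lborel)
      \<le> (\<integral>\<^sup>+t. indicator {t. x + t *\<^sub>R v \<in> B} t \<partial>lborel)"
      by (intro nn_integral_mono) (auto split: split_indicator)
    also have "\<dots> = emeasure lborel {t. x + t *\<^sub>R v \<in> B}" using msl by simp
    also have "\<dots> = 0" using sl[of x] msl
      by (simp add: negligible_iff_emeasure0 sets_completionI_sets)
    finally show "(\<integral>\<^sup>+t. indicator {0..1::real} t * indicator B (x + t *\<^sub>R v) \<partial>lborel) = 0" by simp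
  qed
  finally show ?thesis using B by (simp add: negligible_iff_emeasure0 sets_completionI_sets)
qed

lemma lipschitz_on_line:
  fixes f :: "'a::euclidean_space \<Rightarrow> real"
  assumes "L-lipschitz_on UNIV f"
  shows "(L * norm v)-lipschitz_on UNIV (\<lambda>t. f (x + t *\<^sub>R v))"
proof (rule lipschitz_onI)
  show "0 \<le> L * norm v" using assms lipschitz_on_nonneg by fastforce
  fix s t :: real
  have "dist (f (x + s *\<^sub>R v)) (f (x + t *\<^sub>R v)) \<le> L * dist (x + s *\<^sub>R v) (x + t *\<^sub>R v)"
    using lipschitz_onD[OF assms] by blast
  also have "dist (x + s *\<^sub>R v) (x + t *\<^sub>R v) = norm v * dist s t"
    by (simp add: dist_norm flip: scaleR_left_diff_distrib)
  finally show "dist (f (x + s *\<^sub>R v)) (f (x + t *\<^sub>R v)) \<le> L * norm v * dist s t" by (simp add: mult.assoc)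
qed

lemma dini_gap_negligible:
  fixes f :: "'a::euclidean_space \<Rightarrow> real"
  assumes f: "L-lipschitz_on UNIV f" and pq: "p < q" and s: "s \<in> {1,-1}" "s' \<in> {1,-1}"
  shows "negligible (dini_below s f v p \<inter> dini_below s' (\<lambda>x. - f x) v (- q))" (is "negligible ?B")
proof (rule negligible_if_line_slices)
  have "continuous_on UNIV f" using f lipschitz_on_continuous_on by blast
  then show "?B \<in> sets borel"
    by (intro sets.Int dini_below_borel continuous_on_minus)
  fix x
  have "{t. x + t *\<^sub>R v \<in> ?B} = dini_below s (\<lambda>t. f (x + t *\<^sub>R v)) 1 p \<inter>
      dini_below s' (\<lambda>t. - f (x + t *\<^sub>R v)) 1 (- q)"
    by (auto simp: dini_below_def scaleR_left_distrib add.assoc)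
  then show "negligible {t. x + t *\<^sub>R v \<in> ?B}"
    using dini_gap_negligible_real[OF lipschitz_on_line[OF f] pq s] by simp
qed

definition line_deriv :: "('a::euclidean_space \<Rightarrow> real) \<Rightarrow> 'a \<Rightarrow> 'a \<Rightarrow> real \<Rightarrow> bool" where
  "line_deriv f v x d \<longleftrightarrow> ((\<lambda>t. f (x + t *\<^sub>R v)) has_real_derivative d) (at 0)"

text \<open>One of the two signs of \<open>h\<close> must recur at arbitrarily small scales. The
  strict inequality is open in \<open>h\<close> because \<open>f\<close> is continuous, so a
  rational step can be found next to \<open>h\<close>.\<close>

lemma dini_belowI:
  assumes f: "continuous_on UNIV f"
    and fr: "\<And>d. d > 0 \<Longrightarrow> \<exists>h. h \<noteq> 0 \<and> \<bar>h\<bar> < d \<and> (f (x + h *\<^sub>R v) - f x) / h < p"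
  shows "\<exists>s\<in>{1,-1}. x \<in> dini_below s f v p"
proof -
  have "\<exists>s\<in>{1,-1}. \<forall>d>0. \<exists>h>0. h < d \<and> (f (x + (s*h) *\<^sub>R v) - f x) / (s*h) < p"
  proof (rule ccontr)
    assume "\<not> ?thesis"
    then obtain d1 d2 where d: "d1 > 0" "d2 > 0"
      "\<And>h. h > 0 \<Longrightarrow> h < d1 \<Longrightarrow> \<not> (f (x + (1*h) *\<^sub>R v) - f x) / (1*h) < p"
      "\<And>h. h > 0 \<Longrightarrow> h < d2 \<Longrightarrow> \<not> (f (x + (-1*h) *\<^sub>R v) - f x) / (-1*h) < p"
      by fastforce
    obtain h where h: "h \<noteq> 0" "\<bar>h\<bar> < min d1 d2" "(f (x + h *\<^sub>R v) - f x) / h < p"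
      using fr[of "min d1 d2"] d(1,2) by auto
    show False
    proof (cases "h > 0")
      case True then show ?thesis using d(3)[of h] h by auto
    next
      case False then show ?thesis using d(4)[of "-h"] h by auto
    qed
  qed
  then obtain s where s: "s\<in>{1,-1}"
    and P: "\<And>d. d > 0 \<Longrightarrow> \<exists>h>0. h < d \<and> (f (x + (s*h) *\<^sub>R v) - f x) / (s*h) < p" by blast
  have "x \<in> dini_below s f v p" unfolding dini_below_def
  proof (clarify)
    fix n :: nat
    obtain h where h: "h > 0" "h < 1 / (real n + 1)" "(f (x + (s*h) *\<^sub>R v) - f x) / (s*h) < p"
      using P[of "1 / (real n + 1)"] by auto
    have h3: "s * (f (x + (s * h) *\<^sub>R v) - f x) < p * h"
      using h s by (auto simp: field_simps)
    have op: "open ({h. s * (f (x + (s * h) *\<^sub>R v) - f x) < p * h} \<inter> {0<..<1 / (real n + 1)})" (is "open ?U")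
      by (intro open_Int open_Collect_less continuous_intros continuous_on_compose2[OF f]) auto
    have "h \<in> ?U" using h h3 by auto
    then obtain e where e: "e > 0" "ball h e \<subseteq> ?U" using op open_contains_ball by blast
    obtain r where "r \<in> \<rat>" "h < r" "r < h + e" using Rats_dense_in_real[of h "h + e"] e by auto
    then have "r \<in> \<rat> \<inter> ?U" using e(2) by (auto simp: subset_iff dist_real_def)
    then show "\<exists>h\<in>\<rat> \<inter> {0<..<1 / (real n + 1)}. s * (f (x + (s * h) *\<^sub>R v) - f x) < p * h" by blast
  qed
  then show ?thesis using s by blast
qed

text \<open>Outside countably many null sets, the quotients cannot both drop below \<open>p\<close>
  and exceed \<open>q\<close> at arbitrarily small scales for any rational \<open>p < q\<close>;
  being bounded, they converge.\<close>

lemma AE_line_deriv: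
  fixes f :: "'a::euclidean_space \<Rightarrow> real"
  assumes f: "L-lipschitz_on UNIV f"
  shows "AE x in lebesgue. \<exists>d. line_deriv f v x d"
proof -
  define Bad where "Bad = (\<Union>(s,s',p,q)\<in>{1,-1}\<times>{1,-1}\<times>{(p,q)\<in>\<rat>\<times>\<rat>. p < q}.
     dini_below s f v p \<inter> dini_below s' (\<lambda>x. - f x) v (- q))"
  have cf: "continuous_on UNIV f" using f lipschitz_on_continuous_on by blast
  have "negligible Bad" unfolding Bad_def
  proof (rule negligible_countable_Union)
    have "countable ({1,-1::real}\<times>{1,-1::real}\<times>{(p,q)\<in>\<rat>\<times>\<rat>. p < (q::real)})"
      by (intro countable_SIGMA countable_subset[of "{(p,q)\<in>\<rat>\<times>\<rat>. p < (q::real)}" "\<rat>\<times>\<rat>"] countable_rat) auto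
    then show "countable ((\<lambda>(s,s',p,q). dini_below s f v p \<inter> dini_below s' (\<lambda>x. - f x) v (- q)) `
        ({1,-1}\<times>{1,-1}\<times>{(p,q)\<in>\<rat>\<times>\<rat>. p < q}))" by (rule countable_image)
  next
    fix A assume "A \<in> (\<lambda>(s,s',p,q). dini_below s f v p \<inter> dini_below s' (\<lambda>x. - f x) v (- q)) `
        ({1,-1}\<times>{1,-1}\<times>{(p,q)\<in>\<rat>\<times>\<rat>. p < q})"
    then show "negligible A" using dini_gap_negligible[OF f] by force
  qed
  then have "AE x in lebesgue. x \<notin> Bad"
    by (simp add: AE_not_in negligible_iff_null_sets)
  then show ?thesis
  proof eventually_elim
    fix x assume x: "x \<notin> Bad"
    define Q where "Q h = (f (x + h *\<^sub>R v) - f x) / h" for h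
    have bound: "\<bar>Q h\<bar> \<le> L * norm v" if "h \<noteq> 0" for h
      using lipschitz_onD[OF lipschitz_on_line[OF f], of h 0 x v] that
      by (simp add: Q_def dist_real_def field_simps)
    have gap: False if pq: "p < q" "p \<in> \<rat>" "q \<in> \<rat>"
      and lo: "\<not> (\<forall>\<^sub>F h in at 0. p \<le> Q h)" and up: "\<not> (\<forall>\<^sub>F h in at 0. Q h \<le> q)" for p q
    proof -
      have "\<exists>h. h \<noteq> 0 \<and> \<bar>h\<bar> < d \<and> (f (x + h *\<^sub>R v) - f x) / h < p" if "d > 0" for d
        using lo that unfolding eventually_at Q_def by (auto simp: dist_real_def not_le)
      then obtain s where s: "s \<in> {1,-1}" "x \<in> dini_below s f v p" using dini_belowI[OF cf] by blast
      have "\<exists>h. h \<noteq> 0 \<and> \<bar>h\<bar> < d \<and> (- f (x + h *\<^sub>R v) - (- f x)) / h < - q" if "d > 0" for d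
      proof -
        obtain h where "h \<noteq> 0" "\<bar>h\<bar> < d" "q < (f (x + h *\<^sub>R v) - f x) / h"
        proof -
          have "\<forall>d>0. \<exists>h. h \<noteq> 0 \<and> \<bar>h\<bar> < d \<and> q < (f (x + h *\<^sub>R v) - f x) / h"
            using up unfolding eventually_at Q_def by (auto simp: dist_real_def not_le)
          then show ?thesis using \<open>d > 0\<close> that by blast
        qed
        moreover have "(- f (x + h *\<^sub>R v) - (- f x)) / h = - ((f (x + h *\<^sub>R v) - f x) / h)"
          by (simp add: diff_divide_distrib)
        ultimately show ?thesis by (intro exI[of _ h]) auto
      qed
      then obtain s' where s': "s' \<in> {1,-1}" "x \<in> dini_below s' (\<lambda>x. - f x) v (- q)"
        using dini_belowI[of "\<lambda>x. - f x" x v "-q"] cf continuous_on_minus by blast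
      have "x \<in> Bad" unfolding Bad_def using s s' pq by (intro UN_I[of "(s,s',p,q)"]) auto
      then show False using x by simp
    qed
    have "\<exists>d. (Q \<longlongrightarrow> d) (at 0)"
    proof -
      \<comment> \<open>The eventual lower bounds of the quotient; their supremum is its lower
        limit, finite by the Lipschitz bound.\<close>
      define S where "S = {p. \<forall>\<^sub>F h in at 0. p \<le> Q h}"
      have ne: "- (L * norm v) \<in> S" unfolding S_def
        using bound by (auto simp: eventually_at abs_le_iff intro!: exI[of _ 1]) (metis minus_le_iff)
      have ub: "p \<le> L * norm v" if "p \<in> S" for p
      proof -
        from that have "\<forall>\<^sub>F h in at 0. p \<le> Q h" unfolding S_def by simp
        moreover have "\<forall>\<^sub>F h in at (0::real). h \<noteq> 0" by (simp add: eventually_at_filter)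
        ultimately have "\<forall>\<^sub>F h in at 0. p \<le> Q h \<and> h \<noteq> 0" by (rule eventually_conj)
        then obtain h where "p \<le> Q h" "h \<noteq> 0" using eventually_happens'[OF at_neq_bot] by blast
        then show ?thesis using bound[of h] by linarith
      qed
      have bdd: "bdd_above S" using ub by (rule bdd_aboveI)
      define d where "d = Sup S"
      have "(Q \<longlongrightarrow> d) (at 0)"
      proof (rule order_tendstoI)
        fix a assume "a < d"
        then obtain p where "p \<in> S" "a < p" unfolding d_def using less_cSup_iff[of S a] ne bdd by auto
        then show "\<forall>\<^sub>F h in at 0. a < Q h" unfolding S_def by (auto elim: eventually_mono)
      next
        fix a assume "d < a"
        obtain q where q: "q \<in> \<rat>" "d < q" "q < a" using Rats_dense_in_real[OF \<open>d < a\<close>] by blast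
        obtain p where p: "p \<in> \<rat>" "d < p" "p < q" using Rats_dense_in_real[OF q(2)] by blast
        have "p \<notin> S" using p bdd unfolding d_def using cSup_upper leD by blast
        then have "\<forall>\<^sub>F h in at 0. Q h \<le> q" using gap[OF p(3,1) q(1)] unfolding S_def by blast
        then show "\<forall>\<^sub>F h in at 0. Q h < a" using q by (auto elim: eventually_mono)
      qed
      then show ?thesis by blast
    qed
    then show "\<exists>d. line_deriv f v x d" unfolding line_deriv_def DERIV_def Q_def by simp
  qed
qed

text \<open>The a.e. additivity of directional derivatives follows by testing against continuous
  functions and shifting the difference quotients onto them.\<close>

lemma AE_zero_if_test_integrals_zero:
  fixes u :: "'a::euclidean_space \<Rightarrow> real"
  assumes u[measurable]: "u \<in> borel_measurable borel" and bd: "AE x in lborel. \<bar>u x\<bar> \<le> M"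
    and test: "\<And>\<phi> R. continuous_on UNIV \<phi> \<Longrightarrow> (\<And>x. 0 \<le> \<phi> x \<and> \<phi> x \<le> 1) \<Longrightarrow>
      (\<And>x. R < norm x \<Longrightarrow> \<phi> x = 0) \<Longrightarrow> (\<integral>x. \<phi> x * u x \<partial>lborel) = 0"
  shows "AE x in lborel. u x = 0"
proof -
  have main: "negligible {x. 0 < w x}"
    if w[measurable]: "w \<in> borel_measurable borel" and bd: "AE x in lborel. \<bar>w x\<bar> \<le> M"
    and test: "\<And>\<phi> R. continuous_on UNIV \<phi> \<Longrightarrow> (\<And>x. 0 \<le> \<phi> x \<and> \<phi> x \<le> 1) \<Longrightarrow>
      (\<And>x. R < norm x \<Longrightarrow> \<phi> x = 0) \<Longrightarrow> (\<integral>x. \<phi> x * w x \<partial>lborel) = 0" for w :: "'a \<Rightarrow> real"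
  proof (rule negligible_if_compact_subsets)
    have "{x. 0 < w x} \<in> sets borel" by measurable
    then show "{x. 0 < w x} \<in> sets lebesgue" by simp
    fix C assume C: "compact C" "C \<subseteq> {x. 0 < w x}"
    show "negligible C"
    proof (cases "C = {}")
      case False
      have cl: "closed C" using C compact_imp_closed by blast
      obtain R where R: "C \<subseteq> ball 0 R" using C bounded_subset_ballD compact_imp_bounded by metis
      \<comment> \<open>Continuous cutoffs decreasing to the indicator of \<open>C\<close>. For
        \<open>k = 0\<close> the cutoff is constantly 1, without bounded support, hence
        \<open>Suc k\<close> below.\<close>
      define \<phi> where "\<phi> k x = max 0 (1 - real k * infdist x C)" for k x
      have ph1: "0 \<le> \<phi> k x" "\<phi> k x \<le> 1" for k x unfolding \<phi>_def using infdist_nonneg[of x C] by auto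
      have supp: "\<phi> k x = 0" if "k \<ge> 1" "R + 1 < norm x" for k x
      proof -
        have "1 \<le> infdist x C"
        proof (rule ccontr)
          assume "\<not> 1 \<le> infdist x C"
          moreover obtain y where "y \<in> C" "infdist x C = dist x y"
            using infdist_attains_inf[OF cl False] by blast
          moreover have "norm y < R" using R \<open>y \<in> C\<close> by auto
          moreover have "norm x \<le> norm y + dist x y" by (metis dist_commute dist_norm norm_triangle_sub)
          ultimately show False using that by linarith
        qed
        moreover have "1 \<le> real k" using that by simp
        ultimately have "1 \<le> real k * infdist x C" by (metis mult_mono' mult_1 zero_le_one)
        then show ?thesis unfolding \<phi>_def by simp
      qed
      have cont: "continuous_on UNIV (\<phi> k)" for k
        unfolding \<phi>_def by (intro continuous_intros)
      have lim: "(\<lambda>k. \<phi> (Suc k) x) \<longlonglongrightarrow> indicator C x" for x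
      proof (cases "x \<in> C")
        case True then show ?thesis by (simp add: \<phi>_def)
      next
        case False
        then have pos: "infdist x C > 0" using cl \<open>C \<noteq> {}\<close>
          by (metis infdist_nonneg in_closed_iff_infdist_zero less_eq_real_def)
        obtain n :: nat where n: "1 / infdist x C < real n" using reals_Archimedean2 by blast
        have "\<forall>\<^sub>F k in sequentially. \<phi> (Suc k) x = 0"
        proof (rule eventually_sequentiallyI[of n])
          fix k assume "n \<le> k"
          then have "1 / infdist x C < real (Suc k)" using n by simp
          then show "\<phi> (Suc k) x = 0" using pos unfolding \<phi>_def by (simp add: divide_less_eq max_def del: of_nat_Suc)
        qed
        then show ?thesis using False by (simp add: tendsto_eventually)
      qed
      have Cb[measurable]: "C \<in> sets borel" using C borel_compact by blast
      have meas[measurable]: "\<phi> k \<in> borel_measurable borel" for k using cont borel_measurable_continuous_onI by blast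
      have ib: "integrable lborel (\<lambda>x. indicator (cball 0 (R+1)) x * \<bar>M\<bar>)" for R
        by (intro integrable_mult_left integrable_real_indicator) (use emeasure_lborel_cball_finite in \<open>auto\<close>)
      have "(\<lambda>k. \<integral>x. \<phi> (Suc k) x * w x \<partial>lborel) \<longlonglongrightarrow> (\<integral>x. indicator C x * w x \<partial>lborel)"
      proof (rule integral_dominated_convergence[OF _ _ ib[of R]])
        show "AE x in lborel. (\<lambda>k. \<phi> (Suc k) x * w x) \<longlonglongrightarrow> indicator C x * w x"
          by (intro AE_I2 tendsto_mult lim tendsto_const)
        show "AE x in lborel. norm (\<phi> (Suc k) x * w x) \<le> indicator (cball 0 (R+1)) x * \<bar>M\<bar>" for k
          using bd
        proof eventually_elim
          case (elim x)
          show ?case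
          proof (cases "x \<in> cball 0 (R+1)")
            case True
            have "\<bar>\<phi> (Suc k) x\<bar> * \<bar>w x\<bar> \<le> 1 * \<bar>M\<bar>"
              using ph1[of "Suc k" x] elim by (intro mult_mono) auto
            then show ?thesis using True by (simp add: abs_mult)
          next
            case False then show ?thesis using supp[of "Suc k" x] by simp
          qed
        qed
      qed measurable
      moreover have "(\<integral>x. \<phi> (Suc k) x * w x \<partial>lborel) = 0" for k
        using test[of "\<phi> (Suc k)" "R+1"] cont ph1 supp[of "Suc k"] by auto
      ultimately have "(\<lambda>k. 0) \<longlonglongrightarrow> (\<integral>x. indicator C x * w x \<partial>lborel)" by simp
      then have z: "(\<integral>x. indicator C x * w x \<partial>lborel) = 0"
        using LIMSEQ_unique[OF _ tendsto_const] by metis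
      have int: "integrable lborel (\<lambda>x. indicator C x * w x)"
      proof (rule Bochner_Integration.integrable_bound[OF ib[of R]])
        show "AE x in lborel. norm (indicator C x * w x) \<le> norm (indicator (cball 0 (R+1)) x * \<bar>M\<bar>)"
          using bd by eventually_elim (use R in \<open>auto simp: indicator_def abs_mult\<close>)
      qed measurable
      have "AE x in lborel. indicator C x * w x = 0"
      proof (rule integral_nonneg_eq_0_iff_AE[OF int, THEN iffD1, OF _ z])
        show "AE x in lborel. 0 \<le> indicator C x * w x"
          using C(2) by (intro AE_I2) (auto simp: indicator_def less_imp_le)
      qed
      then have "AE x in lborel. x \<notin> C"
        by eventually_elim (use C(2) in \<open>auto simp: indicator_def split: if_splits\<close>)
      then have "C \<in> null_sets lborel" by (simp add: AE_iff_null_sets)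
      then show ?thesis by (simp add: negligible_iff_null_sets null_sets_completionI)
    qed simp
  qed
  have "negligible {x. 0 < u x}"
  proof (rule main[OF u bd])
    show "(\<integral>x. \<phi> x * u x \<partial>lborel) = 0" if "continuous_on UNIV \<phi>" "\<And>x. 0 \<le> \<phi> x \<and> \<phi> x \<le> 1"
      "\<And>x. R < norm x \<Longrightarrow> \<phi> x = 0" for \<phi> R
      using test[OF that] by simp
  qed
  moreover have "negligible {x. 0 < - u x}"
  proof (rule main)
    show "AE x in lborel. \<bar>- u x\<bar> \<le> M" using bd by simp
    show "(\<integral>x. \<phi> x * - u x \<partial>lborel) = 0" if "continuous_on UNIV \<phi>" "\<And>x. 0 \<le> \<phi> x \<and> \<phi> x \<le> 1"
      "\<And>x. R < norm x \<Longrightarrow> \<phi> x = 0" for \<phi> R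
      using test[OF that] by simp
  qed measurable
  ultimately have "negligible ({x. 0 < u x} \<union> {x. 0 < - u x})" by (rule negligible_Un)
  moreover have eq: "{x. 0 < u x} \<union> {x. 0 < - u x} = {x. \<not> u x = 0}" by auto
  ultimately have "negligible {x. \<not> u x = 0}" by (simp only: eq)
  moreover have "{x. \<not> u x = 0} \<in> sets borel" by measurable
  ultimately have "{x. \<not> u x = 0} \<in> null_sets lborel"
    by (auto simp: negligible_iff_emeasure0 null_sets_def)
  then show ?thesis by (simp add: AE_iff_null_sets)
qed

lemma AE_line_deriv_lborel:
  fixes f :: "'a::euclidean_space \<Rightarrow> real"
  assumes "L-lipschitz_on UNIV f"
  shows "AE x in lborel. \<exists>d. line_deriv f v x d"
  using AE_line_deriv[OF assms] by (simp add: AE_completion_iff)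

section \<open>Additivity of directional derivatives and total differentiability\<close>

text \<open>Steps along a sequence keep the limit visibly Borel measurable.\<close>

definition dline :: "('a::euclidean_space \<Rightarrow> real) \<Rightarrow> 'a \<Rightarrow> nat \<Rightarrow> 'a \<Rightarrow> real" where
  "dline f v n x = real (Suc n) * (f (x + (1 / real (Suc n)) *\<^sub>R v) - f x)"

lemma line_deriv_tendsto:
  assumes "line_deriv f v x d"
  shows "(\<lambda>n. dline f v n x) \<longlonglongrightarrow> d"
proof -
  have "((\<lambda>h. (f (x + h *\<^sub>R v) - f x) / h) \<longlongrightarrow> d) (at 0)"
    using assms unfolding line_deriv_def DERIV_def by simp
  moreover have "filterlim (\<lambda>n. 1 / real (Suc n)) (at 0) sequentially"
    using LIMSEQ_Suc[OF lim_1_over_n] by (auto simp: filterlim_at)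
  ultimately have "(\<lambda>n. (f (x + (1 / real (Suc n)) *\<^sub>R v) - f x) / (1 / real (Suc n))) \<longlonglongrightarrow> d"
    by (rule filterlim_compose)
  then show ?thesis by (simp add: dline_def mult.commute del: of_nat_Suc)
qed

lemma dline_bound:
  assumes "L-lipschitz_on UNIV f"
  shows "\<bar>dline f v n x\<bar> \<le> L * norm v"
proof -
  have "\<bar>f (x + (1 / real (Suc n)) *\<^sub>R v) - f x\<bar> \<le> L * norm ((1 / real (Suc n)) *\<^sub>R v)"
    using lipschitz_onD[OF assms, of "x + (1 / real (Suc n)) *\<^sub>R v" x] by (simp add: dist_norm)
  then have "real (Suc n) * \<bar>f (x + (1 / real (Suc n)) *\<^sub>R v) - f x\<bar> \<le> real (Suc n) * (L * norm ((1 / real (Suc n)) *\<^sub>R v))"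
    by (intro mult_left_mono) auto
  then show ?thesis by (simp add: dline_def abs_mult del: of_nat_Suc)
qed

text \<open>The additivity defect of the quotients telescopes: it is the quotient along
  \<open>w\<close> at \<open>x + vn n\<close> minus that at \<open>x\<close>. Translating the
  integral moves this difference onto the test function, where continuity sends it to zero; by
  dominated convergence the defect of the derivatives integrates to zero against every test
  function.\<close>

lemma line_deriv_add:
  fixes f :: "'a::euclidean_space \<Rightarrow> real"
  assumes f: "L-lipschitz_on UNIV f"
    and dv: "AE x in lborel. line_deriv f v x (Dv x)" and dw: "AE x in lborel. line_deriv f w x (Dw x)"
  shows "AE x in lborel. line_deriv f (v + w) x (Dv x + Dw x)"
proof -
  have cf: "continuous_on UNIV f" using f lipschitz_on_continuous_on by blast
  have [measurable]: "f \<in> borel_measurable borel" using cf borel_measurable_continuous_onI by blast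
  have dlm[measurable]: "dline f v n \<in> borel_measurable borel" for v n
  proof -
    have "(\<lambda>x. real (Suc n) * (f (x + (1 / real (Suc n)) *\<^sub>R v) - f x)) \<in> borel_measurable borel"
      by measurable
    then show ?thesis by (simp add: dline_def[abs_def])
  qed
  \<comment> \<open>\<open>Dv\<close> and \<open>Dw\<close> are arbitrary versions without
    measurability; \<open>E\<close> is a Borel version of the same derivatives.\<close>
  define E where "E v x = lim (\<lambda>n. dline f v n x)" for v x
  have [measurable]: "E v \<in> borel_measurable borel" for v
    unfolding E_def by (rule borel_measurable_lim_metric) (rule dlm)
  have E: "AE x in lborel. line_deriv f v x (E v x) \<and> (\<lambda>n. dline f v n x) \<longlonglongrightarrow> E v x" for v
    using AE_line_deriv_lborel[OF f, of v]
  proof eventually_elim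
    case (elim x)
    then obtain d where d: "line_deriv f v x d" by blast
    then have "(\<lambda>n. dline f v n x) \<longlonglongrightarrow> d" by (rule line_deriv_tendsto)
    then show ?case using d unfolding E_def by (metis limI)
  qed
  define u where "u x = E (v + w) x - E v x - E w x" for x
  define M where "M = L * norm (v + w) + L * norm v + L * norm w"
  have L0: "L \<ge> 0" using f lipschitz_on_nonneg by blast
  define un where "un n x = dline f (v + w) n x - dline f v n x - dline f w n x" for n x
  have unM: "\<bar>un n x\<bar> \<le> M" for n x
    using dline_bound[OF f, of "v+w" n x] dline_bound[OF f, of "v" n x] dline_bound[OF f, of "w" n x]
    unfolding un_def M_def by linarith
  have unl: "AE x in lborel. (\<lambda>n. un n x) \<longlonglongrightarrow> u x"
    using E[of "v+w"] E[of v] E[of w]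
    by eventually_elim (auto simp: un_def u_def intro!: tendsto_diff)
  have [measurable]: "un n \<in> borel_measurable borel" "u \<in> borel_measurable borel" for n
    unfolding un_def u_def by measurable
  have "AE x in lborel. u x = 0"
  proof (rule AE_zero_if_test_integrals_zero)
    show "AE x in lborel. \<bar>u x\<bar> \<le> M"
      using unl
    proof eventually_elim
      case (elim x)
      then have "(\<lambda>n. \<bar>un n x\<bar>) \<longlonglongrightarrow> \<bar>u x\<bar>" by (rule tendsto_rabs)
      then show ?case using unM by (intro LIMSEQ_le_const2) auto
    qed
    fix \<phi> :: "'a \<Rightarrow> real" and R
    assume c\<phi>: "continuous_on UNIV \<phi>" and \<phi>1: "\<And>x. 0 \<le> \<phi> x \<and> \<phi> x \<le> 1" and \<phi>R: "\<And>x. R < norm x \<Longrightarrow> \<phi> x = 0"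
    have [measurable]: "\<phi> \<in> borel_measurable borel" using c\<phi> borel_measurable_continuous_onI by blast
    have ib: "integrable lborel (\<lambda>x::'a. indicator (cball 0 R) x * B)" for R B :: real
      by (intro integrable_mult_left integrable_real_indicator) (use emeasure_lborel_cball_finite in \<open>auto\<close>)
    have "(\<lambda>n. \<integral>x. \<phi> x * un n x \<partial>lborel) \<longlonglongrightarrow> (\<integral>x. \<phi> x * u x \<partial>lborel)"
    proof (rule integral_dominated_convergence[OF _ _ ib[of R M]])
      show "AE x in lborel. (\<lambda>n. \<phi> x * un n x) \<longlonglongrightarrow> \<phi> x * u x"
        using unl by eventually_elim (intro tendsto_mult tendsto_const)
      show "AE x in lborel. norm (\<phi> x * un n x) \<le> indicator (cball 0 R) x * M" for n
      proof (rule AE_I2)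
        fix x
        have "\<bar>\<phi> x\<bar> * \<bar>un n x\<bar> \<le> 1 * M" using \<phi>1[of x] unM[of n x] by (intro mult_mono) auto
        then show "norm (\<phi> x * un n x) \<le> indicator (cball 0 R) x * M"
          using \<phi>R[of x] by (auto simp: abs_mult indicator_def)
      qed
    qed measurable
    moreover have "(\<lambda>n. \<integral>x. \<phi> x * un n x \<partial>lborel) \<longlonglongrightarrow> 0"
    proof -
      define vn where "vn n = (1 / real (Suc n)) *\<^sub>R v" for n
      have vn: "norm (vn n) \<le> norm v" for n
        unfolding vn_def by (simp add: field_simps mult_left_le)
      have vn0: "vn \<longlonglongrightarrow> 0" unfolding vn_def
        using tendsto_scaleR[OF LIMSEQ_Suc[OF lim_1_over_n] tendsto_const[of v]] by simp
      have iphi: "integrable lborel (\<lambda>x. \<phi> (x + c) * dline f w n x)" for c n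
      proof (rule Bochner_Integration.integrable_bound[OF ib[of "R + norm c" "L * norm w"]])
        show "AE x in lborel. norm (\<phi> (x + c) * dline f w n x) \<le> norm (indicator (cball 0 (R + norm c)) x * (L * norm w))"
        proof (rule AE_I2)
          fix x
          have "\<bar>\<phi> (x + c)\<bar> * \<bar>dline f w n x\<bar> \<le> 1 * (L * norm w)"
            using \<phi>1[of "x + c"] dline_bound[OF f, of w n x] by (intro mult_mono) auto
          moreover have "R < norm (x + c)" if "x \<notin> cball 0 (R + norm c)"
            using that norm_triangle_ineq4[of "x + c" c] by simp
          ultimately show "norm (\<phi> (x + c) * dline f w n x) \<le> norm (indicator (cball 0 (R + norm c)) x * (L * norm w))"
            using \<phi>R[of "x + c"] L0 by (auto simp: abs_mult indicator_def)
        qed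
      qed measurable
      have eq: "(\<integral>x. \<phi> x * un n x \<partial>lborel) = (\<integral>x. (\<phi> (x - vn n) - \<phi> x) * dline f w n x \<partial>lborel)" for n
      proof -
        have un: "un n x = dline f w n (x + vn n) - dline f w n x" for x
          by (simp add: un_def dline_def vn_def algebra_simps)
        have e1: "integrable lborel (\<lambda>x. \<phi> x * dline f w n (x + vn n))"
          "(\<integral>x. \<phi> x * dline f w n (x + vn n) \<partial>lborel) = (\<integral>x. \<phi> (x - vn n) * dline f w n x \<partial>lborel)"
        proof -
          have "integrable (distr lborel borel ((+) (vn n))) (\<lambda>x. \<phi> (x + (- vn n)) * dline f w n x)"
            using iphi[of "- vn n" n] by (simp only: lborel_distr_plus)
          then show "integrable lborel (\<lambda>x. \<phi> x * dline f w n (x + vn n))"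
            by (subst (asm) integrable_distr_eq) (auto simp: add.commute)
          have "(\<integral>x. \<phi> (x - vn n) * dline f w n x \<partial>lborel) =
              (\<integral>x. \<phi> (x - vn n) * dline f w n x \<partial>(distr lborel borel ((+) (vn n))))"
            by (simp only: lborel_distr_plus)
          also have "\<dots> = (\<integral>x. \<phi> x * dline f w n (x + vn n) \<partial>lborel)"
            by (subst integral_distr) (auto simp: add.commute)
          finally show "(\<integral>x. \<phi> x * dline f w n (x + vn n) \<partial>lborel) = (\<integral>x. \<phi> (x - vn n) * dline f w n x \<partial>lborel)" by simp
        qed
        have "(\<integral>x. \<phi> x * un n x \<partial>lborel) = (\<integral>x. \<phi> x * dline f w n (x + vn n) - \<phi> x * dline f w n x \<partial>lborel)"
          by (simp add: un right_diff_distrib)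
        also have "\<dots> = (\<integral>x. \<phi> x * dline f w n (x + vn n) \<partial>lborel) - (\<integral>x. \<phi> x * dline f w n x \<partial>lborel)"
          using e1(1) iphi[of 0 n] by (intro Bochner_Integration.integral_diff) auto
        also have "\<dots> = (\<integral>x. \<phi> (x - vn n) * dline f w n x - \<phi> x * dline f w n x \<partial>lborel)"
          unfolding e1(2) using iphi[of "- vn n" n] iphi[of 0 n]
          by (intro Bochner_Integration.integral_diff[symmetric]) auto
        finally show ?thesis by (simp add: left_diff_distrib)
      qed
      have "(\<lambda>n. \<integral>x. (\<phi> (x - vn n) - \<phi> x) * dline f w n x \<partial>lborel) \<longlonglongrightarrow> (\<integral>x. 0 \<partial>(lborel :: 'a measure))"
      proof (rule integral_dominated_convergence[OF _ _ ib[of "R + norm v" "L * norm w"]])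
        show "AE x in lborel. (\<lambda>n. (\<phi> (x - vn n) - \<phi> x) * dline f w n x) \<longlonglongrightarrow> 0"
        proof (rule AE_I2)
          fix x
          have "(\<lambda>n. \<phi> (x - vn n)) \<longlonglongrightarrow> \<phi> x"
          proof (rule continuous_on_tendsto_compose[OF c\<phi>])
            show "(\<lambda>n. x - vn n) \<longlonglongrightarrow> x" using tendsto_diff[OF tendsto_const[of x] vn0] by simp
          qed auto
          then have "(\<lambda>n. \<phi> (x - vn n) - \<phi> x) \<longlonglongrightarrow> 0" by (simp add: LIM_zero)
          then show "(\<lambda>n. (\<phi> (x - vn n) - \<phi> x) * dline f w n x) \<longlonglongrightarrow> 0"
            by (rule tendsto_0_le[where K = "L * norm w"])
              (use dline_bound[OF f] in \<open>auto simp: abs_mult intro!: always_eventually mult_left_mono\<close>)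
        qed
        show "AE x in lborel. norm ((\<phi> (x - vn n) - \<phi> x) * dline f w n x) \<le> indicator (cball 0 (R + norm v)) x * (L * norm w)" for n
        proof (rule AE_I2)
          fix x
          have "\<bar>\<phi> (x - vn n) - \<phi> x\<bar> \<le> 1" using \<phi>1[of x] \<phi>1[of "x - vn n"] by (auto simp: abs_if)
          then have "\<bar>\<phi> (x - vn n) - \<phi> x\<bar> * \<bar>dline f w n x\<bar> \<le> 1 * (L * norm w)"
            using dline_bound[OF f, of w n x] by (intro mult_mono) auto
          moreover have "R < norm (x - vn n)" "R < norm x" if "x \<notin> cball 0 (R + norm v)"
          proof -
            have "norm x > R + norm v" using that by simp
            moreover have "norm x \<le> norm (x - vn n) + norm (vn n)"
              using norm_triangle_ineq[of "x - vn n" "vn n"] by simp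
            ultimately show "R < norm (x - vn n)" using vn[of n] by linarith
            show "R < norm x" using \<open>norm x > R + norm v\<close> norm_ge_zero[of v] by linarith
          qed
          ultimately show "norm ((\<phi> (x - vn n) - \<phi> x) * dline f w n x) \<le> indicator (cball 0 (R + norm v)) x * (L * norm w)"
            using \<phi>R[of "x - vn n"] \<phi>R[of x] by (auto simp: abs_mult indicator_def)
        qed
      qed measurable
      then show ?thesis by (simp add: eq)
    qed
    ultimately show "(\<integral>x. \<phi> x * u x \<partial>lborel) = 0" using LIMSEQ_unique by blast
  qed measurable
  with E[of "v+w"] E[of v] E[of w] dv dw show ?thesis
  proof eventually_elim
    case (elim x)
    have "Dv x = E v x" "Dw x = E w x" using elim unfolding line_deriv_def using DERIV_unique by blast+
    moreover have "E (v + w) x = E v x + E w x" using elim unfolding u_def by simp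
    ultimately show ?case using elim by simp
  qed
qed

lemma line_deriv_scale:
  assumes "line_deriv f v x d"
  shows "line_deriv f (c *\<^sub>R v) x (c * d)"
proof -
  have "((\<lambda>t. f (x + t *\<^sub>R v)) has_real_derivative d) (at (c * 0))" using assms by (simp add: line_deriv_def)
  then have "((\<lambda>t. f (x + (c * t) *\<^sub>R v)) has_real_derivative (d * c)) (at 0)"
    by (rule DERIV_chain2) (auto intro!: derivative_eq_intros)
  then show ?thesis by (simp add: line_deriv_def mult.commute)
qed

lemma line_deriv_sum:
  fixes f :: "'a::euclidean_space \<Rightarrow> real"
  assumes f: "L-lipschitz_on UNIV f"
    and d: "\<And>b. b \<in> Basis \<Longrightarrow> AE x in lborel. line_deriv f b x (D b x)"
    and S: "finite S" "S \<subseteq> Basis"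
  shows "AE x in lborel. line_deriv f (\<Sum>b\<in>S. c b *\<^sub>R b) x (\<Sum>b\<in>S. c b * D b x)"
  using S
proof (induction S rule: finite_induct)
  case empty
  then show ?case by (simp add: line_deriv_def)
next
  case (insert b S)
  have "AE x in lborel. line_deriv f (c b *\<^sub>R b) x (c b * D b x)"
    using d[of b] insert by (auto elim!: eventually_mono intro: line_deriv_scale)
  then have "AE x in lborel. line_deriv f (c b *\<^sub>R b + (\<Sum>b\<in>S. c b *\<^sub>R b)) x (c b * D b x + (\<Sum>b\<in>S. c b * D b x))"
    using insert by (intro line_deriv_add[OF f]) auto
  then show ?case using insert by simp
qed

text \<open>Almost everywhere the directional derivatives come from one linear map for a countable
  dense set of directions. Finitely many of them approximate all unit vectors, and the Lipschitz
  bound makes the convergence uniform over all directions.\<close>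

theorem rademacher_real:
  fixes f :: "'a::euclidean_space \<Rightarrow> real"
  assumes f: "L-lipschitz_on UNIV f"
  shows "negligible {x. \<not> f differentiable (at x)}"
proof -
  have L0: "L \<ge> 0" using f lipschitz_on_nonneg by blast
  have "\<exists>D. \<forall>v. AE x in lborel. line_deriv f v x (D v x)"
  proof (intro exI allI)
    fix v
    show "AE x in lborel. line_deriv f v x (SOME d. line_deriv f v x d)"
      using AE_line_deriv_lborel[OF f, of v] by eventually_elim (metis someI_ex)
  qed
  then obtain D where D: "\<And>v. AE x in lborel. line_deriv f v x (D v x)" by blast
  define l where "l x v = (\<Sum>b\<in>Basis. (v \<bullet> b) * D b x)" for x v
  have l: "AE x in lborel. line_deriv f v x (l x v)" for v
    using line_deriv_sum[OF f D finite_Basis subset_refl, of "\<lambda>b. v \<bullet> b"]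
    by (simp add: l_def euclidean_representation)
  obtain Q :: "'a set" where Q: "countable Q" "\<And>X. open X \<Longrightarrow> X \<noteq> {} \<Longrightarrow> \<exists>d\<in>Q. d \<in> X"
    using countable_dense_setE by blast
  have "AE x in lborel. \<forall>v\<in>Q. line_deriv f v x (l x v)"
    using l Q(1) by (simp add: AE_ball_countable)
  then have "AE x in lborel. f differentiable (at x)"
  proof eventually_elim
    case (elim x)
    have "linear (l x)" unfolding l_def
      by (auto intro!: linearI simp: inner_add_left distrib_right sum.distrib sum_distrib_left mult.assoc)
    then have bl: "bounded_linear (l x)" by (simp add: linear_conv_bounded_linear)
    then obtain B where B: "B > 0" "\<And>v. norm (l x v) \<le> norm v * B"
      using bounded_linear.pos_bounded by blast
    have "(f has_derivative l x) (at x)"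
      unfolding has_derivative_at_alt
    proof (intro conjI allI impI bl)
      fix e :: real assume e: "e > 0"
      \<comment> \<open>Three errors add up to \<open>e\<close>: \<open>L * r\<close> for replacing
        \<open>u\<close> by \<open>v\<close> in \<open>f\<close>, \<open>r\<close> for the
        derivative along \<open>v\<close>, and \<open>B * r\<close> for replacing \<open>v\<close>
        by \<open>u\<close> in the linear map.\<close>
      define r where "r = e / (L + B + 1)"
      have r: "r > 0" "(L + B + 1) * r = e" using e L0 B unfolding r_def by auto
      have "sphere 0 1 \<subseteq> (\<Union>v\<in>Q. ball v r)"
      proof
        fix u :: 'a
        have "\<exists>d\<in>Q. d \<in> ball u r" using Q(2)[of "ball u r"] r by auto
        then show "u \<in> (\<Union>v\<in>Q. ball v r)" by (auto simp: dist_commute)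
      qed
      then obtain Q' where Q': "Q' \<subseteq> Q" "finite Q'" "sphere 0 1 \<subseteq> (\<Union>v\<in>Q'. ball v r)"
        by (meson compactE_image compact_sphere open_ball)
      have "\<exists>d>0. \<forall>t. \<bar>t\<bar> < d \<longrightarrow> \<bar>f (x + t *\<^sub>R v) - f x - t * l x v\<bar> \<le> r * \<bar>t\<bar>" if "v \<in> Q'" for v
      proof -
        have "((\<lambda>t. f (x + t *\<^sub>R v)) has_derivative (*) (l x v)) (at 0)"
          using elim that Q' unfolding line_deriv_def has_field_derivative_def by blast
        then show ?thesis using r unfolding has_derivative_at_alt
          by (auto simp: mult.commute)
      qed
      then obtain d where d: "\<And>v. v \<in> Q' \<Longrightarrow> d v > 0"
        "\<And>v t. v \<in> Q' \<Longrightarrow> \<bar>t\<bar> < d v \<Longrightarrow> \<bar>f (x + t *\<^sub>R v) - f x - t * l x v\<bar> \<le> r * \<bar>t\<bar>" by metis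
      define \<delta> where "\<delta> = Min (insert 1 (d ` Q'))"
      have \<delta>: "\<delta> > 0" "\<And>v. v \<in> Q' \<Longrightarrow> \<delta> \<le> d v"
        unfolding \<delta>_def using Q'(2) d(1) by auto
      have "norm (f y - f x - l x (y - x)) \<le> e * norm (y - x)" if y: "norm (y - x) < \<delta>" for y
      proof (cases "y = x")
        case True then show ?thesis using \<open>linear (l x)\<close> by (simp add: linear_0)
      next
        case False
        define t where "t = norm (y - x)"
        have t: "t > 0" "t < \<delta>" using False y unfolding t_def by auto
        define u where "u = (1 / t) *\<^sub>R (y - x)"
        have u: "norm u = 1" "y = x + t *\<^sub>R u" using t unfolding u_def t_def by auto
        then have "u \<in> sphere 0 1" by simp
        then obtain v where v: "v \<in> Q'" "norm (u - v) < r"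
          using Q'(3) by (auto simp: dist_norm norm_minus_commute)
        have 1: "\<bar>f (x + t *\<^sub>R u) - f (x + t *\<^sub>R v)\<bar> \<le> L * (t * r)"
        proof -
          have "\<bar>f (x + t *\<^sub>R u) - f (x + t *\<^sub>R v)\<bar> \<le> L * norm (t *\<^sub>R (u - v))"
            using lipschitz_onD[OF f, of "x + t *\<^sub>R u" "x + t *\<^sub>R v"] by (simp add: dist_norm scaleR_diff_right)
          also have "\<dots> \<le> L * (t * r)" using v t L0 by (intro mult_left_mono) auto
          finally show ?thesis .
        qed
        have 2: "\<bar>f (x + t *\<^sub>R v) - f x - t * l x v\<bar> \<le> r * t"
          using d(2)[OF v(1), of t] \<delta>(2)[OF v(1)] t by auto
        have 3: "\<bar>t * l x v - t * l x u\<bar> \<le> t * (r * B)"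
        proof -
          have "l x v - l x u = l x (v - u)" using \<open>linear (l x)\<close> linear_diff by metis
          moreover have "\<bar>l x (v - u)\<bar> \<le> r * B"
            using B(2)[of "v - u"] v(2) B(1) by (smt (verit) mult_right_mono norm_minus_commute real_norm_def)
          ultimately show ?thesis using t by (simp add: abs_mult flip: right_diff_distrib)
        qed
        have "l x (y - x) = t * l x u" using u \<open>linear (l x)\<close> by (simp add: linear_cmul)
        then have "\<bar>f y - f x - l x (y - x)\<bar> \<le> L * (t * r) + r * t + t * (r * B)"
          using 1 2 3 arg_cong[OF u(2), of f] by linarith
        also have "\<dots> = ((L + B + 1) * r) * t" by (simp add: algebra_simps)
        finally show ?thesis using r t_def by simp
      qed
      then show "\<exists>d>0. \<forall>y. norm (y - x) < d \<longrightarrow> norm (f y - f x - l x (y - x)) \<le> e * norm (y - x)"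
        using \<delta>(1) by blast
    qed
    then show ?case unfolding differentiable_def by blast
  qed
  then have "AE x in lebesgue. f differentiable (at x)" by (rule AE_completion)
  then show ?thesis by (simp add: completion.AE_iff_null_sets negligible_iff_null_sets null_sets_completion_subset AE_iff_null_sets)
qed

text \<open>Composition with the nearest point projection to a closed ball, which is nonexpansive,
  extends \<open>f\<close> from the ball to a globally Lipschitz map without changing it
  inside.\<close>

theorem rademacher_locally:
  fixes f :: "'a::euclidean_space \<Rightarrow> 'b::euclidean_space"
  assumes loc: "\<And>x. x \<in> S \<Longrightarrow> \<exists>r>0. \<exists>L. ball x r \<subseteq> S \<and> L-lipschitz_on (ball x r) f"
  shows "negligible {x\<in>S. \<not> f differentiable (at x)}"
proof -
  have ball: "negligible {y\<in>ball x r. \<not> f differentiable (at y)}"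
    if L: "L-lipschitz_on (cball x r) f" and r: "r > 0" for x r L
  proof -
    define g where "g = f \<circ> closest_point (cball x r)"
    have L0: "L \<ge> 0" using L lipschitz_on_nonneg by blast
    have gL: "L-lipschitz_on UNIV g"
    proof (rule lipschitz_onI[OF _ L0])
      fix a b
      have "dist (g a) (g b) \<le> L * dist (closest_point (cball x r) a) (closest_point (cball x r) b)"
        unfolding g_def comp_def using r
        by (intro lipschitz_onD[OF L] closest_point_in_set) auto
      also have "\<dots> \<le> L * dist a b"
        using L0 r by (intro mult_left_mono closest_point_lipschitz) auto
      finally show "dist (g a) (g b) \<le> L * dist a b" .
    qed
    have "negligible (\<Union>i\<in>Basis. {y. \<not> (\<lambda>y. g y \<bullet> i) differentiable (at y)})"
    proof (rule negligible_Union)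
      fix T assume "T \<in> (\<lambda>i. {y. \<not> (\<lambda>y. g y \<bullet> i) differentiable (at y)}) ` Basis"
      then obtain i where i: "i \<in> Basis" "T = {y. \<not> (\<lambda>y. g y \<bullet> i) differentiable (at y)}" by blast
      have "L-lipschitz_on UNIV (\<lambda>y. g y \<bullet> i)"
      proof (rule lipschitz_onI[OF _ L0])
        fix a b
        have "dist (g a \<bullet> i) (g b \<bullet> i) \<le> dist (g a) (g b)"
          using Basis_le_norm[OF i(1), of "g a - g b"] by (simp add: dist_norm inner_diff_left)
        also have "\<dots> \<le> L * dist a b" using lipschitz_onD[OF gL] by blast
        finally show "dist (g a \<bullet> i) (g b \<bullet> i) \<le> L * dist a b" .
      qed
      then show "negligible T" unfolding i(2) by (rule rademacher_real)
    qed simp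
    moreover have "{y\<in>ball x r. \<not> f differentiable (at y)} \<subseteq> (\<Union>i\<in>Basis. {y. \<not> (\<lambda>y. g y \<bullet> i) differentiable (at y)})"
    proof (rule subsetI, rule ccontr)
      fix y assume y: "y \<in> {y\<in>ball x r. \<not> f differentiable (at y)}"
        and "y \<notin> (\<Union>i\<in>Basis. {y. \<not> (\<lambda>y. g y \<bullet> i) differentiable (at y)})"
      then have "g differentiable (at y)"
        by (auto simp: differentiable_componentwise_within[of g y UNIV])
      then obtain g' where "(g has_derivative g') (at y)" unfolding differentiable_def by blast
      then have "(f has_derivative g') (at y)"
      proof (rule has_derivative_transform_within_open)
        show "g z = f z" if "z \<in> ball x r" for z
          using that by (simp add: g_def closest_point_self)
      qed (use y in auto)
      then show False using y unfolding differentiable_def by blast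
    qed
    ultimately show ?thesis using negligible_subset by blast
  qed
  show ?thesis
  proof (rule locally_negligible_alt[THEN iffD2], intro ballI)
    fix x assume x: "x \<in> {x\<in>S. \<not> f differentiable (at x)}"
    then obtain r L where r: "r > 0" "ball x r \<subseteq> S" "L-lipschitz_on (ball x r) f" using loc by blast
    have "negligible {y\<in>ball x (r/2). \<not> f differentiable (at y)}"
    proof (rule ball)
      show "L-lipschitz_on (cball x (r/2)) f"
        by (rule lipschitz_on_subset[OF r(3)]) (use r(1) in auto)
    qed (use r in auto)
    moreover have "openin (top_of_set {x\<in>S. \<not> f differentiable (at x)}) ({x\<in>S. \<not> f differentiable (at x)} \<inter> ball x (r/2))"
      by (rule openin_open_Int) simp
    ultimately show "\<exists>U. openin (top_of_set {x \<in> S. \<not> f differentiable at x}) U \<and> x \<in> U \<and> negligible U"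
      using x r(1) by (intro exI[of _ "{x\<in>S. \<not> f differentiable (at x)} \<inter> ball x (r/2)"])
        (auto elim: negligible_subset)
  qed
qed

subsection \<open>Linear maps between inner product planes\<close>

definition spd :: "real^2^2 \<Rightarrow> bool" where
  "spd G \<longleftrightarrow> transpose G = G \<and> (\<forall>v. v \<noteq> 0 \<longrightarrow> 0 < v \<bullet> (G *v v))"

lemma mat2_mult: "(A ** B) $ i $ j = A $ i $ 1 * B $ 1 $ j + A $ i $ 2 * B $ 2 $ (j::2)" for A B :: "real^2^2"
  by (simp add: matrix_matrix_mult_def sum_2)

lemma mat2_transpose: "transpose A $ i $ j = A $ j $ i"
  by (simp add: transpose_def)

lemma norm_mat2: "(norm (X :: real^2^2))\<^sup>2 = (X$1$1)\<^sup>2 + (X$1$2)\<^sup>2 + (X$2$1)\<^sup>2 + (X$2$2)\<^sup>2"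
  unfolding power2_norm_eq_inner by (simp add: inner_vec_def sum_2 power2_eq_square)

lemma spdD:
  assumes "spd G"
  shows "G$1$2 = G$2$1" "0 < G$1$1" "0 < det G"
proof -
  show s: "G$1$2 = G$2$1" using assms unfolding spd_def by (metis mat2_transpose)
  have q: "0 < x * (G$1$1 * x + G$1$2 * y) + y * (G$2$1 * x + G$2$2 * y)" if "x \<noteq> 0 \<or> y \<noteq> 0" for x y
  proof -
    have "(vector [x, y] :: real^2) \<noteq> 0" using that by (auto simp: vec_eq_iff forall_2)
    then have "0 < (vector [x, y] :: real^2) \<bullet> (G *v vector [x, y])" using assms unfolding spd_def by blast
    then show ?thesis by (simp add: inner_vec_def sum_2 matrix_vector_mult_def)
  qed
  show p: "0 < G$1$1" using q[of 1 0] by simp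
  \<comment> \<open>The form is evaluated at the vector \<open>(- G$1$2, G$1$1)\<close>, which is
    \<open>G\<close>-orthogonal to the first axis.\<close>
  have "0 < G$1$1 * det G" using q[of "- (G$1$2)" "G$1$1"] p s by (simp add: det_2 algebra_simps)
  then show "0 < det G" using p by (simp add: zero_less_mult_iff)
qed

lemma ex_frame:
  assumes "spd G"
  shows "\<exists>P. transpose P ** G ** P = mat 1 \<and> det P > 0"
proof -
  define a b c where "a = G$1$1" and "b = G$1$2" and "c = G$2$2"
  have G: "G$1$1 = a" "G$1$2 = b" "G$2$1 = b" "G$2$2 = c" using spdD(1)[OF assms] by (auto simp: a_def b_def c_def)
  have a: "a > 0" and D: "a * c - b * b > 0" using spdD(2,3)[OF assms] by (auto simp: det_2 G)
  \<comment> \<open>Gram-Schmidt: \<open>u\<close> normalizes the first axis and \<open>w\<close>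
    the vector \<open>(- b, a)\<close>, whose squared length is
    \<open>a * (a * c - b * b)\<close>.\<close>
  define u w where "u = 1 / sqrt a" and "w = 1 / sqrt (a * (a * c - b * b))"
  have u: "u * u * a = 1" "u > 0" using a by (auto simp: u_def field_simps)
  have "w\<^sup>2 = 1 / (a * (a * c - b * b))" unfolding w_def using a D by (simp add: power_divide)
  then have w: "w * w * (a * (a * c - b * b)) = 1" "w > 0" using a D by (simp_all add: w_def power2_eq_square)
  define P :: "real^2^2" where "P = vector [vector [u, - b * w], vector [0, a * w]]"
  have P: "P$1$1 = u" "P$1$2 = - b * w" "P$2$1 = 0" "P$2$2 = a * w" unfolding P_def by simp_all
  have "transpose P ** G ** P = mat 1"
    using u w by (simp add: vec_eq_iff forall_2 mat2_mult mat2_transpose P G mat_def algebra_simps)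
  moreover have "det P > 0" using u w a by (simp add: det_2 P)
  ultimately show ?thesis by blast
qed

lemma oriented_frame:
  assumes "spd G"
  shows "transpose (oriented_frame G) ** G ** oriented_frame G = mat 1" "det (oriented_frame G) > 0"
  using someI_ex[OF ex_frame[OF assms]] unfolding oriented_frame_def by auto

lemma frame_inverse:
  fixes P :: "real^2^2"
  assumes "det P > 0"
  shows "matrix_inv P ** P = mat 1" "P ** matrix_inv P = mat 1"
proof -
  have "invertible P" using assms by (simp add: invertible_det_nz)
  then have "\<exists>A'. P ** A' = mat 1 \<and> A' ** P = mat 1" unfolding invertible_def .
  from someI_ex[OF this] show "matrix_inv P ** P = mat 1" "P ** matrix_inv P = mat 1"
    unfolding matrix_inv_def by auto
qed

lemma in_frames_eq:
  assumes "spd H"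
  shows "oriented_frame H ** in_frames G H A = A ** oriented_frame G"
proof -
  have "oriented_frame H ** in_frames G H A = (oriented_frame H ** matrix_inv (oriented_frame H)) ** A ** oriented_frame G"
    by (simp add: in_frames_def matrix_mul_assoc)
  then show ?thesis using frame_inverse[OF oriented_frame(2)[OF assms]] by simp
qed

text \<open>The target frame cancels: the singular values see only the pulled-back form, read in the
  source frame.\<close>

lemma gram_in_frames:
  fixes A :: "real^2^2"
  assumes G: "spd G" and H: "spd H"
  defines "X \<equiv> in_frames G H A"
  shows "transpose X ** X = transpose (oriented_frame G) ** (transpose A ** H ** A) ** oriented_frame G"
proof -
  let ?P = "oriented_frame G" and ?Q = "oriented_frame H"
  have "transpose X ** X = transpose X ** (transpose ?Q ** H ** ?Q) ** X"
    using oriented_frame(1)[OF H] by simp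
  also have "\<dots> = transpose (?Q ** X) ** H ** (?Q ** X)"
    by (simp add: matrix_transpose_mul matrix_mul_assoc)
  also have "?Q ** X = A ** ?P" unfolding X_def by (rule in_frames_eq[OF H])
  finally show ?thesis by (simp add: matrix_transpose_mul matrix_mul_assoc)
qed

lemma orthogonal_mult_invariants:
  fixes R X :: "real^2^2"
  assumes R: "transpose R ** R = mat 1" "det R > 0"
  shows "norm (R ** X) = norm X" "det (R ** X) = det X" "norm (X ** R) = norm X" "det (X ** R) = det X"
proof -
  have "det R * det R = 1"
    using arg_cong[OF R(1), of det] by (simp add: det_mul det_transpose)
  then have d: "det R = 1" using R(2) by (metis mult_cancel_left1 square_eq_1_iff less_asym neg_less_0_iff_less zero_less_one order_less_irrefl)
  show "det (R ** X) = det X" "det (X ** R) = det X" using d by (simp_all add: det_mul)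
  have "R ** transpose R = mat 1" using R(1) matrix_left_right_inverse by blast
  have e1: "(R$1$1)\<^sup>2 + (R$2$1)\<^sup>2 = 1" "(R$1$2)\<^sup>2 + (R$2$2)\<^sup>2 = 1" "R$1$1 * R$1$2 + R$2$1 * R$2$2 = 0"
    using R(1) by (auto simp: vec_eq_iff forall_2 mat2_mult mat2_transpose mat_def power2_eq_square)
  have e2: "(R$1$1)\<^sup>2 + (R$1$2)\<^sup>2 = 1" "(R$2$1)\<^sup>2 + (R$2$2)\<^sup>2 = 1" "R$1$1 * R$2$1 + R$1$2 * R$2$2 = 0"
    using \<open>R ** transpose R = mat 1\<close> by (auto simp: vec_eq_iff forall_2 mat2_mult mat2_transpose mat_def power2_eq_square)
  have "(norm (R ** X))\<^sup>2 = (norm X)\<^sup>2"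
  proof -
    have "(norm (R ** X))\<^sup>2 = ((R$1$1)\<^sup>2 + (R$2$1)\<^sup>2) * ((X$1$1)\<^sup>2 + (X$1$2)\<^sup>2) + ((R$1$2)\<^sup>2 + (R$2$2)\<^sup>2) * ((X$2$1)\<^sup>2 + (X$2$2)\<^sup>2)
        + 2 * (R$1$1 * R$1$2 + R$2$1 * R$2$2) * (X$1$1 * X$2$1 + X$1$2 * X$2$2)"
      unfolding norm_mat2 by (simp add: mat2_mult power2_eq_square algebra_simps)
    then show ?thesis by (simp add: e1 norm_mat2)
  qed
  then show "norm (R ** X) = norm X" by simp
  have "(norm (X ** R))\<^sup>2 = (norm X)\<^sup>2"
  proof -
    have "(norm (X ** R))\<^sup>2 = ((R$1$1)\<^sup>2 + (R$1$2)\<^sup>2) * ((X$1$1)\<^sup>2 + (X$2$1)\<^sup>2) + ((R$2$1)\<^sup>2 + (R$2$2)\<^sup>2) * ((X$1$2)\<^sup>2 + (X$2$2)\<^sup>2)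
        + 2 * (R$1$1 * R$2$1 + R$1$2 * R$2$2) * (X$1$1 * X$1$2 + X$2$1 * X$2$2)"
      unfolding norm_mat2 by (simp add: mat2_mult power2_eq_square algebra_simps)
    then show ?thesis by (simp add: e2 norm_mat2)
  qed
  then show "norm (X ** R) = norm X" by simp
qed

lemma frame_change_rotation:
  assumes G: "spd G" and G': "spd G'" and T: "G = transpose T ** G' ** T" "det T > 0"
  obtains R where "transpose R ** R = mat 1" "det R > 0" "T ** oriented_frame G = oriented_frame G' ** R"
proof -
  let ?P = "oriented_frame G" and ?P' = "oriented_frame G'"
  define R where "R = matrix_inv ?P' ** (T ** ?P)"
  have e: "?P' ** R = T ** ?P" unfolding R_def
    using frame_inverse[OF oriented_frame(2)[OF G']] by (simp add: matrix_mul_assoc)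
  have "transpose R ** R = transpose R ** (transpose ?P' ** G' ** ?P') ** R"
    using oriented_frame(1)[OF G'] by simp
  also have "\<dots> = transpose (?P' ** R) ** G' ** (?P' ** R)"
    by (simp add: matrix_transpose_mul matrix_mul_assoc)
  also have "\<dots> = transpose ?P ** (transpose T ** G' ** T) ** ?P"
    unfolding e by (simp add: matrix_transpose_mul matrix_mul_assoc)
  also have "\<dots> = mat 1" using oriented_frame(1)[OF G] T by simp
  finally have 1: "transpose R ** R = mat 1" .
  have "det ?P' * det R = det T * det ?P" using arg_cong[OF e, of det] by (simp add: det_mul)
  then have "det ?P' * det R > 0" using oriented_frame(2)[OF G] T by simp
  then have "det R > 0" using oriented_frame(2)[OF G'] by (simp add: zero_less_mult_iff)
  then show ?thesis using that 1 e by metis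
qed

text \<open>A change of oriented charts alters the frame matrix by rotations on both sides, which
  preserve Frobenius norm and determinant. This neutralizes the choice made in
  \<open>chart_at\<close>.\<close>

lemma in_frames_invariant:
  assumes G: "spd G" "spd G'" and H: "spd H" "spd H'"
    and T: "G = transpose T ** G' ** T" "det T > 0" and S: "H = transpose S ** H' ** S" "det S > 0"
    and A: "A' ** T = S ** A"
  shows "norm (in_frames G' H' A') = norm (in_frames G H A)"
    and "det (in_frames G' H' A') = det (in_frames G H A)"
proof -
  let ?P = "oriented_frame G" and ?P' = "oriented_frame G'"
  let ?Q = "oriented_frame H" and ?Q' = "oriented_frame H'"
  let ?X = "in_frames G H A" and ?X' = "in_frames G' H' A'"
  obtain R where R: "transpose R ** R = mat 1" "det R > 0" "T ** ?P = ?P' ** R"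
    using frame_change_rotation[OF G T] .
  obtain U where U: "transpose U ** U = mat 1" "det U > 0" "S ** ?Q = ?Q' ** U"
    using frame_change_rotation[OF H S] .
  have "?Q' ** (?X' ** R) = (?Q' ** ?X') ** R" by (simp add: matrix_mul_assoc)
  also have "\<dots> = A' ** (?P' ** R)" by (simp add: in_frames_eq[OF H(2)] matrix_mul_assoc)
  also have "\<dots> = (A' ** T) ** ?P" by (simp add: matrix_mul_assoc flip: R(3))
  also have "\<dots> = S ** (A ** ?P)" by (simp add: A matrix_mul_assoc)
  also have "\<dots> = (S ** ?Q) ** ?X" by (simp add: matrix_mul_assoc flip: in_frames_eq[OF H(1)])
  also have "\<dots> = ?Q' ** (U ** ?X)" by (simp add: U(3) matrix_mul_assoc)
  finally have "?Q' ** (?X' ** R) = ?Q' ** (U ** ?X)" .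
  then have "matrix_inv ?Q' ** (?Q' ** (?X' ** R)) = matrix_inv ?Q' ** (?Q' ** (U ** ?X))" by simp
  then have "?X' ** R = U ** ?X"
    using frame_inverse[OF oriented_frame(2)[OF H(2)]] by (simp add: matrix_mul_assoc)
  then show "norm ?X' = norm ?X" "det ?X' = det ?X"
    using orthogonal_mult_invariants[OF R(1,2), of ?X'] orthogonal_mult_invariants[OF U(1,2), of ?X] by metis+
qed

lemma det_oriented_frame:
  assumes "spd G"
  shows "det (oriented_frame G) = 1 / sqrt (det G)"
proof -
  let ?P = "oriented_frame G"
  have "det ?P * det G * det ?P = 1"
    using arg_cong[OF oriented_frame(1)[OF assms], of det] by (simp add: det_mul det_transpose)
  then have "(det ?P)\<^sup>2 = 1 / det G"
    using spdD(3)[OF assms] by (simp add: power2_eq_square field_simps)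
  then have "sqrt ((det ?P)\<^sup>2) = sqrt (1 / det G)" by simp
  then show ?thesis using oriented_frame(2)[OF assms] by (simp add: real_sqrt_divide)
qed

lemma det_in_frames:
  assumes "spd G" "spd H"
  shows "det (in_frames G H A) = det A * sqrt (det H) / sqrt (det G)"
proof -
  have "det (oriented_frame H) * det (in_frames G H A) = det A * det (oriented_frame G)"
    using arg_cong[OF in_frames_eq[OF assms(2)], of det] by (simp add: det_mul)
  then show ?thesis using spdD(3)[OF assms(1)] spdD(3)[OF assms(2)]
    by (simp add: det_oriented_frame assms field_simps)
qed

text \<open>The trace of the inverse of \<open>G\<close> times the pulled-back form, with the
  inverse written by cofactors. It is rational in the entries and free of
  \<open>oriented_frame\<close>, which makes measurability accessible.\<close>

definition energy_density :: "real^2^2 \<Rightarrow> real^2^2 \<Rightarrow> real^2^2 \<Rightarrow> real" where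
  "energy_density G H A = (let B = transpose A ** H ** A in
     (B$1$1 * G$2$2 - B$1$2 * G$1$2 - B$2$1 * G$2$1 + B$2$2 * G$1$1) / det G)"

lemma norm_in_frames:
  assumes "spd G" "spd H"
  shows "(norm (in_frames G H A))\<^sup>2 = energy_density G H A"
proof -
  let ?P = "oriented_frame G"
  define X where "X = in_frames G H A"
  define B where "B = transpose A ** H ** A"
  \<comment> \<open>\<open>W\<close> is the inverse of \<open>G\<close>; its cofactor form follows
    from \<open>W ** G = mat 1\<close>.\<close>
  define W where "W = ?P ** transpose ?P"
  have "(transpose ?P ** G) ** ?P = mat 1" using oriented_frame(1)[OF assms(1)] by simp
  then have "?P ** (transpose ?P ** G) = mat 1" using matrix_left_right_inverse by blast
  then have W: "W ** G = mat 1" unfolding W_def by (simp add: matrix_mul_assoc)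
  have s: "G$2$1 = G$1$2" using spdD(1)[OF assms(1)] by simp
  have eqs: "W$1$1 * G$1$1 + W$1$2 * G$2$1 = 1" "W$1$1 * G$1$2 + W$1$2 * G$2$2 = 0"
     "W$2$1 * G$1$1 + W$2$2 * G$2$1 = 0" "W$2$1 * G$1$2 + W$2$2 * G$2$2 = 1"
    using W by (auto simp: vec_eq_iff forall_2 mat2_mult mat_def)
  have dW: "W$1$1 * det G = G$2$2" "W$1$2 * det G = - G$1$2" "W$2$1 * det G = - G$2$1" "W$2$2 * det G = G$1$1"
    unfolding det_2 using eqs by algebra+
  have dG: "det G > 0" by (rule spdD(3)[OF assms(1)])
  have "(norm X)\<^sup>2 = (transpose X ** X)$1$1 + (transpose X ** X)$2$2"
    unfolding norm_mat2 by (simp add: mat2_mult mat2_transpose power2_eq_square)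
  also have "transpose X ** X = transpose ?P ** B ** ?P"
    unfolding X_def B_def by (rule gram_in_frames[OF assms])
  also have "(transpose ?P ** B ** ?P)$1$1 + (transpose ?P ** B ** ?P)$2$2 =
      B$1$1 * W$1$1 + B$1$2 * W$2$1 + B$2$1 * W$1$2 + B$2$2 * W$2$2"
    unfolding W_def by (simp add: mat2_mult mat2_transpose algebra_simps)
  finally have "(norm X)\<^sup>2 * det G = B$1$1 * (W$1$1 * det G) + B$1$2 * (W$2$1 * det G) + B$2$1 * (W$1$2 * det G) + B$2$2 * (W$2$2 * det G)"
    by (simp add: algebra_simps)
  also have "\<dots> = B$1$1 * G$2$2 - B$1$2 * G$1$2 - B$2$1 * G$2$1 + B$2$2 * G$1$1"
    unfolding dW using s by simp
  finally show ?thesis using dG unfolding X_def B_def energy_density_def Let_def by (simp add: field_simps)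
qed

lemma abs_det_le_norm: "2 * \<bar>det (X :: real^2^2)\<bar> \<le> (norm X)\<^sup>2"
proof -
  have "0 \<le> (X$1$1 - X$2$2)\<^sup>2 + (X$1$2 + X$2$1)\<^sup>2" "0 \<le> (X$1$1 + X$2$2)\<^sup>2 + (X$1$2 - X$2$1)\<^sup>2" by simp_all
  then show ?thesis unfolding norm_mat2 det_2 abs_le_iff by (simp add: power2_eq_square algebra_simps abs_if)
qed

lemma mat_eqI_quadratic:
  fixes A B :: "real^2^2"
  assumes "\<And>u v. u \<bullet> (A *v v) = u \<bullet> (B *v v)"
  shows "A = B"
proof -
  have "A *v v = B *v v" for v using assms by (metis vector_eq_rdot inner_commute)
  then show ?thesis by (simp add: matrix_eq)
qed

lemma gram_inner_mult: "gram_inner H (A *v u) (A *v v) = u \<bullet> ((transpose A ** H ** A) *v v)"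
proof -
  have "(A *v u) \<bullet> w = u \<bullet> (transpose A *v w)" for w
    by (metis dot_lmul_matrix transpose_matrix_vector transpose_transpose)
  then show ?thesis unfolding gram_inner_def by (simp only: matrix_vector_mul_assoc matrix_mul_assoc)
qed

lemma gram_inner_pullback_iff:
  "(\<forall>u v. gram_inner H (A *v u) (A *v v) = c * gram_inner G u v) \<longleftrightarrow> transpose A ** H ** A = c *\<^sub>R G"
proof -
  have "c * gram_inner G u v = u \<bullet> ((c *\<^sub>R G) *v v)" for u v
    unfolding gram_inner_def by (simp add: scaleR_matrix_vector_assoc[symmetric])
  then show ?thesis unfolding gram_inner_mult using mat_eqI_quadratic by metis
qed

lemma SO_iff:
  assumes "spd G" "spd H"
  shows "R \<in> SO G H \<longleftrightarrow> transpose (in_frames G H R) ** in_frames G H R = mat 1 \<and> det (in_frames G H R) > 0"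
proof -
  let ?P = "oriented_frame G" and ?X = "in_frames G H R"
  have "R \<in> SO G H \<longleftrightarrow> transpose R ** H ** R = G \<and> det R > 0"
    unfolding SO_def using gram_inner_pullback_iff[of H R 1 G] by simp
  moreover have "det R > 0 \<longleftrightarrow> det ?X > 0"
    using spdD(3)[OF assms(1)] spdD(3)[OF assms(2)] by (simp add: det_in_frames[OF assms] zero_less_mult_iff zero_less_divide_iff)
  moreover have "transpose R ** H ** R = G \<longleftrightarrow> transpose ?X ** ?X = mat 1"
  proof
    assume "transpose R ** H ** R = G"
    then show "transpose ?X ** ?X = mat 1" using gram_in_frames[OF assms, of R] oriented_frame(1)[OF assms(1)] by simp
  next
    assume a: "transpose ?X ** ?X = mat 1"
    let ?i = "matrix_inv ?P"
    have i: "?P ** ?i = mat 1" "transpose ?i ** transpose ?P = mat 1"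
      using frame_inverse[OF oriented_frame(2)[OF assms(1)]] by (simp_all flip: matrix_transpose_mul)
    have "transpose ?P ** (transpose R ** H ** R) ** ?P = transpose ?P ** G ** ?P"
      using a gram_in_frames[OF assms, of R] oriented_frame(1)[OF assms(1)] by simp
    then have "transpose ?i ** (transpose ?P ** (transpose R ** H ** R) ** ?P) ** ?i = transpose ?i ** (transpose ?P ** G ** ?P) ** ?i" by simp
    then have "(transpose ?i ** transpose ?P) ** (transpose R ** H ** R) ** (?P ** ?i) = (transpose ?i ** transpose ?P) ** G ** (?P ** ?i)"
      by (simp add: matrix_mul_assoc)
    then show "transpose R ** H ** R = G" unfolding i by simp
  qed
  ultimately show ?thesis by blast
qed

lemma in_frames_diff: "in_frames G H (A - B) = in_frames G H A - in_frames G H B"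
  unfolding in_frames_def by (simp add: vec_eq_iff mat2_mult algebra_simps)

lemma in_frames_surj:
  assumes "spd G" "spd H"
  shows "\<exists>A. in_frames G H A = X"
proof
  show "in_frames G H (oriented_frame H ** X ** matrix_inv (oriented_frame G)) = X"
    unfolding in_frames_def
    using frame_inverse[OF oriented_frame(2)[OF assms(1)]] frame_inverse[OF oriented_frame(2)[OF assms(2)]]
    by (metis matrix_mul_assoc matrix_mul_lid matrix_mul_rid)
qed

section \<open>Distance to the rotations and the equality conditions through norm and
  determinant\<close>

text \<open>The Frobenius product of \<open>X\<close> with the rotation \<open>(c, s)\<close> is
  \<open>c * \<alpha> + s * \<beta>\<close>, with maximum
  \<open>sqrt (\<alpha>\<^sup>2 + \<beta>\<^sup>2)\<close> over the circle by Cauchy-Schwarz. This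
  maximum is \<open>\<sigma>1 + \<sigma>2\<close> if \<open>det X \<ge> 0\<close>, and
  \<open>\<sigma>2 - \<sigma>1\<close> otherwise.\<close>

lemma dist_SO_eq:
  fixes A :: "real^2^2"
  assumes "spd G" "spd H"
  defines "X \<equiv> in_frames G H A"
  shows "dist_SO G H A = sqrt ((norm X)\<^sup>2 + 2 - 2 * sqrt ((norm X)\<^sup>2 + 2 * det X))"
proof -
  define \<alpha> \<beta> where "\<alpha> = X$1$1 + X$2$2" and "\<beta> = X$2$1 - X$1$2"
  define \<Sigma> where "\<Sigma> = sqrt (\<alpha>\<^sup>2 + \<beta>\<^sup>2)"
  have S: "(norm X)\<^sup>2 + 2 * det X = \<alpha>\<^sup>2 + \<beta>\<^sup>2"
    unfolding norm_mat2 by (simp add: det_2 \<alpha>_def \<beta>_def power2_eq_square algebra_simps)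
  have S0: "\<Sigma> \<ge> 0" "\<Sigma>\<^sup>2 = \<alpha>\<^sup>2 + \<beta>\<^sup>2" by (simp_all add: \<Sigma>_def)
  have diff: "(norm (X - R))\<^sup>2 = (norm X)\<^sup>2 + 2 - 2 * (c * \<alpha> + s * \<beta>)"
    if "R$1$1 = c" "R$2$2 = c" "R$2$1 = s" "R$1$2 = - s" "c\<^sup>2 + s\<^sup>2 = 1" for R c s
  proof -
    have "(norm (X - R))\<^sup>2 = (norm X)\<^sup>2 + 2 * (c\<^sup>2 + s\<^sup>2) - 2 * (c * \<alpha> + s * \<beta>)"
      unfolding norm_mat2 by (simp add: that(1-4) \<alpha>_def \<beta>_def power2_eq_square algebra_simps)
    then show ?thesis using that(5) by simp
  qed
  have hn: "hom_norm G H (A - R) = norm (X - in_frames G H R)" for R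
    by (simp add: hom_norm_def in_frames_diff X_def)
  have lower: "sqrt ((norm X)\<^sup>2 + 2 - 2 * \<Sigma>) \<le> hom_norm G H (A - R)" if R: "R \<in> SO G H" for R
  proof -
    define Y where "Y = in_frames G H R"
    have Y: "transpose Y ** Y = mat 1" "det Y > 0" using SO_iff[OF assms(1,2)] R unfolding Y_def by auto
    have e: "(Y$1$1)\<^sup>2 + (Y$2$1)\<^sup>2 = 1" "(Y$1$2)\<^sup>2 + (Y$2$2)\<^sup>2 = 1" "Y$1$1 * Y$1$2 + Y$2$1 * Y$2$2 = 0"
      using Y(1) by (auto simp: vec_eq_iff forall_2 mat2_mult mat2_transpose mat_def power2_eq_square)
    have "det Y = 1" using orthogonal_mult_invariants(2)[OF Y, of "mat 1"] by simp
    then have "(Y$1$1 - Y$2$2)\<^sup>2 + (Y$1$2 + Y$2$1)\<^sup>2 = 0" using e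
      by (simp add: det_2 power2_eq_square algebra_simps)
    then have "Y$1$1 - Y$2$2 = 0 \<and> Y$1$2 + Y$2$1 = 0" by (simp only: sum_power2_eq_zero_iff)
    then have Y2: "Y$2$2 = Y$1$1" "Y$1$2 = - Y$2$1" by auto
    have "(Y$1$1 * \<alpha> + Y$2$1 * \<beta>)\<^sup>2 \<le> ((Y$1$1)\<^sup>2 + (Y$2$1)\<^sup>2) * (\<alpha>\<^sup>2 + \<beta>\<^sup>2)"
    proof -
      have "((Y$1$1)\<^sup>2 + (Y$2$1)\<^sup>2) * (\<alpha>\<^sup>2 + \<beta>\<^sup>2) - (Y$1$1 * \<alpha> + Y$2$1 * \<beta>)\<^sup>2 = (Y$1$1 * \<beta> - Y$2$1 * \<alpha>)\<^sup>2"
        by (simp add: power2_eq_square algebra_simps)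
      then show ?thesis by (metis diff_ge_0_iff_ge zero_le_power2)
    qed
    then have "(Y$1$1 * \<alpha> + Y$2$1 * \<beta>)\<^sup>2 \<le> \<Sigma>\<^sup>2" using e S0 by simp
    then have "Y$1$1 * \<alpha> + Y$2$1 * \<beta> \<le> \<Sigma>" using S0 power2_le_imp_le by blast
    then have "(norm X)\<^sup>2 + 2 - 2 * \<Sigma> \<le> (norm (X - Y))\<^sup>2"
      using diff[of Y "Y$1$1" "Y$2$1"] Y2 e by simp
    then show ?thesis unfolding hn Y_def[symmetric] by (simp add: real_le_lsqrt real_sqrt_le_iff real_le_rsqrt sqrt_le_D real_sqrt_le_mono flip: real_sqrt_abs)
  qed
  obtain c s where cs: "c\<^sup>2 + s\<^sup>2 = 1" "c * \<alpha> + s * \<beta> = \<Sigma>"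
  proof (cases "\<Sigma> = 0")
    \<comment> \<open>All rotations are equally close here, and the identity serves.\<close>
    case True
    then have "\<alpha>\<^sup>2 + \<beta>\<^sup>2 = 0" using S0 by simp
    then have "\<alpha> = 0" "\<beta> = 0" by (simp_all only: sum_power2_eq_zero_iff)
    then show ?thesis using that[of 1 0] True by simp
  next
    case False
    have "(\<alpha> / \<Sigma>)\<^sup>2 + (\<beta> / \<Sigma>)\<^sup>2 = (\<alpha>\<^sup>2 + \<beta>\<^sup>2) / \<Sigma>\<^sup>2" by (simp add: power_divide add_divide_distrib)
    then have "(\<alpha> / \<Sigma>)\<^sup>2 + (\<beta> / \<Sigma>)\<^sup>2 = 1" using False S0(2)[symmetric] by simp
    moreover have "\<alpha> / \<Sigma> * \<alpha> + \<beta> / \<Sigma> * \<beta> = \<Sigma>"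
    proof -
      have "\<alpha> / \<Sigma> * \<alpha> + \<beta> / \<Sigma> * \<beta> = (\<alpha>\<^sup>2 + \<beta>\<^sup>2) / \<Sigma>" by (simp add: power2_eq_square add_divide_distrib)
      also have "\<dots> = \<Sigma>" using S0(2)[symmetric] False by (simp add: power2_eq_square)
      finally show ?thesis .
    qed
    ultimately show ?thesis using that by blast
  qed
  define Y :: "real^2^2" where "Y = vector [vector [c, - s], vector [s, c]]"
  have Yc: "Y$1$1 = c" "Y$2$2 = c" "Y$2$1 = s" "Y$1$2 = - s" by (simp_all add: Y_def)
  obtain R where R: "in_frames G H R = Y" using in_frames_surj[OF assms(1,2)] by blast
  have "transpose Y ** Y = mat 1" "det Y > 0" using cs(1)
    by (simp_all add: vec_eq_iff forall_2 mat2_mult mat2_transpose mat_def Yc det_2 power2_eq_square algebra_simps)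
  then have RSO: "R \<in> SO G H" using SO_iff[OF assms(1,2)] R by simp
  have "(hom_norm G H (A - R))\<^sup>2 = (norm X)\<^sup>2 + 2 - 2 * \<Sigma>"
    unfolding hn R using diff[OF Yc cs(1)] cs(2) by simp
  then have "hom_norm G H (A - R) = sqrt ((norm X)\<^sup>2 + 2 - 2 * \<Sigma>)"
    by (metis hom_norm_def norm_ge_zero real_sqrt_unique)
  then have "dist_SO G H A = sqrt ((norm X)\<^sup>2 + 2 - 2 * \<Sigma>)"
    unfolding dist_SO_def using lower RSO by (intro cInf_eq_minimum) (auto intro!: image_eqI[of _ _ R])
  then show ?thesis unfolding S \<Sigma>_def .
qed

text \<open>For nonnegative determinant, \<open>(\<sigma>1 + \<sigma>2)\<^sup>2\<close> is the
  squared norm plus twice the determinant. Conversely, numbers with sum 1 and product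
  \<open>det X\<close> are \<open>(1 - w) / 2\<close> and \<open>(1 + w) / 2\<close>; the
  discriminant is nonnegative because \<open>2 * det X\<close> is at most the squared norm.\<close>

lemma K_iff:
  "A \<in> K G H \<longleftrightarrow> hom_det G H A \<ge> 0 \<and> (norm (in_frames G H A))\<^sup>2 + 2 * hom_det G H A = 1"
proof -
  define X where "X = in_frames G H A"
  have ch: "det (mat x - transpose X ** X) = x\<^sup>2 - (norm X)\<^sup>2 * x + (det X)\<^sup>2" for x
    unfolding norm_mat2 by (simp add: det_2 mat2_mult mat2_transpose mat_def power2_eq_square algebra_simps)
  show ?thesis
  proof
    assume "A \<in> K G H"
    then obtain a b where d: "det X \<ge> 0" and ab: "0 \<le> a" "a \<le> b" "a + b = 1"
      and eq: "\<And>x. x\<^sup>2 - (norm X)\<^sup>2 * x + (det X)\<^sup>2 = (x - a\<^sup>2) * (x - b\<^sup>2)"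
      unfolding K_def singular_values_def hom_det_def mem_Collect_eq X_def[symmetric] ch by auto
    have "(det X)\<^sup>2 = (a * b)\<^sup>2" using eq[of 0] by (simp add: power_mult_distrib)
    then have dX: "det X = a * b" using d ab by (metis mult_nonneg_nonneg order_trans power2_eq_imp_eq)
    have "(norm X)\<^sup>2 = a\<^sup>2 + b\<^sup>2" using eq[of 1] eq[of 0] by (simp add: algebra_simps)
    then have "(norm X)\<^sup>2 + 2 * det X = (a + b)\<^sup>2" using dX by (simp add: power2_eq_square algebra_simps)
    then show "hom_det G H A \<ge> 0 \<and> (norm (in_frames G H A))\<^sup>2 + 2 * hom_det G H A = 1"
      using d ab by (simp add: hom_det_def X_def)
  next
    assume "hom_det G H A \<ge> 0 \<and> (norm (in_frames G H A))\<^sup>2 + 2 * hom_det G H A = 1"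
    then have d: "det X \<ge> 0" "(norm X)\<^sup>2 = 1 - 2 * det X" by (auto simp: hom_det_def X_def)
    have "2 * det X \<le> (norm X)\<^sup>2" using abs_det_le_norm[of X] by linarith
    then have d4: "0 \<le> 1 - 4 * det X" using d by simp
    define w where "w = sqrt (1 - 4 * det X)"
    have w: "w \<ge> 0" "w * w = 1 - 4 * det X" using d4 by (simp_all add: w_def)
    have w1: "w \<le> 1" unfolding w_def using d(1) by simp
    have dd: "det X = (1 - w * w) / 4" using w by simp
    have "(x - ((1 - w) / 2)\<^sup>2) * (x - ((1 + w) / 2)\<^sup>2) = x\<^sup>2 - (norm X)\<^sup>2 * x + (det X)\<^sup>2" for x
      unfolding d(2) dd by (simp add: power2_eq_square field_simps)
    then have "singular_values G H A ((1 - w) / 2) ((1 + w) / 2)"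
      unfolding singular_values_def X_def[symmetric] ch using w w1 by simp
    moreover have "(1 - w) / 2 + (1 + w) / 2 = 1" by (simp add: field_simps)
    ultimately show "A \<in> K G H" unfolding K_def hom_det_def using d(1) X_def by blast
  qed
qed

text \<open>The squared norm minus twice the determinant is the squared length of the anticonformal
  part \<open>(X$1$1 - X$2$2, X$1$2 + X$2$1)\<close>. The sign of the determinant excludes
  orientation-reversing similarities.\<close>

lemma conformal_iff:
  assumes "spd G" "spd H" and d: "det (in_frames G H A) \<ge> 0"
  shows "(\<forall>u v. gram_inner H (A *v u) (A *v v) = r\<^sup>2 * gram_inner G u v) \<longleftrightarrow>
    (norm (in_frames G H A))\<^sup>2 = 2 * r\<^sup>2 \<and> det (in_frames G H A) = r\<^sup>2"
proof -
  let ?P = "oriented_frame G"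
  define X where "X = in_frames G H A"
  have "transpose A ** H ** A = r\<^sup>2 *\<^sub>R G \<longleftrightarrow> transpose X ** X = r\<^sup>2 *\<^sub>R mat 1"
  proof
    assume a: "transpose A ** H ** A = r\<^sup>2 *\<^sub>R G"
    have "transpose X ** X = r\<^sup>2 *\<^sub>R (transpose ?P ** G ** ?P)"
      unfolding X_def gram_in_frames[OF assms(1,2)] a
      by (simp add: vec_eq_iff forall_2 mat2_mult mat2_transpose algebra_simps)
    then show "transpose X ** X = r\<^sup>2 *\<^sub>R mat 1" using oriented_frame(1)[OF assms(1)] by simp
  next
    assume a: "transpose X ** X = r\<^sup>2 *\<^sub>R mat 1"
    let ?i = "matrix_inv ?P"
    have i: "?P ** ?i = mat 1" "transpose ?i ** transpose ?P = mat 1"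
      using frame_inverse[OF oriented_frame(2)[OF assms(1)]] by (simp_all flip: matrix_transpose_mul)
    have "transpose ?P ** (r\<^sup>2 *\<^sub>R G) ** ?P = r\<^sup>2 *\<^sub>R (transpose ?P ** G ** ?P)"
      by (simp add: vec_eq_iff forall_2 mat2_mult mat2_transpose algebra_simps)
    then have "transpose ?P ** (transpose A ** H ** A) ** ?P = transpose ?P ** (r\<^sup>2 *\<^sub>R G) ** ?P"
      using a gram_in_frames[OF assms(1,2), of A] oriented_frame(1)[OF assms(1)] by (simp add: X_def)
    then have "transpose ?i ** (transpose ?P ** (transpose A ** H ** A) ** ?P) ** ?i = transpose ?i ** (transpose ?P ** (r\<^sup>2 *\<^sub>R G) ** ?P) ** ?i" by simp
    then have "(transpose ?i ** transpose ?P) ** (transpose A ** H ** A) ** (?P ** ?i) = (transpose ?i ** transpose ?P) ** (r\<^sup>2 *\<^sub>R G) ** (?P ** ?i)"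
      by (simp add: matrix_mul_assoc)
    then show "transpose A ** H ** A = r\<^sup>2 *\<^sub>R G" unfolding i by simp
  qed
  moreover have "transpose X ** X = r\<^sup>2 *\<^sub>R mat 1 \<longleftrightarrow> (norm X)\<^sup>2 = 2 * r\<^sup>2 \<and> det X = r\<^sup>2"
  proof
    assume a: "transpose X ** X = r\<^sup>2 *\<^sub>R mat 1"
    have e: "(X$1$1)\<^sup>2 + (X$2$1)\<^sup>2 = r\<^sup>2" "(X$1$2)\<^sup>2 + (X$2$2)\<^sup>2 = r\<^sup>2"
      using a by (auto simp: vec_eq_iff forall_2 mat2_mult mat2_transpose mat_def power2_eq_square)
    have "det (r\<^sup>2 *\<^sub>R mat 1 :: real^2^2) = (r\<^sup>2)\<^sup>2" by (simp add: det_2 mat_def power2_eq_square)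
    then have "(det X)\<^sup>2 = (r\<^sup>2)\<^sup>2" using arg_cong[OF a, of det] by (simp add: det_mul det_transpose power2_eq_square)
    then have "det X = r\<^sup>2" using d X_def power2_eq_imp_eq zero_le_power2 by metis
    then show "(norm X)\<^sup>2 = 2 * r\<^sup>2 \<and> det X = r\<^sup>2" using e by (simp add: norm_mat2)
  next
    assume a: "(norm X)\<^sup>2 = 2 * r\<^sup>2 \<and> det X = r\<^sup>2"
    have "(X$1$1 - X$2$2)\<^sup>2 + (X$1$2 + X$2$1)\<^sup>2 = (norm X)\<^sup>2 - 2 * det X"
      unfolding norm_mat2 by (simp add: det_2 power2_eq_square algebra_simps)
    then have "(X$1$1 - X$2$2)\<^sup>2 + (X$1$2 + X$2$1)\<^sup>2 = 0" using a by simp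
    then have "X$1$1 - X$2$2 = 0 \<and> X$1$2 + X$2$1 = 0" by (simp only: sum_power2_eq_zero_iff)
    then have X2: "X$2$2 = X$1$1" "X$1$2 = - X$2$1" by auto
    then have "(X$1$1)\<^sup>2 + (X$2$1)\<^sup>2 = r\<^sup>2" using a by (simp add: det_2 power2_eq_square)
    then show "transpose X ** X = r\<^sup>2 *\<^sub>R mat 1"
      by (simp add: vec_eq_iff forall_2 mat2_mult mat2_transpose mat_def X2 power2_eq_square algebra_simps)
  qed
  ultimately show ?thesis unfolding gram_inner_pullback_iff X_def by simp
qed

subsection \<open>Change of variables\<close>

lemma nn_set_integral_eq_integral:
  fixes g :: "'a::euclidean_space \<Rightarrow> real"
  assumes g: "g absolutely_integrable_on S" and pos: "\<And>x. x \<in> S \<Longrightarrow> 0 \<le> g x"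
  shows "(\<integral>\<^sup>+x\<in>S. ennreal (g x) \<partial>lebesgue) = ennreal (integral S g)"
proof -
  have i: "integrable lebesgue (\<lambda>x. indicator S x * g x)" using g by (simp add: set_integrable_def)
  have "(\<integral>\<^sup>+x\<in>S. ennreal (g x) \<partial>lebesgue) = (\<integral>\<^sup>+x. ennreal (indicator S x * g x) \<partial>lebesgue)"
    by (intro nn_integral_cong) (auto split: split_indicator)
  also have "\<dots> = ennreal (\<integral>x. indicator S x * g x \<partial>lebesgue)"
    using i pos by (intro nn_integral_eq_integral) (auto split: split_indicator)
  also have "(\<integral>x. indicator S x * g x \<partial>lebesgue) = integral S g"
    using set_lebesgue_integral_eq_integral(2)[OF g] by (simp add: set_lebesgue_integral_def)
  finally show ?thesis .
qed

text \<open>Monotone convergence over an exhaustion of \<open>S\<close> on which image and weight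
  are bounded, so that the change of variables for absolutely integrable functions applies. Infinite
  values on both sides are thereby covered.\<close>

lemma nn_integral_change_of_variables:
  fixes f :: "real^'n::{finite,wellorder} \<Rightarrow> real^'n::_" and h :: "real^'n::_ \<Rightarrow> real"
  assumes S: "S \<in> sets lebesgue"
    and der: "\<And>x. x \<in> S \<Longrightarrow> (f has_derivative f' x) (at x within S)"
    and inj: "inj_on f S" and h: "continuous_on (f ` S) h" and pos: "\<And>y. y \<in> f ` S \<Longrightarrow> 0 \<le> h y"
  shows "(\<integral>\<^sup>+x\<in>S. ennreal (\<bar>det (matrix (f' x))\<bar> * h (f x)) \<partial>lebesgue) = (\<integral>\<^sup>+y\<in>f ` S. ennreal (h y) \<partial>lebesgue)"
proof -
  have fd: "f differentiable_on S" using der unfolding differentiable_on_def differentiable_def by blast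
  then have fc: "continuous_on S f" by (rule differentiable_imp_continuous_on)
  define P where "P k = S \<inter> f -` cball 0 (real k) \<inter> (h \<circ> f) -` {..real k}" for k :: nat
  have hf: "continuous_on S (h \<circ> f)" using fc h continuous_on_compose by blast
  have P1: "S \<inter> f -` cball 0 (real k) \<in> sets lebesgue" "S \<inter> (h \<circ> f) -` {..real k} \<in> sets lebesgue" for k
  proof -
    have pre: "S \<inter> g -` T \<in> sets lebesgue" if "continuous_on S g" "closed T" for g :: "real^'n::_ \<Rightarrow> 'z::euclidean_space" and T
    proof -
      have "{x \<in> S. g x \<in> T} \<in> sets lebesgue"
        using continuous_imp_measurable_on_sets_lebesgue[OF that(1) S] borel_closed[OF that(2)]
        unfolding borel_measurable_lebesgue_on_preimage_borel[OF S] by blast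
      then show ?thesis by (simp add: vimage_def Int_def)
    qed
    show "S \<inter> f -` cball 0 (real k) \<in> sets lebesgue" by (rule pre[OF fc closed_cball])
    show "S \<inter> (h \<circ> f) -` {..real k} \<in> sets lebesgue" by (rule pre[OF hf closed_atMost])
  qed
  have Pk: "P k \<in> sets lebesgue" "P k \<subseteq> S" for k
  proof -
    have "P k = (S \<inter> f -` cball 0 (real k)) \<inter> (S \<inter> (h \<circ> f) -` {..real k})" unfolding P_def by blast
    then show "P k \<in> sets lebesgue" using P1 by auto
    show "P k \<subseteq> S" unfolding P_def by blast
  qed
  have eqk: "(\<integral>\<^sup>+x\<in>P k. ennreal (\<bar>det (matrix (f' x))\<bar> * h (f x)) \<partial>lebesgue) = (\<integral>\<^sup>+y\<in>f ` P k. ennreal (h y) \<partial>lebesgue)" for k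
  proof -
    have dk: "(f has_derivative f' x) (at x within P k)" if "x \<in> P k" for x
      using der[of x] that Pk(2) has_derivative_subset by blast
    have ik: "inj_on f (P k)" using inj Pk(2) inj_on_subset by blast
    have fdk: "f differentiable_on P k" using fd Pk(2) differentiable_on_subset by blast
    have fPk: "f ` P k \<in> sets lebesgue" using differentiable_image_in_sets_lebesgue[OF Pk(1) _ fdk] by simp
    have hk: "continuous_on (f ` P k) h" using h Pk(2) continuous_on_subset by (meson image_mono)
    have bd: "f ` P k \<subseteq> cball 0 (real k)" "\<And>y. y \<in> f ` P k \<Longrightarrow> h y \<le> real k" unfolding P_def by auto
    have posk: "0 \<le> h y" if "y \<in> f ` P k" for y using pos Pk(2) that by blast
    have hint: "h absolutely_integrable_on f ` P k"
      unfolding set_integrable_def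
    proof (rule Bochner_Integration.integrable_bound)
      show "integrable lebesgue (\<lambda>y::real^'n::_. indicator (cball 0 (real k)) y * real k)"
        by (intro integrable_mult_left integrable_real_indicator) (use emeasure_lborel_cball_finite[of 0 "real k"] in auto)
      show "(\<lambda>x. indicat_real (f ` P k) x *\<^sub>R h x) \<in> borel_measurable lebesgue"
        using continuous_imp_measurable_on_sets_lebesgue[OF hk fPk] fPk
        by (subst borel_measurable_restrict_space_iff[symmetric]) auto
      show "AE y in lebesgue. norm (indicat_real (f ` P k) y *\<^sub>R h y) \<le> norm (indicat_real (cball 0 (real k)) y * real k)"
        using bd posk by (intro AE_I2) (auto simp: indicator_def)
    qed
    \<comment> \<open>The change of variables is applied to a vector-valued integrand, so the weight
      passes through \<open>real^1\<close>.\<close>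
    define H where "H y = h y *\<^sub>R (1::real^1)" for y
    have Hint: "H absolutely_integrable_on f ` P k"
      using absolutely_integrable_linear[OF hint bounded_linear_scaleR_left[of "1::real^1"]]
      by (simp add: H_def[abs_def] comp_def)
    note cv = has_absolute_integral_change_of_variables[OF Pk(1) dk ik, of H "integral (f ` P k) H"]
    have c1: "(\<lambda>x. \<bar>det (matrix (f' x))\<bar> *\<^sub>R H (f x)) absolutely_integrable_on P k"
      and c2: "integral (P k) (\<lambda>x. \<bar>det (matrix (f' x))\<bar> *\<^sub>R H (f x)) = integral (f ` P k) H"
      using cv Hint by auto
    have a1: "(\<lambda>x. \<bar>det (matrix (f' x))\<bar> * h (f x)) absolutely_integrable_on P k"
      using absolutely_integrable_linear[OF c1 bounded_linear_vec_nth[of 1]] by (simp add: comp_def H_def)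
    have "integral (P k) (\<lambda>x. \<bar>det (matrix (f' x))\<bar> * h (f x)) = integral (P k) (\<lambda>x. \<bar>det (matrix (f' x))\<bar> *\<^sub>R H (f x)) $ 1"
      using integral_linear[OF set_lebesgue_integral_eq_integral(1)[OF c1] bounded_linear_vec_nth[of 1]]
      by (simp add: comp_def H_def)
    also have "\<dots> = integral (f ` P k) H $ 1" by (simp only: c2)
    also have "\<dots> = integral (f ` P k) h"
      using integral_linear[OF set_lebesgue_integral_eq_integral(1)[OF Hint] bounded_linear_vec_nth[of 1]]
      by (simp add: comp_def H_def)
    finally have i: "integral (P k) (\<lambda>x. \<bar>det (matrix (f' x))\<bar> * h (f x)) = integral (f ` P k) h" .
    have "(\<integral>\<^sup>+x\<in>P k. ennreal (\<bar>det (matrix (f' x))\<bar> * h (f x)) \<partial>lebesgue) = ennreal (integral (P k) (\<lambda>x. \<bar>det (matrix (f' x))\<bar> * h (f x)))"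
      using posk by (intro nn_set_integral_eq_integral[OF a1]) auto
    also have "\<dots> = (\<integral>\<^sup>+y\<in>f ` P k. ennreal (h y) \<partial>lebesgue)"
      unfolding i using posk by (intro nn_set_integral_eq_integral[OF hint, symmetric]) auto
    finally show ?thesis .
  qed
  have ev: "\<forall>\<^sub>F k in sequentially. x \<in> P k" if "x \<in> S" for x
  proof -
    obtain n :: nat where "max (norm (f x)) (h (f x)) \<le> real n" using real_arch_simple by blast
    then have "\<forall>k\<ge>n. x \<in> P k" using that unfolding P_def by auto
    then show ?thesis using eventually_sequentially by blast
  qed
  have mono: "P k \<subseteq> P l" if "k \<le> l" for k l unfolding P_def using that by auto
  have m1: "(\<lambda>x. \<bar>det (matrix (f' x))\<bar> * h (f x)) \<in> borel_measurable (lebesgue_on S)"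
    using borel_measurable_det_Jacobian[OF S der] continuous_imp_measurable_on_sets_lebesgue[OF hf S]
    by (simp add: comp_def)
  have m1k: "(\<lambda>x. ennreal (\<bar>det (matrix (f' x))\<bar> * h (f x)) * indicator (P k) x) \<in> borel_measurable lebesgue" for k
  proof -
    have "(\<lambda>x. ennreal (\<bar>det (matrix (f' x))\<bar> * h (f x)) * indicator S x) \<in> borel_measurable lebesgue"
      using m1 S by (subst borel_measurable_restrict_space_iff_ennreal[symmetric]) auto
    then have "(\<lambda>x. ennreal (\<bar>det (matrix (f' x))\<bar> * h (f x)) * indicator S x * indicator (P k) x) \<in> borel_measurable lebesgue"
      by (rule borel_measurable_times_ennreal[OF _ borel_measurable_indicator[OF Pk(1)]])
    moreover have "ennreal (\<bar>det (matrix (f' x))\<bar> * h (f x)) * indicator S x * indicator (P k) x = ennreal (\<bar>det (matrix (f' x))\<bar> * h (f x)) * indicator (P k) x" for x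
      using Pk(2)[of k] by (auto split: split_indicator)
    ultimately show ?thesis by simp
  qed
  have m2k: "(\<lambda>y. ennreal (h y) * indicator (f ` P k) y) \<in> borel_measurable lebesgue" for k
  proof -
    have fdk: "f differentiable_on P k" using fd Pk(2) differentiable_on_subset by blast
    have fPk: "f ` P k \<in> sets lebesgue" using differentiable_image_in_sets_lebesgue[OF Pk(1) _ fdk] by simp
    have hk: "continuous_on (f ` P k) h" using h Pk(2) continuous_on_subset by (meson image_mono)
    show ?thesis using continuous_imp_measurable_on_sets_lebesgue[OF hk fPk] fPk
      by (subst borel_measurable_restrict_space_iff_ennreal[symmetric]) auto
  qed
  have l1: "(\<lambda>k. \<integral>\<^sup>+x\<in>P k. ennreal (\<bar>det (matrix (f' x))\<bar> * h (f x)) \<partial>lebesgue) \<longlonglongrightarrow> (\<integral>\<^sup>+x\<in>S. ennreal (\<bar>det (matrix (f' x))\<bar> * h (f x)) \<partial>lebesgue)"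
  proof (rule nn_integral_LIMSEQ[OF _ m1k])
    show "incseq (\<lambda>k x. ennreal (\<bar>det (matrix (f' x))\<bar> * h (f x)) * indicator (P k) x)"
      using mono by (auto simp: incseq_def le_fun_def split: split_indicator)
    show "(\<lambda>k. ennreal (\<bar>det (matrix (f' x))\<bar> * h (f x)) * indicator (P k) x) \<longlonglongrightarrow> ennreal (\<bar>det (matrix (f' x))\<bar> * h (f x)) * indicator S x" for x
    proof (cases "x \<in> S")
      case True
      have "\<forall>\<^sub>F k in sequentially. ennreal (\<bar>det (matrix (f' x))\<bar> * h (f x)) * indicator (P k) x = ennreal (\<bar>det (matrix (f' x))\<bar> * h (f x)) * indicator S x"
        using ev[OF True] by eventually_elim (use True in auto)
      then show ?thesis by (rule tendsto_eventually)
    next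
      case False
      then have "x \<notin> P k" for k using Pk(2) by blast
      then show ?thesis using False by simp
    qed
  qed
  have l2: "(\<lambda>k. \<integral>\<^sup>+y\<in>f ` P k. ennreal (h y) \<partial>lebesgue) \<longlonglongrightarrow> (\<integral>\<^sup>+y\<in>f ` S. ennreal (h y) \<partial>lebesgue)"
  proof (rule nn_integral_LIMSEQ[OF _ m2k])
    have "f ` P k \<subseteq> f ` P l" if "k \<le> l" for k l using mono[OF that] by blast
    then show "incseq (\<lambda>k y. ennreal (h y) * indicator (f ` P k) y)"
      by (auto simp: incseq_def le_fun_def indicator_def)
    show "(\<lambda>k. ennreal (h y) * indicator (f ` P k) y) \<longlonglongrightarrow> ennreal (h y) * indicator (f ` S) y" for y
    proof (cases "y \<in> f ` S")
      case True
      then obtain x where x: "x \<in> S" "y = f x" by blast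
      have "\<forall>\<^sub>F k in sequentially. ennreal (h y) * indicator (f ` P k) y = ennreal (h y) * indicator (f ` S) y"
        using ev[OF x(1)] by eventually_elim (use True x in auto)
      then show ?thesis by (rule tendsto_eventually)
    next
      case False
      then have "y \<notin> f ` P k" for k using Pk(2) by blast
      then show ?thesis using False by simp
    qed
  qed
  show ?thesis using l1 l2 unfolding eqk using LIMSEQ_unique by blast
qed

text \<open>The set splits into countably many pieces on which \<open>f\<close> has a Lipschitz inverse.\<close>

lemma negligible_preimage_regular:
  fixes f :: "'a::euclidean_space \<Rightarrow> 'a"
  assumes der: "\<And>x. x \<in> E \<Longrightarrow> (f has_derivative f' x) (at x within E)"
    and inj: "\<And>x. x \<in> E \<Longrightarrow> inj (f' x)" and Y: "negligible Y"
  shows "negligible {x\<in>E. f x \<in> Y}"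
proof -
  define P where "P n = {x\<in>E. \<forall>y\<in>E. dist y x < 1 / real (Suc n) \<longrightarrow> norm (y - x) \<le> real (Suc n) * norm (f y - f x)}" for n
  have cover: "\<exists>n. x \<in> P n" if x: "x \<in> E" for x
  proof -
    have lin: "linear (f' x)" using der[OF x] has_derivative_linear by blast
    obtain B where B: "B > 0" "\<And>v. B * norm v \<le> norm (f' x v)"
      using linear_inj_bounded_below_pos[OF lin inj[OF x]] by blast
    obtain d where d: "d > 0" "\<And>y. y \<in> E \<Longrightarrow> norm (y - x) < d \<Longrightarrow> norm (f y - f x - f' x (y - x)) \<le> B/2 * norm (y - x)"
      using der[OF x] B(1) unfolding has_derivative_within_alt by (meson half_gt_zero)
    have low: "B/2 * norm (y - x) \<le> norm (f y - f x)" if "y \<in> E" "norm (y - x) < d" for y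
    proof -
      have "B * norm (y - x) \<le> norm (f' x (y - x))" by (rule B)
      also have "\<dots> \<le> norm (f y - f x) + norm (f y - f x - f' x (y - x))"
        by (metis norm_minus_commute norm_triangle_sub)
      also have "\<dots> \<le> norm (f y - f x) + B/2 * norm (y - x)" using d(2)[OF that] by simp
      finally show ?thesis by simp
    qed
    obtain n where n: "max (1/d) (2/B) < real (Suc n)" using reals_Archimedean2 less_trans
      by (metis lessI of_nat_less_iff)
    have "norm (y - x) \<le> real (Suc n) * norm (f y - f x)" if y: "y \<in> E" "dist y x < 1 / real (Suc n)" for y
    proof -
      have "1 / real (Suc n) < d" using n d(1) by (simp add: field_simps del: of_nat_Suc)
      then have "norm (y - x) < d" using y(2) by (simp add: dist_norm)
      then have "norm (y - x) \<le> 2 / B * norm (f y - f x)" using low[OF y(1)] B(1) by (simp add: field_simps)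
      also have "\<dots> \<le> real (Suc n) * norm (f y - f x)" using n by (intro mult_right_mono) auto
      finally show ?thesis .
    qed
    then show ?thesis using x unfolding P_def by blast
  qed
  have loc: "negligible {x\<in>P n. f x \<in> Y}" for n
  proof (rule locally_negligible_alt[THEN iffD2], intro ballI)
    fix x assume x: "x \<in> {x\<in>P n. f x \<in> Y}"
    \<comment> \<open>Half the radius, so that any two points of \<open>U\<close> are close enough
      for the bound in \<open>P n\<close>.\<close>
    define U where "U = {y\<in>P n. f y \<in> Y} \<inter> ball x (1 / (2 * real (Suc n)))"
    have close: "norm (y - z) \<le> real (Suc n) * norm (f y - f z)" if "y \<in> U" "z \<in> U" for y z
    proof -
      have "dist y z < 1 / real (Suc n)"
        using that dist_triangle_half_r[of x y "1 / real (Suc n)" z] unfolding U_def by (simp add: field_simps)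
      then show ?thesis using that unfolding U_def P_def by auto
    qed
    have injU: "inj_on f U" using close by (fastforce intro: inj_onI)
    define g where "g = inv_into U f"
    have gf: "g (f y) = y" if "y \<in> U" for y unfolding g_def using injU that by simp
    have "negligible (g ` (f ` U))"
    proof (rule negligible_locally_Lipschitz_image)
      show "negligible (f ` U)" using Y by (rule negligible_subset) (auto simp: U_def)
      fix q assume q: "q \<in> f ` U"
      show "\<exists>T B. open T \<and> q \<in> T \<and> (\<forall>y\<in>f ` U \<inter> T. norm (g y - g q) \<le> B * norm (y - q))"
        by (rule exI[of _ UNIV], rule exI[of _ "real (Suc n)"]) (use q gf close in auto)
    qed simp
    moreover have "g ` (f ` U) = U" using gf by force
    moreover have "openin (top_of_set {x\<in>P n. f x \<in> Y}) U" unfolding U_def by (rule openin_open_Int) simp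
    moreover have "x \<in> U" using x unfolding U_def by simp
    ultimately show "\<exists>U. openin (top_of_set {x \<in> P n. f x \<in> Y}) U \<and> x \<in> U \<and> negligible U" by metis
  qed
  have "{x\<in>E. f x \<in> Y} = (\<Union>n. {x\<in>P n. f x \<in> Y})" using cover unfolding P_def by blast
  then show ?thesis using negligible_Union_nat[OF loc] by simp
qed

subsection \<open>Lipschitz regions\<close>

lemma orthonormal_plane_expansion:
  fixes e n v :: "real^2"
  assumes "norm e = 1" "norm n = 1" "e \<bullet> n = 0"
  shows "v = (v \<bullet> e) *\<^sub>R e + (v \<bullet> n) *\<^sub>R n"
proof -
  have a: "e$1 * e$1 + e$2 * e$2 = 1" "n$1 * n$1 + n$2 * n$2 = 1" "e$1 * n$1 + e$2 * n$2 = 0"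
    using assms by (auto simp: norm_eq_1 inner_vec_def sum_2)
  define Q :: "real^2^2" where "Q = vector [vector [e$1, e$2], vector [n$1, n$2]]"
  have Q: "Q$1$1 = e$1" "Q$1$2 = e$2" "Q$2$1 = n$1" "Q$2$2 = n$2" by (simp_all add: Q_def)
  have "Q ** transpose Q = mat 1"
    using a by (simp add: vec_eq_iff forall_2 matrix_matrix_mult_def sum_2 transpose_def mat_def Q mult.commute)
  \<comment> \<open>Orthonormal rows of a square matrix force orthonormal columns.\<close>
  then have "transpose Q ** Q = mat 1" using matrix_left_right_inverse by blast
  then have b: "e$1 * e$1 + n$1 * n$1 = 1" "e$1 * e$2 + n$1 * n$2 = 0" "e$2 * e$2 + n$2 * n$2 = 1"
    by (auto simp: vec_eq_iff forall_2 matrix_matrix_mult_def sum_2 transpose_def mat_def Q)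
  have "v$1 = (v$1 * e$1 + v$2 * e$2) * e$1 + (v$1 * n$1 + v$2 * n$2) * n$1"
    "v$2 = (v$1 * e$1 + v$2 * e$2) * e$2 + (v$1 * n$1 + v$2 * n$2) * n$2"
    using b by algebra+
  then show ?thesis by (simp add: vec_eq_iff forall_2 inner_vec_def sum_2)
qed

text \<open>The graph is the image of the line spanned by \<open>e\<close>, a null set in the plane,
  under a Lipschitz map.\<close>

lemma negligible_lipschitz_graph:
  fixes e n :: "real^2"
  assumes en: "norm e = 1" "norm n = 1" "e \<bullet> n = 0" and f: "L-lipschitz_on UNIV (f :: real \<Rightarrow> real)"
  shows "negligible {q. f (q \<bullet> e) = q \<bullet> n}"
proof -
  define H where "H = {q. n \<bullet> q = 0}"
  define g where "g q = (q \<bullet> e) *\<^sub>R e + f (q \<bullet> e) *\<^sub>R n" for q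
  have L0: "L \<ge> 0" using f lipschitz_on_nonneg by blast
  have "negligible H" unfolding H_def using en by (intro negligible_hyperplane) auto
  have "negligible (g ` H)"
  proof (rule negligible_locally_Lipschitz_image)
    fix x assume "x \<in> H"
    have "norm (g y - g x) \<le> (1 + L) * norm (y - x)" for y
    proof -
      have "g y - g x = ((y - x) \<bullet> e) *\<^sub>R e + (f (y \<bullet> e) - f (x \<bullet> e)) *\<^sub>R n"
        by (simp add: g_def algebra_simps inner_diff_left)
      then have "norm (g y - g x) \<le> \<bar>(y - x) \<bullet> e\<bar> + \<bar>f (y \<bullet> e) - f (x \<bullet> e)\<bar>"
        using norm_triangle_ineq[of "((y - x) \<bullet> e) *\<^sub>R e" "(f (y \<bullet> e) - f (x \<bullet> e)) *\<^sub>R n"] en by simp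
      also have "\<bar>f (y \<bullet> e) - f (x \<bullet> e)\<bar> \<le> L * \<bar>(y - x) \<bullet> e\<bar>"
        using lipschitz_onD[OF f, of "y \<bullet> e" "x \<bullet> e"] by (simp add: dist_real_def inner_diff_left)
      also have "\<bar>(y - x) \<bullet> e\<bar> + L * \<bar>(y - x) \<bullet> e\<bar> = (1 + L) * \<bar>(y - x) \<bullet> e\<bar>" by (simp add: algebra_simps)
      also have "\<dots> \<le> (1 + L) * norm (y - x)"
        using Cauchy_Schwarz_ineq2[of "y - x" e] en L0 by (intro mult_left_mono) auto
      finally show ?thesis by simp
    qed
    then show "\<exists>T B. open T \<and> x \<in> T \<and> (\<forall>y\<in>H \<inter> T. norm (g y - g x) \<le> B * norm (y - x))"
      by (intro exI[of _ UNIV] exI[of _ "1 + L"]) auto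
  qed (use \<open>negligible H\<close> in auto)
  moreover have "{q. f (q \<bullet> e) = q \<bullet> n} \<subseteq> g ` H"
  proof
    fix q assume "q \<in> {q. f (q \<bullet> e) = q \<bullet> n}"
    then have q: "f (q \<bullet> e) = q \<bullet> n" by simp
    define q0 where "q0 = (q \<bullet> e) *\<^sub>R e"
    have "q0 \<bullet> e = q \<bullet> e" "q0 \<in> H" using en by (simp_all add: q0_def H_def norm_eq_1 inner_commute)
    then have "g q0 = q" using orthonormal_plane_expansion[OF en, of q] q by (simp add: g_def)
    then show "q \<in> g ` H" using \<open>q0 \<in> H\<close> by blast
  qed
  ultimately show ?thesis using negligible_subset by blast
qed

lemma lipschitz_regionE:
  assumes "lipschitz_region S" "p \<in> S"
  obtains R e n f L where "R > 0" "norm e = 1" "norm n = 1" "e \<bullet> n = 0" "L-lipschitz_on UNIV (f :: real \<Rightarrow> real)"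
    "\<And>q. dist p q < R \<Longrightarrow> q \<in> S \<longleftrightarrow> f (q \<bullet> e) \<le> q \<bullet> n"
proof -
  from bspec[OF assms(1)[unfolded lipschitz_region_def] assms(2)]
  obtain W e n f L where W: "open W" "p \<in> W" "norm e = 1" "norm n = 1" "e \<bullet> n = 0" "L-lipschitz_on UNIV (f :: real \<Rightarrow> real)"
    "S \<inter> W = {q \<in> W. f (q \<bullet> e) \<le> q \<bullet> n}"
    by (elim exE conjE) (rule that)
  obtain R where R: "R > 0" "ball p R \<subseteq> W" using W(1,2) open_contains_ball by blast
  show ?thesis
  proof (rule that[OF R(1) W(3-6)])
    fix q assume "dist p q < R"
    then have "q \<in> W" using R(2) by auto
    then show "q \<in> S \<longleftrightarrow> f (q \<bullet> e) \<le> q \<bullet> n" using W(7) by blast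
  qed
qed

lemma
  assumes "L-lipschitz_on UNIV (f :: real \<Rightarrow> real)"
  shows closed_epigraph: "closed {q :: real^2. f (q \<bullet> e) \<le> q \<bullet> n}"
    and open_strict_epigraph: "open {q :: real^2. f (q \<bullet> e) < q \<bullet> n}"
proof -
  have "continuous_on UNIV f" using assms lipschitz_on_continuous_on by blast
  moreover have "continuous_on UNIV (\<lambda>q :: real^2. q \<bullet> e)" by (intro continuous_intros)
  ultimately have c: "continuous_on UNIV (\<lambda>q :: real^2. f (q \<bullet> e))"
    using continuous_on_compose2 by blast
  have c': "continuous_on UNIV (\<lambda>q :: real^2. q \<bullet> n)" by (intro continuous_intros)
  show "closed {q :: real^2. f (q \<bullet> e) \<le> q \<bullet> n}" by (rule closed_Collect_le[OF c c'])
  show "open {q :: real^2. f (q \<bullet> e) < q \<bullet> n}" by (rule open_Collect_less[OF c c'])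
qed

text \<open>A region need not be closed, but it is so near each of its points; this supplies the
  compact coordinate neighbourhoods on which metrics are bounded.\<close>

lemma lipschitz_region_compact:
  assumes "lipschitz_region S" "p \<in> S"
  obtains R where "R > 0" "\<And>r. r < R \<Longrightarrow> compact (S \<inter> cball p r)"
proof -
  obtain R e n f L where R: "R > 0" "L-lipschitz_on UNIV (f :: real \<Rightarrow> real)"
    "\<And>q. dist p q < R \<Longrightarrow> q \<in> S \<longleftrightarrow> f (q \<bullet> e) \<le> q \<bullet> n"
    using lipschitz_regionE[OF assms] by metis
  show ?thesis
  proof (rule that[OF R(1)])
    fix r assume "r < R"
    then have "S \<inter> cball p r = cball p r \<inter> {q. f (q \<bullet> e) \<le> q \<bullet> n}" using R(3) by auto
    then show "compact (S \<inter> cball p r)" using closed_epigraph[OF R(2)] by (simp add: compact_Int_closed)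
  qed
qed

lemma lipschitz_region_borel:
  assumes "lipschitz_region S"
  shows "S \<in> sets borel"
proof -
  define \<W> where "\<W> = {W. open W \<and> S \<inter> W \<in> sets borel}"
  have "S \<subseteq> \<Union>\<W>"
  proof
    fix p assume p: "p \<in> S"
    obtain R where R: "R > 0" "\<And>r. r < R \<Longrightarrow> compact (S \<inter> cball p r)" using lipschitz_region_compact[OF assms p] by blast
    have "S \<inter> ball p (R/2) = (S \<inter> cball p (R/2)) \<inter> ball p (R/2)" using ball_subset_cball by blast
    moreover have "S \<inter> cball p (R/2) \<in> sets borel" by (intro borel_compact R(2)) (use R(1) in simp)
    ultimately have "S \<inter> ball p (R/2) \<in> sets borel" by (metis borel_open open_ball sets.Int)
    then show "p \<in> \<Union>\<W>" unfolding \<W>_def using R(1) by (intro UnionI[of "ball p (R/2)"]) auto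
  qed
  moreover obtain \<W>' where W': "\<W>' \<subseteq> \<W>" "countable \<W>'" "\<Union>\<W>' = \<Union>\<W>"
    using Lindelof[of \<W>] unfolding \<W>_def by auto
  ultimately have "S \<subseteq> \<Union>\<W>'" by simp
  then have "S = (\<Union>W\<in>\<W>'. S \<inter> W)" by blast
  also have "\<dots> \<in> sets borel" using W' unfolding \<W>_def by (intro sets.countable_UN') auto
  finally show ?thesis .
qed

text \<open>Near a noninterior point all such points lie on the graph. Two-sided derivatives can
  thus be used almost everywhere, also on surfaces with boundary.\<close>

lemma negligible_lipschitz_region_boundary:
  assumes "lipschitz_region S"
  shows "negligible (S - interior S)"
proof (rule locally_negligible_alt[THEN iffD2], intro ballI)
  fix p assume p: "p \<in> S - interior S"
  then obtain R e n f L where R: "R > 0" "norm e = 1" "norm n = 1" "e \<bullet> n = 0" "L-lipschitz_on UNIV (f :: real \<Rightarrow> real)"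
    "\<And>q. dist p q < R \<Longrightarrow> q \<in> S \<longleftrightarrow> f (q \<bullet> e) \<le> q \<bullet> n"
    using lipschitz_regionE[OF assms] by (metis Diff_iff)
  have op: "open {q :: real^2. f (q \<bullet> e) < q \<bullet> n}" by (rule open_strict_epigraph[OF R(5)])
  have "(S - interior S) \<inter> ball p R \<subseteq> {q. f (q \<bullet> e) = q \<bullet> n}"
  proof
    fix q assume q: "q \<in> (S - interior S) \<inter> ball p R"
    then have le: "f (q \<bullet> e) \<le> q \<bullet> n" using R(6) by auto
    moreover have "\<not> f (q \<bullet> e) < q \<bullet> n"
    proof
      assume "f (q \<bullet> e) < q \<bullet> n"
      then have "q \<in> ball p R \<inter> {q. f (q \<bullet> e) < q \<bullet> n}" using q by auto
      moreover have "ball p R \<inter> {q. f (q \<bullet> e) < q \<bullet> n} \<subseteq> S" using R(6) by auto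
      ultimately have "q \<in> interior S" using op by (meson interiorI open_Int open_ball)
      then show False using q by blast
    qed
    ultimately show "q \<in> {q. f (q \<bullet> e) = q \<bullet> n}" by simp
  qed
  then have "negligible ((S - interior S) \<inter> ball p R)"
    using negligible_lipschitz_graph[OF R(2-5)] negligible_subset by blast
  moreover have "openin (top_of_set (S - interior S)) ((S - interior S) \<inter> ball p R)"
    by (rule openin_open_Int) simp
  ultimately show "\<exists>U. openin (top_of_set (S - interior S)) U \<and> p \<in> U \<and> negligible U"
    using p R(1) by (intro exI[of _ "(S - interior S) \<inter> ball p R"]) auto
qed

text \<open>A small move from \<open>p\<close> in the direction \<open>n\<close> leads strictly
  above the graph.\<close>

lemma lipschitz_region_contains_open:
  assumes "lipschitz_region S" "p \<in> S" "open V" "p \<in> V"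
  obtains U where "open U" "U \<noteq> {}" "U \<subseteq> S \<inter> V"
proof -
  obtain R e n f L where R: "R > 0" "norm e = 1" "norm n = 1" "e \<bullet> n = 0" "L-lipschitz_on UNIV (f :: real \<Rightarrow> real)"
    "\<And>q. dist p q < R \<Longrightarrow> q \<in> S \<longleftrightarrow> f (q \<bullet> e) \<le> q \<bullet> n"
    using lipschitz_regionE[OF assms(1,2)] by metis
  obtain r where r: "r > 0" "ball p r \<subseteq> V" using assms(3,4) open_contains_ball by blast
  define t where "t = min R r / 2"
  have t: "t > 0" "t < R" "t < r" using R(1) r(1) unfolding t_def by auto
  have op: "open {q :: real^2. f (q \<bullet> e) < q \<bullet> n}" by (rule open_strict_epigraph[OF R(5)])
  define U where "U = ball p (min R r) \<inter> {q. f (q \<bullet> e) < q \<bullet> n}"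
  have "f (p \<bullet> e) \<le> p \<bullet> n" using R(6)[of p] R(1) assms(2) by simp
  moreover have "n \<bullet> n = 1" "n \<bullet> e = 0" using R(3,4) by (simp_all add: norm_eq_1 inner_commute)
  ultimately have "p + t *\<^sub>R n \<in> U" using t R(3) unfolding U_def
    by (simp add: inner_add_left dist_norm)
  moreover have "open U" unfolding U_def using op by auto
  moreover have "U \<subseteq> S \<inter> V" unfolding U_def using R(6) r(2) by auto
  ultimately show ?thesis using that by blast
qed

text \<open>The two segments go steeply into the region, so the Lipschitz graph never cuts them off.\<close>

lemma lipschitz_region_broken_segment:
  assumes "lipschitz_region S" "p \<in> S"
  obtains C where "C \<ge> 0" "\<And>R. R > 0 \<Longrightarrow> \<exists>r>0. r \<le> R \<and> (\<forall>x\<in>S \<inter> ball p r. \<forall>y\<in>S \<inter> ball p r. \<exists>m.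
     closed_segment x m \<subseteq> S \<inter> ball p R \<and> closed_segment y m \<subseteq> S \<inter> ball p R \<and>
     norm (m - x) \<le> C * norm (x - y) \<and> norm (m - y) \<le> C * norm (x - y))"
proof -
  obtain R0 e n f L where R: "R0 > 0" "norm e = 1" "norm n = 1" "e \<bullet> n = 0" "L-lipschitz_on UNIV (f :: real \<Rightarrow> real)"
    "\<And>q. dist p q < R0 \<Longrightarrow> q \<in> S \<longleftrightarrow> f (q \<bullet> e) \<le> q \<bullet> n"
    using lipschitz_regionE[OF assms] by metis
  have L0: "L \<ge> 0" using R(5) lipschitz_on_nonneg by blast
  have nn: "n \<bullet> n = 1" "n \<bullet> e = 0" using R(3,4) by (simp_all add: norm_eq_1 inner_commute)
  define C where "C = (L + 2) / 2"
  have C: "C \<ge> 0" using L0 by (simp add: C_def)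
  show ?thesis
  proof (rule that[OF C])
    fix R' :: real assume "R' > 0"
    define Q where "Q = min R' R0"
    have Q: "Q > 0" "Q \<le> R'" "Q \<le> R0" using \<open>R' > 0\<close> R(1) unfolding Q_def by auto
    \<comment> \<open>A connecting point lies within \<open>C * (2 * r) = (L + 2) * r\<close> of its
      endpoint; together with the radius \<open>r\<close> this gives
      \<open>(L + 3) * r = Q\<close>.\<close>
    define r where "r = Q / (L + 3)"
    have r: "r > 0" "(L + 3) * r = Q" using Q(1) L0 by (auto simp: r_def)
    have rQ: "r \<le> Q" using mult_right_mono[of 1 "L + 3" r] r L0 by simp
    \<comment> \<open>The midpoint, lifted by \<open>(L + 1) / 2\<close> times the distance. Even if
      the half chord descends vertically, a rise of \<open>L / 2\<close> times the distance is left,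
      enough to stay above the Lipschitz graph.\<close>
    define m where "m x y = (1/2) *\<^sub>R (x + y) + ((L + 1) * norm (x - y) / 2) *\<^sub>R n" for x y
    have msym: "m x y = m y x" for x y unfolding m_def by (simp add: add.commute norm_minus_commute)
    have mx: "m x y - x = (1/2) *\<^sub>R (y - x) + ((L + 1) * norm (x - y) / 2) *\<^sub>R n" for x y
    proof -
      have "(1/2) *\<^sub>R (x + y) - x = (1/2) *\<^sub>R (y - x)"
        by (simp add: vec_eq_iff field_simps)
      then show ?thesis unfolding m_def by (simp add: algebra_simps)
    qed
    have mn: "norm (m x y - x) \<le> C * norm (x - y)" for x y
    proof -
      have "norm (m x y - x) \<le> norm (x - y) / 2 + (L + 1) * norm (x - y) / 2"
        unfolding mx using norm_triangle_ineq[of "(1/2) *\<^sub>R (y - x)" "((L + 1) * norm (x - y) / 2) *\<^sub>R n"] R(3) L0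
        by (simp add: norm_minus_commute)
      also have "\<dots> = C * norm (x - y)" by (simp add: C_def field_simps)
      finally show ?thesis .
    qed
    have seg: "closed_segment x (m x y) \<subseteq> S \<inter> ball p R'" if xy: "x \<in> S \<inter> ball p r" "y \<in> S \<inter> ball p r" for x y
    proof
      fix z assume "z \<in> closed_segment x (m x y)"
      then obtain t where t: "0 \<le> t" "t \<le> 1" "z = (1 - t) *\<^sub>R x + t *\<^sub>R m x y" unfolding closed_segment_def by blast
      have z: "z = x + t *\<^sub>R (m x y - x)" using t(3) by (simp add: algebra_simps)
      have xy2: "norm (x - y) < 2 * r"
        using xy dist_triangle[of x y p] by (simp add: dist_norm norm_minus_commute)
      have "dist p z \<le> dist p x + norm (m x y - x)"
      proof -
        have "dist x z \<le> norm (m x y - x)" unfolding z using t by (simp add: dist_norm mult_left_le_one_le)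
        then show ?thesis using dist_triangle[of p z x] by linarith
      qed
      also have "norm (m x y - x) \<le> C * norm (x - y)" by (rule mn)
      also have "C * norm (x - y) \<le> C * (2 * r)" using xy2 C by (intro mult_left_mono) auto
      also have "dist p x + C * (2 * r) < r + C * (2 * r)" using xy by simp
      also have "r + C * (2 * r) = (L + 3) * r" by (simp add: C_def field_simps)
      finally have pz: "dist p z < Q" using r by simp
      have ze: "z \<bullet> e = x \<bullet> e + t * ((y - x) \<bullet> e) / 2"
        unfolding z mx by (simp add: inner_add_left nn distrib_left)
      have zn: "z \<bullet> n = x \<bullet> n + t * ((y - x) \<bullet> n) / 2 + t * ((L + 1) * norm (x - y) / 2)"
        unfolding z mx by (simp add: inner_add_left nn distrib_left)
      have "x \<in> S" "dist p x < R0" using xy rQ Q(3) by auto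
      then have fx: "f (x \<bullet> e) \<le> x \<bullet> n" using R(6) by blast
      have "f (z \<bullet> e) - f (x \<bullet> e) \<le> \<bar>f (z \<bullet> e) - f (x \<bullet> e)\<bar>" by simp
      also have "\<dots> \<le> L * \<bar>t * ((y - x) \<bullet> e) / 2\<bar>"
        using lipschitz_onD[OF R(5), of "z \<bullet> e" "x \<bullet> e"] unfolding ze by (simp add: dist_real_def)
      also have "\<bar>t * ((y - x) \<bullet> e) / 2\<bar> \<le> t * norm (x - y) / 2"
        using Cauchy_Schwarz_ineq2[of "y - x" e] R(2) t(1) by (simp add: abs_mult mult_left_mono norm_minus_commute)
      finally have f1: "f (z \<bullet> e) \<le> x \<bullet> n + L * (t * norm (x - y) / 2)" using fx L0
        by (simp add: mult_left_mono) 
      have "- norm (x - y) \<le> (y - x) \<bullet> n"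
        using Cauchy_Schwarz_ineq2[of "y - x" n] R(3) by (simp add: norm_minus_commute abs_le_iff)
      then have "t * (- norm (x - y)) \<le> t * ((y - x) \<bullet> n)" using t(1) by (intro mult_left_mono) auto
      then have "x \<bullet> n + L * (t * norm (x - y) / 2) \<le> z \<bullet> n"
      proof -
        have "t * ((L + 1) * norm (x - y) / 2) = L * (t * norm (x - y) / 2) + t * norm (x - y) / 2"
          by (simp add: field_simps)
        then show ?thesis using \<open>t * (- norm (x - y)) \<le> t * ((y - x) \<bullet> n)\<close> unfolding zn by linarith
      qed
      then have "f (z \<bullet> e) \<le> z \<bullet> n" using f1 by linarith
      then have "z \<in> S" using R(6)[of z] pz Q(3) by simp
      then show "z \<in> S \<inter> ball p R'" using pz Q(2) by auto
    qed
    show "\<exists>r>0. r \<le> R' \<and> (\<forall>x\<in>S \<inter> ball p r. \<forall>y\<in>S \<inter> ball p r. \<exists>m.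
     closed_segment x m \<subseteq> S \<inter> ball p R' \<and> closed_segment y m \<subseteq> S \<inter> ball p R' \<and>
     norm (m - x) \<le> C * norm (x - y) \<and> norm (m - y) \<le> C * norm (x - y))"
    proof (intro exI[of _ r] conjI ballI)
      show "r > 0" "r \<le> R'" using r rQ Q by auto
      fix x y assume xy: "x \<in> S \<inter> ball p r" "y \<in> S \<inter> ball p r"
      have "closed_segment y (m x y) \<subseteq> S \<inter> ball p R'" using seg[OF xy(2,1)] msym by simp
      moreover have "norm (m x y - y) \<le> C * norm (x - y)" using mn[of y x] msym norm_minus_commute by metis
      ultimately show "\<exists>m. closed_segment x m \<subseteq> S \<inter> ball p R' \<and> closed_segment y m \<subseteq> S \<inter> ball p R' \<and>
         norm (m - x) \<le> C * norm (x - y) \<and> norm (m - y) \<le> C * norm (x - y)"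
        using seg[OF xy] mn[of x y] by blast
    qed
  qed
qed

subsection \<open>Charts\<close>

lemma smooth_on_differentiable:
  assumes "smooth_on S f" "x \<in> S"
  shows "f differentiable (at x within S)"
proof -
  obtain W g where W: "open W" "x \<in> W" "\<forall>n. Ck_on n W g" "\<forall>y\<in>S \<inter> W. f y = g y"
    using assms unfolding smooth_on_def by blast
  have "Ck_on (Suc 0) W g" using W(3) by blast
  then have "g differentiable (at x)" using W(2) by simp
  then obtain g' where "(g has_derivative g') (at x)" unfolding differentiable_def by blast
  then have "(g has_derivative g') (at x within S)" by (rule has_derivative_at_withinI)
  note gS = this
  obtain r where r: "r > 0" "ball x r \<subseteq> W" using W(1,2) open_contains_ball by blast
  have gf: "g y = f y" if "y \<in> S" "dist y x < r" for y
  proof -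
    have "y \<in> W" using that(2) r(2) by (auto simp: dist_commute)
    then show ?thesis using W(4) that(1) by simp
  qed
  have "(f has_derivative g') (at x within S)"
    by (rule has_derivative_transform_within[OF gS r(1) assms(2) gf])
  then show ?thesis unfolding differentiable_def by blast
qed

context riemannian_surface
begin

abbreviation cdom_image :: "'a chart \<Rightarrow> (real^2) set" where
  "cdom_image c \<equiv> cmap c ` cdom c"

lemma cdom_subset: "c \<in> atlas M \<Longrightarrow> cdom c \<subseteq> pts M"
  using chart_open openin_subset by blast

lemma ex_chart:
  assumes "x \<in> pts M"
  shows "\<exists>c\<in>atlas M. x \<in> cdom c"
  using assms charts_cover by blast

lemma chart_at:
  assumes "x \<in> pts M"
  shows "chart_at M x \<in> atlas M" "x \<in> cdom (chart_at M x)"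
  using someI_ex[of "\<lambda>c. c \<in> atlas M \<and> x \<in> cdom c"] ex_chart[OF assms] unfolding chart_at_def by blast+

lemma spd_gmat: "c \<in> atlas M \<Longrightarrow> x \<in> cdom c \<Longrightarrow> spd (gmat M c x)"
  using metric_sym metric_pos unfolding spd_def by blast

lemma spd_gmat_at: "x \<in> pts M \<Longrightarrow> spd (gmat_at M x)"
  unfolding gmat_at_def using chart_at spd_gmat by blast

lemma topspace_cdom: "c \<in> atlas M \<Longrightarrow> topspace (subtopology (mtop M) (cdom c)) = cdom c"
  using cdom_subset by (simp add: inf.absorb2)

lemma inj_cmap: "c \<in> atlas M \<Longrightarrow> inj_on (cmap c) (cdom c)"
  using homeomorphic_imp_injective_map[OF chart_homeo] topspace_cdom by metis

lemma cinv_cmap: "c \<in> atlas M \<Longrightarrow> x \<in> cdom c \<Longrightarrow> cinv c (cmap c x) = x"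
  using inj_cmap by simp

lemma cinv_cdom: "p \<in> cdom_image c \<Longrightarrow> cinv c p \<in> cdom c"
  by (rule inv_into_into)

lemma cmap_cinv: "p \<in> cdom_image c \<Longrightarrow> cmap c (cinv c p) = p"
  by (rule f_inv_into_f)

lemma cmap_open:
  assumes c: "c \<in> atlas M" and U: "openin (mtop M) U"
  shows "openin (top_of_set (cdom_image c)) (cmap c ` (U \<inter> cdom c))"
proof -
  have "openin (subtopology (mtop M) (cdom c)) (U \<inter> cdom c)"
    using U openin_subtopology by blast
  then show ?thesis using homeomorphic_imp_open_map[OF chart_homeo[OF c]] unfolding open_map_def by blast
qed

lemma cmap_vimage_open:
  assumes c: "c \<in> atlas M" and V: "openin (top_of_set (cdom_image c)) (cdom_image c \<inter> V)"
  shows "openin (mtop M) {x\<in>cdom c. cmap c x \<in> V}"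
proof -
  have "openin (subtopology (mtop M) (cdom c)) {x \<in> topspace (subtopology (mtop M) (cdom c)). cmap c x \<in> cdom_image c \<inter> V}"
    using homeomorphic_imp_continuous_map[OF chart_homeo[OF c]] V by (rule openin_continuous_map_preimage)
  moreover have "{x \<in> topspace (subtopology (mtop M) (cdom c)). cmap c x \<in> cdom_image c \<inter> V} = {x\<in>cdom c. cmap c x \<in> V}"
    unfolding topspace_cdom[OF c] by auto
  ultimately show ?thesis using openin_trans_full[OF _ chart_open[OF c]] by simp
qed

lemma cmap_vimage_open': "c \<in> atlas M \<Longrightarrow> open V \<Longrightarrow> openin (mtop M) {x\<in>cdom c. cmap c x \<in> V}"
  using cmap_vimage_open openin_open_Int by blast

lemma region_borel: "c \<in> atlas M \<Longrightarrow> cdom_image c \<in> sets borel"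
  using chart_region lipschitz_region_borel by blast

lemma openin_region_borel:
  assumes "c \<in> atlas M" "openin (top_of_set (cdom_image c)) V"
  shows "V \<in> sets borel"
  using assms region_borel unfolding openin_open by auto

definition overlap :: "'a chart \<Rightarrow> 'a chart \<Rightarrow> (real^2) set" where
  "overlap c d = cmap c ` (cdom c \<inter> cdom d)"

lemma overlap_open:
  assumes "c \<in> atlas M" "d \<in> atlas M"
  shows "openin (top_of_set (cdom_image c)) (overlap c d)"
  using cmap_open[OF assms(1) chart_open[OF assms(2)]] by (simp add: overlap_def Int_commute)

lemma transition_has_derivative:
  assumes c: "c \<in> atlas M" and d: "d \<in> atlas M" and x: "x \<in> cdom c \<inter> cdom d"
  shows "((cmap d \<circ> cinv c) has_derivative (*v) (transition_deriv c d x)) (at (cmap c x) within overlap c d)"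
proof -
  let ?f = "cmap d \<circ> cinv c"
  have "?f differentiable (at (cmap c x) within overlap c d)"
    unfolding overlap_def using transition_smooth[OF c d] x by (intro smooth_on_differentiable) auto
  then have h: "(?f has_derivative frechet_derivative ?f (at (cmap c x) within overlap c d)) (at (cmap c x) within overlap c d)"
    by (simp add: frechet_derivative_works)
  have "(*v) (transition_deriv c d x) = frechet_derivative ?f (at (cmap c x) within overlap c d)"
    unfolding transition_deriv_def overlap_def[symmetric]
    by (intro ext matrix_works) (use has_derivative_linear[OF h] in \<open>simp add: linear_def scalar_mult_eq_scaleR[abs_def]\<close>)
  then show ?thesis using h by simp
qed

lemma transition_overlap: "c \<in> atlas M \<Longrightarrow> d \<in> atlas M \<Longrightarrow> p \<in> overlap c d \<Longrightarrow>
   cinv c p \<in> cdom c \<inter> cdom d \<and> cmap c (cinv c p) = p"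
  unfolding overlap_def using cinv_cmap by auto

lemma transition_differentiable_on:
  assumes "c \<in> atlas M" "d \<in> atlas M"
  shows "(cmap d \<circ> cinv c) differentiable_on overlap c d"
  unfolding differentiable_on_def overlap_def
  using smooth_on_differentiable[OF transition_smooth[OF assms]] by blast

lemma transition_image:
  assumes "c \<in> atlas M" "S \<subseteq> cdom c"
  shows "(cmap d \<circ> cinv c) ` (cmap c ` S) = cmap d ` S"
  using assms cinv_cmap[OF assms(1)] by (force simp: image_image)

lemma gmat_continuous:
  assumes "c \<in> atlas M"
  shows "continuous_on (cdom_image c) (\<lambda>p. gmat M c (cinv c p))"
proof -
  have "(gmat M c \<circ> cinv c) differentiable_on cdom_image c"
    unfolding differentiable_on_def using smooth_on_differentiable[OF metric_smooth[OF assms]] by blast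
  then show ?thesis using differentiable_imp_continuous_on by (auto simp: comp_def)
qed

section \<open>Riemannian area in charts\<close>

definition dens :: "'a chart \<Rightarrow> real^2 \<Rightarrow> real" where
  "dens c p = sqrt (det (gmat M c (cinv c p)))"

lemma dens_continuous:
  assumes "c \<in> atlas M"
  shows "continuous_on (cdom_image c) (dens c)"
  unfolding dens_def det_2 by (intro continuous_intros gmat_continuous[OF assms])

lemma dens_pos: "c \<in> atlas M \<Longrightarrow> p \<in> cdom_image c \<Longrightarrow> dens c p > 0"
  unfolding dens_def using spd_gmat[of c "cinv c p"] cinv_cdom spdD(3) by simp

lemma dens_transition:
  assumes c: "c \<in> atlas M" and d: "d \<in> atlas M" and x: "x \<in> cdom c \<inter> cdom d"
  shows "dens c (cmap c x) = \<bar>det (transition_deriv c d x)\<bar> * dens d (cmap d x)"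
proof -
  have "det (gmat M c x) = (det (transition_deriv c d x))\<^sup>2 * det (gmat M d x)"
    using arg_cong[OF metric_compat[OF c d x], of det] by (simp add: det_mul det_transpose power2_eq_square)
  then show ?thesis using x unfolding dens_def by (simp add: cinv_cmap c d real_sqrt_mult)
qed

text \<open>As a density measure on the plane, \<open>chart_area\<close> inherits countable
  additivity. The density is cut off outside the chart image because \<open>cinv c\<close> is
  meaningful only there.\<close>

lemma chart_area_density:
  assumes c: "c \<in> atlas M" and S: "S \<subseteq> cdom c" "cmap c ` S \<in> sets lebesgue"
  shows "chart_area M c S = emeasure (density lebesgue (\<lambda>p. ennreal (dens c p) * indicator (cdom_image c) p)) (cmap c ` S)"
    and "(\<lambda>p. ennreal (dens c p) * indicator (cdom_image c) p) \<in> borel_measurable lebesgue"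
proof -
  have R: "cdom_image c \<in> sets lebesgue" using region_borel[OF c] by simp
  show m: "(\<lambda>p. ennreal (dens c p) * indicator (cdom_image c) p) \<in> borel_measurable lebesgue"
    using continuous_imp_measurable_on_sets_lebesgue[OF dens_continuous[OF c] R] R
    by (subst borel_measurable_restrict_space_iff_ennreal[symmetric]) auto
  have "emeasure (density lebesgue (\<lambda>p. ennreal (dens c p) * indicator (cdom_image c) p)) (cmap c ` S) =
      (\<integral>\<^sup>+p. ennreal (dens c p) * indicator (cdom_image c) p * indicator (cmap c ` S) p \<partial>lebesgue)"
    by (rule emeasure_density[OF m S(2)])
  also have "\<dots> = chart_area M c S"
    unfolding chart_area_def dens_def using S(1) by (intro nn_integral_cong) (auto simp: indicator_def)
  finally show "chart_area M c S = emeasure (density lebesgue (\<lambda>p. ennreal (dens c p) * indicator (cdom_image c) p)) (cmap c ` S)" by simp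
qed

lemma chart_area_eq_dens: "chart_area M c S = (\<integral>\<^sup>+p\<in>cmap c ` S. ennreal (dens c p) \<partial>lebesgue)"
  unfolding chart_area_def dens_def by simp

text \<open>Metric compatibility makes the two densities differ by the absolute Jacobian of the
  transition, exactly the factor in the change of variables.\<close>

lemma chart_area_transition:
  assumes c: "c \<in> atlas M" and d: "d \<in> atlas M" and S: "S \<subseteq> cdom c \<inter> cdom d" "cmap c ` S \<in> sets lebesgue"
  shows "chart_area M c S = chart_area M d S"
proof -
  let ?f = "cmap d \<circ> cinv c"
  have img: "?f ` (cmap c ` S) = cmap d ` S" using transition_image[OF c] S by blast
  have sub: "cmap c ` S \<subseteq> overlap c d" using S unfolding overlap_def by blast
  have "(\<integral>\<^sup>+p\<in>cmap c ` S. ennreal (\<bar>det (matrix ((*v) (transition_deriv c d (cinv c p))))\<bar> * dens d (?f p)) \<partial>lebesgue)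
     = (\<integral>\<^sup>+q\<in>?f ` (cmap c ` S). ennreal (dens d q) \<partial>lebesgue)"
  proof (rule nn_integral_change_of_variables[OF S(2)])
    fix p assume p: "p \<in> cmap c ` S"
    then obtain x where x: "x \<in> S" "p = cmap c x" by blast
    then have xx: "x \<in> cdom c \<inter> cdom d" "cinv c p = x" using S cinv_cmap[OF c] by auto
    then show "(?f has_derivative (*v) (transition_deriv c d (cinv c p))) (at p within cmap c ` S)"
      using has_derivative_subset[OF transition_has_derivative[OF c d xx(1)] sub] x by simp
  next
    show "inj_on ?f (cmap c ` S)"
      using S inj_on_subset[OF inj_cmap[OF d]] cinv_cmap[OF c] by (auto intro!: inj_onI dest: inj_onD[OF inj_cmap[OF d]]) (metis IntD1 IntD2 inj_onD inj_cmap[OF d] subsetD)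
    show "continuous_on (?f ` cmap c ` S) (dens d)"
      unfolding img by (rule continuous_on_subset[OF dens_continuous[OF d]]) (use S in blast)
    fix q assume "q \<in> ?f ` cmap c ` S"
    then have "q \<in> cdom_image d" unfolding img using S by blast
    then show "0 \<le> dens d q" using dens_pos[OF d] less_imp_le by blast
  qed
  moreover have "dens c p = \<bar>det (transition_deriv c d (cinv c p))\<bar> * dens d (?f p)" if p: "p \<in> cmap c ` S" for p
  proof -
    obtain x where x: "x \<in> S" "p = cmap c x" using p by blast
    then have xx: "x \<in> cdom c \<inter> cdom d" "cinv c p = x" using S cinv_cmap[OF c] by auto
    then show ?thesis using dens_transition[OF c d xx(1)] x by simp
  qed
  then have "(\<integral>\<^sup>+p\<in>cmap c ` S. ennreal (dens c p) \<partial>lebesgue) =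
      (\<integral>\<^sup>+p\<in>cmap c ` S. ennreal (\<bar>det (matrix ((*v) (transition_deriv c d (cinv c p))))\<bar> * dens d (?f p)) \<partial>lebesgue)"
    by (intro nn_integral_cong) (simp split: split_indicator)
  ultimately show ?thesis unfolding chart_area_eq_dens img by simp
qed

subsection \<open>The area measure\<close>

text \<open>Transitions are differentiable on the overlaps and so preserve Lebesgue measurability;
  hence one chart decides.\<close>

lemma area_sets_sub:
  assumes c: "c \<in> atlas M" and S: "S \<subseteq> cdom c" "cmap c ` S \<in> sets lebesgue"
  shows "S \<in> area_sets M"
  unfolding area_sets_def
proof (intro CollectI conjI ballI)
  show "S \<subseteq> pts M" using S cdom_subset[OF c] by blast
  fix d assume d: "d \<in> atlas M"
  let ?f = "cmap d \<circ> cinv c"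
  have e: "cmap c ` (S \<inter> cdom d) = cmap c ` S \<inter> overlap c d"
    unfolding overlap_def using S inj_cmap[OF c] by (auto dest: inj_onD)
  have m: "cmap c ` (S \<inter> cdom d) \<in> sets lebesgue"
    unfolding e using S openin_region_borel[OF c overlap_open[OF c d]] by auto
  have "?f ` (cmap c ` (S \<inter> cdom d)) \<in> sets lebesgue"
    by (rule differentiable_image_in_sets_lebesgue[OF m])
      (use e in \<open>auto intro: differentiable_on_subset[OF transition_differentiable_on[OF c d]]\<close>)
  moreover have "?f ` (cmap c ` (S \<inter> cdom d)) = cmap d ` (S \<inter> cdom d)"
    by (rule transition_image[OF c]) (use S in blast)
  ultimately show "cmap d ` (S \<inter> cdom d) \<in> sets lebesgue" by simp
qed

lemma area_setsD:
  assumes "S \<in> area_sets M" "c \<in> atlas M"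
  shows "S \<subseteq> pts M" "cmap c ` (S \<inter> cdom c) \<in> sets lebesgue" "S \<subseteq> cdom c \<Longrightarrow> cmap c ` S \<in> sets lebesgue"
  using assms unfolding area_sets_def by (auto simp: inf.absorb1 dest: bspec)

lemma openin_area_sets:
  assumes "openin (mtop M) U"
  shows "U \<in> area_sets M"
  unfolding area_sets_def using openin_subset[OF assms] openin_region_borel[OF _ cmap_open[OF _ assms]] by auto

lemma sigma_algebra_area_sets: "sigma_algebra (pts M) (area_sets M)"
  unfolding sigma_algebra_iff2
proof (intro conjI ballI allI impI)
  show "area_sets M \<subseteq> Pow (pts M)" unfolding area_sets_def by blast
  show "{} \<in> area_sets M" unfolding area_sets_def by simp
  fix S assume S: "S \<in> area_sets M"
  show "pts M - S \<in> area_sets M" unfolding area_sets_def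
  proof (intro CollectI conjI ballI)
    fix c assume c: "c \<in> atlas M"
    have "cmap c ` ((pts M - S) \<inter> cdom c) = cdom_image c - cmap c ` (S \<inter> cdom c)"
      using inj_cmap[OF c] cdom_subset[OF c] by (auto dest: inj_onD)
    then show "cmap c ` ((pts M - S) \<inter> cdom c) \<in> sets lebesgue"
      using area_setsD(2)[OF S c] region_borel[OF c] by auto
  qed blast
next
  fix A :: "nat \<Rightarrow> 'a set" assume A: "range A \<subseteq> area_sets M"
  show "(\<Union>i. A i) \<in> area_sets M" unfolding area_sets_def
  proof (intro CollectI conjI ballI)
    show "(\<Union>i. A i) \<subseteq> pts M" using A unfolding area_sets_def by blast
    fix c assume c: "c \<in> atlas M"
    have "cmap c ` ((\<Union>i. A i) \<inter> cdom c) = (\<Union>i. cmap c ` (A i \<inter> cdom c))" by blast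
    also have "\<dots> \<in> sets lebesgue" using A area_setsD(2)[OF _ c] by (intro sets.countable_UN) auto
    finally show "cmap c ` ((\<Union>i. A i) \<inter> cdom c) \<in> sets lebesgue" .
  qed
qed

lemma finite_subcover:
  assumes "\<And>x. x \<in> pts M \<Longrightarrow> \<exists>U. openin (mtop M) U \<and> x \<in> U \<and> P U"
  obtains \<U> where "finite \<U>" "\<And>U. U \<in> \<U> \<Longrightarrow> openin (mtop M) U \<and> P U" "pts M \<subseteq> \<Union>\<U>"
proof -
  have "pts M \<subseteq> \<Union>{U. openin (mtop M) U \<and> P U}" using assms by blast
  then obtain \<U> where "finite \<U>" "\<U> \<subseteq> {U. openin (mtop M) U \<and> P U}" "pts M \<subseteq> \<Union>\<U>"
    using compact unfolding compact_space_alt by (metis (mono_tags, lifting) mem_Collect_eq)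
  then show ?thesis using that by blast
qed

definition chart_partition :: "(nat \<Rightarrow> 'a chart) \<Rightarrow> nat \<Rightarrow> (nat \<Rightarrow> 'a set) \<Rightarrow> bool" where
  "chart_partition cs n A \<longleftrightarrow> (\<forall>i<n. cs i \<in> atlas M \<and> A i \<subseteq> cdom (cs i) \<and> A i \<in> area_sets M) \<and>
     (\<Union>i<n. A i) = pts M \<and> disjoint_family_on A {..<n}"

lemma ex_chart_partition: "\<exists>cs n A. chart_partition cs n A"
proof -
  obtain \<U> where U: "finite \<U>" "\<And>U. U \<in> \<U> \<Longrightarrow> openin (mtop M) U \<and> (\<exists>c\<in>atlas M. U = cdom c)" "pts M \<subseteq> \<Union>\<U>"
    using finite_subcover[of "\<lambda>U. \<exists>c\<in>atlas M. U = cdom c"] ex_chart chart_open by metis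
  obtain Us where Us: "set Us = \<U>" using finite_list[OF U(1)] by blast
  define n where "n = length Us"
  have "\<forall>i<n. \<exists>c\<in>atlas M. Us ! i = cdom c" using U(2) Us unfolding n_def using nth_mem by blast
  then obtain cs where cs: "\<And>i. i < n \<Longrightarrow> cs i \<in> atlas M \<and> Us ! i = cdom (cs i)" by metis
  define A where "A i = cdom (cs i) - (\<Union>j<i. cdom (cs j))" for i
  interpret sa: sigma_algebra "pts M" "area_sets M" by (rule sigma_algebra_area_sets)
  have cover: "(\<Union>i<n. cdom (cs i)) = pts M"
  proof
    show "(\<Union>i<n. cdom (cs i)) \<subseteq> pts M" using cs cdom_subset by blast
    show "pts M \<subseteq> (\<Union>i<n. cdom (cs i))"
    proof
      fix x assume "x \<in> pts M"
      then obtain U where "U \<in> set Us" "x \<in> U" using U(3) Us by blast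
      then show "x \<in> (\<Union>i<n. cdom (cs i))" using cs unfolding n_def in_set_conv_nth by auto
    qed
  qed
  have "(\<Union>i<n. A i) = pts M"
  proof -
    have "(\<Union>i<m. A i) = (\<Union>i<m. cdom (cs i))" for m
      by (induction m) (auto simp: A_def lessThan_Suc)
    then show ?thesis using cover by simp
  qed
  moreover have "A i \<in> area_sets M" if "i < n" for i
    unfolding A_def using cs that
    by (intro sa.Diff sa.finite_UN openin_area_sets chart_open) auto
  moreover have "disjoint_family_on A {..<n}"
    unfolding disjoint_family_on_def
  proof (intro ballI impI)
    fix i j assume ij: "i \<in> {..<n}" "j \<in> {..<n}" "i \<noteq> j"
    have "A i \<inter> A j = {}" if "i < j" for i j using that unfolding A_def by blast
    then show "A i \<inter> A j = {}" using ij(3) by (metis Int_commute linorder_neqE_nat)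
  qed
  moreover have "A i \<subseteq> cdom (cs i)" for i unfolding A_def by blast
  ultimately have "chart_partition cs n A" unfolding chart_partition_def using cs by blast
  then show ?thesis by blast
qed

lemma chart_area_UN:
  assumes c: "c \<in> atlas M" and I: "countable I" and A: "\<And>i. i \<in> I \<Longrightarrow> A i \<in> area_sets M \<and> A i \<subseteq> cdom c"
    and disj: "disjoint_family_on A I"
  shows "chart_area M c (\<Union>i\<in>I. A i) = (\<integral>\<^sup>+i. chart_area M c (A i) \<partial>count_space I)"
proof -
  let ?\<mu> = "density lebesgue (\<lambda>p. ennreal (dens c p) * indicator (cdom_image c) p)"
  have Ai: "cmap c ` A i \<in> sets lebesgue" if "i \<in> I" for i using A[OF that] area_setsD(3)[OF _ c] by blast
  have img: "cmap c ` (\<Union>i\<in>I. A i) = (\<Union>i\<in>I. cmap c ` A i)" by blast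
  have m: "(\<Union>i\<in>I. cmap c ` A i) \<in> sets lebesgue" using I Ai by (intro sets.countable_UN') auto
  have "chart_area M c (\<Union>i\<in>I. A i) = emeasure ?\<mu> (\<Union>i\<in>I. cmap c ` A i)"
    using chart_area_density(1)[OF c, of "\<Union>i\<in>I. A i"] A m unfolding img by blast
  also have "\<dots> = (\<integral>\<^sup>+i. emeasure ?\<mu> (cmap c ` A i) \<partial>count_space I)"
  proof (rule emeasure_UN_countable)
    show "disjoint_family_on (\<lambda>i. cmap c ` A i) I"
      unfolding disjoint_family_on_def
    proof (intro ballI impI)
      fix i j assume ij: "i \<in> I" "j \<in> I" "i \<noteq> j"
      then have "A i \<inter> A j = {}" using disj unfolding disjoint_family_on_def by blast
      then show "cmap c ` A i \<inter> cmap c ` A j = {}"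
        using A ij inj_cmap[OF c] by (metis image_empty inj_on_image_Int)
    qed
  qed (use I Ai in auto)
  also have "\<dots> = (\<integral>\<^sup>+i. chart_area M c (A i) \<partial>count_space I)"
    using chart_area_density(1)[OF c] A Ai by (intro nn_integral_cong) auto
  finally show ?thesis .
qed

lemma chart_area_UN_finite:
  assumes c: "c \<in> atlas M" and I: "finite I" and A: "\<And>i. i \<in> I \<Longrightarrow> A i \<in> area_sets M \<and> A i \<subseteq> cdom c"
    and disj: "disjoint_family_on A I"
  shows "chart_area M c (\<Union>i\<in>I. A i) = (\<Sum>i\<in>I. chart_area M c (A i))"
  using chart_area_UN[OF c countable_finite[OF I] A disj] I by (simp add: nn_integral_count_space_finite)

section \<open>Existence and uniqueness of the area measure\<close>

definition is_area :: "'a measure \<Rightarrow> bool" where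
  "is_area \<mu> \<longleftrightarrow> space \<mu> = pts M \<and> sets \<mu> = area_sets M \<and>
     (\<forall>c\<in>atlas M. \<forall>S\<in>area_sets M. S \<subseteq> cdom c \<longrightarrow> emeasure \<mu> S = chart_area M c S)"

text \<open>The measure sums chart areas over a finite partition into pieces lying in single charts.
  Independence of the chart then yields the prescribed value in every chart of the atlas, not only
  in those of the partition.\<close>

lemma is_area_exists: "\<exists>\<mu>. is_area \<mu>"
proof -
  interpret sa: sigma_algebra "pts M" "area_sets M" by (rule sigma_algebra_area_sets)
  obtain cs n A where P: "chart_partition cs n A" using ex_chart_partition by blast
  then have cs: "\<And>i. i < n \<Longrightarrow> cs i \<in> atlas M" and A: "\<And>i. i < n \<Longrightarrow> A i \<subseteq> cdom (cs i)" "\<And>i. i < n \<Longrightarrow> A i \<in> area_sets M"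
    and cover: "(\<Union>i<n. A i) = pts M" and disj: "disjoint_family_on A {..<n}"
    unfolding chart_partition_def by auto
  define m where "m S = (\<Sum>i<n. chart_area M (cs i) (S \<inter> A i))" for S
  define \<mu> where "\<mu> = measure_of (pts M) (area_sets M) m"
  have pos: "positive (area_sets M) m"
    unfolding positive_def m_def by (simp add: chart_area_def)
  have ca: "countably_additive (area_sets M) m"
    unfolding countably_additive_def
  proof (intro allI impI)
    fix B :: "nat \<Rightarrow> 'a set" assume B: "range B \<subseteq> area_sets M" "disjoint_family B" "(\<Union>i. B i) \<in> area_sets M"
    have "chart_area M (cs i) ((\<Union>j. B j) \<inter> A i) = (\<Sum>j. chart_area M (cs i) (B j \<inter> A i))" if i: "i < n" for i
    proof -
      have "chart_area M (cs i) (\<Union>j\<in>UNIV. B j \<inter> A i) = (\<integral>\<^sup>+j. chart_area M (cs i) (B j \<inter> A i) \<partial>count_space UNIV)"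
      proof (rule chart_area_UN[OF cs[OF i]])
        show "B j \<inter> A i \<in> area_sets M \<and> B j \<inter> A i \<subseteq> cdom (cs i)" for j
          using B(1) A[OF i] by (auto intro!: sa.Int)
        show "disjoint_family (\<lambda>j. B j \<inter> A i)"
          using B(2) unfolding disjoint_family_on_def by blast
      qed simp
      then show ?thesis by (simp add: nn_integral_count_space_nat)
    qed
    then have "m (\<Union>i. B i) = (\<Sum>i<n. \<Sum>j. chart_area M (cs i) (B j \<inter> A i))" unfolding m_def by simp
    also have "\<dots> = (\<Sum>j. m (B j))" unfolding m_def by (rule suminf_sum[symmetric]) simp
    finally show "(\<Sum>j. m (B j)) = m (\<Union>i. B i)" by simp
  qed
  have em: "emeasure \<mu> S = m S" if "S \<in> area_sets M" for S
    unfolding \<mu>_def by (rule emeasure_measure_of_sigma[OF sigma_algebra_area_sets pos ca that])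
  have "is_area \<mu>"
    unfolding is_area_def
  proof (intro conjI ballI impI)
    show "space \<mu> = pts M" unfolding \<mu>_def by (rule space_measure_of) (use sa.space_closed in blast)
    show "sets \<mu> = area_sets M" unfolding \<mu>_def by (rule sa.sets_measure_of_eq)
    fix c S assume c: "c \<in> atlas M" and S: "S \<in> area_sets M" "S \<subseteq> cdom c"
    have "m S = (\<Sum>i<n. chart_area M c (S \<inter> A i))"
      unfolding m_def
    proof (rule sum.cong)
      fix i assume "i \<in> {..<n}"
      then have i: "i < n" by simp
      have SA: "S \<inter> A i \<in> area_sets M" using S A[OF i] by blast
      show "chart_area M (cs i) (S \<inter> A i) = chart_area M c (S \<inter> A i)"
        using A[OF i] S area_setsD(3)[OF SA cs[OF i]] by (intro chart_area_transition[OF cs[OF i] c]) auto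
    qed simp
    also have "\<dots> = chart_area M c (\<Union>i\<in>{..<n}. S \<inter> A i)"
    proof (rule chart_area_UN_finite[OF c, symmetric])
      show "disjoint_family_on (\<lambda>i. S \<inter> A i) {..<n}"
        using disj unfolding disjoint_family_on_def by blast
    qed (use S A in auto)
    also have "(\<Union>i\<in>{..<n}. S \<inter> A i) = S" using cover S area_setsD(1)[OF S(1) c] by blast
    finally show "emeasure \<mu> S = chart_area M c S" using em[OF S(1)] by simp
  qed
  then show ?thesis by blast
qed

lemma is_area_unique:
  assumes "is_area \<mu>" "is_area \<nu>"
  shows "\<mu> = \<nu>"
proof (rule measure_eqI)
  show s: "sets \<mu> = sets \<nu>" using assms unfolding is_area_def by simp
  fix S assume "S \<in> sets \<mu>"
  then have S: "S \<in> area_sets M" using assms unfolding is_area_def by simp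
  interpret sa: sigma_algebra "pts M" "area_sets M" by (rule sigma_algebra_area_sets)
  obtain cs n A where P: "chart_partition cs n A" using ex_chart_partition by blast
  then have cs: "\<And>i. i < n \<Longrightarrow> cs i \<in> atlas M" and A: "\<And>i. i < n \<Longrightarrow> A i \<subseteq> cdom (cs i)" "\<And>i. i < n \<Longrightarrow> A i \<in> area_sets M"
    and cover: "(\<Union>i<n. A i) = pts M" and disj: "disjoint_family_on A {..<n}"
    unfolding chart_partition_def by auto
  have SA: "S \<inter> A i \<in> area_sets M" if "i < n" for i using S A[OF that] by blast
  have eq: "S = (\<Union>i\<in>{..<n}. S \<inter> A i)" using cover S unfolding area_sets_def by blast
  have "emeasure \<kappa> S = (\<Sum>i<n. chart_area M (cs i) (S \<inter> A i))" if \<kappa>: "is_area \<kappa>" for \<kappa>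
  proof -
    have "emeasure \<kappa> (\<Union>i\<in>{..<n}. S \<inter> A i) = (\<Sum>i<n. emeasure \<kappa> (S \<inter> A i))"
    proof (rule sum_emeasure[symmetric])
      show "disjoint_family_on (\<lambda>i. S \<inter> A i) {..<n}"
        using disj unfolding disjoint_family_on_def by blast
    qed (use SA \<kappa> in \<open>auto simp: is_area_def\<close>)
    also have "\<dots> = (\<Sum>i<n. chart_area M (cs i) (S \<inter> A i))"
    proof (rule sum.cong[OF refl])
      fix i assume "i \<in> {..<n}"
      then have "cs i \<in> atlas M" "S \<inter> A i \<in> area_sets M" "S \<inter> A i \<subseteq> cdom (cs i)" using SA A cs by auto
      then show "emeasure \<kappa> (S \<inter> A i) = chart_area M (cs i) (S \<inter> A i)" using \<kappa> unfolding is_area_def by blast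
    qed
    finally show ?thesis using eq by simp
  qed
  then show "emeasure \<mu> S = emeasure \<nu> S" using assms by simp
qed

text \<open>Existence and uniqueness give the definite description in \<open>area\<close> its
  meaning.\<close>

lemma is_area_area: "is_area (area M)"
proof -
  have "\<exists>!\<mu>. is_area \<mu>" using is_area_exists is_area_unique by blast
  from theI'[OF this] show ?thesis unfolding area_def is_area_def[symmetric] .
qed

lemma space_area[simp]: "space (area M) = pts M"
  and sets_area[simp]: "sets (area M) = area_sets M"
  and emeasure_area_chart: "c \<in> atlas M \<Longrightarrow> S \<in> area_sets M \<Longrightarrow> S \<subseteq> cdom c \<Longrightarrow> emeasure (area M) S = chart_area M c S"
  using is_area_area unfolding is_area_def by auto

lemma null_sets_area_chart:
  assumes c: "c \<in> atlas M" and S: "S \<subseteq> cdom c" "negligible (cmap c ` S)"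
  shows "S \<in> null_sets (area M)"
proof -
  have SA: "S \<in> area_sets M" by (rule area_sets_sub[OF c S(1) negligible_imp_sets[OF S(2)]])
  have "cmap c ` S \<in> null_sets lebesgue" using S(2) negligible_iff_null_sets by blast
  then have "chart_area M c S = 0" unfolding chart_area_def by (rule nn_integral_null_set)
  then show ?thesis using emeasure_area_chart[OF c SA S(1)] SA by (simp add: null_setsI)
qed

text \<open>The density is strictly positive on the chart image, so null sets for the area and for
  Lebesgue measure coincide.\<close>

lemma chart_area_eq_0_iff:
  assumes c: "c \<in> atlas M" and S: "S \<in> area_sets M" "S \<subseteq> cdom c"
  shows "emeasure (area M) S = 0 \<longleftrightarrow> negligible (cmap c ` S)"
proof
  assume "negligible (cmap c ` S)"
  then show "emeasure (area M) S = 0" using null_sets_area_chart[OF c S(2)] by auto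
next
  assume e: "emeasure (area M) S = 0"
  have m: "cmap c ` S \<in> sets lebesgue" using area_setsD(3)[OF S(1) c S(2)] .
  have sub: "cmap c ` S \<subseteq> cdom_image c" using S(2) by blast
  have "(\<lambda>p. ennreal (dens c p)) \<in> borel_measurable (lebesgue_on (cmap c ` S))"
    using continuous_imp_measurable_on_sets_lebesgue[OF continuous_on_subset[OF dens_continuous[OF c] sub] m] by simp
  then have "(\<lambda>p. ennreal (dens c p) * indicator (cmap c ` S) p) \<in> borel_measurable lebesgue"
    using m by (subst borel_measurable_restrict_space_iff_ennreal[symmetric]) auto
  moreover have "(\<integral>\<^sup>+p\<in>cmap c ` S. ennreal (dens c p) \<partial>lebesgue) = 0"
    using e emeasure_area_chart[OF c S] unfolding chart_area_eq_dens by simp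
  ultimately have "AE p in lebesgue. ennreal (dens c p) * indicator (cmap c ` S) p = 0"
    by (simp add: nn_integral_0_iff_AE)
  then have "AE p in lebesgue. p \<notin> cmap c ` S"
  proof eventually_elim
    case (elim p)
    show ?case
    proof
      assume p: "p \<in> cmap c ` S"
      then have "dens c p > 0" using dens_pos[OF c] sub by blast
      then show False using elim p by simp
    qed
  qed
  then have "cmap c ` S \<in> null_sets lebesgue" using m by (simp add: AE_iff_null_sets)
  then show "negligible (cmap c ` S)" by (simp add: negligible_iff_null_sets)
qed

section \<open>Positivity, finiteness and completeness of the area\<close>

text \<open>Even around a boundary point the chart image of the set contains a nonempty open set of
  the plane. This later turns a closed image of full area into the whole target.\<close>

lemma open_area_pos:
  assumes U: "openin (mtop M) U" "U \<noteq> {}"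
  shows "emeasure (area M) U > 0"
proof -
  obtain x where x: "x \<in> U" using U by blast
  then have "x \<in> pts M" using U openin_subset by blast
  then obtain c where c: "c \<in> atlas M" "x \<in> cdom c" using ex_chart by blast
  have UA: "U \<inter> cdom c \<in> area_sets M" using openin_area_sets[OF openin_Int[OF U(1) chart_open[OF c(1)]]] .
  obtain V where V: "open V" "cmap c ` (U \<inter> cdom c) = cdom_image c \<inter> V"
    using cmap_open[OF c(1) U(1)] unfolding openin_open by blast
  have p: "cmap c x \<in> cdom_image c" "cmap c x \<in> V" using x c V by blast+
  obtain W where W: "open W" "W \<noteq> {}" "W \<subseteq> cdom_image c \<inter> V"
    using lipschitz_region_contains_open[OF chart_region[OF c(1)] p(1) V(1) p(2)] .
  have "\<not> negligible (cmap c ` (U \<inter> cdom c))"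
    using open_not_negligible[OF W(1,2)] W(3) negligible_subset unfolding V(2) by blast
  then have "emeasure (area M) (U \<inter> cdom c) \<noteq> 0"
    using chart_area_eq_0_iff[OF c(1) UA] by blast
  moreover have "emeasure (area M) (U \<inter> cdom c) \<le> emeasure (area M) U"
    using openin_area_sets[OF U(1)] by (intro emeasure_mono) auto
  ultimately show ?thesis by (simp add: zero_less_iff_neq_zero) (metis le_zero_eq)
qed

lemma cmap_ball_open:
  assumes "c \<in> atlas M"
  shows "openin (mtop M) {y\<in>cdom c. cmap c y \<in> ball p r}"
  using cmap_vimage_open'[OF assms] by blast

lemma compact_ball:
  assumes c: "c \<in> atlas M" "x \<in> cdom c"
  obtains R where "R > 0" "\<And>r. r < R \<Longrightarrow> compact (cdom_image c \<inter> cball (cmap c x) r)"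
proof -
  have "cmap c x \<in> cdom_image c" using c by blast
  then show ?thesis using lipschitz_region_compact[OF chart_region[OF c(1)]] that by blast
qed

text \<open>The density is bounded on a compact coordinate ball around each point, and compactness
  leaves finitely many such balls.\<close>

lemma finite_area: "emeasure (area M) (pts M) < \<infinity>"
proof -
  have "\<exists>U. openin (mtop M) U \<and> x \<in> U \<and> emeasure (area M) U < \<infinity>" if x: "x \<in> pts M" for x
  proof -
    obtain c where c: "c \<in> atlas M" "x \<in> cdom c" using ex_chart[OF x] by blast
    obtain R where R: "R > 0" "\<And>r. r < R \<Longrightarrow> compact (cdom_image c \<inter> cball (cmap c x) r)"
      using compact_ball[OF c] by blast
    define r where "r = R / 2"
    have r: "r > 0" "compact (cdom_image c \<inter> cball (cmap c x) r)" using R unfolding r_def by auto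
    have "compact (dens c ` (cdom_image c \<inter> cball (cmap c x) r))"
      using r(2) continuous_on_subset[OF dens_continuous[OF c(1)]] compact_continuous_image by blast
    then obtain B where B: "\<And>p. p \<in> cdom_image c \<inter> cball (cmap c x) r \<Longrightarrow> dens c p \<le> B"
      using compact_imp_bounded bounded_imp_bdd_above by (metis bdd_above.unfold image_eqI)
    define U where "U = {y\<in>cdom c. cmap c y \<in> ball (cmap c x) r}"
    have U: "openin (mtop M) U" "x \<in> U" "U \<subseteq> cdom c"
      using cmap_ball_open[OF c(1)] c(2) r(1) unfolding U_def by auto
    have "emeasure (area M) U = chart_area M c U"
      by (rule emeasure_area_chart[OF c(1) openin_area_sets[OF U(1)] U(3)])
    also have "\<dots> \<le> (\<integral>\<^sup>+p. ennreal B * indicator (cball (cmap c x) r) p \<partial>lebesgue)"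
      unfolding chart_area_eq_dens
    proof (rule nn_integral_mono)
      fix p
      show "ennreal (dens c p) * indicator (cmap c ` U) p \<le> ennreal B * indicator (cball (cmap c x) r) p"
      proof (cases "p \<in> cmap c ` U")
        case True
        then have "p \<in> cdom_image c \<inter> cball (cmap c x) r" unfolding U_def by auto
        then show ?thesis using B[of p] True by (simp add: ennreal_leI)
      qed simp
    qed
    also have "\<dots> = ennreal B * emeasure lebesgue (cball (cmap c x) r)"
      by (rule nn_integral_cmult_indicator) simp
    also have "\<dots> < \<infinity>" using emeasure_lborel_cball_finite[of "cmap c x" r]
      by (simp add: ennreal_mult_less_top)
    finally show ?thesis using U by blast
  qed
  then obtain \<U> where U: "finite \<U>" "\<And>U. U \<in> \<U> \<Longrightarrow> openin (mtop M) U \<and> emeasure (area M) U < \<infinity>" "pts M \<subseteq> \<Union>\<U>"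
    using finite_subcover[of "\<lambda>U. emeasure (area M) U < \<infinity>"] by metis
  have "emeasure (area M) (pts M) \<le> emeasure (area M) (\<Union>U\<in>\<U>. U)"
    using U openin_area_sets sets.finite_UN[of \<U> "\<lambda>U. U" "area M"] by (intro emeasure_mono) auto
  also have "\<dots> \<le> (\<Sum>U\<in>\<U>. emeasure (area M) U)"
    using U openin_area_sets by (intro emeasure_subadditive_finite) auto
  also have "\<dots> < \<infinity>" using U by (simp add: less_top)
  finally show ?thesis .
qed

lemma finite_measure_area: "finite_measure (area M)"
  by standard (use finite_area in auto)

lemma total_area_pos: "total_area M > 0"
proof -
  interpret finite_measure "area M" by (rule finite_measure_area)
  have "emeasure (area M) (pts M) > 0"
    using open_area_pos[OF openin_topspace] nonempty by blast
  then show ?thesis unfolding total_area_def by (simp add: emeasure_eq_measure)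
qed

lemma sets_area_open[measurable]: "openin (mtop M) U \<Longrightarrow> U \<in> sets (area M)"
  by (simp add: openin_area_sets)

text \<open>The chart images of \<open>T\<close> are negligible, hence Lebesgue measurable, so
  \<open>T\<close> itself lies in \<open>area_sets\<close>.\<close>

lemma null_area_subset:
  assumes "S \<in> null_sets (area M)" "T \<subseteq> S"
  shows "T \<in> null_sets (area M)"
proof -
  have S: "S \<in> area_sets M" "emeasure (area M) S = 0" using assms(1) by auto
  have neg: "negligible (cmap c ` (T \<inter> cdom c))" if c: "c \<in> atlas M" for c
  proof -
    have SA: "S \<inter> cdom c \<in> area_sets M"
      using S openin_area_sets[OF chart_open[OF c]] sets.Int[of S "area M" "cdom c"] by simp
    have "emeasure (area M) (S \<inter> cdom c) \<le> emeasure (area M) S" using S by (intro emeasure_mono) auto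
    then have "emeasure (area M) (S \<inter> cdom c) = 0" using S by simp
    then have "negligible (cmap c ` (S \<inter> cdom c))" using chart_area_eq_0_iff[OF c SA] by simp
    then show ?thesis by (rule negligible_subset) (use assms(2) in blast)
  qed
  have "T \<subseteq> pts M" using S(1) assms(2) unfolding area_sets_def by blast
  then have "T \<in> area_sets M" unfolding area_sets_def using negligible_imp_sets[OF neg] by simp
  moreover have "emeasure (area M) T \<le> emeasure (area M) S" using assms(2) S by (intro emeasure_mono) auto
  ultimately show ?thesis using S by (auto simp: null_sets_def)
qed

lemma complete_area:
  assumes "AE x in area M. P x"
  shows "{x\<in>pts M. \<not> P x} \<in> null_sets (area M)"
proof -
  obtain S where "{x \<in> space (area M). \<not> P x} \<subseteq> S" "emeasure (area M) S = 0" "S \<in> sets (area M)"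
    using AE_E[OF assms] .
  then show ?thesis using null_area_subset[of S] by (auto simp: null_sets_def)
qed

text \<open>The area restricted to \<open>A\<close> is the image under \<open>cinv c\<close> of a
  weighted Lebesgue measure; the two measures are compared on sets, and integrals follow.\<close>

lemma nn_integral_area_chart:
  assumes c: "c \<in> atlas M" and A: "A \<in> area_sets M" "A \<subseteq> cdom c"
    and g: "g \<in> borel_measurable (area M)"
  shows "(\<integral>\<^sup>+x\<in>A. g x \<partial>area M) = (\<integral>\<^sup>+p\<in>cmap c ` A. g (cinv c p) * ennreal (dens c p) \<partial>lebesgue)"
proof -
  define E where "E = cmap c ` A"
  have E: "E \<in> sets lebesgue" unfolding E_def by (rule area_setsD(3)[OF A(1) c A(2)])
  have Esub: "E \<subseteq> cdom_image c" using A(2) unfolding E_def by blast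
  have AM: "A \<inter> space (area M) \<in> sets (area M)" using A area_setsD(1)[OF A(1) c] by (simp add: inf.absorb1)
  define N1 where "N1 = restrict_space (area M) A"
  have sN1: "space N1 = A" "sets N1 = {B. B \<subseteq> A \<and> B \<in> area_sets M}"
    using A area_setsD(1)[OF A(1) c] unfolding N1_def
    by (auto simp: space_restrict_space sets_restrict_space_iff[OF AM])
  have dm: "(\<lambda>p. ennreal (dens c p)) \<in> borel_measurable (lebesgue_on E)"
    using continuous_imp_measurable_on_sets_lebesgue[OF continuous_on_subset[OF dens_continuous[OF c] Esub] E] by simp
  have cim: "cinv c \<in> measurable (lebesgue_on E) N1"
  proof (rule measurableI)
    fix p assume "p \<in> space (lebesgue_on E)"
    then show "cinv c p \<in> space N1" using cinv_cmap[OF c] A(2) unfolding sN1 E_def by auto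
  next
    fix B assume "B \<in> sets N1"
    then have B: "B \<subseteq> A" "B \<in> area_sets M" unfolding sN1 by auto
    have "cinv c -` B \<inter> space (lebesgue_on E) = cmap c ` B"
      using cinv_cmap[OF c] A(2) B(1) unfolding E_def by force
    moreover have "cmap c ` B \<in> sets lebesgue" using area_setsD(3)[OF B(2) c] B(1) A(2) by blast
    ultimately show "cinv c -` B \<inter> space (lebesgue_on E) \<in> sets (lebesgue_on E)"
      using E B(1) by (auto simp: sets_restrict_space_iff E_def)
  qed
  have N1eq: "N1 = distr (density (lebesgue_on E) (\<lambda>p. ennreal (dens c p))) N1 (cinv c)"
  proof (rule measure_eqI)
    fix B assume BN: "B \<in> sets N1"
    then have B: "B \<subseteq> A" "B \<in> area_sets M" unfolding sN1 by auto
    have img: "cinv c -` B \<inter> E = cmap c ` B"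
      using cinv_cmap[OF c] A(2) B(1) unfolding E_def by force
    have mB: "cmap c ` B \<in> sets lebesgue" using area_setsD(3)[OF B(2) c] B(1) A(2) by blast
    have subB: "cmap c ` B \<subseteq> E" using B(1) unfolding E_def by blast
    have "emeasure (distr (density (lebesgue_on E) (\<lambda>p. ennreal (dens c p))) N1 (cinv c)) B
      = emeasure (density (lebesgue_on E) (\<lambda>p. ennreal (dens c p))) (cmap c ` B)"
      using cim BN img by (subst emeasure_distr) auto
    also have "\<dots> = (\<integral>\<^sup>+p. ennreal (dens c p) * indicator (cmap c ` B) p \<partial>lebesgue_on E)"
      using dm E mB subB by (intro emeasure_density) (auto simp: sets_restrict_space_iff)
    also have "\<dots> = (\<integral>\<^sup>+p. ennreal (dens c p) * indicator (cmap c ` B) p * indicator E p \<partial>lebesgue)"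
      using E by (intro nn_integral_restrict_space) auto
    also have "\<dots> = chart_area M c B"
      unfolding chart_area_eq_dens using subB by (intro nn_integral_cong) (auto split: split_indicator)
    also have "\<dots> = emeasure (area M) B" using emeasure_area_chart[OF c B(2)] B(1) A(2) by auto
    also have "\<dots> = emeasure N1 B" unfolding N1_def using A B area_setsD(1)[OF A(1) c]
      by (subst emeasure_restrict_space) (auto simp: inf.absorb1)
    finally show "emeasure N1 B = emeasure (distr (density (lebesgue_on E) (\<lambda>p. ennreal (dens c p))) N1 (cinv c)) B" by simp
  qed simp
  have gN1: "g \<in> borel_measurable N1" unfolding N1_def using g by (rule measurable_restrict_space1)
  have "(\<integral>\<^sup>+x\<in>A. g x \<partial>area M) = (\<integral>\<^sup>+x. g x \<partial>N1)"
    unfolding N1_def by (rule nn_integral_restrict_space[OF AM, symmetric])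
  also have "\<dots> = (\<integral>\<^sup>+x. g x \<partial>distr (density (lebesgue_on E) (\<lambda>p. ennreal (dens c p))) N1 (cinv c))"
    using N1eq by simp
  also have "\<dots> = (\<integral>\<^sup>+p. g (cinv c p) \<partial>density (lebesgue_on E) (\<lambda>p. ennreal (dens c p)))"
    using cim gN1 by (subst nn_integral_distr) auto
  also have "\<dots> = (\<integral>\<^sup>+p. ennreal (dens c p) * g (cinv c p) \<partial>lebesgue_on E)"
    using dm measurable_compose[OF cim gN1] by (subst nn_integral_density) auto
  also have "\<dots> = (\<integral>\<^sup>+p. ennreal (dens c p) * g (cinv c p) * indicator E p \<partial>lebesgue)"
    using E by (intro nn_integral_restrict_space) auto
  finally show ?thesis unfolding E_def by (simp add: mult.commute)
qed

lemma measurable_area_localI: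
  fixes f :: "'a \<Rightarrow> 'c::topological_space" and I :: "'i set"
  assumes "finite I" and cover: "pts M \<subseteq> (\<Union>i\<in>I. U i)"
    and U: "\<And>i. i \<in> I \<Longrightarrow> c i \<in> atlas M \<and> openin (mtop M) (U i) \<and> U i \<subseteq> cdom (c i)"
    and f: "\<And>i. i \<in> I \<Longrightarrow> (\<lambda>p. f (cinv (c i) p)) \<in> borel_measurable (lebesgue_on (cmap (c i) ` U i))"
  shows "f \<in> borel_measurable (area M)"
proof (rule measurableI)
  fix B :: "'c set" assume B: "B \<in> sets borel"
  have "f -` B \<inter> U i \<in> area_sets M" if i: "i \<in> I" for i
  proof (rule area_sets_sub)
    have Ui: "U i \<subseteq> cdom (c i)" "c i \<in> atlas M" using U[OF i] by auto
    show "c i \<in> atlas M" "f -` B \<inter> U i \<subseteq> cdom (c i)" using Ui by auto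
    have m: "cmap (c i) ` U i \<in> sets lebesgue"
      using area_setsD(3)[OF openin_area_sets Ui(2)] U[OF i] by blast
    have "(\<lambda>p. f (cinv (c i) p)) -` B \<inter> cmap (c i) ` U i \<in> sets (lebesgue_on (cmap (c i) ` U i))"
      using measurable_sets[OF f[OF i] B] by simp
    then have "(\<lambda>p. f (cinv (c i) p)) -` B \<inter> cmap (c i) ` U i \<in> sets lebesgue"
      using m by (auto simp: sets_restrict_space_iff)
    moreover have "(\<lambda>p. f (cinv (c i) p)) -` B \<inter> cmap (c i) ` U i = cmap (c i) ` (f -` B \<inter> U i)"
      using cinv_cmap[OF Ui(2)] Ui(1) by force
    ultimately show "cmap (c i) ` (f -` B \<inter> U i) \<in> sets lebesgue" by simp
  qed
  then have "(\<Union>i\<in>I. f -` B \<inter> U i) \<in> sets (area M)" using assms(1) by (intro sets.finite_UN) auto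
  moreover have "(\<Union>i\<in>I. f -` B \<inter> U i) = f -` B \<inter> space (area M)"
    using cover U cdom_subset by fastforce
  ultimately show "f -` B \<inter> space (area M) \<in> sets (area M)" by simp
qed simp

text \<open>Invariance of domain makes being an interior point independent of the chart. This
  matters because \<open>diff_at\<close> differentiates in whichever chart \<open>chart_at\<close>
  picks.\<close>

lemma interior_transition:
  assumes c: "c \<in> atlas M" and d: "d \<in> atlas M" and x: "x \<in> cdom c" "x \<in> cdom d"
    and int: "cmap c x \<in> interior (cdom_image c)"
  shows "cmap d x \<in> interior (cdom_image d)"
proof -
  let ?f = "cmap d \<circ> cinv c"
  obtain V where V: "open V" "overlap c d = cdom_image c \<inter> V"
    using overlap_open[OF c d] unfolding openin_open by blast
  define W where "W = interior (cdom_image c) \<inter> V"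
  have Wsub: "W \<subseteq> overlap c d" unfolding W_def V(2) using interior_subset by blast
  have "open W" unfolding W_def using V(1) by blast
  have "cmap c x \<in> overlap c d" using x unfolding overlap_def by blast
  then have xW: "cmap c x \<in> W" unfolding W_def using int V(2) by blast
  have cont: "continuous_on W ?f"
    using continuous_on_subset[OF differentiable_imp_continuous_on[OF transition_differentiable_on[OF c d]] Wsub] .
  have inj: "inj_on ?f W"
  proof (rule inj_onI)
    fix p q assume pq: "p \<in> W" "q \<in> W" "?f p = ?f q"
    then have "cinv c p \<in> cdom d" "cinv c q \<in> cdom d" "cmap c (cinv c p) = p" "cmap c (cinv c q) = q"
      using transition_overlap[OF c d] Wsub by blast+
    moreover from this have "cinv c p = cinv c q" using inj_onD[OF inj_cmap[OF d]] pq(3) by simp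
    ultimately show "p = q" by metis
  qed
  have "open (?f ` W)" by (rule invariance_of_domain[OF cont \<open>open W\<close> inj])
  moreover have "?f ` W \<subseteq> cdom_image d" using transition_overlap[OF c d] Wsub by fastforce
  moreover have "cmap d x \<in> ?f ` W" using xW cinv_cmap[OF c x(1)] by (metis comp_apply imageI)
  ultimately show ?thesis using interior_maximal by blast
qed

end

subsection \<open>Curve length and distance\<close>

context riemannian_surface
begin

lemma curve_nhd:
  assumes g: "continuous_map (subtopology euclideanreal {0..1}) (mtop M) \<gamma>" and U: "openin (mtop M) U"
  obtains V where "open V" "{t\<in>{0..1}. \<gamma> t \<in> U} = {0..1} \<inter> V"
proof -
  have "openin (subtopology euclideanreal {0..1}) {t \<in> topspace (subtopology euclideanreal {0..1}). \<gamma> t \<in> U}"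
    by (rule openin_continuous_map_preimage[OF g U])
  then show ?thesis using that unfolding openin_open by auto
qed

text \<open>Chain rule through the transition to the picked chart, combined with metric
  compatibility. The endpoints are excluded because \<open>speed\<close> takes a two-sided
  derivative.\<close>

lemma speed_eq:
  assumes g: "continuous_map (subtopology euclideanreal {0..1}) (mtop M) \<gamma>" and t: "0 < t" "t < 1"
    and c: "c \<in> atlas M" "\<gamma> t \<in> cdom c" and w: "((cmap c \<circ> \<gamma>) has_vector_derivative w) (at t)"
  shows "speed M \<gamma> t = sqrt (w \<bullet> (gmat M c (\<gamma> t) *v w))"
proof -
  let ?x = "\<gamma> t"
  let ?e = "chart_at M ?x"
  let ?T = "transition_deriv c ?e ?x"
  have xM: "?x \<in> pts M" using c cdom_subset by blast
  have e: "?e \<in> atlas M" "?x \<in> cdom ?e" using chart_at[OF xM] by auto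
  obtain V where V: "open V" "{s\<in>{0..1}. \<gamma> s \<in> cdom c \<inter> cdom ?e} = {0..1} \<inter> V"
    using curve_nhd[OF g openin_Int[OF chart_open[OF c(1)] chart_open[OF e(1)]]] .
  define U where "U = V \<inter> {0<..<1}"
  have "t \<in> {s\<in>{0..1}. \<gamma> s \<in> cdom c \<inter> cdom ?e}" using t c e by simp
  then have "t \<in> V" unfolding V(2) by blast
  then have U: "open U" "t \<in> U" unfolding U_def using V(1) t by auto
  have U3: "\<gamma> s \<in> cdom c \<inter> cdom ?e" if "s \<in> U" for s
  proof -
    have "s \<in> {0..1} \<inter> V" using that unfolding U_def by auto
    then show ?thesis unfolding V(2)[symmetric] by blast
  qed
  have img: "(cmap c \<circ> \<gamma>) ` U \<subseteq> overlap c ?e" using U3 unfolding overlap_def by auto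
  have T: "((cmap ?e \<circ> cinv c) has_derivative (*v) ?T) (at ((cmap c \<circ> \<gamma>) t) within overlap c ?e)"
    using transition_has_derivative[OF c(1) e(1)] c(2) e(2) by simp
  have w': "((cmap c \<circ> \<gamma>) has_derivative (\<lambda>h. h *\<^sub>R w)) (at t within U)"
    using w unfolding has_vector_derivative_def by (rule has_derivative_at_withinI)
  have "((cmap ?e \<circ> cinv c) \<circ> (cmap c \<circ> \<gamma>) has_derivative (*v) ?T \<circ> (\<lambda>h. h *\<^sub>R w)) (at t within U)"
    by (rule diff_chain_within[OF w' has_derivative_subset[OF T img]])
  then have "((cmap ?e \<circ> cinv c) \<circ> (cmap c \<circ> \<gamma>) has_derivative (*v) ?T \<circ> (\<lambda>h. h *\<^sub>R w)) (at t)"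
    using at_within_open[OF U(2,1)] by simp
  then have "(cmap ?e \<circ> \<gamma> has_derivative (*v) ?T \<circ> (\<lambda>h. h *\<^sub>R w)) (at t)"
  proof (rule has_derivative_transform_within_open[OF _ U(1,2)])
    show "((cmap ?e \<circ> cinv c) \<circ> (cmap c \<circ> \<gamma>)) s = (cmap ?e \<circ> \<gamma>) s" if "s \<in> U" for s
      using U3[OF that] cinv_cmap[OF c(1)] by simp
  qed
  then have "(cmap ?e \<circ> \<gamma> has_vector_derivative ?T *v w) (at t)"
    unfolding has_vector_derivative_def by (simp add: comp_def matrix_vector_mult_scaleR)
  then have "vector_derivative (cmap ?e \<circ> \<gamma>) (at t) = ?T *v w" by (rule vector_derivative_at)
  then have "speed M \<gamma> t = sqrt ((?T *v w) \<bullet> (gmat M ?e ?x *v (?T *v w)))"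
    unfolding speed_def Let_def gmat_at_def by simp
  also have "(?T *v w) \<bullet> (gmat M ?e ?x *v (?T *v w)) = w \<bullet> ((transpose ?T ** gmat M ?e ?x ** ?T) *v w)"
    using gram_inner_mult[of "gmat M ?e ?x" ?T w w] by (simp add: gram_inner_def)
  also have "transpose ?T ** gmat M ?e ?x ** ?T = gmat M c ?x"
    using metric_compat[OF c(1) e(1)] c e by simp
  finally show ?thesis .
qed

text \<open>The form attains a positive minimum and a maximum on \<open>C\<close> times the unit
  circle; homogeneity extends the bounds to all vectors.\<close>

lemma metric_bounds:
  assumes c: "c \<in> atlas M" and C: "compact C" "C \<subseteq> cdom_image c"
  obtains m B where "m > 0" "B > 0"
    "\<And>p v. p \<in> C \<Longrightarrow> m * norm v \<le> sqrt (v \<bullet> (gmat M c (cinv c p) *v v))"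
    "\<And>p v. p \<in> C \<Longrightarrow> sqrt (v \<bullet> (gmat M c (cinv c p) *v v)) \<le> B * norm v"
proof -
  define q where "q p v = v \<bullet> (gmat M c (cinv c p) *v v)" for p and v :: "real^2"
  have K: "compact (C \<times> (sphere 0 1 :: (real^2) set))" using C by (intro compact_Times) auto
  have "continuous_on (C \<times> sphere 0 1) (\<lambda>z. gmat M c (cinv c (fst z)))"
    by (rule continuous_on_compose2[OF gmat_continuous[OF c] continuous_on_fst[OF continuous_on_id]]) (use C in auto)
  then have cont: "continuous_on (C \<times> sphere 0 1) (\<lambda>z. q (fst z) (snd z))"
    unfolding q_def inner_vec_def matrix_vector_mult_def sum_2 by (simp add: sum_2) (intro continuous_intros)
  have qpos: "0 < q p v" if "p \<in> C" "v \<noteq> 0" for p v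
    unfolding q_def using spd_gmat[OF c cinv_cdom[of p c]] C that unfolding spd_def by blast
  have scale: "q p v = (norm v)\<^sup>2 * q p (v /\<^sub>R norm v)" if "v \<noteq> 0" for p v
  proof -
    have "q p (inverse (norm v) *\<^sub>R v) = (inverse (norm v))\<^sup>2 * q p v"
      unfolding q_def by (simp add: matrix_vector_mult_scaleR power2_eq_square)
    moreover have "(norm v)\<^sup>2 * (inverse (norm v))\<^sup>2 = 1" using that by (simp flip: power_mult_distrib)
    ultimately show ?thesis by (metis mult.assoc mult_1)
  qed
  show ?thesis
  proof (cases "C = {}")
    case True
    then show ?thesis using that[of 1 1] by simp
  next
    case False
    have ne: "C \<times> (sphere 0 1 :: (real^2) set) \<noteq> {}" using False by auto
    obtain z where z: "z \<in> C \<times> sphere 0 1" "\<And>y. y \<in> C \<times> sphere 0 1 \<Longrightarrow> q (fst z) (snd z) \<le> q (fst y) (snd y)"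
      using continuous_attains_inf[OF K ne cont] by blast
    obtain z' where z': "z' \<in> C \<times> sphere 0 1" "\<And>y. y \<in> C \<times> sphere 0 1 \<Longrightarrow> q (fst y) (snd y) \<le> q (fst z') (snd z')"
      using continuous_attains_sup[OF K ne cont] by blast
    define a b where "a = q (fst z) (snd z)" and "b = q (fst z') (snd z')"
    have sn: "snd z \<noteq> 0" using z(1) by auto
    have a: "a > 0" unfolding a_def using qpos z(1) sn by auto
    have b: "b > 0" using z'(2)[OF z(1)] a unfolding a_def b_def by linarith
    have bounds: "a * (norm v)\<^sup>2 \<le> q p v \<and> q p v \<le> b * (norm v)\<^sup>2" if p: "p \<in> C" for p v
    proof (cases "v = 0")
      case True then show ?thesis by (simp add: q_def)
    next
      case False
      have mem: "(p, v /\<^sub>R norm v) \<in> C \<times> sphere 0 1" using p False by simp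
      have "a \<le> q p (v /\<^sub>R norm v)" "q p (v /\<^sub>R norm v) \<le> b" using z(2)[OF mem] z'(2)[OF mem] by (auto simp: a_def b_def)
      then have "(norm v)\<^sup>2 * a \<le> (norm v)\<^sup>2 * q p (v /\<^sub>R norm v)" "(norm v)\<^sup>2 * q p (v /\<^sub>R norm v) \<le> (norm v)\<^sup>2 * b"
        by (simp_all add: mult_left_mono)
      then show ?thesis by (simp only: scale[OF False, symmetric] mult.commute)
    qed
    show ?thesis
    proof (rule that[of "sqrt a" "sqrt b"])
      show "sqrt a > 0" "sqrt b > 0" using a b by simp_all
      fix p v assume p: "p \<in> C"
      have "sqrt (a * (norm v)\<^sup>2) \<le> sqrt (q p v)" "sqrt (q p v) \<le> sqrt (b * (norm v)\<^sup>2)"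
        using bounds[OF p, of v] by simp_all
      then show "sqrt a * norm v \<le> sqrt (v \<bullet> (gmat M c (cinv c p) *v v))"
        "sqrt (v \<bullet> (gmat M c (cinv c p) *v v)) \<le> sqrt b * norm v"
        by (simp_all add: real_sqrt_mult q_def)
    qed
  qed
qed

section \<open>Comparison of the Riemannian distance with coordinates\<close>

text \<open>Between breakpoints the fundamental theorem of calculus bounds the coordinate
  displacement by the integral of the coordinate speed; the triangle inequality joins the pieces, by
  induction on the number of breakpoints inside the interval.\<close>

lemma curve_length_lower:
  assumes \<gamma>: "piecewise_C1_curve M \<gamma>" and c: "c \<in> atlas M" and T: "0 \<le> T" "T \<le> 1"
    and dom: "\<And>t. 0 \<le> t \<Longrightarrow> t \<le> T \<Longrightarrow> \<gamma> t \<in> cdom c" and m: "m \<ge> 0"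
    and low: "\<And>t v. 0 \<le> t \<Longrightarrow> t \<le> T \<Longrightarrow> m * norm v \<le> sqrt (v \<bullet> (gmat M c (\<gamma> t) *v v))"
  shows "ennreal (m * norm (cmap c (\<gamma> T) - cmap c (\<gamma> 0))) \<le> curve_length M \<gamma>"
proof -
  have g: "continuous_map (subtopology euclideanreal {0..1}) (mtop M) \<gamma>"
    using \<gamma> unfolding piecewise_C1_curve_def by blast
  obtain S where S0: "finite S"
    "\<forall>a b. 0 \<le> a \<and> a < b \<and> b \<le> 1 \<and> S \<inter> {a<..<b} = {} \<longrightarrow>
         (\<forall>c\<in>atlas M. \<exists>D. continuous_on {t\<in>{a..b}. \<gamma> t \<in> cdom c} D \<and>
            (\<forall>t\<in>{a..b}. \<gamma> t \<in> cdom c \<longrightarrow> (cmap c \<circ> \<gamma> has_vector_derivative D t) (at t within {a..b})))"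
    using \<gamma> unfolding piecewise_C1_curve_def by (elim conjE exE) (rule that)
  have S: "finite S"
    "\<And>a b. 0 \<le> a \<Longrightarrow> a < b \<Longrightarrow> b \<le> 1 \<Longrightarrow> S \<inter> {a<..<b} = {} \<Longrightarrow>
         \<exists>D. continuous_on {t\<in>{a..b}. \<gamma> t \<in> cdom c} D \<and>
            (\<forall>t\<in>{a..b}. \<gamma> t \<in> cdom c \<longrightarrow> (cmap c \<circ> \<gamma> has_vector_derivative D t) (at t within {a..b}))"
    using S0 c by simp_all
  \<comment> \<open>Measurability of \<open>speed\<close> is not established, so the induction
    carries a measurable minorant \<open>h\<close>; breakpoints and endpoints are exempt, being
    null.\<close>
  have main: "\<exists>h\<in>borel_measurable lborel. (\<forall>t. t \<notin> S \<union> {a,b} \<longrightarrow> h t \<le> ennreal (speed M \<gamma> t) * indicator {a..b} t) \<and>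
      ennreal (m * norm (cmap c (\<gamma> b) - cmap c (\<gamma> a))) \<le> (\<integral>\<^sup>+t. h t \<partial>lborel)"
    if "0 \<le> a" "a \<le> b" "b \<le> T" "card (S \<inter> {a<..<b}) = n" for a b n
    using that
  proof (induction n arbitrary: a b rule: less_induct)
    case (less n a b)
    consider "a = b" | "a < b" "S \<inter> {a<..<b} = {}" | s where "s \<in> S" "a < s" "s < b"
      using less.prems by force
    then show ?case
    proof cases
      case 1
      then show ?thesis by (intro bexI[of _ "\<lambda>_. 0"]) auto
    next
      case 2
      obtain D where D: "continuous_on {t\<in>{a..b}. \<gamma> t \<in> cdom c} D"
        "\<forall>t\<in>{a..b}. \<gamma> t \<in> cdom c \<longrightarrow> (cmap c \<circ> \<gamma> has_vector_derivative D t) (at t within {a..b})"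
        using S(2)[of a b] 2 less.prems T by auto
      have all: "{t\<in>{a..b}. \<gamma> t \<in> cdom c} = {a..b}" using dom less.prems by auto
      have Dc: "continuous_on {a..b} D" using D(1) all by simp
      have Dd: "(cmap c \<circ> \<gamma> has_vector_derivative D t) (at t within {a..b})" if "t \<in> {a..b}" for t
        using D(2) that dom less.prems by auto
      have "(D has_integral ((cmap c \<circ> \<gamma>) b - (cmap c \<circ> \<gamma>) a)) {a..b}"
        by (rule fundamental_theorem_of_calculus[OF less.prems(2) Dd])
      then have int: "integral {a..b} D = cmap c (\<gamma> b) - cmap c (\<gamma> a)" "D integrable_on {a..b}"
        by (auto simp: integral_unique)
      have nDc: "continuous_on {a..b} (\<lambda>t. m * norm (D t))" by (intro continuous_intros Dc)
      have ai: "(\<lambda>t. m * norm (D t)) absolutely_integrable_on {a..b}"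
        using absolutely_integrable_continuous[where a=a and b=b and f="\<lambda>t. m * norm (D t)"] nDc by simp
      have nint: "(\<lambda>t. norm (D t)) integrable_on {a..b}"
        by (intro integrable_continuous_interval continuous_intros Dc)
      have "norm (integral {a..b} D) \<le> integral {a..b} (\<lambda>t. norm (D t))"
        by (rule integral_norm_bound_integral[OF int(2) nint]) simp
      then have "m * norm (cmap c (\<gamma> b) - cmap c (\<gamma> a)) \<le> integral {a..b} (\<lambda>t. m * norm (D t))"
        using m int(1) by (simp add: mult_left_mono)
      then have le: "ennreal (m * norm (cmap c (\<gamma> b) - cmap c (\<gamma> a))) \<le> (\<integral>\<^sup>+t\<in>{a..b}. ennreal (m * norm (D t)) \<partial>lborel)"
        using nn_set_integral_eq_integral[OF ai] m by (simp add: nn_integral_completion ennreal_leI)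
      have meas: "(\<lambda>t. ennreal (m * norm (D t)) * indicator {a..b} t) \<in> borel_measurable lborel"
      proof -
        have "(\<lambda>t. m * norm (D t)) \<in> borel_measurable (restrict_space borel {a..b})"
          using nDc by (rule borel_measurable_continuous_on_restrict)
        then have "(\<lambda>t. ennreal (m * norm (D t))) \<in> borel_measurable (restrict_space borel {a..b})" by simp
        then show ?thesis by (subst (asm) borel_measurable_restrict_space_iff_ennreal) auto
      qed
      show ?thesis
      proof (intro bexI[OF _ meas] conjI allI impI le)
        fix t assume t: "t \<notin> S \<union> {a,b}"
        show "ennreal (m * norm (D t)) * indicator {a..b} t \<le> ennreal (speed M \<gamma> t) * indicator {a..b} t"
        proof (cases "t \<in> {a..b}")
          case True
          then have tt: "a < t" "t < b" using t by auto
          have "(cmap c \<circ> \<gamma> has_vector_derivative D t) (at t)"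
            using Dd[OF True] tt by (simp add: at_within_Icc_at)
          then have "speed M \<gamma> t = sqrt (D t \<bullet> (gmat M c (\<gamma> t) *v D t))"
            using tt less.prems T dom[of t] by (intro speed_eq[OF g _ _ c]) auto
          then show ?thesis using low[of t "D t"] tt less.prems True by (simp add: ennreal_leI)
        qed simp
      qed
    next
      case 3
      have fin: "finite (S \<inter> {a<..<b})" using S(1) by simp
      have l1: "card (S \<inter> {a<..<s}) < n" "card (S \<inter> {s<..<b}) < n"
      proof -
        have sb: "s \<in> S \<inter> {a<..<b}" using 3 by simp
        have "S \<inter> {a<..<s} \<subseteq> S \<inter> {a<..<b}" "S \<inter> {s<..<b} \<subseteq> S \<inter> {a<..<b}" using 3 by auto
        then have "S \<inter> {a<..<s} \<subset> S \<inter> {a<..<b}" "S \<inter> {s<..<b} \<subset> S \<inter> {a<..<b}" using sb by auto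
        then show "card (S \<inter> {a<..<s}) < n" "card (S \<inter> {s<..<b}) < n"
          unfolding less.prems(4)[symmetric] by (simp_all add: psubset_card_mono[OF fin])
      qed
      obtain h1 where h1[measurable]: "h1 \<in> borel_measurable lborel"
        and h1': "\<forall>t. t \<notin> S \<union> {a,s} \<longrightarrow> h1 t \<le> ennreal (speed M \<gamma> t) * indicator {a..s} t"
        "ennreal (m * norm (cmap c (\<gamma> s) - cmap c (\<gamma> a))) \<le> (\<integral>\<^sup>+t. h1 t \<partial>lborel)"
        using less.IH[OF l1(1), of a s] less.prems 3 by auto
      obtain h2 where h2[measurable]: "h2 \<in> borel_measurable lborel"
        and h2': "\<forall>t. t \<notin> S \<union> {s,b} \<longrightarrow> h2 t \<le> ennreal (speed M \<gamma> t) * indicator {s..b} t"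
        "ennreal (m * norm (cmap c (\<gamma> b) - cmap c (\<gamma> s))) \<le> (\<integral>\<^sup>+t. h2 t \<partial>lborel)"
        using less.IH[OF l1(2), of s b] less.prems 3 by auto
      show ?thesis
      proof (intro bexI[of _ "\<lambda>t. h1 t + h2 t"] conjI allI impI)
        show "(\<lambda>t. h1 t + h2 t) \<in> borel_measurable lborel" by measurable
        fix t assume t: "t \<notin> S \<union> {a,b}"
        then have ts: "t \<noteq> s" using 3 by auto
        have "h1 t + h2 t \<le> ennreal (speed M \<gamma> t) * indicator {a..s} t + ennreal (speed M \<gamma> t) * indicator {s..b} t"
          using h1'(1) h2'(1) t ts by (intro add_mono) auto
        also have "\<dots> = ennreal (speed M \<gamma> t) * indicator {a..b} t"
          using ts 3 by (auto simp: indicator_def)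
        finally show "h1 t + h2 t \<le> ennreal (speed M \<gamma> t) * indicator {a..b} t" .
      next
        have "norm (cmap c (\<gamma> b) - cmap c (\<gamma> a)) \<le> norm (cmap c (\<gamma> s) - cmap c (\<gamma> a)) + norm (cmap c (\<gamma> b) - cmap c (\<gamma> s))"
          using norm_triangle_ineq[of "cmap c (\<gamma> s) - cmap c (\<gamma> a)" "cmap c (\<gamma> b) - cmap c (\<gamma> s)"] by simp
        then have "m * norm (cmap c (\<gamma> b) - cmap c (\<gamma> a)) \<le> m * norm (cmap c (\<gamma> s) - cmap c (\<gamma> a)) + m * norm (cmap c (\<gamma> b) - cmap c (\<gamma> s))"
          using m by (metis distrib_left mult_left_mono)
        then have "ennreal (m * norm (cmap c (\<gamma> b) - cmap c (\<gamma> a))) \<le>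
          ennreal (m * norm (cmap c (\<gamma> s) - cmap c (\<gamma> a))) + ennreal (m * norm (cmap c (\<gamma> b) - cmap c (\<gamma> s)))"
          using m by (simp add: ennreal_leI flip: ennreal_plus)
        also have "\<dots> \<le> (\<integral>\<^sup>+t. h1 t \<partial>lborel) + (\<integral>\<^sup>+t. h2 t \<partial>lborel)" by (intro add_mono h1' h2')
        also have "\<dots> = (\<integral>\<^sup>+t. h1 t + h2 t \<partial>lborel)" by (rule nn_integral_add[symmetric, OF h1 h2])
        finally show "ennreal (m * norm (cmap c (\<gamma> b) - cmap c (\<gamma> a))) \<le> (\<integral>\<^sup>+t. h1 t + h2 t \<partial>lborel)" .
      qed
    qed
  qed
  obtain h where h: "h \<in> borel_measurable lborel"
    "\<forall>t. t \<notin> S \<union> {0,T} \<longrightarrow> h t \<le> ennreal (speed M \<gamma> t) * indicator {0..T} t"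
    "ennreal (m * norm (cmap c (\<gamma> T) - cmap c (\<gamma> 0))) \<le> (\<integral>\<^sup>+t. h t \<partial>lborel)"
    using main[of 0 T "card (S \<inter> {0<..<T})"] T by auto
  have "AE t in lborel. t \<notin> S \<union> {0,T}"
    using S(1) by (intro AE_not_in finite_imp_null_set_lborel) auto
  then have "(\<integral>\<^sup>+t. h t \<partial>lborel) \<le> (\<integral>\<^sup>+t. ennreal (speed M \<gamma> t) * indicator {0..1} t \<partial>lborel)"
  proof (rule nn_integral_mono_AE[OF eventually_mono])
    fix t assume "t \<notin> S \<union> {0,T}"
    then have "h t \<le> ennreal (speed M \<gamma> t) * indicator {0..T} t" using h(2) by blast
    also have "\<dots> \<le> ennreal (speed M \<gamma> t) * indicator {0..1} t" using T by (intro mult_left_mono) (auto simp: indicator_def)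
    finally show "h t \<le> ennreal (speed M \<gamma> t) * indicator {0..1} t" .
  qed
  then show ?thesis using h(3) unfolding curve_length_def by (rule order_trans[rotated])
qed

text \<open>A curve that starts in the half ball and leaves the ball of radius \<open>r\<close> has
  length at least \<open>m * r / 2\<close>. A shorter curve stays in the chart, where its length
  dominates \<open>m\<close> times the coordinate displacement.\<close>

lemma rdist_lower:
  assumes c: "c \<in> atlas M" "x \<in> cdom c"
  obtains r m where "r > 0" "m > 0" "\<And>y z. y \<in> cdom c \<Longrightarrow> dist (cmap c y) (cmap c x) < r / 2 \<Longrightarrow>
    rdist M y z < ennreal (m * r / 2) \<Longrightarrow>
    z \<in> cdom c \<and> dist (cmap c z) (cmap c x) < r \<and> ennreal (m * norm (cmap c z - cmap c y)) \<le> rdist M y z"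
proof -
  obtain R where R: "R > 0" "\<And>r. r < R \<Longrightarrow> compact (cdom_image c \<inter> cball (cmap c x) r)"
    using compact_ball[OF c] by blast
  define r where "r = R / 2"
  define C where "C = cdom_image c \<inter> cball (cmap c x) r"
  have r: "r > 0" and C: "compact C" "C \<subseteq> cdom_image c" using R unfolding r_def C_def by auto
  obtain m B where m: "m > 0" "\<And>p v. p \<in> C \<Longrightarrow> m * norm v \<le> sqrt (v \<bullet> (gmat M c (cinv c p) *v v))"
    using metric_bounds[OF c(1) C] by metis
  define U where "U = {y\<in>cdom c. cmap c y \<in> ball (cmap c x) r}"
  define A where "A = {y\<in>cdom c. cmap c y \<in> cball (cmap c x) r}"
  have U: "openin (mtop M) U" unfolding U_def by (rule cmap_ball_open[OF c(1)])
  \<comment> \<open>Compact in a Hausdorff space, hence closed in the whole surface: a curve cannot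
    leave the chart without first meeting the coordinate sphere.\<close>
  have A: "closedin (mtop M) A"
  proof -
    have hm: "homeomorphic_map (subtopology (mtop M) (cdom c)) (top_of_set (cdom_image c)) (cmap c)"
      using chart_homeo[OF c(1)] .
    have "cmap c ` A = C" unfolding A_def C_def by auto
    moreover have "A \<subseteq> topspace (subtopology (mtop M) (cdom c))" unfolding topspace_cdom[OF c(1)] A_def by blast
    moreover have "compactin (top_of_set (cdom_image c)) C" using C by (simp add: compactin_subtopology)
    ultimately have "compactin (subtopology (mtop M) (cdom c)) A"
      using homeomorphic_map_compactness[OF hm] by metis
    then have "compactin (mtop M) A" by (simp add: compactin_subtopology)
    then show ?thesis using compactin_imp_closedin[OF hausdorff] by blast
  qed
  have mA: "m * norm v \<le> sqrt (v \<bullet> (gmat M c u *v v))" if "u \<in> A" for u v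
  proof -
    have "cmap c u \<in> C" "cinv c (cmap c u) = u" using that cinv_cmap[OF c(1)] unfolding A_def C_def by auto
    then show ?thesis using m(2)[of "cmap c u" v] by simp
  qed
  have curve: "\<gamma> 1 \<in> U \<and> ennreal (m * norm (cmap c (\<gamma> 1) - cmap c (\<gamma> 0))) \<le> curve_length M \<gamma>"
    if \<gamma>: "piecewise_C1_curve M \<gamma>" and y: "\<gamma> 0 \<in> cdom c" "dist (cmap c (\<gamma> 0)) (cmap c x) < r / 2"
      and len: "curve_length M \<gamma> < ennreal (m * r / 2)" for \<gamma>
  proof -
    have g: "continuous_map (subtopology euclideanreal {0..1}) (mtop M) \<gamma>"
      using \<gamma> unfolding piecewise_C1_curve_def by blast
    have gA: "closed {t\<in>{0..1}. \<gamma> t \<in> A}"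
    proof -
      have "closedin (subtopology euclideanreal {0..1}) {t \<in> topspace (subtopology euclideanreal {0..1}). \<gamma> t \<in> A}"
        by (rule closedin_continuous_map_preimage[OF g A])
      then show ?thesis by (auto intro: closedin_closed_trans)
    qed
    have UA: "U \<subseteq> A" unfolding U_def A_def by auto
    have all: "\<gamma> t \<in> U" if "t \<in> {0..1}" for t
    proof (rule ccontr)
      assume bad: "\<gamma> t \<notin> U"
      obtain V where V: "open V" "{t\<in>{0..1}. \<gamma> t \<in> U} = {0..1} \<inter> V" using curve_nhd[OF g U] .
      define X where "X = {0..1} - V"
      have X: "closed X" "X \<noteq> {}" "bdd_below X"
      proof -
        show "closed X" unfolding X_def using V(1) by (simp add: closed_Diff)
        have "t \<notin> {0..1} \<inter> V" unfolding V(2)[symmetric] using bad by simp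
        then show "X \<noteq> {}" using \<open>t \<in> {0..1}\<close> unfolding X_def by blast
        show "bdd_below X" unfolding X_def by (rule bdd_belowI[of _ 0]) auto
      qed
      \<comment> \<open>The first exit time from \<open>U\<close>. By closedness of \<open>A\<close>
        the curve is still in the chart at that time, at distance exactly \<open>r\<close>.\<close>
      define T where "T = Inf X"
      have TX: "T \<in> X" unfolding T_def by (rule closed_contains_Inf[OF X(2,3,1)])
      then have T01: "0 \<le> T" "T \<le> 1" "\<gamma> T \<notin> U" using V(2) unfolding X_def by auto
      have before: "\<gamma> s \<in> U" if s: "0 \<le> s" "s < T" for s
      proof -
        have "s \<notin> X" using cInf_lower[OF _ X(3), of s] s(2) unfolding T_def by auto
        then have "s \<in> {0..1} \<inter> V" using s T01 unfolding X_def by auto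
        then show ?thesis using V(2) by blast
      qed
      have "\<gamma> 0 \<in> U" using y r unfolding U_def by (simp add: dist_commute)
      then have T0: "0 < T" using T01 by (metis less_eq_real_def)
      have "T \<in> closure {0..<T}" using T0 by simp
      moreover have "closure {0..<T} \<subseteq> {t\<in>{0..1}. \<gamma> t \<in> A}"
        using before UA T01 by (intro closure_minimal[OF _ gA]) auto
      ultimately have TA: "\<gamma> T \<in> A" by blast
      have onA: "\<gamma> s \<in> A" if "0 \<le> s" "s \<le> T" for s
        using before[of s] UA TA that by (cases "s = T") auto
      have "dist (cmap c (\<gamma> T)) (cmap c x) = r" using TA T01(3) unfolding A_def U_def by (auto simp: dist_commute)
      then have far: "r / 2 \<le> norm (cmap c (\<gamma> T) - cmap c (\<gamma> 0))"
        using y(2) dist_triangle[of "cmap c (\<gamma> T)" "cmap c x" "cmap c (\<gamma> 0)"] by (simp add: dist_norm)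
      have "ennreal (m * (r / 2)) \<le> ennreal (m * norm (cmap c (\<gamma> T) - cmap c (\<gamma> 0)))"
        using far m(1) by (intro ennreal_leI mult_left_mono) auto
      also have "\<dots> \<le> curve_length M \<gamma>"
      proof (rule curve_length_lower[OF \<gamma> c(1) T01(1,2)])
        show "\<gamma> t \<in> cdom c" if "0 \<le> t" "t \<le> T" for t using onA[OF that] unfolding A_def by blast
        show "m * norm v \<le> sqrt (v \<bullet> (gmat M c (\<gamma> t) *v v))" if "0 \<le> t" "t \<le> T" for t v
          using mA onA[OF that] by blast
      qed (use m in simp)
      finally show False using len by simp
    qed
    have "ennreal (m * norm (cmap c (\<gamma> 1) - cmap c (\<gamma> 0))) \<le> curve_length M \<gamma>"
    proof (rule curve_length_lower[OF \<gamma> c(1)])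
      show "\<gamma> t \<in> cdom c" if "0 \<le> t" "t \<le> 1" for t using all[of t] that unfolding U_def by auto
      show "m * norm v \<le> sqrt (v \<bullet> (gmat M c (\<gamma> t) *v v))" if "0 \<le> t" "t \<le> 1" for t v
        using mA all[of t] UA that by auto
    qed (use m in auto)
    then show ?thesis using all[of 1] by simp
  qed
  show ?thesis
  proof (rule that[OF r m(1)])
    fix y z assume y: "y \<in> cdom c" "dist (cmap c y) (cmap c x) < r / 2" and d: "rdist M y z < ennreal (m * r / 2)"
    have ex: "\<exists>\<gamma>. piecewise_C1_curve M \<gamma> \<and> \<gamma> 0 = y \<and> \<gamma> 1 = z \<and> curve_length M \<gamma> < b" if "rdist M y z < b" for b
      using that unfolding rdist_def INF_less_iff by blast
    obtain \<gamma> where \<gamma>: "piecewise_C1_curve M \<gamma>" "\<gamma> 0 = y" "\<gamma> 1 = z" "curve_length M \<gamma> < ennreal (m * r / 2)"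
      using ex[OF d] by blast
    have zU: "z \<in> U" using curve[OF \<gamma>(1)] \<gamma> y by simp
    have "ennreal (m * norm (cmap c z - cmap c y)) \<le> rdist M y z"
    proof (rule ccontr)
      assume "\<not> ?thesis"
      \<comment> \<open>One curve below both bounds: short enough to stay in the chart, and too
        short for its displacement.\<close>
      then have "rdist M y z < min (ennreal (m * r / 2)) (ennreal (m * norm (cmap c z - cmap c y)))" using d by simp
      then obtain \<gamma> where \<gamma>: "piecewise_C1_curve M \<gamma>" "\<gamma> 0 = y" "\<gamma> 1 = z"
        "curve_length M \<gamma> < min (ennreal (m * r / 2)) (ennreal (m * norm (cmap c z - cmap c y)))"
        using ex by blast
      then have "ennreal (m * norm (cmap c z - cmap c y)) \<le> curve_length M \<gamma>" using curve[OF \<gamma>(1)] y by simp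
      then show False using \<gamma>(4) min_less_iff_conj leD by blast
    qed
    then show "z \<in> cdom c \<and> dist (cmap c z) (cmap c x) < r \<and> ennreal (m * norm (cmap c z - cmap c y)) \<le> rdist M y z"
      using zU unfolding U_def by (simp add: dist_commute)
  qed
qed

text \<open>The curve runs along the coordinate segment. Its length is immediate; the effort goes
  into showing that it is continuously differentiable in every chart, which uses local smooth
  extensions of the transition maps.\<close>

lemma rdist_segment_upper:
  assumes c: "c \<in> atlas M" and seg: "closed_segment p q \<subseteq> cdom_image c"
    and up: "\<And>z v. z \<in> closed_segment p q \<Longrightarrow> sqrt (v \<bullet> (gmat M c (cinv c z) *v v)) \<le> B * norm v"
  shows "rdist M (cinv c p) (cinv c q) \<le> ennreal (B * norm (q - p))"
proof -
  define l where "l t = p + t *\<^sub>R (q - p)" for t :: real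
  define \<gamma> where "\<gamma> t = cinv c (l t)" for t
  have lseg: "l t \<in> closed_segment p q" if "t \<in> {0..1}" for t
    unfolding closed_segment_def l_def using that by (auto simp: algebra_simps intro!: exI[of _ t])
  have lim: "l t \<in> cdom_image c" if "t \<in> {0..1}" for t using lseg[OF that] seg by blast
  have g\<gamma>: "\<gamma> t \<in> cdom c" "cmap c (\<gamma> t) = l t" if "t \<in> {0..1}" for t
    unfolding \<gamma>_def using cinv_cdom[OF lim[OF that]] cmap_cinv[OF lim[OF that]] by auto
  have lc: "continuous_on UNIV l" unfolding l_def by (intro continuous_intros)
  have ld: "(l has_vector_derivative (q - p)) (at t within S)" for t S
    unfolding l_def by (auto intro!: derivative_eq_intros)
  have cont: "continuous_map (subtopology euclideanreal {0..1}) (mtop M) \<gamma>"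
    unfolding continuous_map_def
  proof (intro conjI allI impI)
    show "\<gamma> \<in> topspace (subtopology euclideanreal {0..1}) \<rightarrow> topspace (mtop M)"
      using g\<gamma>(1) cdom_subset[OF c] by auto
    fix U assume U: "openin (mtop M) U"
    obtain V where V: "open V" "cmap c ` (U \<inter> cdom c) = cdom_image c \<inter> V"
      using cmap_open[OF c U] unfolding openin_open by blast
    have "{t \<in> topspace (subtopology euclideanreal {0..1}). \<gamma> t \<in> U} = {0..1} \<inter> l -` V"
    proof (intro set_eqI iffI)
      fix t assume "t \<in> {t \<in> topspace (subtopology euclideanreal {0..1}). \<gamma> t \<in> U}"
      then have t: "t \<in> {0..1}" "\<gamma> t \<in> U" by auto
      then have "cmap c (\<gamma> t) \<in> cmap c ` (U \<inter> cdom c)" using g\<gamma> by blast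
      then show "t \<in> {0..1} \<inter> l -` V" using t V(2) g\<gamma>(2)[OF t(1)] by auto
    next
      fix t assume t: "t \<in> {0..1} \<inter> l -` V"
      then have "l t \<in> cmap c ` (U \<inter> cdom c)" using lim[of t] V(2) by blast
      then have "\<gamma> t \<in> U" unfolding \<gamma>_def using cinv_cmap[OF c] by auto
      then show "t \<in> {t \<in> topspace (subtopology euclideanreal {0..1}). \<gamma> t \<in> U}" using t by auto
    qed
    moreover have "open (l -` V)" using V(1) lc by (simp add: open_vimage)
    ultimately show "openin (subtopology euclideanreal {0..1}) {t \<in> topspace (subtopology euclideanreal {0..1}). \<gamma> t \<in> U}"
      by (simp add: openin_open_Int)
  qed
  have C1: "\<exists>D. continuous_on {t\<in>{a..b}. \<gamma> t \<in> cdom e} D \<and>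
            (\<forall>t\<in>{a..b}. \<gamma> t \<in> cdom e \<longrightarrow> (cmap e \<circ> \<gamma> has_vector_derivative D t) (at t within {a..b}))"
    if ab: "0 \<le> a" "a < b" "b \<le> 1" and e: "e \<in> atlas M" for a b e
  proof -
    define D where "D t = vector_derivative (cmap e \<circ> \<gamma>) (at t within {a..b})" for t
    define \<Sigma> where "\<Sigma> = {t\<in>{a..b}. \<gamma> t \<in> cdom e}"
    \<comment> \<open>Near \<open>t0\<close> the curve reads \<open>g \<circ> l\<close> in the chart
      \<open>e\<close>, with \<open>g\<close> a smooth extension of the transition; the derivative
      of \<open>g\<close> along the segment is the continuous \<open>D'\<close>.\<close>
    have loc: "\<exists>O' D'. open O' \<and> t0 \<in> O' \<and> continuous_on (\<Sigma> \<inter> O') D' \<and>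
        (\<forall>t\<in>\<Sigma> \<inter> O'. (cmap e \<circ> \<gamma> has_vector_derivative D' t) (at t within {a..b}))" if t0: "t0 \<in> \<Sigma>" for t0
    proof -
      have t01: "t0 \<in> {0..1}" "\<gamma> t0 \<in> cdom e" using t0 ab unfolding \<Sigma>_def by auto
      have "l t0 \<in> cmap c ` (cdom c \<inter> cdom e)" using g\<gamma>[OF t01(1)] t01(2) by (metis IntI imageI)
      then obtain W g where W: "open W" "l t0 \<in> W" "\<forall>n. Ck_on n W g"
        "\<forall>y\<in>cmap c ` (cdom c \<inter> cdom e) \<inter> W. (cmap e \<circ> cinv c) y = g y"
        using transition_smooth[OF c e] unfolding smooth_on_def by blast
      have "Ck_on (Suc 0) W g" using W(3) by blast
      then have gd: "\<And>y. y \<in> W \<Longrightarrow> g differentiable (at y)"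
        and gc: "\<And>i. i \<in> Basis \<Longrightarrow> continuous_on W (\<lambda>y. frechet_derivative g (at y) i)" by auto
      obtain V where V: "open V" "{t\<in>{0..1}. \<gamma> t \<in> cdom e} = {0..1} \<inter> V"
        using curve_nhd[OF cont chart_open[OF e]] .
      define O' where "O' = V \<inter> l -` W"
      have O: "open O'" "t0 \<in> O'" unfolding O'_def using V W(1,2) lc t01 by (auto simp: open_vimage)
      have eq: "(cmap e \<circ> \<gamma>) t = g (l t)" "\<gamma> t \<in> cdom e" if "t \<in> {a..b} \<inter> O'" for t
      proof -
        have t: "t \<in> {0..1}" "t \<in> V" "l t \<in> W" using that ab unfolding O'_def by auto
        then show ge: "\<gamma> t \<in> cdom e" using V(2) by blast
        then have "l t \<in> cmap c ` (cdom c \<inter> cdom e)" using g\<gamma>[OF t(1)] by (metis IntI imageI)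
        then show "(cmap e \<circ> \<gamma>) t = g (l t)" using W(4) t(3) unfolding \<gamma>_def by auto
      qed
      define D' where "D' t = (\<Sum>i\<in>Basis. ((q - p) \<bullet> i) *\<^sub>R frechet_derivative g (at (l t)) i)" for t
      have gl: "frechet_derivative g (at (l t)) (q - p) = D' t" if "l t \<in> W" for t
      proof -
        have lin: "linear (frechet_derivative g (at (l t)))" by (rule linear_frechet_derivative[OF gd[OF that]])
        have "frechet_derivative g (at (l t)) (\<Sum>i\<in>Basis. ((q - p) \<bullet> i) *\<^sub>R i) = D' t"
          unfolding D'_def by (simp only: linear_sum[OF lin] linear_cmul[OF lin])
        then show ?thesis by (simp only: euclidean_representation)
      qed
      have "continuous_on (\<Sigma> \<inter> O') D'" unfolding D'_def
      proof (intro continuous_intros)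
        fix i :: "real^2" assume "i \<in> Basis"
        then show "continuous_on (\<Sigma> \<inter> O') (\<lambda>t. frechet_derivative g (at (l t)) i)"
          by (intro continuous_on_compose2[OF gc continuous_on_subset[OF lc]]) (auto simp: O'_def)
      qed
      moreover have "(cmap e \<circ> \<gamma> has_vector_derivative D' t) (at t within {a..b})" if t: "t \<in> \<Sigma> \<inter> O'" for t
      proof -
        have lW: "l t \<in> W" using t unfolding O'_def by auto
        have gd': "(g has_derivative frechet_derivative g (at (l t))) (at (l t))"
          using gd[OF lW] by (simp add: frechet_derivative_works)
        have ld': "(l has_derivative (\<lambda>h. h *\<^sub>R (q - p))) (at t within {a..b})"
          using ld[of t "{a..b}"] unfolding has_vector_derivative_def .
        have "((\<lambda>s. g (l s)) has_derivative (\<lambda>h. frechet_derivative g (at (l t)) (h *\<^sub>R (q - p)))) (at t within {a..b})"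
          by (rule has_derivative_compose[OF ld' gd'])
        then have gv: "((\<lambda>s. g (l s)) has_vector_derivative D' t) (at t within {a..b})"
          unfolding has_vector_derivative_def
          by (simp only: linear_cmul[OF linear_frechet_derivative[OF gd[OF lW]]] gl[OF lW])
        obtain \<delta> where \<delta>: "\<delta> > 0" "ball t \<delta> \<subseteq> O'" using O(1) t open_contains_ball by blast
        have tab: "t \<in> {a..b}" using t unfolding \<Sigma>_def by blast
        show ?thesis
        proof (rule has_vector_derivative_transform_within[OF gv \<delta>(1) tab])
          fix s assume s: "s \<in> {a..b}" "dist s t < \<delta>"
          then have "s \<in> {a..b} \<inter> O'" using \<delta>(2) by (auto simp: dist_commute)
          then show "g (l s) = (cmap e \<circ> \<gamma>) s" using eq(1) by simp
        qed
      qed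
      ultimately show ?thesis using O by blast
    qed
    have "continuous_on \<Sigma> D"
      unfolding continuous_on_eq_continuous_within
    proof
      fix t0 assume t0: "t0 \<in> \<Sigma>"
      obtain O' D' where O: "open O'" "t0 \<in> O'" "continuous_on (\<Sigma> \<inter> O') D'"
        "\<forall>t\<in>\<Sigma> \<inter> O'. (cmap e \<circ> \<gamma> has_vector_derivative D' t) (at t within {a..b})"
        using loc[OF t0] by blast
      \<comment> \<open>Derivatives within a nondegenerate interval are unique, so the local
        \<open>D'\<close> all agree with the single function \<open>D\<close>.\<close>
      have DD: "D t = D' t" if "t \<in> \<Sigma> \<inter> O'" for t
      proof -
        have "t \<in> cbox a b" using that unfolding \<Sigma>_def by auto
        then show ?thesis unfolding D_def
          using vector_derivative_within_cbox[OF ab(2), of t "cmap e \<circ> \<gamma>" "D' t"] O(4) that by simp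
      qed
      have "continuous_on (\<Sigma> \<inter> O') D" by (rule continuous_on_eq[OF O(3)]) (simp add: DD)
      then have "continuous (at t0 within \<Sigma> \<inter> O') D"
        using t0 O(2) by (simp add: continuous_on_eq_continuous_within)
      moreover have "at t0 within \<Sigma> = at t0 within (\<Sigma> \<inter> O')"
        by (rule at_within_nhd[OF O(2,1)]) blast
      ultimately show "continuous (at t0 within \<Sigma>) D" by simp
    qed
    moreover have "(cmap e \<circ> \<gamma> has_vector_derivative D t) (at t within {a..b})" if t: "t \<in> \<Sigma>" for t
    proof -
      obtain O' D' where O: "t \<in> O'" "\<forall>t\<in>\<Sigma> \<inter> O'. (cmap e \<circ> \<gamma> has_vector_derivative D' t) (at t within {a..b})"
        using loc[OF t] by blast
      then have "(cmap e \<circ> \<gamma> has_vector_derivative D' t) (at t within {a..b})" using t by blast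
      then show ?thesis unfolding D_def by (metis vector_derivative_works differentiableI_vector)
    qed
    ultimately show ?thesis unfolding \<Sigma>_def by blast
  qed
  have pw: "piecewise_C1_curve M \<gamma>" unfolding piecewise_C1_curve_def
    using cont C1 by (intro conjI exI[of _ "{}"]) auto
  have "AE t in lborel. t \<notin> {0,1::real}"
    by (intro AE_not_in finite_imp_null_set_lborel) auto
  then have "curve_length M \<gamma> \<le> (\<integral>\<^sup>+t. ennreal (B * norm (q - p)) * indicator {0..1::real} t \<partial>lborel)"
    unfolding curve_length_def
  proof (rule nn_integral_mono_AE[OF eventually_mono])
    fix t :: real assume t: "t \<notin> {0,1}"
    show "ennreal (speed M \<gamma> t) * indicator {0..1} t \<le> ennreal (B * norm (q - p)) * indicator {0..1} t"
    proof (cases "t \<in> {0..1}")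
      case True
      then have t01: "0 < t" "t < 1" using t by auto
      have "(cmap c \<circ> \<gamma> has_vector_derivative (q - p)) (at t)"
      proof (rule has_vector_derivative_transform_within_open[OF ld open_greaterThanLessThan[of 0 "1::real"]])
        show "l s = (cmap c \<circ> \<gamma>) s" if "s \<in> {0<..<1}" for s using g\<gamma>(2)[of s] that by simp
      qed (use t01 in auto)
      then have "speed M \<gamma> t = sqrt ((q - p) \<bullet> (gmat M c (\<gamma> t) *v (q - p)))"
        using g\<gamma>(1)[OF True] by (intro speed_eq[OF cont t01 c]) auto
      also have "\<dots> \<le> B * norm (q - p)" unfolding \<gamma>_def by (rule up[OF lseg[OF True]])
      finally show ?thesis by (intro mult_right_mono ennreal_leI) auto
    qed simp
  qed
  also have "\<dots> = ennreal (B * norm (q - p))" by (simp add: nn_integral_cmult_indicator)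
  finally have len: "curve_length M \<gamma> \<le> ennreal (B * norm (q - p))" .
  have "\<gamma> 0 = cinv c p" "\<gamma> 1 = cinv c q" by (simp_all add: \<gamma>_def l_def)
  then have "rdist M (cinv c p) (cinv c q) \<le> curve_length M \<gamma>"
    unfolding rdist_def using pw by (intro INF_lower) auto
  then show ?thesis using len by (rule order_trans)
qed

end

subsection \<open>Lipschitz maps in coordinates\<close>

lemma lipschitz_derivative_bound:
  fixes f :: "'a::real_normed_vector \<Rightarrow> 'b::real_normed_vector"
  assumes f': "(f has_derivative f') (at x)" and r: "r > 0" and L: "L-lipschitz_on (ball x r) f"
  shows "norm (f' v) \<le> L * norm v"
proof (cases "v = 0")
  case True
  then show ?thesis using f' by (simp add: has_derivative_bounded_linear linear_simps(3))
next
  case False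
  have lin: "linear f'" using f' has_derivative_linear by blast
  have "norm (f' v) \<le> L * norm v + e * norm v" if e: "e > 0" for e
  proof -
    obtain d where d: "d > 0" "\<And>y. norm (y - x) < d \<Longrightarrow> norm (f y - f x - f' (y - x)) \<le> e * norm (y - x)"
      using f' e unfolding has_derivative_at_alt by blast
    define t where "t = min d r / (2 * norm v)"
    have t: "t > 0" "t * norm v < d" "t * norm v < r" using d(1) r False unfolding t_def by auto
    define y where "y = x + t *\<^sub>R v"
    have yx: "y - x = t *\<^sub>R v" "norm (y - x) = t * norm v" using t(1) by (simp_all add: y_def)
    have "norm (f y - f x) \<le> L * (t * norm v)"
      using lipschitz_onD[OF L, of y x] t(3) r yx(2) by (simp add: dist_norm norm_minus_commute)
    moreover have "norm (f y - f x - f' (y - x)) \<le> e * (t * norm v)" using d(2)[of y] t yx by simp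
    moreover have "norm (f' (y - x)) \<le> norm (f y - f x) + norm (f y - f x - f' (y - x))"
      by (metis norm_minus_commute norm_triangle_sub)
    moreover have "norm (f' (y - x)) = t * norm (f' v)" using t(1) by (simp add: yx linear_cmul[OF lin])
    ultimately have "t * norm (f' v) \<le> t * (L * norm v + e * norm v)" by (simp add: algebra_simps)
    then show ?thesis using t(1) by simp
  qed
  note main = this
  show ?thesis
  proof (rule field_le_epsilon)
    fix e :: real assume "e > 0"
    then show "norm (f' v) \<le> L * norm v + e" using main[of "e / norm v"] False by simp
  qed
qed

text \<open>The squared norm is the trace of \<open>transpose X ** X\<close>, whose two diagonal
  entries are values of the pulled-back form on the \<open>G\<close>-unit vectors of the
  frame.\<close>

lemma norm_in_frames_bound:
  assumes G: "spd G" and H: "spd H" and b: "\<And>u. (A *v u) \<bullet> (H *v (A *v u)) \<le> b * (u \<bullet> (G *v u))"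
  shows "(norm (in_frames G H A))\<^sup>2 \<le> 2 * b"
proof -
  let ?P = "oriented_frame G"
  define X where "X = in_frames G H A"
  have diag: "(transpose ?P ** B ** ?P) $ i $ i = (?P *v axis i 1) \<bullet> (B *v (?P *v axis i 1))" for B and i :: 2
  proof -
    have "(?P *v axis i 1) \<bullet> (B *v (?P *v axis i 1)) = axis i 1 \<bullet> ((transpose ?P ** B ** ?P) *v axis i 1)"
      using gram_inner_mult[of B ?P "axis i 1" "axis i 1"] by (simp add: gram_inner_def)
    then show ?thesis by (simp add: inner_axis' matrix_vector_mul_component inner_axis)
  qed
  have one: "(?P *v axis i 1) \<bullet> (G *v (?P *v axis i 1)) = 1" for i :: 2
    unfolding diag[symmetric] oriented_frame(1)[OF G] by (simp add: mat_def)
  have diag_le: "(transpose X ** X) $ i $ i \<le> b" for i :: 2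
  proof -
    have "(transpose X ** X) $ i $ i = (?P *v axis i 1) \<bullet> ((transpose A ** H ** A) *v (?P *v axis i 1))"
      unfolding X_def gram_in_frames[OF G H] diag ..
    also have "\<dots> = (A *v (?P *v axis i 1)) \<bullet> (H *v (A *v (?P *v axis i 1)))"
      using gram_inner_mult[of H A "?P *v axis i 1" "?P *v axis i 1"] by (simp add: gram_inner_def)
    also have "\<dots> \<le> b" using b[of "?P *v axis i 1"] one[of i] by simp
    finally show ?thesis .
  qed
  have "(transpose X ** X) $ 1 $ 1 + (transpose X ** X) $ 2 $ 2 \<le> b + b" by (rule add_mono[OF diag_le diag_le])
  moreover have "(norm X)\<^sup>2 = (transpose X ** X)$1$1 + (transpose X ** X)$2$2"
    unfolding norm_mat2 by (simp add: mat2_mult mat2_transpose power2_eq_square)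
  ultimately show ?thesis unfolding X_def by simp
qed

locale surface_map = M: riemannian_surface M + N: riemannian_surface N
  for M :: "'a surface" and N :: "'b surface" +
  fixes \<phi> :: "'a \<Rightarrow> 'b"
  assumes lip: "lipschitz_map M N \<phi>"
begin

lemma map_pts: "x \<in> pts M \<Longrightarrow> \<phi> x \<in> pts N"
  using lip unfolding lipschitz_map_def by blast

definition rep :: "'a chart \<Rightarrow> 'b chart \<Rightarrow> real^2 \<Rightarrow> real^2" where
  "rep c d = cmap d \<circ> \<phi> \<circ> cinv c"

lemma rep_cmap: "c \<in> atlas M \<Longrightarrow> x \<in> cdom c \<Longrightarrow> rep c d (cmap c x) = cmap d (\<phi> x)"
  unfolding rep_def by (simp add: M.cinv_cmap)

text \<open>Upper bounds along segments in the domain, the Lipschitz property and the lower bound in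
  the target combine. That lower bound presupposes a point already located in the target chart, so
  images are located before they are compared; every comparison goes through the corner of a broken
  segment.\<close>

lemma rep_lipschitz:
  assumes c: "c \<in> atlas M" "x \<in> cdom c" and d: "d \<in> atlas N" "\<phi> x \<in> cdom d"
  obtains r L where "r > 0" "\<And>y. y \<in> cdom c \<Longrightarrow> dist (cmap c y) (cmap c x) < r \<Longrightarrow> \<phi> y \<in> cdom d"
    "L-lipschitz_on (cmap c ` cdom c \<inter> ball (cmap c x) r) (rep c d)"
proof -
  let ?S = "cmap c ` cdom c" and ?x = "cmap c x"
  have xS: "?x \<in> ?S" using c by blast
  obtain \<Lambda> where \<Lambda>: "\<Lambda> \<ge> 0" "\<And>u v. u \<in> pts M \<Longrightarrow> v \<in> pts M \<Longrightarrow> rdist N (\<phi> u) (\<phi> v) \<le> ennreal \<Lambda> * rdist M u v"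
    using lip unfolding lipschitz_map_def by blast
  obtain R0 where R0: "R0 > 0" "\<And>r. r < R0 \<Longrightarrow> compact (?S \<inter> cball ?x r)"
    using M.compact_ball[OF c] by blast
  define R where "R = R0 / 2"
  have R: "R > 0" "compact (?S \<inter> cball ?x R)" using R0 unfolding R_def by auto
  obtain m0 B where B: "B > 0"
    "\<And>p v. p \<in> ?S \<inter> cball ?x R \<Longrightarrow> sqrt (v \<bullet> (gmat M c (cinv c p) *v v)) \<le> B * norm v"
    using M.metric_bounds[OF c(1) R(2) Int_lower1] by metis
  obtain C r0 where C: "C \<ge> 0" and r0: "r0 > 0" "r0 \<le> R"
    and seg: "\<And>p q. p \<in> ?S \<inter> ball ?x r0 \<Longrightarrow> q \<in> ?S \<inter> ball ?x r0 \<Longrightarrow> \<exists>m.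
     closed_segment p m \<subseteq> ?S \<inter> ball ?x R \<and> closed_segment q m \<subseteq> ?S \<inter> ball ?x R \<and>
     norm (m - p) \<le> C * norm (p - q) \<and> norm (m - q) \<le> C * norm (p - q)"
    using lipschitz_region_broken_segment[OF M.chart_region[OF c(1)] xS] R(1) by metis
  obtain r1 m where r1: "r1 > 0" "m > 0"
    and low: "\<And>y z. y \<in> cdom d \<Longrightarrow> dist (cmap d y) (cmap d (\<phi> x)) < r1 / 2 \<Longrightarrow>
    rdist N y z < ennreal (m * r1 / 2) \<Longrightarrow>
    z \<in> cdom d \<and> dist (cmap d z) (cmap d (\<phi> x)) < r1 \<and> ennreal (m * norm (cmap d z - cmap d y)) \<le> rdist N y z"
    using N.rdist_lower[OF d] by metis
  define A where "A = \<Lambda> * B * C"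
  have A: "A \<ge> 0" unfolding A_def using \<Lambda>(1) B(1) C by simp
  have edge: "rdist N (\<phi> (cinv c u)) (\<phi> (cinv c v)) \<le> ennreal (A * l)"
    if sg: "closed_segment u v \<subseteq> ?S \<inter> ball ?x R" and uv: "norm (v - u) \<le> C * l" for u v l
  proof -
    have uvS: "u \<in> ?S" "v \<in> ?S" using sg by auto
    then have P: "cinv c u \<in> pts M" "cinv c v \<in> pts M" using M.cinv_cdom M.cdom_subset[OF c(1)] by blast+
    have "rdist M (cinv c u) (cinv c v) \<le> ennreal (B * norm (v - u))"
    proof (rule M.rdist_segment_upper[OF c(1)])
      show "closed_segment u v \<subseteq> ?S" using sg by blast
      show "sqrt (w \<bullet> (gmat M c (cinv c z) *v w)) \<le> B * norm w" if "z \<in> closed_segment u v" for z w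
        using B(2)[of z w] that sg ball_subset_cball by blast
    qed
    then have "rdist N (\<phi> (cinv c u)) (\<phi> (cinv c v)) \<le> ennreal \<Lambda> * ennreal (B * norm (v - u))"
      using \<Lambda>(2)[OF P] by (meson mult_left_mono order_trans zero_le)
    also have "\<dots> = ennreal (\<Lambda> * (B * norm (v - u)))" using \<Lambda>(1) B(1) by (simp add: ennreal_mult)
    also have "\<dots> \<le> ennreal (\<Lambda> * (B * (C * l)))"
      using \<Lambda>(1) B(1) uv by (intro ennreal_leI mult_left_mono) auto
    finally show ?thesis by (simp add: A_def mult.assoc)
  qed
  have link: "rdist N (\<phi> (cinv c p)) (\<phi> (cinv c q')) \<le> ennreal (A * norm (p - q)) \<and>
      rdist N (\<phi> (cinv c q')) (\<phi> (cinv c p)) \<le> ennreal (A * norm (p - q))"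
    if "closed_segment p q' \<subseteq> ?S \<inter> ball ?x R" "norm (q' - p) \<le> C * norm (p - q)" for p q q'
    using edge[of p q' "norm (p - q)"] edge[of q' p "norm (p - q)"] that
    by (auto simp: closed_segment_commute norm_minus_commute)
  \<comment> \<open>With \<open>4 * A * r < m * r1\<close>, each of the two legs from
    \<open>cmap c x\<close> moves the image by less than \<open>r1 / 4\<close>, and comparisons over
    distances below \<open>2 * r\<close> stay within the range of the lower bound.\<close>
  define r where "r = min r0 (m * r1 / (4 * A + 1))"
  have r: "r > 0" "r \<le> r0" unfolding r_def using r0 r1 A by auto
  have Ar: "4 * A * r < m * r1"
  proof -
    have "r \<le> m * r1 / (4 * A + 1)" unfolding r_def by simp
    then have "(4 * A + 1) * r \<le> m * r1" using A by (simp add: field_simps)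
    then show ?thesis using r(1) by (simp add: algebra_simps)
  qed
  have use_low: "z \<in> cdom d \<and> norm (cmap d z - cmap d y) \<le> A * l / m"
    if y: "y \<in> cdom d" "dist (cmap d y) (cmap d (\<phi> x)) < r1 / 2" and yz: "rdist N y z \<le> ennreal (A * l)"
      and l: "0 \<le> l" "l < 2 * r" for y z l
  proof -
    have "A * l \<le> A * (2 * r)" using A l by (intro mult_left_mono) auto
    then have "A * l < m * r1 / 2" using Ar by linarith
    then have "ennreal (A * l) < ennreal (m * r1 / 2)" using A l by (simp add: ennreal_less_iff)
    then have "rdist N y z < ennreal (m * r1 / 2)" using yz by simp
    from low[OF y this] have z: "z \<in> cdom d" "ennreal (m * norm (cmap d z - cmap d y)) \<le> rdist N y z" by auto
    then have "ennreal (m * norm (cmap d z - cmap d y)) \<le> ennreal (A * l)" using yz by simp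
    then have "m * norm (cmap d z - cmap d y) \<le> A * l" using A l by (simp add: ennreal_le_iff)
    then show ?thesis using z(1) r1(2) by (simp add: field_simps)
  qed
  \<comment> \<open>Two legs, to the corner \<open>q\<close> and on to \<open>p\<close>: the first
    places the image of \<open>q\<close> in the target chart, where it serves as the starting point
    for the second.\<close>
  have near: "\<phi> (cinv c p) \<in> cdom d \<and> dist (cmap d (\<phi> (cinv c p))) (cmap d (\<phi> x)) < r1 / 2"
    if p: "p \<in> ?S \<inter> ball ?x r" for p
  proof -
    have xr0: "?x \<in> ?S \<inter> ball ?x r0" using xS r0 by simp
    have pr0: "p \<in> ?S \<inter> ball ?x r0" using p r(2) by auto
    obtain q where q: "closed_segment ?x q \<subseteq> ?S \<inter> ball ?x R" "closed_segment p q \<subseteq> ?S \<inter> ball ?x R"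
     "norm (q - ?x) \<le> C * norm (?x - p)" "norm (q - p) \<le> C * norm (?x - p)" using seg[OF xr0 pr0] by blast
    have lx: "norm (?x - p) < r" using p by (simp add: dist_norm)
    have cx: "cinv c ?x = x" by (rule M.cinv_cmap[OF c])
    have lx2: "norm (?x - p) < 2 * r" using lx r(1) by linarith
    have 1: "\<phi> (cinv c q) \<in> cdom d \<and> norm (cmap d (\<phi> (cinv c q)) - cmap d (\<phi> x)) \<le> A * norm (?x - p) / m"
      using link[OF q(1,3)] cx r1 lx2 by (intro use_low[OF d(2)]) auto
    have Am: "A * norm (?x - p) / m < r1 / 4"
    proof -
      have "A * norm (?x - p) \<le> A * r" using A lx by (intro mult_left_mono) auto
      then have "4 * (A * norm (?x - p)) < m * r1" using Ar by linarith
      then show ?thesis using r1(2) by (simp add: field_simps)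
    qed
    have 2: "\<phi> (cinv c p) \<in> cdom d \<and> norm (cmap d (\<phi> (cinv c p)) - cmap d (\<phi> (cinv c q))) \<le> A * norm (?x - p) / m"
    proof (rule use_low)
      show "dist (cmap d (\<phi> (cinv c q))) (cmap d (\<phi> x)) < r1 / 2" unfolding dist_norm using conjunct2[OF 1] Am r1 by linarith
      show "rdist N (\<phi> (cinv c q)) (\<phi> (cinv c p)) \<le> ennreal (A * norm (?x - p))"
        using link[of p q ?x] q by (simp add: norm_minus_commute)
    qed (use 1 lx2 in auto)
    have "dist (cmap d (\<phi> (cinv c p))) (cmap d (\<phi> x)) \<le> norm (cmap d (\<phi> (cinv c p)) - cmap d (\<phi> (cinv c q))) + norm (cmap d (\<phi> (cinv c q)) - cmap d (\<phi> x))"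
      using norm_triangle_ineq[of "cmap d (\<phi> (cinv c p)) - cmap d (\<phi> (cinv c q))" "cmap d (\<phi> (cinv c q)) - cmap d (\<phi> x)"] by (simp add: dist_norm)
    then show ?thesis using 1 2 Am by linarith
  qed
  show ?thesis
  proof (rule that[OF r(1)])
    fix y assume y: "y \<in> cdom c" "dist (cmap c y) ?x < r"
    then show "\<phi> y \<in> cdom d" using near[of "cmap c y"] M.cinv_cmap[OF c(1) y(1)] by (simp add: dist_commute)
  next
    show "(2 * A / m)-lipschitz_on (?S \<inter> ball ?x r) (rep c d)"
    proof (rule lipschitz_onI)
      show "0 \<le> 2 * A / m" using A r1 by simp
      fix p q assume pq: "p \<in> ?S \<inter> ball ?x r" "q \<in> ?S \<inter> ball ?x r"
      have pr0: "p \<in> ?S \<inter> ball ?x r0" "q \<in> ?S \<inter> ball ?x r0" using pq r(2) by auto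
      obtain w where w: "closed_segment p w \<subseteq> ?S \<inter> ball ?x R" "closed_segment q w \<subseteq> ?S \<inter> ball ?x R"
       "norm (w - p) \<le> C * norm (p - q)" "norm (w - q) \<le> C * norm (p - q)" using seg[OF pr0] by blast
      have l: "norm (p - q) < 2 * r" using pq dist_triangle[of p q ?x] by (simp add: dist_norm norm_minus_commute)
      have 1: "norm (cmap d (\<phi> (cinv c w)) - cmap d (\<phi> (cinv c p))) \<le> A * norm (p - q) / m"
        using use_low[of "\<phi> (cinv c p)" "\<phi> (cinv c w)" "norm (p - q)"] near[OF pq(1)] link[OF w(1,3)] l by simp
      have "rdist N (\<phi> (cinv c q)) (\<phi> (cinv c w)) \<le> ennreal (A * norm (p - q))"
        using link[of q w p] w by (simp add: norm_minus_commute)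
      then have 2: "norm (cmap d (\<phi> (cinv c w)) - cmap d (\<phi> (cinv c q))) \<le> A * norm (p - q) / m"
        using use_low[of "\<phi> (cinv c q)" "\<phi> (cinv c w)" "norm (p - q)"] near[OF pq(2)] l by simp
      have "dist (rep c d p) (rep c d q) \<le> norm (cmap d (\<phi> (cinv c w)) - cmap d (\<phi> (cinv c p))) + norm (cmap d (\<phi> (cinv c w)) - cmap d (\<phi> (cinv c q)))"
        unfolding rep_def dist_norm comp_def
        using norm_triangle_ineq4[of "cmap d (\<phi> (cinv c w)) - cmap d (\<phi> (cinv c q))" "cmap d (\<phi> (cinv c w)) - cmap d (\<phi> (cinv c p))"] by simp
      also have "\<dots> \<le> 2 * A / m * dist p q" using 1 2 by (simp add: dist_norm)
      finally show "dist (rep c d p) (rep c d q) \<le> 2 * A / m * dist p q" .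
    qed
  qed
qed

lemma continuous_map: "continuous_map (mtop M) (mtop N) \<phi>"
  unfolding continuous_map_def
proof (intro conjI allI impI)
  show "\<phi> \<in> topspace (mtop M) \<rightarrow> topspace (mtop N)" using map_pts by blast
  fix V assume V: "openin (mtop N) V"
  show "openin (mtop M) {x \<in> topspace (mtop M). \<phi> x \<in> V}"
  proof (subst openin_subopen, intro ballI)
    fix x assume "x \<in> {x \<in> topspace (mtop M). \<phi> x \<in> V}"
    then have x: "x \<in> pts M" "\<phi> x \<in> V" by auto
    obtain c where c: "c \<in> atlas M" "x \<in> cdom c" using M.ex_chart[OF x(1)] by blast
    obtain d where d: "d \<in> atlas N" "\<phi> x \<in> cdom d" using N.ex_chart[OF map_pts[OF x(1)]] by blast
    obtain r L where r: "r > 0" "\<And>y. y \<in> cdom c \<Longrightarrow> dist (cmap c y) (cmap c x) < r \<Longrightarrow> \<phi> y \<in> cdom d"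
      "L-lipschitz_on (cmap c ` cdom c \<inter> ball (cmap c x) r) (rep c d)"
      using rep_lipschitz[OF c d] by blast
    obtain W where W: "open W" "cmap d ` (V \<inter> cdom d) = cmap d ` cdom d \<inter> W"
      using N.cmap_open[OF d(1) V] unfolding openin_open by blast
    have "cmap d (\<phi> x) \<in> W" using W(2) x(2) d(2) by blast
    then obtain e where e: "e > 0" "ball (cmap d (\<phi> x)) e \<subseteq> W" using W(1) open_contains_ball by blast
    have L0: "L \<ge> 0" using r(3) lipschitz_on_nonneg by blast
    define \<rho> where "\<rho> = min r (e / (L + 1))"
    have \<rho>: "\<rho> > 0" "\<rho> \<le> r" "L * \<rho> < e"
    proof -
      show "\<rho> > 0" "\<rho> \<le> r" unfolding \<rho>_def using r(1) e(1) L0 by auto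
      have "\<rho> \<le> e / (L + 1)" unfolding \<rho>_def by simp
      then have "(L + 1) * \<rho> \<le> e" using L0 by (simp add: field_simps)
      then show "L * \<rho> < e" using \<open>\<rho> > 0\<close> by (simp add: algebra_simps)
    qed
    define T where "T = {y\<in>cdom c. cmap c y \<in> ball (cmap c x) \<rho>}"
    have "openin (mtop M) T" unfolding T_def by (rule M.cmap_ball_open[OF c(1)])
    moreover have "x \<in> T" using c \<rho>(1) unfolding T_def by simp
    moreover have "\<phi> y \<in> V" if y: "y \<in> T" for y
    proof -
      have yc: "y \<in> cdom c" "dist (cmap c y) (cmap c x) < \<rho>" using y unfolding T_def by (auto simp: dist_commute)
      have yd: "\<phi> y \<in> cdom d" using r(2)[OF yc(1)] yc(2) \<rho>(2) by simp
      have "dist (rep c d (cmap c y)) (rep c d (cmap c x)) \<le> L * dist (cmap c y) (cmap c x)"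
        using yc c \<rho>(2) r(1) by (intro lipschitz_onD[OF r(3)]) (auto simp: dist_commute)
      also have "\<dots> \<le> L * \<rho>" using L0 yc(2) by (intro mult_left_mono) auto
      finally have "dist (cmap d (\<phi> y)) (cmap d (\<phi> x)) < e"
        using \<rho>(3) by (simp add: rep_cmap[OF c(1) yc(1)] rep_cmap[OF c])
      then have "cmap d (\<phi> y) \<in> W" using e(2) by (auto simp: dist_commute)
      then have "cmap d (\<phi> y) \<in> cmap d ` (V \<inter> cdom d)" using W(2) yd by blast
      then show ?thesis using inj_onD[OF N.inj_cmap[OF d(1)] _ yd] by auto
    qed
    moreover have "T \<subseteq> pts M" unfolding T_def using M.cdom_subset[OF c(1)] by blast
    ultimately show "\<exists>T. openin (mtop M) T \<and> x \<in> T \<and> T \<subseteq> {x \<in> topspace (mtop M). \<phi> x \<in> V}" by blast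
  qed
qed

lemma closedin_image: "closedin (mtop N) (\<phi> ` pts M)"
proof -
  have "compactin (mtop N) (\<phi> ` pts M)"
    using image_compactin[OF _ continuous_map, of "pts M"] M.compact by (simp add: compact_space_def)
  then show ?thesis using compactin_imp_closedin[OF N.hausdorff] by blast
qed

section \<open>Patches, regular points and invariance of the differential\<close>

text \<open>The number \<open>b\<close> bounds the squared operator norm of the differential with
  respect to the two metrics, uniformly over the patch.\<close>

definition patch :: "'a set \<Rightarrow> 'a chart \<Rightarrow> 'b chart \<Rightarrow> real \<Rightarrow> bool" where
  "patch U c d b \<longleftrightarrow> openin (mtop M) U \<and> c \<in> atlas M \<and> d \<in> atlas N \<and> U \<subseteq> cdom c \<and> \<phi> ` U \<subseteq> cdom d \<and>
     (\<exists>L m B. L-lipschitz_on (cmap c ` U) (rep c d) \<and> m > 0 \<and> B > 0 \<and> b = (B * L / m)\<^sup>2 \<and>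
       (\<forall>x\<in>U. \<forall>v. m * norm v \<le> sqrt (v \<bullet> (gmat M c x *v v))) \<and>
       (\<forall>x\<in>U. \<forall>v. sqrt (v \<bullet> (gmat N d (\<phi> x) *v v)) \<le> B * norm v))"

lemma ex_patch:
  assumes x: "x \<in> pts M"
  shows "\<exists>U c d b. patch U c d b \<and> x \<in> U"
proof -
  obtain c where c: "c \<in> atlas M" "x \<in> cdom c" using M.ex_chart[OF x(1)] by blast
  obtain d where d: "d \<in> atlas N" "\<phi> x \<in> cdom d" using N.ex_chart[OF map_pts[OF x(1)]] by blast
  obtain r L where r: "r > 0" "\<And>y. y \<in> cdom c \<Longrightarrow> dist (cmap c y) (cmap c x) < r \<Longrightarrow> \<phi> y \<in> cdom d"
    "L-lipschitz_on (cmap c ` cdom c \<inter> ball (cmap c x) r) (rep c d)"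
    using rep_lipschitz[OF c d] by blast
  have L0: "L \<ge> 0" using r(3) lipschitz_on_nonneg by blast
  obtain R1 where R1: "R1 > 0" "\<And>r. r < R1 \<Longrightarrow> compact (cmap c ` cdom c \<inter> cball (cmap c x) r)"
    using M.compact_ball[OF c] by blast
  obtain R2 where R2: "R2 > 0" "\<And>r. r < R2 \<Longrightarrow> compact (cmap d ` cdom d \<inter> cball (cmap d (\<phi> x)) r)"
    using N.compact_ball[OF d] by blast
  \<comment> \<open>The last bound keeps the image in the ball of radius \<open>R2 / 2\<close>, on
    which the target metric is bounded by compactness; \<open>L + 1\<close> guards against
    \<open>L = 0\<close>.\<close>
  define \<rho> where "\<rho> = min (min r (R1 / 2)) (R2 / 2 / (L + 1))"
  have \<rho>: "\<rho> > 0" "\<rho> \<le> r" "\<rho> < R1" "L * \<rho> \<le> R2 / 2"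
  proof -
    show "\<rho> > 0" "\<rho> \<le> r" "\<rho> < R1" unfolding \<rho>_def using r(1) R1(1) R2(1) L0 by auto
    have "\<rho> \<le> R2 / 2 / (L + 1)" unfolding \<rho>_def by simp
    then have "\<rho> * (L + 1) \<le> R2 / 2" by (subst (asm) pos_le_divide_eq) (use L0 in auto)
    then show "L * \<rho> \<le> R2 / 2" using \<open>\<rho> > 0\<close> by (simp add: algebra_simps)
  qed
  define U where "U = {y\<in>cdom c. cmap c y \<in> ball (cmap c x) \<rho>}"
  have U: "openin (mtop M) U" "x \<in> U" "U \<subseteq> cdom c"
    using M.cmap_ball_open[OF c(1)] c(2) \<rho>(1) unfolding U_def by auto
  have Ud: "\<phi> ` U \<subseteq> cdom d" using r(2) \<rho>(2) unfolding U_def by (force simp: dist_commute)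
  have Usub: "cmap c ` U \<subseteq> cmap c ` cdom c \<inter> ball (cmap c x) r" unfolding U_def using \<rho>(2) by auto
  have lipU: "L-lipschitz_on (cmap c ` U) (rep c d)" using r(3) Usub lipschitz_on_subset by blast
  obtain m B0 where m: "m > 0" "\<And>p v. p \<in> cmap c ` cdom c \<inter> cball (cmap c x) \<rho> \<Longrightarrow> m * norm v \<le> sqrt (v \<bullet> (gmat M c (cinv c p) *v v))"
    using M.metric_bounds[OF c(1) R1(2)[OF \<rho>(3)] Int_lower1] by metis
  have "R2 / 2 < R2" using R2(1) by simp
  obtain m0 B where B: "B > 0" "\<And>p v. p \<in> cmap d ` cdom d \<inter> cball (cmap d (\<phi> x)) (R2 / 2) \<Longrightarrow> sqrt (v \<bullet> (gmat N d (cinv d p) *v v)) \<le> B * norm v"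
    using N.metric_bounds[OF d(1) R2(2)[OF \<open>R2 / 2 < R2\<close>] Int_lower1] by metis
  have "m * norm v \<le> sqrt (v \<bullet> (gmat M c y *v v))" if y: "y \<in> U" for y v
  proof -
    have "cmap c y \<in> cmap c ` cdom c \<inter> cball (cmap c x) \<rho>" "y \<in> cdom c" using y unfolding U_def by auto
    then show ?thesis using m(2)[of "cmap c y" v] M.cinv_cmap[OF c(1)] by simp
  qed
  moreover have "sqrt (v \<bullet> (gmat N d (\<phi> y) *v v)) \<le> B * norm v" if y: "y \<in> U" for y v
  proof -
    have yc: "y \<in> cdom c" using y U(3) by blast
    have "dist (rep c d (cmap c y)) (rep c d (cmap c x)) \<le> L * dist (cmap c y) (cmap c x)"
      using y U(2) by (intro lipschitz_onD[OF lipU]) auto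
    also have "\<dots> \<le> L * \<rho>" using y L0 unfolding U_def by (intro mult_left_mono) (auto simp: dist_commute)
    finally have "dist (cmap d (\<phi> y)) (cmap d (\<phi> x)) \<le> R2 / 2"
      using \<rho>(4) by (simp add: rep_cmap[OF c(1) yc] rep_cmap[OF c])
    then have "cmap d (\<phi> y) \<in> cmap d ` cdom d \<inter> cball (cmap d (\<phi> x)) (R2 / 2)" "\<phi> y \<in> cdom d"
      using Ud y by (auto simp: dist_commute)
    then show ?thesis using B(2)[of "cmap d (\<phi> y)" v] N.cinv_cmap[OF d(1)] by simp
  qed
  ultimately have "patch U c d ((B * L / m)\<^sup>2)"
    unfolding patch_def using U c d Ud lipU m(1) B(1) by blast
  then show ?thesis using U(2) by blast
qed

text \<open>Only interior points, so that the derivative is two-sided and unique.\<close>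

definition regular :: "'a set \<Rightarrow> 'a chart \<Rightarrow> 'b chart \<Rightarrow> (real^2) set" where
  "regular U c d = {p \<in> cmap c ` U \<inter> interior (cmap c ` cdom c). rep c d differentiable (at p)}"

definition rep_deriv :: "'a chart \<Rightarrow> 'b chart \<Rightarrow> real^2 \<Rightarrow> real^2^2" where
  "rep_deriv c d p = matrix (frechet_derivative (rep c d) (at p))"

lemma rep_deriv:
  assumes "p \<in> regular U c d"
  shows "(rep c d has_derivative (*v) (rep_deriv c d p)) (at p)"
proof -
  have h: "(rep c d has_derivative frechet_derivative (rep c d) (at p)) (at p)"
    using assms unfolding regular_def by (simp add: frechet_derivative_works)
  have "(*v) (rep_deriv c d p) = frechet_derivative (rep c d) (at p)"
    unfolding rep_deriv_def
    by (intro ext matrix_works) (use has_derivative_linear[OF h] in \<open>simp add: linear_def scalar_mult_eq_scaleR[abs_def]\<close>)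
  then show ?thesis using h by simp
qed

lemma patch_open:
  assumes "patch U c d b"
  shows "open (cmap c ` U \<inter> interior (cmap c ` cdom c))"
proof -
  have c: "c \<in> atlas M" "openin (mtop M) U" "U \<subseteq> cdom c" using assms unfolding patch_def by auto
  obtain V where V: "open V" "cmap c ` (U \<inter> cdom c) = cmap c ` cdom c \<inter> V"
    using M.cmap_open[OF c(1,2)] unfolding openin_open by blast
  have "cmap c ` U = cmap c ` cdom c \<inter> V" using V(2) c(3) by (simp add: inf.absorb1)
  then have "cmap c ` U \<inter> interior (cmap c ` cdom c) = V \<inter> interior (cmap c ` cdom c)"
    using interior_subset by blast
  then show ?thesis using V(1) by auto
qed

text \<open>Rademacher's theorem on the open part, and the null boundary of a Lipschitz
  region.\<close>

lemma negligible_irregular: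
  assumes P: "patch U c d b"
  shows "negligible (cmap c ` U - regular U c d)"
proof -
  obtain L where L: "L-lipschitz_on (cmap c ` U) (rep c d)" and c: "c \<in> atlas M" "U \<subseteq> cdom c"
    using P unfolding patch_def by blast
  let ?O = "cmap c ` U \<inter> interior (cmap c ` cdom c)"
  have "negligible {p\<in>?O. \<not> rep c d differentiable (at p)}"
  proof (rule rademacher_locally)
    fix p assume "p \<in> ?O"
    then obtain r where r: "r > 0" "ball p r \<subseteq> ?O" using patch_open[OF P] open_contains_ball by blast
    have "L-lipschitz_on (ball p r) (rep c d)" by (rule lipschitz_on_subset[OF L]) (use r(2) in blast)
    then show "\<exists>r>0. \<exists>L. ball p r \<subseteq> ?O \<and> L-lipschitz_on (ball p r) (rep c d)" using r by blast
  qed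
  moreover have "negligible (cmap c ` cdom c - interior (cmap c ` cdom c))"
    by (rule negligible_lipschitz_region_boundary[OF M.chart_region[OF c(1)]])
  ultimately have "negligible ({p\<in>?O. \<not> rep c d differentiable (at p)} \<union> (cmap c ` cdom c - interior (cmap c ` cdom c)))"
    by (rule negligible_Un)
  then show ?thesis by (rule negligible_subset) (use c(2) in \<open>auto simp: regular_def\<close>)
qed

text \<open>In the picked charts the differential is \<open>S ** (A ** T)\<close> with transition
  derivatives \<open>S\<close> and \<open>T\<close> of positive determinant, to which norm and
  determinant in frames are insensitive. At an interior point the derivative within the chart image,
  used by \<open>diff_at\<close>, is the ordinary one.\<close>

lemma diff_at_transform:
  assumes P: "patch U c d b" and x: "x \<in> U" "cmap c x \<in> regular U c d"
  shows "norm (in_frames (gmat_at M x) (gmat_at N (\<phi> x)) (diff_at M N \<phi> x)) =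
      norm (in_frames (gmat M c x) (gmat N d (\<phi> x)) (rep_deriv c d (cmap c x)))" (is ?thesis1)
    and "det (in_frames (gmat_at M x) (gmat_at N (\<phi> x)) (diff_at M N \<phi> x)) =
      det (in_frames (gmat M c x) (gmat N d (\<phi> x)) (rep_deriv c d (cmap c x)))" (is ?thesis2)
proof -
  have c: "c \<in> atlas M" "x \<in> cdom c" and d: "d \<in> atlas N" "\<phi> x \<in> cdom d"
    using P x unfolding patch_def by auto
  have xM: "x \<in> pts M" using c M.cdom_subset by blast
  let ?c = "chart_at M x" and ?d = "chart_at N (\<phi> x)"
  have c': "?c \<in> atlas M" "x \<in> cdom ?c" using M.chart_at[OF xM] by auto
  have d': "?d \<in> atlas N" "\<phi> x \<in> cdom ?d" using N.chart_at[OF map_pts[OF xM]] by auto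
  let ?p = "cmap c x" and ?x = "cmap ?c x"
  define A where "A = rep_deriv c d ?p"
  define T where "T = transition_deriv ?c c x"
  define S where "S = transition_deriv d ?d (\<phi> x)"
  have pint: "?p \<in> interior (cmap c ` cdom c)" using x(2) unfolding regular_def by blast
  have xint: "?x \<in> interior (cmap ?c ` cdom ?c)"
    by (rule M.interior_transition[OF c(1) c'(1) c(2) c'(2) pint])
  define O1 where "O1 = U \<inter> {y\<in>pts M. \<phi> y \<in> cdom ?d}"
  have "openin (mtop M) {y\<in>pts M. \<phi> y \<in> cdom ?d}"
    by (rule openin_continuous_map_preimage[OF continuous_map N.chart_open[OF d'(1)]])
  then have O1: "openin (mtop M) O1" unfolding O1_def using P by (auto simp: patch_def)
  obtain V where V: "open V" "cmap ?c ` (O1 \<inter> cdom ?c) = cmap ?c ` cdom ?c \<inter> V"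
    using M.cmap_open[OF c'(1) O1] unfolding openin_open by blast
  define W where "W = V \<inter> interior (cmap ?c ` cdom ?c)"
  have xO1: "x \<in> O1" using x(1) xM d'(2) unfolding O1_def by blast
  have W: "open W" "?x \<in> W" unfolding W_def using V xint xO1 c'(2) by auto
  have Wim: "W \<subseteq> cmap ?c ` (O1 \<inter> cdom ?c)" unfolding W_def V(2) using interior_subset by blast
  have Wy: "\<exists>y. y \<in> U \<and> y \<in> cdom c \<and> y \<in> cdom ?c \<and> \<phi> y \<in> cdom d \<and> \<phi> y \<in> cdom ?d \<and> q = cmap ?c y" if q: "q \<in> W" for q
  proof -
    obtain y where "y \<in> O1 \<inter> cdom ?c" "q = cmap ?c y" using Wim q by blast
    then show ?thesis using P unfolding O1_def patch_def by blast
  qed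
  have Wov: "W \<subseteq> M.overlap ?c c" unfolding M.overlap_def using Wy by blast
  have T: "(cmap c \<circ> cinv ?c has_derivative (*v) T) (at ?x within W)"
    unfolding T_def by (rule has_derivative_subset[OF M.transition_has_derivative[OF c'(1) c(1)] Wov]) (use c c' in blast)
  have e1: "(cmap c \<circ> cinv ?c) ?x = ?p" using M.cinv_cmap[OF c'] by simp
  have A1: "(rep c d has_derivative (*v) A) (at ((cmap c \<circ> cinv ?c) ?x) within (cmap c \<circ> cinv ?c) ` W)"
    unfolding e1 A_def by (rule has_derivative_at_withinI[OF rep_deriv[OF x(2)]])
  have AT: "(rep c d \<circ> (cmap c \<circ> cinv ?c) has_derivative (*v) A \<circ> (*v) T) (at ?x within W)"
    by (rule diff_chain_within[OF T A1])
  have e2: "(rep c d \<circ> (cmap c \<circ> cinv ?c)) q = cmap d (\<phi> y)" if "y \<in> cdom c" "y \<in> cdom ?c" "q = cmap ?c y" for q y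
    using that M.cinv_cmap[OF c'(1)] M.cinv_cmap[OF c(1)] by (simp add: rep_def)
  have Sim: "(rep c d \<circ> (cmap c \<circ> cinv ?c)) ` W \<subseteq> N.overlap d ?d"
  proof
    fix z assume "z \<in> (rep c d \<circ> (cmap c \<circ> cinv ?c)) ` W"
    then obtain q where q: "q \<in> W" "z = (rep c d \<circ> (cmap c \<circ> cinv ?c)) q" by blast
    then obtain y where "y \<in> cdom c" "y \<in> cdom ?c" "\<phi> y \<in> cdom d" "\<phi> y \<in> cdom ?d" "q = cmap ?c y" using Wy by blast
    then show "z \<in> N.overlap d ?d" unfolding N.overlap_def q(2) using e2 by blast
  qed
  have e3: "(rep c d \<circ> (cmap c \<circ> cinv ?c)) ?x = cmap d (\<phi> x)" by (rule e2[OF c(2) c'(2) refl])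
  have S: "(cmap ?d \<circ> cinv d has_derivative (*v) S) (at ((rep c d \<circ> (cmap c \<circ> cinv ?c)) ?x) within (rep c d \<circ> (cmap c \<circ> cinv ?c)) ` W)"
    unfolding e3 S_def by (rule has_derivative_subset[OF N.transition_has_derivative[OF d(1) d'(1)] Sim]) (use d d' in blast)
  have "((cmap ?d \<circ> cinv d) \<circ> (rep c d \<circ> (cmap c \<circ> cinv ?c)) has_derivative (*v) S \<circ> ((*v) A \<circ> (*v) T)) (at ?x within W)"
    by (rule diff_chain_within[OF AT S])
  then have "((cmap ?d \<circ> cinv d) \<circ> (rep c d \<circ> (cmap c \<circ> cinv ?c)) has_derivative (*v) S \<circ> ((*v) A \<circ> (*v) T)) (at ?x)"
    using at_within_open[OF W(2,1)] by simp
  then have "(cmap ?d \<circ> \<phi> \<circ> cinv ?c has_derivative (*v) S \<circ> ((*v) A \<circ> (*v) T)) (at ?x)"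
  proof (rule has_derivative_transform_within_open[OF _ W])
    fix q assume "q \<in> W"
    then obtain y where y: "y \<in> cdom c" "y \<in> cdom ?c" "\<phi> y \<in> cdom d" "q = cmap ?c y" using Wy by blast
    then show "((cmap ?d \<circ> cinv d) \<circ> (rep c d \<circ> (cmap c \<circ> cinv ?c))) q = (cmap ?d \<circ> \<phi> \<circ> cinv ?c) q"
      using e2[OF y(1,2,4)] M.cinv_cmap[OF c'(1) y(2)] N.cinv_cmap[OF d(1) y(3)] by simp
  qed
  then have "frechet_derivative (cmap ?d \<circ> \<phi> \<circ> cinv ?c) (at ?x) = (*v) S \<circ> ((*v) A \<circ> (*v) T)"
    using frechet_derivative_at by metis
  then have D: "diff_at M N \<phi> x = S ** (A ** T)"
    unfolding diff_at_def Let_def at_within_interior[OF xint]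
    by (simp add: comp_def matrix_vector_mul_assoc matrix_mul_assoc)
  have sG: "spd (gmat M c x)" "spd (gmat M ?c x)" "spd (gmat N d (\<phi> x))" "spd (gmat N ?d (\<phi> x))"
    using M.spd_gmat c c' N.spd_gmat d d' by blast+
  have mT: "gmat M ?c x = transpose T ** gmat M c x ** T" "det T > 0"
    unfolding T_def using M.metric_compat[OF c'(1) c(1)] M.oriented[OF c'(1) c(1)] c c' by auto
  have mS: "gmat N d (\<phi> x) = transpose S ** gmat N ?d (\<phi> x) ** S" "det S > 0"
    unfolding S_def using N.metric_compat[OF d(1) d'(1)] N.oriented[OF d(1) d'(1)] d d' by auto
  have one: "G = transpose (mat 1) ** G ** mat 1" "det (mat 1 :: real^2^2) > 0" for G :: "real^2^2"
    by (simp_all add: transpose_mat)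
  \<comment> \<open>Source and target charts are exchanged one at a time, with the identity on the
    other side.\<close>
  have s1: "A ** T = mat 1 ** (A ** T)" by simp
  have s2: "(S ** (A ** T)) ** mat 1 = S ** (A ** T)" by simp
  show ?thesis1 ?thesis2
    unfolding D gmat_at_def A_def[symmetric]
    using in_frames_invariant[OF sG(2,1) sG(3,3) mT one s1] in_frames_invariant[OF sG(2,2) sG(3,4) one mS s2] by simp_all
qed

end

subsection \<open>The area formula\<close>

lemma borel_measurable_lebesgue_on_conull:
  fixes f :: "'a::euclidean_space \<Rightarrow> real"
  assumes E: "E \<in> sets lebesgue" and G: "G \<subseteq> E" "negligible (E - G)" and f: "f \<in> borel_measurable (lebesgue_on G)"
  shows "f \<in> borel_measurable (lebesgue_on E)"
proof -
  have GL: "G \<in> sets lebesgue"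
  proof -
    have "G = E - (E - G)" using G by blast
    then show ?thesis using E negligible_imp_sets[OF G(2)] by (metis sets.Diff)
  qed
  have "{x\<in>E. f x \<in> T} \<in> sets lebesgue" if T: "T \<in> sets borel" for T
  proof -
    have "{x\<in>G. f x \<in> T} \<in> sets lebesgue"
      using f T borel_measurable_lebesgue_on_preimage_borel[OF GL] by blast
    moreover have "{x\<in>E - G. f x \<in> T} \<in> sets lebesgue"
      by (rule negligible_imp_sets[OF negligible_subset[OF G(2)]]) blast
    moreover have "{x\<in>E. f x \<in> T} = {x\<in>G. f x \<in> T} \<union> {x\<in>E - G. f x \<in> T}" using G by blast
    ultimately show ?thesis by simp
  qed
  then show ?thesis using borel_measurable_lebesgue_on_preimage_borel[OF E] by blast
qed

lemma (in riemannian_surface) null_sets_area_negligible: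
  assumes c: "c \<in> atlas M" and S: "S \<in> null_sets (area M)" "S \<subseteq> cdom c"
  shows "negligible (cmap c ` S)"
proof -
  have "S \<in> area_sets M" "emeasure (area M) S = 0" using S(1) by (auto simp: null_sets_def)
  then show ?thesis using chart_area_eq_0_iff[OF c _ S(2)] by simp
qed

context surface_map
begin

abbreviation frame_diff :: "'a \<Rightarrow> real^2^2" where
  "frame_diff x \<equiv> in_frames (gmat_at M x) (gmat_at N (\<phi> x)) (diff_at M N \<phi> x)"

section \<open>Measurability and boundedness of the invariants of the differential\<close>

text \<open>The squared Hilbert-Schmidt norm. Where the Jacobian is nonnegative, energy and equality
  conditions depend on the differential only through \<open>hs\<close> and
  \<open>jac\<close>.\<close>

definition hs :: "'a \<Rightarrow> real" where
  "hs x = (norm (frame_diff x))\<^sup>2"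

definition jac :: "'a \<Rightarrow> real" where
  "jac x = det (frame_diff x)"

lemma patchD:
  assumes "patch U c d b"
  shows "openin (mtop M) U" "c \<in> atlas M" "d \<in> atlas N" "U \<subseteq> cdom c" "\<phi> ` U \<subseteq> cdom d"
  using assms unfolding patch_def by auto

lemma patch_point:
  assumes P: "patch U c d b" and p: "p \<in> cmap c ` U"
  shows "cinv c p \<in> U" "cmap c (cinv c p) = p" "\<phi> (cinv c p) \<in> cdom d" "cinv d (rep c d p) = \<phi> (cinv c p)"
    "rep c d p \<in> cmap d ` cdom d" "rep c d p = cmap d (\<phi> (cinv c p))"
proof -
  obtain x where x: "x \<in> U" "p = cmap c x" using p by blast
  have cx: "cinv c p = x" using x patchD[OF P] M.cinv_cmap by auto
  show "cinv c p \<in> U" "cmap c (cinv c p) = p" using cx x by auto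
  show i: "\<phi> (cinv c p) \<in> cdom d" using cx x patchD(5)[OF P] by auto
  show r: "rep c d p = cmap d (\<phi> (cinv c p))" by (simp add: rep_def)
  show "cinv d (rep c d p) = \<phi> (cinv c p)" unfolding r by (rule N.cinv_cmap[OF patchD(3)[OF P] i])
  show "rep c d p \<in> cmap d ` cdom d" unfolding r using i by blast
qed

lemma patch_sets:
  assumes P: "patch U c d b"
  shows "cmap c ` U \<in> sets lebesgue" "regular U c d \<in> sets lebesgue" "regular U c d \<subseteq> cmap c ` U"
proof -
  show 1: "cmap c ` U \<in> sets lebesgue"
    using M.area_setsD(3)[OF M.openin_area_sets] patchD[OF P] by blast
  show sub: "regular U c d \<subseteq> cmap c ` U" unfolding regular_def by blast
  have "regular U c d = cmap c ` U - (cmap c ` U - regular U c d)" using sub by blast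
  then show "regular U c d \<in> sets lebesgue" using 1 negligible_imp_sets[OF negligible_irregular[OF P]] by (metis sets.Diff)
qed

lemma hs_jac_regular:
  assumes P: "patch U c d b" and p: "p \<in> regular U c d"
  shows "hs (cinv c p) = energy_density (gmat M c (cinv c p)) (gmat N d (cinv d (rep c d p))) (rep_deriv c d p)"
    and "jac (cinv c p) = det (rep_deriv c d p) * N.dens d (rep c d p) / M.dens c p"
proof -
  have pU: "p \<in> cmap c ` U" using p patch_sets(3)[OF P] by blast
  note pp = patch_point[OF P pU]
  have xr: "cmap c (cinv c p) \<in> regular U c d" using pp(2) p by simp
  have G: "spd (gmat M c (cinv c p))" using M.spd_gmat patchD[OF P] pp(1) by blast
  have H: "spd (gmat N d (\<phi> (cinv c p)))" using N.spd_gmat patchD[OF P] pp(3) by blast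
  show "hs (cinv c p) = energy_density (gmat M c (cinv c p)) (gmat N d (cinv d (rep c d p))) (rep_deriv c d p)"
    unfolding hs_def diff_at_transform(1)[OF P pp(1) xr] pp(2,4) norm_in_frames[OF G H] ..
  show "jac (cinv c p) = det (rep_deriv c d p) * N.dens d (rep c d p) / M.dens c p"
    unfolding jac_def diff_at_transform(2)[OF P pp(1) xr] pp(2) det_in_frames[OF G H] N.dens_def M.dens_def pp(4) by simp
qed

lemma rep_continuous:
  assumes P: "patch U c d b"
  shows "continuous_on (cmap c ` U) (rep c d)"
  using P lipschitz_on_continuous_on unfolding patch_def by blast

text \<open>At regular points both are explicit expressions in continuous metric coefficients and
  measurable partial derivatives; the other points form a null set.\<close>

lemma hs_jac_measurable_patch:
  assumes P: "patch U c d b"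
  shows "(\<lambda>p. hs (cinv c p)) \<in> borel_measurable (lebesgue_on (cmap c ` U))" (is ?th1)
    and "(\<lambda>p. jac (cinv c p)) \<in> borel_measurable (lebesgue_on (cmap c ` U))" (is ?th2)
proof -
  let ?E = "cmap c ` U" and ?R = "regular U c d"
  note E = patch_sets[OF P]
  have "continuous_on ?E (\<lambda>p. gmat M c (cinv c p))"
    by (rule continuous_on_subset[OF M.gmat_continuous[OF patchD(2)[OF P]]]) (use patchD(4)[OF P] in blast)
  then have gc: "continuous_on ?R (\<lambda>p. gmat M c (cinv c p))" using E(3) continuous_on_subset by blast
  have rc: "continuous_on ?R (rep c d)" using rep_continuous[OF P] E(3) continuous_on_subset by blast
  have rim: "rep c d ` ?R \<subseteq> cmap d ` cdom d" using patch_point(5)[OF P] E(3) by blast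
  have hc: "continuous_on ?R (\<lambda>p. gmat N d (cinv d (rep c d p)))"
    by (rule continuous_on_compose2[OF N.gmat_continuous[OF patchD(3)[OF P]] rc rim])
  have dc: "continuous_on ?R (\<lambda>p. N.dens d (rep c d p))"
    by (rule continuous_on_compose2[OF N.dens_continuous[OF patchD(3)[OF P]] rc rim])
  have dMc: "continuous_on ?R (M.dens c)"
    by (rule continuous_on_subset[OF M.dens_continuous[OF patchD(2)[OF P]]]) (use patchD(4)[OF P] E(3) in blast)
  have mg[measurable]: "(\<lambda>p. gmat M c (cinv c p) $ i $ j) \<in> borel_measurable (lebesgue_on ?R)" for i j
    by (intro continuous_imp_measurable_on_sets_lebesgue[OF _ E(2)] continuous_intros gc)
  have mh[measurable]: "(\<lambda>p. gmat N d (cinv d (rep c d p)) $ i $ j) \<in> borel_measurable (lebesgue_on ?R)" for i j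
    by (intro continuous_imp_measurable_on_sets_lebesgue[OF _ E(2)] continuous_intros hc)
  have md[measurable]: "(\<lambda>p. N.dens d (rep c d p)) \<in> borel_measurable (lebesgue_on ?R)"
    by (rule continuous_imp_measurable_on_sets_lebesgue[OF dc E(2)])
  have mdM[measurable]: "(\<lambda>p. M.dens c p) \<in> borel_measurable (lebesgue_on ?R)"
    by (rule continuous_imp_measurable_on_sets_lebesgue[OF dMc E(2)])
  have ma[measurable]: "(\<lambda>p. rep_deriv c d p $ i $ j) \<in> borel_measurable (lebesgue_on ?R)" for i j
    using borel_measurable_partial_derivatives[OF E(2), of "rep c d" "\<lambda>p. (*v) (rep_deriv c d p)" i j]
      has_derivative_at_withinI[OF rep_deriv] by simp
  have "(\<lambda>p. energy_density (gmat M c (cinv c p)) (gmat N d (cinv d (rep c d p))) (rep_deriv c d p)) \<in> borel_measurable (lebesgue_on ?R)"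
    unfolding energy_density_def Let_def det_2 mat2_mult mat2_transpose by measurable
  then have "(\<lambda>p. hs (cinv c p)) \<in> borel_measurable (lebesgue_on ?R)"
    by (rule measurable_cong[THEN iffD1, rotated]) (simp add: hs_jac_regular(1)[OF P])
  then show ?th1 by (rule borel_measurable_lebesgue_on_conull[OF E(1,3) negligible_irregular[OF P]])
  have "(\<lambda>p. det (rep_deriv c d p) * N.dens d (rep c d p) / M.dens c p) \<in> borel_measurable (lebesgue_on ?R)"
    unfolding det_2 by measurable
  then have "(\<lambda>p. jac (cinv c p)) \<in> borel_measurable (lebesgue_on ?R)"
    by (rule measurable_cong[THEN iffD1, rotated]) (simp add: hs_jac_regular(2)[OF P])
  then show ?th2 by (rule borel_measurable_lebesgue_on_conull[OF E(1,3) negligible_irregular[OF P]])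
qed

lemma ex_patches:
  "\<exists>(n::nat) U c d b. (\<forall>i<n. patch (U i) (c i) (d i) (b i)) \<and> pts M \<subseteq> (\<Union>i<n. U i)"
proof -
  have "\<exists>U. openin (mtop M) U \<and> x \<in> U \<and> (\<exists>c d b. patch U c d b)" if "x \<in> pts M" for x
    using ex_patch[OF that] patchD(1) by blast
  then obtain \<U> where U: "finite \<U>" "\<And>U. U \<in> \<U> \<Longrightarrow> openin (mtop M) U \<and> (\<exists>c d b. patch U c d b)" "pts M \<subseteq> \<Union>\<U>"
    using M.finite_subcover[of "\<lambda>U. \<exists>c d b. patch U c d b"] by metis
  obtain Us where Us: "set Us = \<U>" using finite_list[OF U(1)] by blast
  have "\<forall>i<length Us. \<exists>c d b. patch (Us ! i) c d b" using U(2) Us nth_mem by blast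
  then obtain c d b where P: "\<And>i. i < length Us \<Longrightarrow> patch (Us ! i) (c i) (d i) (b i)" by metis
  have "pts M \<subseteq> (\<Union>i<length Us. Us ! i)"
  proof
    fix x assume "x \<in> pts M"
    then obtain V where "V \<in> set Us" "x \<in> V" using U(3) Us by blast
    then show "x \<in> (\<Union>i<length Us. Us ! i)" unfolding in_set_conv_nth by auto
  qed
  then show ?thesis using P by (intro exI[of _ "length Us"] exI[of _ "(!) Us"] exI[of _ c] exI[of _ d] exI[of _ b]) simp
qed

lemma
  shows hs_measurable[measurable]: "hs \<in> borel_measurable (area M)"
    and jac_measurable[measurable]: "jac \<in> borel_measurable (area M)"
proof -
  obtain n :: nat and U c d b where P: "\<And>i. i < n \<Longrightarrow> patch (U i) (c i) (d i) (b i)" "pts M \<subseteq> (\<Union>i<n. U i)"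
    using ex_patches by metis
  show "hs \<in> borel_measurable (area M)"
    by (rule M.measurable_area_localI[of "{..<n}" U c]) (use P patchD[OF P(1)] hs_jac_measurable_patch(1)[OF P(1)] in auto)
  show "jac \<in> borel_measurable (area M)"
    by (rule M.measurable_area_localI[of "{..<n}" U c]) (use P patchD[OF P(1)] hs_jac_measurable_patch(2)[OF P(1)] in auto)
qed

lemma hs_bound_patch:
  assumes P: "patch U c d b" and x: "x \<in> U" "cmap c x \<in> regular U c d"
  shows "hs x \<le> 2 * b"
proof -
  obtain L m B where L: "L-lipschitz_on (cmap c ` U) (rep c d)" and m: "m > 0" and B: "B > 0" "b = (B * L / m)\<^sup>2"
    and lu: "\<forall>x\<in>U. \<forall>v. m * norm v \<le> sqrt (v \<bullet> (gmat M c x *v v))"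
      "\<forall>x\<in>U. \<forall>v. sqrt (v \<bullet> (gmat N d (\<phi> x) *v v)) \<le> B * norm v"
    using P unfolding patch_def by (elim exE conjE) (rule that)
  have low: "\<And>v. m * norm v \<le> sqrt (v \<bullet> (gmat M c x *v v))"
    and up: "\<And>v. sqrt (v \<bullet> (gmat N d (\<phi> x) *v v)) \<le> B * norm v"
    using lu x(1) by simp_all
  have L0: "L \<ge> 0" using L lipschitz_on_nonneg by blast
  let ?A = "rep_deriv c d (cmap c x)"
  have G: "spd (gmat M c x)" using M.spd_gmat patchD[OF P] x(1) by blast
  have H: "spd (gmat N d (\<phi> x))" using N.spd_gmat patchD[OF P] x(1) by blast
  have "cmap c x \<in> cmap c ` U \<inter> interior (cmap c ` cdom c)" using x(2) unfolding regular_def by blast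
  then obtain r where r: "r > 0" "ball (cmap c x) r \<subseteq> cmap c ` U"
    using patch_open[OF P] open_contains_ball by (metis Int_subset_iff)
  have Av: "norm (?A *v v) \<le> L * norm v" for v
    by (rule lipschitz_derivative_bound[OF rep_deriv[OF x(2)] r(1) lipschitz_on_subset[OF L r(2)]])
  have "(?A *v u) \<bullet> (gmat N d (\<phi> x) *v (?A *v u)) \<le> b * (u \<bullet> (gmat M c x *v u))" for u
  proof -
    have "sqrt ((?A *v u) \<bullet> (gmat N d (\<phi> x) *v (?A *v u))) \<le> B * (L * norm u)"
      using up[of "?A *v u"] Av[of u] B(1) by (meson mult_left_mono order_trans less_imp_le)
    also have "\<dots> = (B * L / m) * (m * norm u)" using m by simp
    also have "\<dots> \<le> (B * L / m) * sqrt (u \<bullet> (gmat M c x *v u))"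
      using low[of u] B(1) L0 m by (intro mult_left_mono) auto
    finally have "sqrt ((?A *v u) \<bullet> (gmat N d (\<phi> x) *v (?A *v u))) \<le> (B * L / m) * sqrt (u \<bullet> (gmat M c x *v u))" .
    then have "(?A *v u) \<bullet> (gmat N d (\<phi> x) *v (?A *v u)) \<le> ((B * L / m) * sqrt (u \<bullet> (gmat M c x *v u)))\<^sup>2"
      by (rule sqrt_le_D)
    also have "\<dots> = b * (u \<bullet> (gmat M c x *v u))"
      using G unfolding B(2) power_mult_distrib spd_def by (cases "u = 0") (auto simp: less_imp_le)
    finally show ?thesis .
  qed
  then show ?thesis unfolding hs_def diff_at_transform(1)[OF P x] by (rule norm_in_frames_bound[OF G H])
qed

text \<open>Essential boundedness on a finite measure space secures the later integrability.\<close>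

lemma hs_bounded: "\<exists>b. AE x in area M. hs x \<le> b"
proof -
  obtain n :: nat and U c d b where P: "\<And>i. i < n \<Longrightarrow> patch (U i) (c i) (d i) (b i)" "pts M \<subseteq> (\<Union>i<n. U i)"
    using ex_patches by metis
  define S where "S i = {x\<in>U i. cmap (c i) x \<notin> regular (U i) (c i) (d i)}" for i
  have "S i \<in> null_sets (area M)" if i: "i < n" for i
  proof (rule M.null_sets_area_chart[OF patchD(2)[OF P(1)[OF i]]])
    show "S i \<subseteq> cdom (c i)" using patchD(4)[OF P(1)[OF i]] unfolding S_def by blast
    show "negligible (cmap (c i) ` S i)"
      by (rule negligible_subset[OF negligible_irregular[OF P(1)[OF i]]]) (auto simp: S_def)
  qed
  then have "(\<Union>i\<in>{..<n}. S i) \<in> null_sets (area M)" by (intro null_sets.finite_UN) auto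
  from AE_not_in[OF this] have "AE x in area M. hs x \<le> (\<Sum>i<n. \<bar>2 * b i\<bar>)"
  proof (rule AE_mp[OF _ AE_I2], intro impI)
    fix x assume x: "x \<in> space (area M)" "x \<notin> (\<Union>i\<in>{..<n}. S i)"
    then obtain i where i: "i < n" "x \<in> U i" using P(2) by auto
    then have "cmap (c i) x \<in> regular (U i) (c i) (d i)" using x(2) unfolding S_def by auto
    then have "hs x \<le> 2 * b i" by (rule hs_bound_patch[OF P(1)[OF i(1)] i(2)])
    also have "\<dots> \<le> \<bar>2 * b i\<bar>" by simp
    also have "\<dots> \<le> (\<Sum>i<n. \<bar>2 * b i\<bar>)" using i(1) by (intro member_le_sum) auto
    finally show "hs x \<le> (\<Sum>i<n. \<bar>2 * b i\<bar>)" .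
  qed
  then show ?thesis by blast
qed

section \<open>The area of the image as the integral of the Jacobian\<close>

text \<open>\<open>A'\<close> keeps the regular points with nonzero Jacobian that are not mapped
  into \<open>Z\<close>; there the coordinate map is injective and the change of variables applies.
  The discarded points do not contribute to the integral, and their image is null: Lipschitz maps
  preserve null sets, critical values are null by Sard, and the rest lands in
  \<open>Z\<close>.\<close>

lemma area_piece:
  assumes P: "patch U c d b" and A: "A \<in> area_sets M" "A \<subseteq> U" and Z: "Z \<in> null_sets (area N)"
    and inj: "\<And>x y. x \<in> pts M \<Longrightarrow> y \<in> pts M \<Longrightarrow> \<phi> x = \<phi> y \<Longrightarrow> \<phi> x \<notin> Z \<Longrightarrow> x = y"
    and J: "AE x in area M. jac x \<ge> 0"
  obtains A' where "A' \<subseteq> A" "\<phi> ` A' \<in> sets (area N)" "\<phi> ` A' \<inter> Z = {}" "\<phi> ` A - \<phi> ` A' \<in> null_sets (area N)"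
    "(\<integral>\<^sup>+x\<in>A. ennreal (jac x) \<partial>area M) = emeasure (area N) (\<phi> ` A')"
proof -
  let ?f = "rep c d" and ?D = "rep_deriv c d"
  note c = patchD(2)[OF P] and d = patchD(3)[OF P]
  have Ac: "A \<subseteq> cdom c" using A(2) patchD(4)[OF P] by blast
  define E where "E = cmap c ` A"
  have E: "E \<in> sets lebesgue" unfolding E_def by (rule M.area_setsD(3)[OF A(1) c Ac])
  have EU: "E \<subseteq> cmap c ` U" using A(2) unfolding E_def by blast
  define R where "R = E \<inter> regular U c d"
  have R: "R \<in> sets lebesgue" unfolding R_def using E patch_sets(2)[OF P] by blast
  have RD: "(?f has_derivative (*v) (?D p)) (at p within T)" if "p \<in> R" for p T
    using rep_deriv[of p U c d] that unfolding R_def by (blast intro: has_derivative_at_withinI)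
  have nER: "negligible (E - R)"
    by (rule negligible_subset[OF negligible_irregular[OF P]]) (use EU in \<open>auto simp: R_def\<close>)
  define Y where "Y = cmap d ` (Z \<inter> cdom d)"
  have "Z \<inter> cdom d \<in> null_sets (area N)" by (rule N.null_area_subset[OF Z]) blast
  then have Y: "negligible Y" unfolding Y_def by (rule N.null_sets_area_negligible[OF d]) blast
  define R1 where "R1 = {p\<in>R. det (?D p) \<noteq> 0}"
  have R1: "R1 \<in> sets lebesgue"
  proof -
    have m: "(\<lambda>p. det (?D p)) \<in> borel_measurable (lebesgue_on R)"
      using borel_measurable_det_Jacobian[OF R RD] by simp
    have "\<forall>T. T \<in> sets borel \<longrightarrow> {p\<in>R. det (?D p) \<in> T} \<in> sets lebesgue"
      using m borel_measurable_lebesgue_on_preimage_borel[OF R, of "\<lambda>p. det (?D p)"] by simp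
    moreover have "- {0::real} \<in> sets borel" by simp
    ultimately have "{p\<in>R. det (?D p) \<in> - {0}} \<in> sets lebesgue" by blast
    then show ?thesis unfolding R1_def by simp
  qed
  \<comment> \<open>Away from critical points the preimage of a null set is null, however large the
    whole preimage of \<open>Z\<close> may be.\<close>
  define R2 where "R2 = {p\<in>R1. ?f p \<in> Y}"
  have R2: "negligible R2" unfolding R2_def
  proof (rule negligible_preimage_regular[OF _ _ Y])
    fix p assume p: "p \<in> R1"
    then show "(?f has_derivative (*v) (?D p)) (at p within R1)" using RD unfolding R1_def by blast
    have "invertible (?D p)" using p unfolding R1_def by (simp add: invertible_det_nz)
    then show "inj ((*v) (?D p))" by (simp add: inj_matrix_vector_mult)
  qed
  define R3 where "R3 = R1 - R2"
  have R3: "R3 \<in> sets lebesgue" unfolding R3_def using R1 negligible_imp_sets[OF R2] by blast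
  have R3sub: "R3 \<subseteq> R" "R3 \<subseteq> E" "R3 \<subseteq> cmap c ` U" unfolding R3_def R1_def R_def using EU by blast+
  have R3D: "(?f has_derivative (*v) (?D p)) (at p within R3)" if "p \<in> R3" for p
    using RD R3sub(1) that by blast
  define A' where "A' = cinv c ` R3"
  have A'A: "A' \<subseteq> A"
    using R3sub(2) M.cinv_cmap[OF c] Ac unfolding A'_def E_def by force
  have img: "cmap d ` (\<phi> ` A') = ?f ` R3"
    unfolding A'_def rep_def by (simp add: image_image)
  have A'd: "\<phi> ` A' \<subseteq> cdom d" using A'A A(2) patchD(5)[OF P] by blast
  have fR3: "?f ` R3 \<in> sets lebesgue"
    by (rule differentiable_image_in_sets_lebesgue[OF R3])
      (use R3D in \<open>auto simp: differentiable_on_def differentiable_def\<close>)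
  have S1: "\<phi> ` A' \<in> area_sets N"
    by (rule N.area_sets_sub[OF d A'd]) (use img fR3 in simp)
  have S2: "\<phi> (cinv c p) \<notin> Z" if p: "p \<in> R3" for p
  proof
    assume "\<phi> (cinv c p) \<in> Z"
    moreover have "\<phi> (cinv c p) \<in> cdom d" "?f p = cmap d (\<phi> (cinv c p))"
      using patch_point(3,6)[OF P subsetD[OF R3sub(3) p]] by simp_all
    ultimately have "?f p \<in> Y" unfolding Y_def by blast
    then show False using p unfolding R3_def R2_def by blast
  qed
  have S3: "\<phi> ` A - \<phi> ` A' \<in> null_sets (area N)"
  proof -
    define B where "B = {x\<in>A. cmap c x \<notin> R3}"
    have "cmap d ` (\<phi> ` B) \<subseteq> ?f ` (E - R) \<union> ?f ` {p\<in>R. det (?D p) = 0} \<union> Y"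
    proof
      fix q assume "q \<in> cmap d ` (\<phi> ` B)"
      then obtain x where x: "x \<in> A" "cmap c x \<notin> R3" "q = cmap d (\<phi> x)" unfolding B_def by blast
      have xc: "x \<in> cdom c" using x(1) Ac by blast
      have q: "q = ?f (cmap c x)" using rep_cmap[OF c xc] x(3) by simp
      have pE: "cmap c x \<in> E" using x(1) unfolding E_def by blast
      show "q \<in> ?f ` (E - R) \<union> ?f ` {p\<in>R. det (?D p) = 0} \<union> Y"
      proof (cases "cmap c x \<in> R1")
        case True
        then have "cmap c x \<in> R2" using x(2) unfolding R3_def by blast
        then show ?thesis unfolding q R2_def by blast
      next
        case False
        then show ?thesis unfolding q using pE unfolding R1_def by blast
      qed
    qed
    moreover have "negligible (?f ` (E - R))"
    proof (rule negligible_locally_Lipschitz_image[OF _ nER])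
      obtain L where L: "L-lipschitz_on (cmap c ` U) ?f" using P unfolding patch_def by blast
      fix p assume p: "p \<in> E - R"
      show "\<exists>T B. open T \<and> p \<in> T \<and> (\<forall>y\<in>(E - R) \<inter> T. norm (?f y - ?f p) \<le> B * norm (y - p))"
      proof (intro exI[of _ UNIV] exI[of _ L] conjI ballI)
        fix y assume "y \<in> (E - R) \<inter> UNIV"
        then show "norm (?f y - ?f p) \<le> L * norm (y - p)"
          using p EU by (intro lipschitz_on_normD[OF L]) auto
      qed auto
    qed simp
    moreover have "negligible (?f ` {p\<in>R. det (?D p) = 0})"
    proof (rule baby_Sard)
      fix p assume p: "p \<in> {p\<in>R. det (?D p) = 0}"
      then show "(?f has_derivative (*v) (?D p)) (at p within {p\<in>R. det (?D p) = 0})" using RD by blast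
      show "rank (matrix ((*v) (?D p))) < CARD(2)" using p det_eq_0_rank[of "?D p"] by simp
    qed simp
    ultimately have "negligible (cmap d ` (\<phi> ` B))" using Y by (meson negligible_Un negligible_subset)
    then have "\<phi> ` B \<in> null_sets (area N)"
      using patchD(5)[OF P] A(2) unfolding B_def by (intro N.null_sets_area_chart[OF d]) auto
    moreover have "\<phi> ` A - \<phi> ` A' \<subseteq> \<phi> ` B"
    proof
      fix z assume z: "z \<in> \<phi> ` A - \<phi> ` A'"
      then obtain x where x: "x \<in> A" "z = \<phi> x" by blast
      have "cmap c x \<notin> R3"
      proof
        assume "cmap c x \<in> R3"
        then have "x \<in> A'" unfolding A'_def using M.cinv_cmap[OF c, of x] x(1) Ac by (metis imageI subsetD)
        then show False using z x(2) by blast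
      qed
      then show "z \<in> \<phi> ` B" using x unfolding B_def by blast
    qed
    ultimately show ?thesis by (rule N.null_area_subset)
  qed
  have nJ: "negligible (cmap c ` {x\<in>A. \<not> jac x \<ge> 0})"
  proof -
    have "{x\<in>pts M. \<not> jac x \<ge> 0} \<in> null_sets (area M)" using M.complete_area[OF J] .
    then have n: "{x\<in>A. \<not> jac x \<ge> 0} \<in> null_sets (area M)"
      by (rule M.null_area_subset) (use A M.area_setsD(1)[OF A(1) c] in blast)
    then show ?thesis by (rule M.null_sets_area_negligible[OF c]) (use Ac in blast)
  qed
  have "(\<integral>\<^sup>+x\<in>A. ennreal (jac x) \<partial>area M) = (\<integral>\<^sup>+p\<in>E. ennreal (jac (cinv c p)) * ennreal (M.dens c p) \<partial>lebesgue)"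
    unfolding E_def by (rule M.nn_integral_area_chart[OF c A(1) Ac measurable_compose[OF jac_measurable measurable_ennreal]])
  \<comment> \<open>Off a null set the integrands agree: outside \<open>R3\<close> the Jacobian is
    zero, and on \<open>R3\<close> it is positive, so the absolute value disappears.\<close>
  also have "\<dots> = (\<integral>\<^sup>+p\<in>R3. ennreal (\<bar>det (matrix ((*v) (?D p)))\<bar> * N.dens d (?f p)) \<partial>lebesgue)"
  proof (rule nn_integral_cong_AE)
    have "negligible ((E - R) \<union> R2 \<union> cmap c ` {x\<in>A. \<not> jac x \<ge> 0})" using nER R2 nJ by simp
    then have "(E - R) \<union> R2 \<union> cmap c ` {x\<in>A. \<not> jac x \<ge> 0} \<in> null_sets lebesgue" by (simp add: negligible_iff_null_sets)
    from AE_not_in[OF this]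
    show "AE p in lebesgue. ennreal (jac (cinv c p)) * ennreal (M.dens c p) * indicator E p =
        ennreal (\<bar>det (matrix ((*v) (?D p)))\<bar> * N.dens d (?f p)) * indicator R3 p"
    proof eventually_elim
      case (elim p)
      show ?case
      proof (cases "p \<in> E")
        case False
        then have "p \<notin> R3" using R3sub(2) by blast
        then show ?thesis using False by simp
      next
        case True
        then have pR: "p \<in> R" "p \<in> regular U c d" "p \<notin> R2" "p \<in> cmap c ` U" using elim EU unfolding R_def by auto
        obtain x where x: "x \<in> A" "p = cmap c x" using True unfolding E_def by blast
        have cx: "cinv c p = x" using x Ac M.cinv_cmap[OF c] by blast
        have j0: "jac (cinv c p) \<ge> 0" using elim x unfolding cx by blast
        have dp: "M.dens c p > 0" using M.dens_pos[OF c] x Ac by blast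
        have dq: "N.dens d (?f p) > 0" by (rule N.dens_pos[OF d patch_point(5)[OF P pR(4)]])
        have eq: "jac (cinv c p) * M.dens c p = det (?D p) * N.dens d (?f p)"
          using hs_jac_regular(2)[OF P pR(2)] dp by simp
        have D0: "det (?D p) \<ge> 0"
          using eq j0 dp dq by (metis mult_nonneg_nonneg less_imp_le zero_le_mult_iff not_less)
        have "ennreal (jac (cinv c p)) * ennreal (M.dens c p) = ennreal (det (?D p) * N.dens d (?f p))"
          using j0 dp eq by (simp add: ennreal_mult[symmetric])
        moreover have "p \<in> R3 \<longleftrightarrow> det (?D p) \<noteq> 0" using pR unfolding R3_def R1_def by blast
        ultimately show ?thesis using True D0 by (cases "p \<in> R3") auto
      qed
    qed
  qed
  also have "\<dots> = (\<integral>\<^sup>+q\<in>?f ` R3. ennreal (N.dens d q) \<partial>lebesgue)"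
  proof (rule nn_integral_change_of_variables[OF R3 R3D])
    have sub: "?f ` R3 \<subseteq> cmap d ` cdom d" using patch_point(5)[OF P] R3sub(3) by blast
    then show "continuous_on (?f ` R3) (N.dens d)" using continuous_on_subset N.dens_continuous[OF d] by blast
    show "0 \<le> N.dens d q" if "q \<in> ?f ` R3" for q using N.dens_pos[OF d] sub that less_imp_le by blast
    show "inj_on ?f R3"
    proof (rule inj_onI)
      fix p q assume pq: "p \<in> R3" "q \<in> R3" "?f p = ?f q"
      have pqU: "p \<in> cmap c ` U" "q \<in> cmap c ` U" using pq R3sub(3) by blast+
      have "\<phi> (cinv c p) = \<phi> (cinv c q)" using patch_point(4)[OF P pqU(1)] patch_point(4)[OF P pqU(2)] pq(3) by simp
      moreover have "cinv c p \<in> pts M" "cinv c q \<in> pts M"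
        using patch_point(1)[OF P pqU(1)] patch_point(1)[OF P pqU(2)] patchD(4)[OF P] M.cdom_subset[OF c] by blast+
      ultimately have "cinv c p = cinv c q" using inj S2[OF pq(1)] by blast
      then show "p = q" using patch_point(2)[OF P pqU(1)] patch_point(2)[OF P pqU(2)] by metis
    qed
  qed
  also have "\<dots> = emeasure (area N) (\<phi> ` A')"
    unfolding N.emeasure_area_chart[OF d S1 A'd] N.chart_area_eq_dens img ..
  finally have "(\<integral>\<^sup>+x\<in>A. ennreal (jac x) \<partial>area M) = emeasure (area N) (\<phi> ` A')" .
  moreover have "\<phi> ` A' \<inter> Z = {}" using S2 unfolding A'_def by blast
  ultimately show ?thesis using that[of A'] A'A S1 S3 by simp
qed

text \<open>The reduced pieces are disjoint and their images avoid \<open>Z\<close>, so the images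
  are disjoint as well; they fill the whole image up to a null set.\<close>

lemma area_formula:
  assumes inj: "AE q in area N. \<forall>x\<in>pts M. \<forall>y\<in>pts M. \<phi> x = q \<and> \<phi> y = q \<longrightarrow> x = y"
    and J: "AE x in area M. jac x \<ge> 0"
  shows "(\<integral>\<^sup>+x. ennreal (jac x) \<partial>area M) = emeasure (area N) (\<phi> ` pts M)"
proof -
  define Z where "Z = {q\<in>pts N. \<not> (\<forall>x\<in>pts M. \<forall>y\<in>pts M. \<phi> x = q \<and> \<phi> y = q \<longrightarrow> x = y)}"
  have Z: "Z \<in> null_sets (area N)" unfolding Z_def by (rule N.complete_area[OF inj])
  have Zinj: "x = y" if "x \<in> pts M" "y \<in> pts M" "\<phi> x = \<phi> y" "\<phi> x \<notin> Z" for x y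
    using that map_pts unfolding Z_def by auto
  obtain n :: nat and U c d b where P: "\<And>i. i < n \<Longrightarrow> patch (U i) (c i) (d i) (b i)" "pts M \<subseteq> (\<Union>i<n. U i)"
    using ex_patches by metis
  define A where "A i = U i - (\<Union>j<i. U j)" for i
  have UA: "U i \<in> sets (area M)" if "i < n" for i by (rule M.sets_area_open[OF patchD(1)[OF P(1)[OF that]]])
  have A: "A i \<in> sets (area M)" "A i \<subseteq> U i" if "i < n" for i
  proof -
    show "A i \<in> sets (area M)" unfolding A_def
      by (rule sets.Diff[OF UA[OF that] sets.finite_UN]) (use UA that in auto)
    show "A i \<subseteq> U i" unfolding A_def by blast
  qed
  have Adisj: "A i \<inter> A j = {}" if "i \<noteq> j" for i j
  proof -
    have "A i \<inter> A j = {}" if "i < j" for i j using that unfolding A_def by blast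
    then show ?thesis using that by (metis Int_commute linorder_neqE_nat)
  qed
  have "(\<Union>i<m. A i) = (\<Union>i<m. U i)" for m
    by (induction m) (auto simp: A_def lessThan_Suc)
  then have cover: "pts M = (\<Union>i<n. A i)"
    using P(2) A(2) patchD(1)[OF P(1)] openin_subset by fastforce
  define Q where "Q i A' \<longleftrightarrow> A' \<subseteq> A i \<and> \<phi> ` A' \<in> sets (area N) \<and> \<phi> ` A' \<inter> Z = {} \<and> \<phi> ` A i - \<phi> ` A' \<in> null_sets (area N) \<and>
    (\<integral>\<^sup>+x\<in>A i. ennreal (jac x) \<partial>area M) = emeasure (area N) (\<phi> ` A')" for i A'
  have exQ: "\<exists>A'. Q i A'" if i: "i < n" for i
    unfolding Q_def
  proof (rule area_piece[OF P(1)[OF i] _ A(2)[OF i] Z Zinj J])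
    show "A i \<in> area_sets M" using A(1)[OF i] by simp
  qed blast+
  define A' where "A' i = (SOME A'. Q i A')" for i
  have "Q i (A' i)" if "i < n" for i unfolding A'_def by (rule someI_ex[OF exQ[OF that]])
  then have A': "\<And>i. i < n \<Longrightarrow> A' i \<subseteq> A i" "\<And>i. i < n \<Longrightarrow> \<phi> ` A' i \<in> sets (area N)"
    "\<And>i. i < n \<Longrightarrow> \<phi> ` A' i \<inter> Z = {}" "\<And>i. i < n \<Longrightarrow> \<phi> ` A i - \<phi> ` A' i \<in> null_sets (area N)"
    "\<And>i. i < n \<Longrightarrow> (\<integral>\<^sup>+x\<in>A i. ennreal (jac x) \<partial>area M) = emeasure (area N) (\<phi> ` A' i)"
    unfolding Q_def by blast+
  have "(\<integral>\<^sup>+x. ennreal (jac x) \<partial>area M) = (\<integral>\<^sup>+x. (\<Sum>i<n. ennreal (jac x) * indicator (A i) x) \<partial>area M)"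
  proof (rule nn_integral_cong)
    fix x assume "x \<in> space (area M)"
    then obtain i where i: "i < n" "x \<in> A i" using cover by auto
    have "ennreal (jac x) * indicator (A j) x = (if j = i then ennreal (jac x) else 0)" for j
      using i(2) Adisj[of i j] by (cases "j = i") (auto simp: indicator_def)
    then have "(\<Sum>j<n. ennreal (jac x) * indicator (A j) x) = ennreal (jac x)" using i(1) by simp
    then show "ennreal (jac x) = (\<Sum>j<n. ennreal (jac x) * indicator (A j) x)" using i by simp
  qed
  also have "\<dots> = (\<Sum>i<n. \<integral>\<^sup>+x\<in>A i. ennreal (jac x) \<partial>area M)"
    using A(1) by (intro nn_integral_sum) (auto intro!: borel_measurable_times_ennreal borel_measurable_indicator)
  also have "\<dots> = (\<Sum>i<n. emeasure (area N) (\<phi> ` A' i))" using A'(5) by simp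
  also have "\<dots> = emeasure (area N) (\<Union>i\<in>{..<n}. \<phi> ` A' i)"
  proof (rule sum_emeasure)
    show "disjoint_family_on (\<lambda>i. \<phi> ` A' i) {..<n}"
      unfolding disjoint_family_on_def
    proof (intro ballI impI)
      fix i j assume ij: "i \<in> {..<n}" "j \<in> {..<n}" "i \<noteq> j"
      show "\<phi> ` A' i \<inter> \<phi> ` A' j = {}"
      proof (rule ccontr)
        assume "\<phi> ` A' i \<inter> \<phi> ` A' j \<noteq> {}"
        then obtain x y where xy: "x \<in> A' i" "y \<in> A' j" "\<phi> x = \<phi> y" by blast
        moreover have "i < n" "j < n" using ij by auto
        ultimately have "x \<in> A i" "y \<in> A j" "\<phi> x \<notin> Z" using A'(1)[of i] A'(1)[of j] A'(3)[of i] by blast+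
        moreover from this have "x \<in> pts M" "y \<in> pts M" using cover ij by auto
        ultimately have "x = y" using Zinj xy(3) by blast
        then show False using Adisj[OF ij(3)] \<open>x \<in> A i\<close> \<open>y \<in> A j\<close> by blast
      qed
    qed
  qed (use A'(2) in auto)
  also have "\<dots> = emeasure (area N) (\<phi> ` pts M)"
  proof -
    let ?W = "\<Union>i\<in>{..<n}. \<phi> ` A' i"
    have "(\<Union>i\<in>{..<n}. \<phi> ` A i - \<phi> ` A' i) \<in> null_sets (area N)" using A'(4) by (intro null_sets.finite_UN) auto
    then have "\<phi> ` pts M - ?W \<in> null_sets (area N)"
      by (rule N.null_area_subset) (use cover in auto)
    moreover have "?W \<in> sets (area N)" using A'(2) by (intro sets.finite_UN) auto
    ultimately have "emeasure (area N) (?W \<union> (\<phi> ` pts M - ?W)) = emeasure (area N) ?W"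
      by (intro emeasure_Un_null_set)
    moreover have "?W \<union> (\<phi> ` pts M - ?W) = \<phi> ` pts M" using A'(1) cover by blast
    ultimately show ?thesis by simp
  qed
  finally show ?thesis .
qed

lemma image_sets: "\<phi> ` pts M \<in> sets (area N)"
proof -
  have "openin (mtop N) (pts N - \<phi> ` pts M)" using closedin_image by (simp add: openin_diff)
  then have "pts N - \<phi> ` pts M \<in> sets (area N)" by (rule N.sets_area_open)
  from sets.compl_sets[OF this] have "pts N - (pts N - \<phi> ` pts M) \<in> sets (area N)"
    by (simp only: N.space_area)
  moreover have "pts N - (pts N - \<phi> ` pts M) = \<phi> ` pts M" using map_pts by blast
  ultimately show ?thesis by metis
qed

lemma surjective_iff: "\<phi> ` pts M = pts N \<longleftrightarrow> emeasure (area N) (\<phi> ` pts M) = emeasure (area N) (pts N)"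
proof
  assume e: "emeasure (area N) (\<phi> ` pts M) = emeasure (area N) (pts N)"
  interpret finite_measure "area N" by (rule N.finite_measure_area)
  have op: "openin (mtop N) (pts N - \<phi> ` pts M)" using closedin_image by (simp add: openin_diff)
  have "emeasure (area N) (pts N - \<phi> ` pts M) = emeasure (area N) (pts N) - emeasure (area N) (\<phi> ` pts M)"
    using image_sets map_pts sets.top[of "area N"] by (intro emeasure_Diff) auto
  then have "emeasure (area N) (pts N - \<phi> ` pts M) = 0" unfolding e by simp
  then have "pts N - \<phi> ` pts M = {}" using N.open_area_pos[OF op] by auto
  then show "\<phi> ` pts M = pts N" using map_pts by blast
qed simp

end

subsection \<open>The pointwise inequality\<close>

lemma bernoulli_powr_strict:
  fixes y q :: real
  assumes y: "0 \<le> y" "y \<noteq> 1" and q: "1 < q"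
  shows "1 + q * (y - 1) < y powr q"
proof -
  consider "y = 0" | "0 < y" "y < 1" | "1 < y" using y by linarith
  then show ?thesis
  proof cases
    case 1 then show ?thesis using q by simp
  next
    case 2
    have "\<exists>z. y < z \<and> z < 1 \<and> 1 powr q - y powr q = (1 - y) * (q * z powr (q - 1))"
      using 2 by (intro MVT2 has_real_derivative_powr) auto
    then obtain z where z: "y < z" "z < 1" "1 powr q - y powr q = (1 - y) * (q * z powr (q - 1))" by blast
    have "z powr (q - 1) < 1 powr (q - 1)" using z 2 q by (intro powr_less_mono2) auto
    then have "q * z powr (q - 1) < q" using q by simp
    then have "(1 - y) * (q * z powr (q - 1)) < (1 - y) * q" using 2 by simp
    then show ?thesis using z(3) by (simp add: algebra_simps)
  next
    case 3
    have "\<exists>z. 1 < z \<and> z < y \<and> y powr q - 1 powr q = (y - 1) * (q * z powr (q - 1))"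
      using 3 by (intro MVT2 has_real_derivative_powr) auto
    then obtain z where z: "1 < z" "z < y" "y powr q - 1 powr q = (y - 1) * (q * z powr (q - 1))" by blast
    have "1 powr (q - 1) < z powr (q - 1)" using z q by (intro powr_less_mono2) auto
    then have "q < q * z powr (q - 1)" using q by simp
    then have "(y - 1) * q < (y - 1) * (q * z powr (q - 1))" using 3 by simp
    then show ?thesis using z(3) by (simp add: algebra_simps)
  qed
qed

text \<open>Scaling by \<open>a\<close> reduces this to the tangent at 1.\<close>

lemma powr_tangent:
  fixes x a q :: real
  assumes x: "0 \<le> x" and a: "0 \<le> a" and q: "1 \<le> q"
  shows "a powr q + q * a powr (q - 1) * (x - a) \<le> x powr q"
    and "0 < a \<Longrightarrow> 1 < q \<Longrightarrow> x \<noteq> a \<Longrightarrow> a powr q + q * a powr (q - 1) * (x - a) < x powr q"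
proof -
  have scale: "a powr q + q * a powr (q - 1) * (x - a) = a powr q * (1 + q * (x / a - 1))"
    "x powr q = a powr q * (x / a) powr q" if "a > 0"
    using that x by (simp_all add: powr_diff powr_divide field_simps)
  show strict: "0 < a \<Longrightarrow> 1 < q \<Longrightarrow> x \<noteq> a \<Longrightarrow> a powr q + q * a powr (q - 1) * (x - a) < x powr q"
    using bernoulli_powr_strict[of "x / a" q] x by (simp add: scale)
  show "a powr q + q * a powr (q - 1) * (x - a) \<le> x powr q"
  proof (cases "a = 0 \<or> q = 1 \<or> x = a")
    \<comment> \<open>As \<open>0 powr (q - 1)\<close> is 0 even for \<open>q = 1\<close>, the
      tangent used at \<open>a = 0\<close> is the zero function, and the inequality
      survives.\<close>
    case True
    then show ?thesis using x a by auto
  next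
    case False
    then show ?thesis using strict a q by simp
  qed
qed

text \<open>In terms of the singular values, \<open>h\<close> is the sum of their squares, \<open>j\<close> their product
  and \<open>svsum h j\<close> their sum; \<open>sqdist h j\<close> is the squared distance to the rotations and
  \<open>F_rem s h j\<close> its excess over the tangent line of \<open>F\<close> at \<open>s\<close>.\<close>

definition svsum :: "real \<Rightarrow> real \<Rightarrow> real" where
  "svsum h j = sqrt (h + 2 * j)"

definition sqdist :: "real \<Rightarrow> real \<Rightarrow> real" where
  "sqdist h j = h + 2 - 2 * svsum h j"

text \<open>The derivative of \<open>F\<close>. Both formulas give -2 at 1/4, so one tangent line
  serves there.\<close>

definition F_slope :: "real \<Rightarrow> real" where
  "F_slope s = (if s \<le> 1/4 then - 2 else 2 * (1 - 1 / sqrt s))"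

definition F_rem :: "real \<Rightarrow> real \<Rightarrow> real \<Rightarrow> real" where
  "F_rem s h j = (if s \<le> 1/4 then (svsum h j - 1)\<^sup>2
     else (h - 2 * j) * (1 - 1 / (2 * sqrt s)) + (svsum h j - 2 * sqrt s)\<^sup>2 / (2 * sqrt s))"

lemma svsum_square: "0 \<le> j \<Longrightarrow> 2 * j \<le> h \<Longrightarrow> (svsum h j)\<^sup>2 = h + 2 * j"
  by (simp add: svsum_def)

lemma svsum_nonneg: "0 \<le> j \<Longrightarrow> 2 * j \<le> h \<Longrightarrow> 0 \<le> svsum h j"
  by (simp add: svsum_def)

lemma sqdist_eq: "0 \<le> j \<Longrightarrow> 2 * j \<le> h \<Longrightarrow> sqdist h j = (svsum h j - 2)\<^sup>2 / 2 + (h - 2 * j) / 2"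
  using svsum_square[of j h] unfolding sqdist_def by (simp add: power2_eq_square field_simps)

lemma sqdist_nonneg: "0 \<le> j \<Longrightarrow> 2 * j \<le> h \<Longrightarrow> 0 \<le> sqdist h j"
  by (simp add: sqdist_eq)

lemma sqdist_tangent:
  assumes s: "0 < s" and j: "0 \<le> j" "2 * j \<le> h"
  shows "sqdist h j = F s + F_slope s * (j - s) + F_rem s h j"
proof (cases "s \<le> 1/4")
  case True
  then show ?thesis using svsum_square[OF j]
    unfolding sqdist_def F_def F_slope_def F_rem_def by (simp add: power2_eq_square algebra_simps)
next
  case False
  define t where "t = sqrt s"
  have t: "t > 0" "s = t * t" using s by (simp_all add: t_def)
  have h: "h = svsum h j * svsum h j - 2 * j" using svsum_square[OF j] by (simp add: power2_eq_square)
  define u where "u = 1 / t"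
  have tu: "t * u = 1" using t(1) by (simp add: u_def)
  define S where "S = svsum h j"
  have hS: "h = S * S - 2 * j" using h by (simp add: S_def)
  \<comment> \<open>With \<open>u\<close> for \<open>1 / t\<close> this is a polynomial identity
    modulo \<open>t * u = 1\<close>.\<close>
  have "h + 2 - 2 * S = 2 * (t - 1)\<^sup>2 + 2 * (1 - u) * (j - s) + ((h - 2 * j) * (1 - u / 2) + (S - 2 * t)\<^sup>2 * u / 2)"
    unfolding hS t(2) using tu by algebra
  moreover have e: "1 / (2 * t) = u / 2" "(S - 2 * t)\<^sup>2 / (2 * t) = (S - 2 * t)\<^sup>2 * u / 2" by (simp_all add: u_def)
  ultimately show ?thesis
    unfolding sqdist_def F_def F_slope_def F_rem_def t_def[symmetric] S_def[symmetric] u_def[symmetric]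
    by (simp only: False if_False e)
qed

text \<open>Here the threshold enters: \<open>1 / (2 * sqrt s) < 1\<close> exactly for
  \<open>s > 1/4\<close>, which makes the weight of \<open>h - 2 * j\<close>, the squared difference
  of the singular values, positive.\<close>

lemma F_rem_nonneg:
  assumes s: "0 < s" and j: "0 \<le> j" "2 * j \<le> h"
  shows "0 \<le> F_rem s h j"
proof (cases "s \<le> 1/4")
  case False
  then have "1/2 < sqrt s" using real_less_rsqrt[of "1/2" s] by (simp add: power2_eq_square)
  moreover have inv: "1 / x < 1" if "1 < x" for x :: real using that by simp
  ultimately have "1 / (2 * sqrt s) < 1" using inv[of "2 * sqrt s"] by linarith
  then show ?thesis using j s False unfolding F_rem_def by simp
qed (simp add: F_rem_def)

text \<open>Both summands vanish, so the singular values coincide and add up to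
  \<open>2 * sqrt s\<close>.\<close>

lemma F_rem_eq_0:
  assumes s: "1/4 < s" and j: "0 \<le> j" "2 * j \<le> h" and z: "F_rem s h j = 0"
  shows "j = s" "h = 2 * s"
proof -
  have t: "1/2 < sqrt s" using s real_less_rsqrt[of "1/2" s] by (simp add: power2_eq_square)
  moreover have inv: "1 / x < 1" if "1 < x" for x :: real using that by simp
  ultimately have "1 / (2 * sqrt s) < 1" using inv[of "2 * sqrt s"] by linarith
  then have "0 < 1 - 1 / (2 * sqrt s)" by simp
  then have "0 \<le> (h - 2 * j) * (1 - 1 / (2 * sqrt s))" "0 \<le> (svsum h j - 2 * sqrt s)\<^sup>2 / (2 * sqrt s)"
    using s j by auto
  moreover have "(h - 2 * j) * (1 - 1 / (2 * sqrt s)) + (svsum h j - 2 * sqrt s)\<^sup>2 / (2 * sqrt s) = 0"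
    using z s unfolding F_rem_def by simp
  ultimately have "(h - 2 * j) * (1 - 1 / (2 * sqrt s)) = 0" "(svsum h j - 2 * sqrt s)\<^sup>2 / (2 * sqrt s) = 0" by linarith+
  then have h: "h = 2 * j" and sv: "svsum h j = 2 * sqrt s" using \<open>0 < 1 - 1 / (2 * sqrt s)\<close> t by auto
  have "h + 2 * j = (2 * sqrt s)\<^sup>2" using svsum_square[OF j] sv by simp
  then have "h + 2 * j = 4 * s" using s by (simp add: power2_eq_square)
  then show "j = s" "h = 2 * s" using h by auto
qed

lemma F_nonneg: "0 < s \<Longrightarrow> s \<le> 1 \<Longrightarrow> 0 \<le> F s"
  unfolding F_def by auto

lemma F_pos: "0 < s \<Longrightarrow> s < 1 \<Longrightarrow> 0 < F s"
  unfolding F_def by auto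

lemma F_slope_nonpos: "0 < s \<Longrightarrow> s \<le> 1 \<Longrightarrow> F_slope s \<le> 0"
  unfolding F_slope_def by (auto simp: le_divide_eq)

lemma F_slope_neg: "0 < s \<Longrightarrow> s < 1 \<Longrightarrow> F_slope s < 0"
  unfolding F_slope_def by (auto simp: less_divide_eq)

section \<open>Integration of the pointwise inequality\<close>

text \<open>To be used with \<open>q = p / 2\<close>. The excess over the bound is a sum of three
  nonnegative terms: the convexity defect \<open>T\<close>, the missing area of the image weighted
  by \<open>k \<le> 0\<close>, and the pointwise remainder \<open>R\<close>. The last two carry the
  factor \<open>c\<close>, positive for \<open>s < 1\<close>, so in that case equality makes each
  vanish separately.\<close>

lemma (in finite_measure) integral_sqdist:
  fixes h j :: "'a \<Rightarrow> real" and q s :: real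
  assumes meas[measurable]: "h \<in> borel_measurable M" "j \<in> borel_measurable M"
    and hb: "AE x in M. h x \<le> b" and j0: "AE x in M. 0 \<le> j x" and jh: "AE x in M. 2 * j x \<le> h x"
    and q: "1 \<le> q" and s: "0 < s" "s \<le> 1" and V: "V = measure M (space M)" "V > 0"
    and jint: "(\<integral>x. j x \<partial>M) \<le> s * V"
  defines "D \<equiv> \<lambda>x. sqdist (h x) (j x)"
  shows "F s powr q * V \<le> (\<integral>x. D x powr q \<partial>M)" (is ?ineq)
    and "(\<integral>x. D x powr q \<partial>M) = F s powr q * V \<longleftrightarrow>
      (\<integral>x. j x \<partial>M) = s * V \<and>
      (s \<ge> 1/4 \<longrightarrow> (\<exists>r>0. AE x in M. h x = 2 * r\<^sup>2 \<and> j x = r\<^sup>2)) \<and>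
      (s \<le> 1/4 \<and> q = 1 \<longrightarrow> (AE x in M. j x \<ge> 0 \<and> h x + 2 * j x = 1)) \<and>
      (s \<le> 1/4 \<and> q > 1 \<longrightarrow> (AE x in M. j x \<ge> 0 \<and> h x + 2 * j x = 1 \<and> j x = s))" (is "?eq \<longleftrightarrow> ?cond")
proof -
  have Dm[measurable]: "D \<in> borel_measurable M" unfolding D_def sqdist_def svsum_def by measurable
  define R where "R x = F_rem s (h x) (j x)" for x
  define a where "a = F s"
  define k where "k = F_slope s"
  \<comment> \<open>The slope of the power at \<open>a\<close>; for \<open>a = 0\<close> it is 0,
    also when \<open>q = 1\<close>.\<close>
  define c where "c = q * a powr (q - 1)"
  have a0: "a \<ge> 0" unfolding a_def by (rule F_nonneg[OF s])
  have k0: "k \<le> 0" unfolding k_def by (rule F_slope_nonpos[OF s])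
  have c0: "c \<ge> 0" unfolding c_def using q by simp
  have pt: "AE x in M. 0 \<le> D x \<and> 0 \<le> R x \<and> D x = a + k * (j x - s) + R x"
    using j0 jh
  proof eventually_elim
    case (elim x)
    show ?case unfolding D_def R_def a_def k_def
      using sqdist_nonneg[OF elim] F_rem_nonneg[OF s(1) elim] sqdist_tangent[OF s(1) elim] by simp
  qed
  have b0: "AE x in M. \<bar>h x\<bar> \<le> \<bar>b\<bar> \<and> \<bar>j x\<bar> \<le> \<bar>b\<bar>" using hb j0 jh
    by eventually_elim (intro conjI; linarith)
  have ji: "integrable M j"
    by (rule integrable_const_bound[of _ "\<bar>b\<bar>"]) (use b0 in auto)
  have Dle: "AE x in M. D x \<le> \<bar>b\<bar> + 2" using b0 j0 jh
  proof eventually_elim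
    case (elim x)
    then show ?case using svsum_nonneg[of "j x" "h x"] unfolding D_def sqdist_def by linarith
  qed
  have Di: "integrable M D"
    by (rule integrable_const_bound[of _ "\<bar>b\<bar> + 2"]) (use Dle pt in \<open>auto elim!: eventually_elim2\<close>)
  have Dqi: "integrable M (\<lambda>x. D x powr q)"
  proof (rule integrable_const_bound[of _ "(\<bar>b\<bar> + 2) powr q"])
    show "AE x in M. norm (D x powr q) \<le> (\<bar>b\<bar> + 2) powr q"
      using Dle pt by eventually_elim (use q in \<open>auto intro!: powr_mono2\<close>)
  qed measurable
  have Ri: "integrable M R"
  proof (rule integrable_cong_AE_imp)
    show "integrable M (\<lambda>x. D x - a - k * (j x - s))" using Di ji by simp
    show "R \<in> borel_measurable M"
      unfolding R_def F_rem_def svsum_def by measurable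
    show "AE x in M. D x - a - k * (j x - s) = R x" using pt by eventually_elim simp
  qed
  define T where "T x = D x powr q - (a powr q + c * (D x - a))" for x
  have Ti: "integrable M T" unfolding T_def using Dqi Di by simp
  have T0: "AE x in M. 0 \<le> T x" using pt
  proof eventually_elim
    case (elim x)
    then show ?case using powr_tangent(1)[of "D x" a q] a0 q unfolding T_def c_def by simp
  qed
  have R0: "AE x in M. 0 \<le> R x" using pt by eventually_elim simp
  have intD: "(\<integral>x. D x \<partial>M) = a * V + k * ((\<integral>x. j x \<partial>M) - s * V) + (\<integral>x. R x \<partial>M)"
  proof -
    have "(\<integral>x. D x \<partial>M) = (\<integral>x. (a - k * s) + k * j x + R x \<partial>M)"
      using pt Di ji Ri by (intro integral_cong_AE) (auto elim!: eventually_mono simp: algebra_simps)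
    also have "\<dots> = (a - k * s) * V + k * (\<integral>x. j x \<partial>M) + (\<integral>x. R x \<partial>M)"
      using ji Ri by (simp add: V(1))
    finally show ?thesis by (simp add: algebra_simps)
  qed
  have main: "(\<integral>x. D x powr q \<partial>M) = a powr q * V + (\<integral>x. T x \<partial>M) + c * (k * ((\<integral>x. j x \<partial>M) - s * V)) + c * (\<integral>x. R x \<partial>M)"
  proof -
    have "(\<integral>x. D x powr q \<partial>M) = (\<integral>x. (a powr q - c * a) + c * D x + T x \<partial>M)"
      by (intro Bochner_Integration.integral_cong) (auto simp: T_def algebra_simps)
    also have "\<dots> = (a powr q - c * a) * V + c * (\<integral>x. D x \<partial>M) + (\<integral>x. T x \<partial>M)"
      using Di Ti by (simp add: V(1))
    finally show ?thesis unfolding intD by (simp add: algebra_simps)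
  qed
  have nn: "0 \<le> (\<integral>x. T x \<partial>M)" "0 \<le> (\<integral>x. R x \<partial>M)" "0 \<le> k * ((\<integral>x. j x \<partial>M) - s * V)"
    using T0 R0 k0 jint by (auto intro!: integral_nonneg_AE mult_nonpos_nonpos)
  show ?ineq using main nn c0 by (simp add: a_def)
  have const: "?eq" if "AE x in M. D x = a"
  proof -
    have "(\<integral>x. D x powr q \<partial>M) = (\<integral>x. a powr q \<partial>M)"
      using that by (intro integral_cong_AE) auto
    then show ?thesis by (simp add: V(1) a_def)
  qed
  show "?eq \<longleftrightarrow> ?cond"
  proof
    assume e: ?eq
    show ?cond
    proof (cases "s = 1")
      \<comment> \<open>Here \<open>a = 0\<close> and \<open>c = 0\<close>, so the decomposition
        says nothing about \<open>j\<close> and \<open>R\<close>. Instead the integrand itself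
        vanishes, which makes both singular values 1.\<close>
      case True
      have a: "a = 0" unfolding a_def F_def True by simp
      have "(\<integral>x. D x powr q \<partial>M) = 0" using e a unfolding a_def[symmetric] by simp
      then have "AE x in M. D x powr q = 0"
        using integral_nonneg_eq_0_iff_AE[OF Dqi] by simp
      then have hj: "AE x in M. h x = 2 * 1\<^sup>2 \<and> j x = 1\<^sup>2" using j0 jh
      proof eventually_elim
        case (elim x)
        then have "D x = 0" by simp
        then have "(svsum (h x) (j x) - 2)\<^sup>2 / 2 + (h x - 2 * j x) / 2 = 0"
          using sqdist_eq[of "j x" "h x"] elim unfolding D_def by simp
        moreover have "0 \<le> (svsum (h x) (j x) - 2)\<^sup>2 / 2" "0 \<le> (h x - 2 * j x) / 2" using elim by auto
        ultimately have "(svsum (h x) (j x) - 2)\<^sup>2 / 2 = 0" "(h x - 2 * j x) / 2 = 0" by linarith+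
        then have "svsum (h x) (j x) = 2" "h x = 2 * j x" by auto
        then show ?case using svsum_square[of "j x" "h x"] elim by simp
      qed
      have "(\<integral>x. j x \<partial>M) = (\<integral>x. 1 \<partial>M)" using hj ji by (intro integral_cong_AE) (auto elim!: eventually_mono)
      then have "(\<integral>x. j x \<partial>M) = s * V" using True by (simp add: V(1))
      then show ?thesis using True hj by (auto intro!: exI[of _ 1])
    next
      case False
      then have s1: "s < 1" using s by simp
      have apos: "a > 0" unfolding a_def by (rule F_pos[OF s(1) s1])
      have kneg: "k < 0" unfolding k_def by (rule F_slope_neg[OF s(1) s1])
      have cpos: "c > 0" unfolding c_def using q apos by simp
      have cn: "0 \<le> c * (k * ((\<integral>x. j x \<partial>M) - s * V))" "0 \<le> c * (\<integral>x. R x \<partial>M)" using nn c0 by auto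
      have "(\<integral>x. T x \<partial>M) + c * (k * ((\<integral>x. j x \<partial>M) - s * V)) + c * (\<integral>x. R x \<partial>M) = 0"
        using main e unfolding a_def by simp
      then have z: "(\<integral>x. T x \<partial>M) = 0" "c * (k * ((\<integral>x. j x \<partial>M) - s * V)) = 0" "c * (\<integral>x. R x \<partial>M) = 0"
        using nn(1) cn by linarith+
      have js: "(\<integral>x. j x \<partial>M) = s * V" using z(2) cpos kneg by simp
      have "(\<integral>x. R x \<partial>M) = 0" using z(3) cpos by simp
      then have RA: "AE x in M. R x = 0" using integral_nonneg_eq_0_iff_AE[OF Ri R0] by simp
      have TA: "AE x in M. T x = 0" using integral_nonneg_eq_0_iff_AE[OF Ti T0] z(1) by simp
      have DA: "AE x in M. D x = a" if "q > 1" using TA pt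
      proof eventually_elim
        case (elim x)
        then show ?case using powr_tangent(2)[of "D x" a q] apos that q unfolding T_def c_def by force
      qed
      have small: "AE x in M. j x \<ge> 0 \<and> h x + 2 * j x = 1" if "s \<le> 1/4" using RA j0 jh
      proof eventually_elim
        case (elim x)
        then have "svsum (h x) (j x) = 1" using that unfolding R_def F_rem_def by simp
        then show ?case using svsum_square[of "j x" "h x"] elim by simp
      qed
      have big: "\<exists>r>0. AE x in M. h x = 2 * r\<^sup>2 \<and> j x = r\<^sup>2" if s4: "s \<ge> 1/4"
      proof (cases "s = 1/4")
        case False
        then have s4': "1/4 < s" using s4 by simp
        have "AE x in M. h x = 2 * (sqrt s)\<^sup>2 \<and> j x = (sqrt s)\<^sup>2" using RA j0 jh
        proof eventually_elim
          case (elim x)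
          then show ?case using F_rem_eq_0[OF s4'] s unfolding R_def by simp
        qed
        then show ?thesis using s by (intro exI[of _ "sqrt s"]) auto
      next
        case True
        have sm: "AE x in M. 0 \<le> 1/4 - j x \<and> h x + 2 * j x = 1" using small jh True
          by (auto elim!: eventually_elim2)
        have "(\<integral>x. 1/4 - j x \<partial>M) = 0" using ji js True by (simp add: V(1))
        moreover have "integrable M (\<lambda>x. 1/4 - j x)" using ji by simp
        moreover have "AE x in M. 0 \<le> 1/4 - j x" using sm by (auto elim!: eventually_mono)
        ultimately have "AE x in M. 1/4 - j x = 0" using integral_nonneg_eq_0_iff_AE by blast
        then have "AE x in M. h x = 2 * (1/2)\<^sup>2 \<and> j x = (1/2)\<^sup>2" using sm
          by eventually_elim (auto simp: power2_eq_square)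
        then show ?thesis by (intro exI[of _ "1/2"]) auto
      qed
      have smallq: "AE x in M. j x \<ge> 0 \<and> h x + 2 * j x = 1 \<and> j x = s" if "s \<le> 1/4" "q > 1"
        using small[OF that(1)] DA[OF that(2)]
      proof eventually_elim
        case (elim x)
        then have "svsum (h x) (j x) = 1" by (simp add: svsum_def)
        then have "h x = 1 - 2 * s" using elim that(1) unfolding D_def sqdist_def a_def F_def by simp
        then show ?case using elim by simp
      qed
      show ?thesis using js big small smallq by blast
    qed
  next
    assume c: ?cond
    then have js: "(\<integral>x. j x \<partial>M) = s * V" by blast
    show ?eq
    proof (cases "s \<ge> 1/4")
      case True
      then obtain r where r: "r > 0" "AE x in M. h x = 2 * r\<^sup>2 \<and> j x = r\<^sup>2" using c by blast
      \<comment> \<open>The factor \<open>r\<close> is only known to exist; the integral of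
        \<open>j\<close> identifies it as \<open>sqrt s\<close>.\<close>
      have "(\<integral>x. j x \<partial>M) = (\<integral>x. r\<^sup>2 \<partial>M)" using r(2) ji by (intro integral_cong_AE) (auto elim!: eventually_mono)
      then have "r\<^sup>2 = s" using js V(2) by (simp add: V(1))
      then have rs: "r = sqrt s" using r(1) by (simp add: real_sqrt_unique)
      have as: "a = 2 * (sqrt s - 1)\<^sup>2"
      proof (cases "s = 1/4")
        case True
        have sq: "sqrt s = 1/2" using True by (intro real_sqrt_unique) (simp_all add: power2_eq_square)
        have "2 * (sqrt s - 1)\<^sup>2 = 1/2" unfolding sq by (simp add: power2_eq_square)
        moreover have "F s = 1/2" unfolding F_def using True by simp
        ultimately show ?thesis unfolding a_def by linarith
      qed (use True in \<open>simp add: a_def F_def\<close>)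
      have "AE x in M. D x = a" using r(2)
      proof eventually_elim
        case (elim x)
        have "svsum (h x) (j x) = sqrt ((2 * r)\<^sup>2)" unfolding svsum_def using elim by (simp add: power_mult_distrib)
        moreover have "sqrt ((2 * r)\<^sup>2) = 2 * r" using r(1) by (intro real_sqrt_unique) auto
        ultimately have "svsum (h x) (j x) = 2 * r" by simp
        then show ?case unfolding D_def sqdist_def as rs[symmetric] using elim by (simp add: power2_eq_square algebra_simps)
      qed
      then show ?thesis by (rule const)
    next
      case False
      then have s4: "s \<le> 1/4" by simp
      have as: "a = 1 - 2 * s" unfolding a_def F_def using s4 by simp
      show ?thesis
      proof (cases "q = 1")
        case True
        then have "AE x in M. j x \<ge> 0 \<and> h x + 2 * j x = 1" using c s4 by blast
        \<comment> \<open>The integrand is affine in \<open>j\<close>, so only the mean of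
          \<open>j\<close> matters; this is why the Jacobian may vary in this case.\<close>
        then have "AE x in M. D x powr q = 1 - 2 * j x" using pt
        proof eventually_elim
          case (elim x)
          then have "svsum (h x) (j x) = 1" by (simp add: svsum_def)
          then have "D x = 1 - 2 * j x" using elim unfolding D_def sqdist_def by linarith
          then show ?case using elim True by simp
        qed
        then have "(\<integral>x. D x powr q \<partial>M) = (\<integral>x. 1 - 2 * j x \<partial>M)"
          by (intro integral_cong_AE) auto
        also have "\<dots> = V - 2 * (s * V)" using ji js by (simp add: V(1))
        also have "\<dots> = a * V" unfolding as by (simp add: algebra_simps)
        finally show ?thesis using True a0 unfolding a_def[symmetric] by simp
      next
        case False
        then have "AE x in M. j x \<ge> 0 \<and> h x + 2 * j x = 1 \<and> j x = s" using c s4 q by auto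
        then have "AE x in M. D x = a"
        proof eventually_elim
          case (elim x)
          then have "svsum (h x) (j x) = 1" by (simp add: svsum_def)
          then show ?case using elim unfolding D_def sqdist_def as by linarith
        qed
        then show ?thesis by (rule const)
      qed
    qed
  qed
qed

subsection \<open>The energy\<close>

context surface_map
begin

lemma two_jac_le_hs: "2 * \<bar>jac x\<bar> \<le> hs x"
  unfolding jac_def hs_def by (rule abs_det_le_norm)

lemma jacobian_eq: "jacobian M N \<phi> x = jac x"
  by (simp add: jacobian_def hom_det_def jac_def)

lemma energy_eq: "energy M N p \<phi> = 1 / total_area M * (\<integral>x. sqdist (hs x) (jac x) powr (p / 2) \<partial>area M)"
  unfolding energy_def
proof (intro arg_cong2[where f="(*)"] refl Bochner_Integration.integral_cong)
  fix x assume "x \<in> space (area M)"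
  then have x: "x \<in> pts M" by simp
  have sp: "spd (gmat_at M x)" "spd (gmat_at N (\<phi> x))" using M.spd_gmat_at[OF x] N.spd_gmat_at[OF map_pts[OF x]] by auto
  have h0: "0 \<le> hs x" by (simp add: hs_def)
  \<comment> \<open>No sign of \<open>jac\<close> is available here; nonnegativity of the squared
    distance comes from \<open>2 * \<bar>jac x\<bar> \<le> hs x\<close> and
    \<open>(hs x - 2)\<^sup>2 \<ge> 0\<close>.\<close>
  have "sqrt (hs x + 2 * jac x) \<le> (hs x + 2) / 2"
  proof (rule real_le_lsqrt)
    have "hs x + 2 * jac x \<le> 2 * hs x" using two_jac_le_hs[of x] by linarith
    also have "\<dots> \<le> ((hs x + 2) / 2)\<^sup>2"
      using zero_le_power2[of "hs x - 2"] by (simp add: power2_eq_square field_simps)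
    finally show "hs x + 2 * jac x \<le> ((hs x + 2) / 2)\<^sup>2" .
  qed (use h0 in simp)
  then have D0: "0 \<le> sqdist (hs x) (jac x)" unfolding sqdist_def svsum_def by simp
  have "dist_SO (gmat_at M x) (gmat_at N (\<phi> x)) (diff_at M N \<phi> x) = sqrt (sqdist (hs x) (jac x))"
    unfolding dist_SO_eq[OF sp] sqdist_def svsum_def hs_def jac_def ..
  also have "\<dots> = sqdist (hs x) (jac x) powr (1 / 2)" using D0 by (simp add: powr_half_sqrt)
  finally show "dist_SO (gmat_at M x) (gmat_at N (\<phi> x)) (diff_at M N \<phi> x) powr p = sqdist (hs x) (jac x) powr (p / 2)"
    by (simp add: powr_powr)
qed

lemma homothety_iff:
  assumes J: "AE x in area M. jac x \<ge> 0"
  shows "homothety M N \<phi> \<longleftrightarrow> (\<exists>r>0. AE x in area M. hs x = 2 * r\<^sup>2 \<and> jac x = r\<^sup>2)"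
proof -
  have "(AE x in area M. \<forall>u v. gram_inner (gmat_at N (\<phi> x)) (diff_at M N \<phi> x *v u) (diff_at M N \<phi> x *v v)
       = r\<^sup>2 * gram_inner (gmat_at M x) u v) \<longleftrightarrow> (AE x in area M. hs x = 2 * r\<^sup>2 \<and> jac x = r\<^sup>2)" for r
  proof (rule eventually_subst)
    show "AE x in area M. (\<forall>u v. gram_inner (gmat_at N (\<phi> x)) (diff_at M N \<phi> x *v u) (diff_at M N \<phi> x *v v)
       = r\<^sup>2 * gram_inner (gmat_at M x) u v) \<longleftrightarrow> (hs x = 2 * r\<^sup>2 \<and> jac x = r\<^sup>2)"
      using J AE_space
    proof eventually_elim
      case (elim x)
      then have x: "x \<in> pts M" by simp
      show ?case unfolding hs_def jac_def
        by (rule conformal_iff[OF M.spd_gmat_at[OF x] N.spd_gmat_at[OF map_pts[OF x]]])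
          (use elim in \<open>simp add: jac_def\<close>)
    qed
  qed
  then show ?thesis unfolding homothety_def by simp
qed

lemma diff_in_K_iff: "diff_in_K M N \<phi> \<longleftrightarrow> (AE x in area M. jac x \<ge> 0 \<and> hs x + 2 * jac x = 1)"
  unfolding diff_in_K_def K_iff hom_det_def hs_def jac_def ..

lemma diff_in_Ks_iff: "diff_in_Ks s M N \<phi> \<longleftrightarrow> (AE x in area M. jac x \<ge> 0 \<and> hs x + 2 * jac x = 1 \<and> jac x = s)"
  unfolding diff_in_Ks_def Ks_def by (simp add: K_iff hom_det_def hs_def jac_def conj_assoc)

lemma integral_jac:
  assumes inj: "AE q in area N. \<forall>x\<in>pts M. \<forall>y\<in>pts M. \<phi> x = q \<and> \<phi> y = q \<longrightarrow> x = y"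
    and J: "AE x in area M. jac x \<ge> 0"
  shows "(\<integral>x. jac x \<partial>area M) \<le> total_area N"
    and "(\<integral>x. jac x \<partial>area M) = total_area N \<longleftrightarrow> \<phi> ` pts M = pts N"
proof -
  interpret finite_measure "area N" by (rule N.finite_measure_area)
  have eq: "(\<integral>x. jac x \<partial>area M) = measure (area N) (\<phi> ` pts M)"
    using integral_eq_nn_integral[OF jac_measurable J] area_formula[OF inj J] by (simp add: measure_def)
  show "(\<integral>x. jac x \<partial>area M) \<le> total_area N"
    unfolding eq total_area_def by (rule finite_measure_mono) (use map_pts sets.top[of "area N"] in auto)
  show "(\<integral>x. jac x \<partial>area M) = total_area N \<longleftrightarrow> \<phi> ` pts M = pts N"
    unfolding eq total_area_def surjective_iff emeasure_eq_measure by simp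
qed

lemma energy_bound:
  assumes inj: "AE q in area N. \<forall>x\<in>pts M. \<forall>y\<in>pts M. \<phi> x = q \<and> \<phi> y = q \<longrightarrow> x = y"
    and J: "AE x in area M. jac x \<ge> 0" and p: "p \<ge> 2" and le: "total_area N \<le> total_area M"
  shows "energy M N p \<phi> \<ge> F (total_area N / total_area M) powr (p / 2)"
    and "energy M N p \<phi> = F (total_area N / total_area M) powr (p / 2) \<longleftrightarrow>
       \<phi> ` pts M = pts N \<and> optimality_condition M N p \<phi>"
proof -
  interpret finite_measure "area M" by (rule M.finite_measure_area)
  define V where "V = total_area M"
  define s where "s = total_area N / V"
  define I where "I = (\<integral>x. sqdist (hs x) (jac x) powr (p / 2) \<partial>area M)"
  have V: "V = measure (area M) (space (area M))" "V > 0" unfolding V_def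
    using M.total_area_pos by (simp_all add: total_area_def)
  have s: "0 < s" "s \<le> 1" "s * V = total_area N"
    unfolding s_def using N.total_area_pos V le by (simp_all add: V_def)
  have q: "1 \<le> p / 2" "p / 2 = 1 \<longleftrightarrow> p = 2" "1 < p / 2 \<longleftrightarrow> p > 2" using p by auto
  obtain b where b: "AE x in area M. hs x \<le> b" using hs_bounded by blast
  have jh: "AE x in area M. 2 * jac x \<le> hs x" 
  proof (rule AE_I2)
    fix x show "2 * jac x \<le> hs x" using two_jac_le_hs[of x] abs_ge_self[of "jac x"] by linarith
  qed
  have jint: "(\<integral>x. jac x \<partial>area M) \<le> s * V" using integral_jac(1)[OF inj J] s(3) by simp
  note core = integral_sqdist[OF hs_measurable jac_measurable b J jh q(1) s(1,2) V jint]
  have E: "energy M N p \<phi> = I / V" unfolding energy_eq I_def V_def by simp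
  have sF: "total_area N / total_area M = s" by (simp add: s_def V_def)
  show "energy M N p \<phi> \<ge> F (total_area N / total_area M) powr (p / 2)"
    unfolding sF E using core(1) V(2) unfolding I_def[symmetric] by (simp add: le_divide_eq)
  have "energy M N p \<phi> = F s powr (p / 2) \<longleftrightarrow> I = F s powr (p / 2) * V"
    unfolding E using V(2) by (simp add: divide_eq_eq)
  also have "\<dots> \<longleftrightarrow> \<phi> ` pts M = pts N \<and> optimality_condition M N p \<phi>"
    unfolding I_def core(2) s(3) integral_jac(2)[OF inj J] q(2,3)
      homothety_iff[OF J, symmetric] diff_in_K_iff[symmetric] diff_in_Ks_iff[symmetric]
      optimality_condition_def Let_def sF ..
  finally show "energy M N p \<phi> = F (total_area N / total_area M) powr (p / 2) \<longleftrightarrow>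
       \<phi> ` pts M = pts N \<and> optimality_condition M N p \<phi>"
    unfolding sF .
qed

end

theorem corollary1p2:
  fixes M :: "'a surface" and N :: "'b surface" and p :: real
  assumes "riemannian_surface M" and "riemannian_surface N"
    and "p \<ge> 2"
    and "total_area N \<le> total_area M"
  shows "(\<forall>\<phi>\<in>Lip_inj_plus M N.
            energy M N p \<phi> \<ge> F (total_area N / total_area M) powr (p / 2) \<and>
            (energy M N p \<phi> = F (total_area N / total_area M) powr (p / 2) \<longleftrightarrow>
               \<phi> ` pts M = pts N \<and> optimality_condition M N p \<phi>)) \<and>
         (\<forall>\<phi>\<in>Lip_inj_plus M N.
            bij_betw \<phi> (pts M) (pts N) \<and> optimality_condition M N p \<phi> \<longrightarrow>
            (\<forall>\<psi>\<in>Lip_inj_plus M N. energy M N p \<phi> \<le> energy M N p \<psi>))"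
proof -
  have main: "energy M N p \<phi> \<ge> F (total_area N / total_area M) powr (p / 2) \<and>
      (energy M N p \<phi> = F (total_area N / total_area M) powr (p / 2) \<longleftrightarrow>
         \<phi> ` pts M = pts N \<and> optimality_condition M N p \<phi>)" if \<phi>: "\<phi> \<in> Lip_inj_plus M N" for \<phi>
  proof -
    interpret surface_map M N \<phi>
      using assms(1,2) \<phi> unfolding surface_map_def surface_map_axioms_def Lip_inj_plus_def by blast
    have inj: "AE q in area N. \<forall>x\<in>pts M. \<forall>y\<in>pts M. \<phi> x = q \<and> \<phi> y = q \<longrightarrow> x = y"
      and J: "AE x in area M. jac x \<ge> 0"
      using \<phi> by (simp_all add: Lip_inj_plus_def jacobian_eq)
    show ?thesis using energy_bound[OF inj J assms(3,4)] by blast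
  qed
  show ?thesis
  proof (intro conjI ballI impI)
    fix \<phi> \<psi> assume \<phi>: "\<phi> \<in> Lip_inj_plus M N" and \<psi>: "\<psi> \<in> Lip_inj_plus M N"
      and opt: "bij_betw \<phi> (pts M) (pts N) \<and> optimality_condition M N p \<phi>"
    have "energy M N p \<phi> = F (total_area N / total_area M) powr (p / 2)"
      using main[OF \<phi>] opt by (simp add: bij_betw_def)
    then show "energy M N p \<phi> \<le> energy M N p \<psi>" using main[OF \<psi>] by simp
  qed (use main in blast)+
qed

end
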